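(* Consider the one-epoch coalescence process (OCP) with parameters $0<d_{\min}<d_{\max}$ and rates $\lambda_\ell,\lambda_r$ as defined in the context. Let $\nu,\mu$ be probability measures on $\mathbb R$ and $[d_{\min},\infty)$, respectively. Then for every $t\in[0,\infty]$ there exist probability measures $\nu_t,\mu_t$ on $\mathbb R$ and $[d_{\min},\infty)$, respectively, such that $\nu_0=\nu$, $\mu_0=\mu$ and, denoting by $\mathcal Q$ the law of $\xi(0)$ and by $\mathcal Q_t$ the law of $\xi(t)$, $t\in[0,\infty]$: (i) if $\mathcal Q=\mathrm{Ren}(\nu,\mu)$, then $\mathcal Q_t=\mathrm{Ren}(\nu_t,\mu_t)$; (ii) if $\mathcal Q=\mathrm{Ren}(\mu)$, then $\mathcal Q_t=\mathrm{Ren}(\mu_t)$; (iii) if $\mathcal Q=\mathrm{Ren}_{\mathbb Z}(\mu)$, then $\mathcal Q_t=\mathrm{Ren}_{\mathbb Z}(\mu_t)$; (iv) if $\mathcal Q=\mathrm{Ren}(\delta_0,\mu)$, then $\mathcal Q_t(\,\cdot\mid 0\in\xi)=\mathrm{Ren}(\delta_0,\mu_t)$; (v) $\lim_{t\to\infty}\nu_t=\nu_\infty$ and $\lim_{t\to\infty}\mu_t=\mu_\infty$ weakly.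
   Context: **Point processes.** $\mathcal N$ is the set of locally finite subsets $\xi\subset\mathbb R$ with the $\sigma$-algebra generated by the maps $\xi\mapsto|\xi\cap A|$, $A\subset\mathbb R$ bounded Borel; a simple point process (SPP) is a random element of $\mathcal N$. A domain of $\xi$ is an interval between two consecutive points of $\xi\cup\{-\infty,+\infty\}$; its length may be $\infty$. $\mathcal N(d_{\min})$ is the set of $\xi\in\mathcal N$ all of whose domains having an endpoint in $\xi$ have length at least $d_{\min}$. **Renewal SPPs.** - $\mathrm{Ren}(\nu,\mu)$: law of $\{x_0<x_1<x_2<\cdots\}$ where $x_0$ has law $\nu$, the gaps $x_k-x_{k-1}$ ($k\ge1$) have law $\mu$, and $x_0$ and all gaps are independent. $\delta_0$ is the Dirac mass at $0$. - $\mathrm{Ren}(\mu)$ (defined when $\mu$ has finite mean): law $\mathcal Q$ of an $\mathbb R$-translation invariant SPP with finite intensity $\lambda_{\mathcal Q}=\mathbb E_{\mathcal Q}|\xi\cap[0,1]|$, a.s. nonempty, such that under its Palm distribution $\mathcal Q_0(A)=\lambda_{\mathcal Q}^{-1}\,\mathbb E_{\mathcal Q}\big|\{x\in\xi\cap[0,1]:\xi-x\in A\}\big|$ the gaps $x_k-x_{k-1}$, $k\in\mathbb Z$, are i.i.d. with law $\mu$ (points labelled increasingly with $x_0\le 0<x_1$). - $\mathrm{Ren}_{\mathbb Z}(\mu)$ (defined when $\mu$ is supported on $\{1,2,\dots\}$ with finite mean): law of an SPP $\xi\subset\mathbb Z$, invariant under integer translations, a.s. nonempty, such that conditionally on $0\in\xi$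 the gaps $x_k-x_{k-1}$, $k\in\mathbb Z$, are i.i.d. with law $\mu$. **One-epoch coalescence process (OCP).** Let $0<d_{\min}<d_{\max}$ and let $\lambda_\ell,\lambda_r:[d_{\min},\infty]\to[0,\infty)$ be bounded (Borel) functions, $\lambda=\lambda_\ell+\lambda_r$, such that: (A1) $\lambda(d)>0$ if and only if $d\in[d_{\min},d_{\max})$; (A2) if $d,d'\ge d_{\min}$ then $d+d'\ge d_{\max}$. The OCP is the Markov jump process $(\xi(t))_{t\ge0}$ on $\mathcal N(d_{\min})$ in which each existing domain $[x,x']$ of length $d$ incorporates its left neighbour (the point $x$ is deleted) at rate $\lambda_r(d)$ and its right neighbour (the point $x'$ is deleted) at rate $\lambda_\ell(d)$. Concretely: given $\xi(0)$, attach independently to each domain $\Delta=[x,x']$ of $\xi(0)$ of length $d$ an exponential time $T_\Delta$ of parameter $\lambda(d)$ ($T_\Delta=\infty$ if $\lambda(d)=0$) and a coin; at time $T_\Delta$, if $\Delta$ is still a domain, delete $x$ with probability $\lambda_r(d)/\lambda(d)$ and $x'$ with probability $\lambda_\ell(d)/\lambda(d)$. Domains of length $\ge d_{\max}$ (in particular all merged or infinite domains) never act. Since rates are bounded this is a.s. well defined. Points are only deleted, and $\xi(\infty):=\bigcap_{t\ge0}\xi(t)$. *)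

theory Defs
  imports "HOL-Probability.Probability"
begin

section \<open>Configurations and point processes\<close>

definition locally_finite :: "real set \<Rightarrow> bool" where
  "locally_finite \<xi> \<longleftrightarrow> (\<forall>a b. finite (\<xi> \<inter> {a..b}))"

text \<open>The \<open>\<sigma>\<close>-algebra generated by the counting maps of bounded Borel sets. The law of a simple
  point process is a probability measure on this space.\<close>

definition config_space :: "real set measure" where
  "config_space =
     (SUP A \<in> {A. A \<in> sets borel \<and> bounded A}.
        vimage_algebra {\<xi>. locally_finite \<xi>} (\<lambda>\<xi>. card (\<xi> \<inter> A)) (count_space UNIV))"

text \<open>A domain is represented by its pair of endpoints, which may be infinite.\<close>

definition ext_points :: "real set \<Rightarrow> ereal set" where
  "ext_points \<xi> = ereal ` \<xi> \<union> {-\<infinity>, \<infinity>}"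

definition domains :: "real set \<Rightarrow> (ereal \<times> ereal) set" where
  "domains \<xi> = {(x, x'). x \<in> ext_points \<xi> \<and> x' \<in> ext_points \<xi> \<and> x < x' \<and>
                         {x<..<x'} \<inter> ext_points \<xi> = {}}"

definition endpoints :: "ereal \<times> ereal \<Rightarrow> ereal set" where
  "endpoints \<Delta> = {fst \<Delta>, snd \<Delta>}"

definition dom_length :: "ereal \<times> ereal \<Rightarrow> ereal" where
  "dom_length \<Delta> = snd \<Delta> - fst \<Delta>"

definition min_configs :: "real \<Rightarrow> real set set" where
  "min_configs dmin = {\<xi> \<in> space config_space.
     \<forall>\<Delta>\<in>domains \<xi>. endpoints \<Delta> \<inter> ereal ` \<xi> \<noteq> {} \<longrightarrow> ereal dmin \<le> dom_length \<Delta>}"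

section \<open>Renewal point processes\<close>

text \<open>The alternative \<open>{}\<close> only serves to make the map take values in the space of configurations
  everywhere: for positive i.i.d. gaps the point set is almost surely locally finite.\<close>

definition Ren :: "real measure \<Rightarrow> real measure \<Rightarrow> real set measure" where
  "Ren \<nu> \<mu> = distr (\<nu> \<Otimes>\<^sub>M (\<Pi>\<^sub>M k\<in>(UNIV :: nat set). \<mu>)) config_space
     (\<lambda>(x0, g). let \<xi> = range (\<lambda>k. x0 + (\<Sum>i<k. g i)) in if locally_finite \<xi> then \<xi> else {})"

definition is_labelling :: "real set \<Rightarrow> (int \<Rightarrow> real) \<Rightarrow> bool" where
  "is_labelling \<xi> x \<longleftrightarrow> strict_mono x \<and> range x = \<xi> \<and> x 0 \<le> 0 \<and> 0 < x 1"

definition point :: "real set \<Rightarrow> int \<Rightarrow> real" where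
  "point \<xi> = (THE x. is_labelling \<xi> x)"

definition gap :: "int \<Rightarrow> real set \<Rightarrow> real" where
  "gap k \<xi> = point \<xi> k - point \<xi> (k - 1)"

definition iid_gaps :: "real measure \<Rightarrow> real set measure \<Rightarrow> bool" where
  "iid_gaps \<mu> P \<longleftrightarrow>
     prob_space P \<and> (AE \<xi> in P. \<exists>x. is_labelling \<xi> x) \<and>
     prob_space.indep_vars P (\<lambda>_. borel) gap UNIV \<and> (\<forall>k. distr P borel (gap k) = \<mu>)"

definition is_spp_law :: "real set measure \<Rightarrow> bool" where
  "is_spp_law Q \<longleftrightarrow> prob_space Q \<and> sets Q = sets config_space"

definition invariant_under :: "real \<Rightarrow> real set measure \<Rightarrow> bool" where
  "invariant_under a Q \<longleftrightarrow> distr Q config_space (\<lambda>\<xi>. (\<lambda>y. y + a) ` \<xi>) = Q"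

definition intensity :: "real set measure \<Rightarrow> ennreal" where
  "intensity Q = (\<integral>\<^sup>+\<xi>. of_nat (card (\<xi> \<inter> {0..1})) \<partial>Q)"

definition palm :: "real set measure \<Rightarrow> real set measure" where
  "palm Q = measure_of (space config_space) (sets config_space)
     (\<lambda>A. (\<integral>\<^sup>+\<xi>. of_nat (card {x \<in> \<xi> \<inter> {0..1}. (\<lambda>y. y - x) ` \<xi> \<in> A}) \<partial>Q) / intensity Q)"

definition cond_origin :: "real set measure \<Rightarrow> real set measure" where
  "cond_origin Q = uniform_measure Q {\<xi> \<in> space config_space. 0 \<in> \<xi>}"

text \<open>The stationary renewal laws on the line and on the integers are given by their defining
  properties: \<open>is_Ren_R \<mu> Q\<close> and \<open>is_Ren_Z \<mu> Q\<close> say that \<open>Q\<close> is the stationary renewal law with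
  gap law \<open>\<mu>\<close>.\<close>

definition is_Ren_R :: "real measure \<Rightarrow> real set measure \<Rightarrow> bool" where
  "is_Ren_R \<mu> Q \<longleftrightarrow>
     integrable \<mu> (\<lambda>x. x) \<and>
     is_spp_law Q \<and> (\<forall>a. invariant_under a Q) \<and> intensity Q < \<infinity> \<and>
     (AE \<xi> in Q. \<xi> \<noteq> {}) \<and> iid_gaps \<mu> (palm Q)"

definition is_Ren_Z :: "real measure \<Rightarrow> real set measure \<Rightarrow> bool" where
  "is_Ren_Z \<mu> Q \<longleftrightarrow>
     (AE x in \<mu>. x \<in> \<nat> \<and> 1 \<le> x) \<and> integrable \<mu> (\<lambda>x. x) \<and>
     is_spp_law Q \<and> (AE \<xi> in Q. \<xi> \<subseteq> \<int>) \<and> (\<forall>a\<in>\<int>. invariant_under a Q) \<and>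
     (AE \<xi> in Q. \<xi> \<noteq> {}) \<and> iid_gaps \<mu> (cond_origin Q)"

section \<open>The one-epoch coalescence process\<close>

text \<open>Every domain carries a mark: its clock \<open>T\<^sub>\<Delta>\<close> and a coin, which is \<open>True\<close> if the domain wants
  to incorporate its left neighbour, that is, to delete its own left endpoint.\<close>

type_synonym marks = "ereal \<times> ereal \<Rightarrow> ennreal \<times> bool"

definition clock :: "marks \<Rightarrow> ereal \<times> ereal \<Rightarrow> ennreal" where
  "clock m \<Delta> = fst (m \<Delta>)"

definition victim :: "marks \<Rightarrow> ereal \<times> ereal \<Rightarrow> ereal" where
  "victim m \<Delta> = (if snd (m \<Delta>) then fst \<Delta> else snd \<Delta>)"

definition clock_law :: "real \<Rightarrow> ennreal measure" where
  "clock_law r = (if 0 < r then distr (density lborel (exponential_density r)) borel ennreal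
                  else return borel \<infinity>)"

definition mark_law ::
    "(ereal \<Rightarrow> real) \<Rightarrow> (ereal \<Rightarrow> real) \<Rightarrow> ereal \<Rightarrow> (ennreal \<times> bool) measure" where
  "mark_law rl rr d =
     clock_law (rl d + rr d) \<Otimes>\<^sub>M measure_pmf (bernoulli_pmf (rr d / (rl d + rr d)))"

definition threatens :: "real set \<Rightarrow> marks \<Rightarrow> ereal \<times> ereal \<Rightarrow> ereal \<times> ereal \<Rightarrow> bool" where
  "threatens \<xi> m \<Delta>' \<Delta> \<longleftrightarrow>
     \<Delta>' \<in> domains \<xi> \<and> \<Delta> \<in> domains \<xi> \<and> clock m \<Delta>' < clock m \<Delta> \<and> victim m \<Delta>' \<in> endpoints \<Delta>"

text \<open>
  \<open>acts \<xi> m \<Delta>\<close>: the initial domain \<open>\<Delta>\<close> is still a domain when its clock rings;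
  \<open>preempted \<xi> m \<Delta>\<close>: an endpoint of \<open>\<Delta>\<close> has been deleted before its clock rings.
  Only domains of the initial configuration need to be considered, since merged domains have
  length at least \<open>d\<^sub>m\<^sub>a\<^sub>x\<close> and never act. Whether \<open>\<Delta>\<close> acts depends on domains with smaller clocks
  only; if there is no infinite descending chain of threats (an almost sure event, since the rates
  are bounded) exactly one of the two predicates holds for each domain, see \<open>acts_iff\<close> below. On the
  exceptional null event undecided domains do nothing.\<close>

inductive acts :: "real set \<Rightarrow> marks \<Rightarrow> ereal \<times> ereal \<Rightarrow> bool"
  and preempted :: "real set \<Rightarrow> marks \<Rightarrow> ereal \<times> ereal \<Rightarrow> bool"
  for \<xi> m where
  acts: "\<Delta> \<in> domains \<xi> \<Longrightarrow> (\<And>\<Delta>'. threatens \<xi> m \<Delta>' \<Delta> \<Longrightarrow> preempted \<xi> m \<Delta>') \<Longrightarrow> acts \<xi> m \<Delta>"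
| preempted: "threatens \<xi> m \<Delta>' \<Delta> \<Longrightarrow> acts \<xi> m \<Delta>' \<Longrightarrow> preempted \<xi> m \<Delta>"

definition alive :: "real set \<Rightarrow> marks \<Rightarrow> ennreal \<Rightarrow> real set" where
  "alive \<xi> m s = {x \<in> \<xi>. \<not> (\<exists>\<Delta>. acts \<xi> m \<Delta> \<and> clock m \<Delta> \<le> s \<and> victim m \<Delta> = ereal x)}"

definition ocp_path :: "real set \<Rightarrow> marks \<Rightarrow> ennreal \<Rightarrow> real set" where
  "ocp_path \<xi> m t = (if t = \<infinity> then (\<Inter>s\<in>{..<\<infinity>}. alive \<xi> m s) else alive \<xi> m t)"

lemma domains_alive_iff:
  assumes "\<Delta> \<in> domains \<xi>"
  shows "\<Delta> \<in> domains (alive \<xi> m s) \<longleftrightarrow>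
           \<not> (\<exists>\<Delta>'. acts \<xi> m \<Delta>' \<and> clock m \<Delta>' \<le> s \<and> victim m \<Delta>' \<in> endpoints \<Delta> \<inter> ereal ` \<xi>)"
proof
  assume "\<Delta> \<in> domains (alive \<xi> m s)"
  then show "\<not> (\<exists>\<Delta>'. acts \<xi> m \<Delta>' \<and> clock m \<Delta>' \<le> s \<and> victim m \<Delta>' \<in> endpoints \<Delta> \<inter> ereal ` \<xi>)"
    by (auto simp: domains_def ext_points_def alive_def endpoints_def)
next
  have sub: "ext_points (alive \<xi> m s) \<subseteq> ext_points \<xi>"
    by (auto simp: ext_points_def alive_def)
  assume *: "\<not> (\<exists>\<Delta>'. acts \<xi> m \<Delta>' \<and> clock m \<Delta>' \<le> s \<and> victim m \<Delta>' \<in> endpoints \<Delta> \<inter> ereal ` \<xi>)"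
  have "y \<in> ext_points (alive \<xi> m s)" if y: "y \<in> endpoints \<Delta>" "y \<in> ext_points \<xi>" for y
  proof (cases "y \<in> ereal ` \<xi>")
    case True
    then obtain x where x: "y = ereal x" "x \<in> \<xi>" by blast
    have "victim m \<Delta>' \<noteq> ereal x" if "acts \<xi> m \<Delta>'" "clock m \<Delta>' \<le> s" for \<Delta>'
    proof
      assume "victim m \<Delta>' = ereal x"
      then have "victim m \<Delta>' \<in> endpoints \<Delta> \<inter> ereal ` \<xi>"
        using x y(1) by simp
      with * that show False by iprover
    qed
    then have "x \<in> alive \<xi> m s"
      unfolding alive_def using x(2) by simp
    then show ?thesis using x by (simp add: ext_points_def)
  next
    case False
    then show ?thesis using y(2) by (auto simp: ext_points_def)
  qed
  then show "\<Delta> \<in> domains (alive \<xi> m s)"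
    using assms sub unfolding domains_def endpoints_def by (cases \<Delta>) (simp, fast)
qed

text \<open>The defining property of the graphical construction: \<open>\<Delta>\<close> acts iff it is a domain at all times
  before its clock rings. The victims are assumed to be points of the configuration for domains with
  finite clock, which holds almost surely because infinite domains have infinite clocks.\<close>

lemma acts_iff:
  assumes wf: "wf {(\<Delta>', \<Delta>). threatens \<xi> m \<Delta>' \<Delta>}"
    and fin: "\<And>\<Delta>'. \<Delta>' \<in> domains \<xi> \<Longrightarrow> clock m \<Delta>' < \<infinity> \<Longrightarrow> victim m \<Delta>' \<in> ereal ` \<xi>"
    and \<Delta>: "\<Delta> \<in> domains \<xi>"
  shows "acts \<xi> m \<Delta> \<longleftrightarrow> (\<forall>s < clock m \<Delta>. \<Delta> \<in> domains (alive \<xi> m s))"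
proof -
  have dom: "\<Delta>' \<in> domains \<xi>" if "acts \<xi> m \<Delta>'" for \<Delta>'
    using that by (auto elim: acts.cases)
  have excl: "\<Delta>' \<in> domains \<xi> \<longrightarrow> (acts \<xi> m \<Delta>' \<longleftrightarrow> \<not> preempted \<xi> m \<Delta>')" for \<Delta>'
    using wf
  proof (induction \<Delta>' rule: wf_induct_rule)
    case (less \<Delta>')
    have IH: "acts \<xi> m \<Delta>'' \<longleftrightarrow> \<not> preempted \<xi> m \<Delta>''" if "threatens \<xi> m \<Delta>'' \<Delta>'" for \<Delta>''
      using less that by (auto simp: threatens_def)
    show ?case
    proof (intro impI iffI notI)
      assume "acts \<xi> m \<Delta>'" and "preempted \<xi> m \<Delta>'"
      then obtain \<Delta>'' where "threatens \<xi> m \<Delta>'' \<Delta>'" "acts \<xi> m \<Delta>''" "preempted \<xi> m \<Delta>''"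
        by (meson acts.cases preempted.cases)
      then show False using IH by blast
    next
      assume "\<Delta>' \<in> domains \<xi>" "\<not> preempted \<xi> m \<Delta>'"
      show "acts \<xi> m \<Delta>'"
      proof (rule acts_preempted.acts)
        show "\<Delta>' \<in> domains \<xi>" by fact
        show "preempted \<xi> m \<Delta>''" if "threatens \<xi> m \<Delta>'' \<Delta>'" for \<Delta>''
          using IH[OF that] acts_preempted.preempted[OF that] \<open>\<not> preempted \<xi> m \<Delta>'\<close> by metis
      qed
    qed
  qed
  have "(\<exists>s < clock m \<Delta>. \<Delta> \<notin> domains (alive \<xi> m s)) \<longleftrightarrow>
        (\<exists>\<Delta>'. acts \<xi> m \<Delta>' \<and> clock m \<Delta>' < clock m \<Delta> \<and> victim m \<Delta>' \<in> endpoints \<Delta>)"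
  proof
    assume "\<exists>s < clock m \<Delta>. \<Delta> \<notin> domains (alive \<xi> m s)"
    then show "\<exists>\<Delta>'. acts \<xi> m \<Delta>' \<and> clock m \<Delta>' < clock m \<Delta> \<and> victim m \<Delta>' \<in> endpoints \<Delta>"
      unfolding domains_alive_iff[OF \<Delta>] by (blast intro: le_less_trans)
  next
    assume "\<exists>\<Delta>'. acts \<xi> m \<Delta>' \<and> clock m \<Delta>' < clock m \<Delta> \<and> victim m \<Delta>' \<in> endpoints \<Delta>"
    then obtain \<Delta>' where *: "acts \<xi> m \<Delta>'" "clock m \<Delta>' < clock m \<Delta>" "victim m \<Delta>' \<in> endpoints \<Delta>"
      by blast
    then have "clock m \<Delta>' < \<infinity>"
      by (metis infinity_ennreal_def not_less_iff_gr_or_eq order_less_le_trans top_greatest)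
    with * have "victim m \<Delta>' \<in> ereal ` \<xi>"
      using fin dom by blast
    with * show "\<exists>s < clock m \<Delta>. \<Delta> \<notin> domains (alive \<xi> m s)"
      unfolding domains_alive_iff[OF \<Delta>] by blast
  qed
  also have "\<dots> \<longleftrightarrow> preempted \<xi> m \<Delta>"
    using \<Delta> dom by (auto simp: preempted.simps threatens_def)
  finally show ?thesis
    using excl \<Delta> by blast
qed

text \<open>Given \<open>\<xi>(0) = \<xi>\<close>, the marks of the domains of \<open>\<xi>\<close> are independent.\<close>

definition ocp_kernel ::
    "(ereal \<Rightarrow> real) \<Rightarrow> (ereal \<Rightarrow> real) \<Rightarrow> ennreal \<Rightarrow> real set \<Rightarrow> real set measure" where
  "ocp_kernel rl rr t \<xi> =
     distr (\<Pi>\<^sub>M \<Delta>\<in>domains \<xi>. mark_law rl rr (dom_length \<Delta>)) config_space (\<lambda>m. ocp_path \<xi> m t)"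

text \<open>The law of \<open>\<xi>(t)\<close> for the process with rates \<open>rl = \<lambda>\<^sub>\<ell>\<close> and \<open>rr = \<lambda>\<^sub>r\<close> whose initial state has
  law \<open>Q\<close>, for \<open>t \<in> [0,\<infinity>]\<close>. The initial law is restricted to the state space of the process; it is
  understood that \<open>Q\<close> is carried by this set.\<close>

definition ocp_law ::
    "real \<Rightarrow> (ereal \<Rightarrow> real) \<Rightarrow> (ereal \<Rightarrow> real) \<Rightarrow> real set measure \<Rightarrow> ennreal \<Rightarrow> real set measure"
  where
  "ocp_law dmin rl rr Q t = restrict_space Q (min_configs dmin) \<bind> ocp_kernel rl rr t"

section \<open>Weak convergence along a filter\<close>

text \<open>The library notion \<open>weak_conv_m\<close> covers sequences only.\<close>

definition weak_limit :: "('i \<Rightarrow> real measure) \<Rightarrow> real measure \<Rightarrow> 'i filter \<Rightarrow> bool" where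
  "weak_limit M L F \<longleftrightarrow>
     (\<forall>f :: real \<Rightarrow> real. continuous_on UNIV f \<and> bounded (range f) \<longrightarrow>
        ((\<lambda>i. \<integral>x. f x \<partial>M i) \<longlongrightarrow> (\<integral>x. f x \<partial>L)) F)"

end

theory Submission imports Defs
begin

text \<open>Domains of length at least \<open>dmax\<close> never act, so the process is a function of the sequence of
  lengths and marks of the initial domains. As long as a point survives, the two sides of it do not
  influence each other: the point survives iff it survives in both half-line processes, and then both
  sides evolve like half-line processes. For i.i.d. domains on a half-line this makes survival of the
  \<open>k\<close>-th point a renewal event: it is an event of the first \<open>k\<close> domains together with the survival of
  the origin for the shifted sequence. Hence the gaps between consecutive survivors are i.i.d. given
  that the origin survives, and independent of the first survivor in any case. Reversing a finite block
  of domains exchanges left and right without changing its length, so a half-line to the left yields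
  the same gap law. If many consecutive points are deleted, then clocks of neighbouring domains
  are ordered in a way that has probability at most \<open>1/2\<close> in each block of ten domains; so gaps have
  exponential tails in units of initial gaps, which yields infinitely many survivors, finite means, and
  the limit of large times.

  For stationary initial laws, the transition kernel commutes with translations, and Campbell's
  formula shows that the Palm measure of the evolved law is the law evolved from the Palm measure,
  conditioned on the survival of the origin. This reduces the stationary cases to two independent
  half-lines.\<close>

section \<open>Status predicates along a threat relation\<close>

text \<open>Two obstacles shape the proof. The construction is unambiguous only if threats have no
  infinite descending chain, and the product space that carries the marks changes with the
  configuration. Against the first, \<open>status\<close> is a least fixed point that makes sense
  without well-foundedness, and well-foundedness comes almost surely from the estimate that also
  bounds the gaps: an infinite descent makes all late blocks of ten domains \<open>Bad\<close>.
  Against the second, a mark is written as a function of the length and of noise with a fixed law,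
  and every injective labelling of the domains is shown to give the same kernel; grid cells,
  integers or the domains themselves then serve as labels. Why ten: if all nine interior points die,
  the domain that deletes the middle one fixes a direction in which four further domains must act.
  Their clocks form two disjoint ordered pairs, of joint probability at most 1/4 by exchangeability;
  two directions give 1/2. Reversal acts only on finite blocks. The gap law is therefore rewritten
  as a series over blocks, in which the survival probability used for conditioning cancels.\<close>

inductive status :: "('a \<Rightarrow> 'a \<Rightarrow> bool) \<Rightarrow> bool \<Rightarrow> 'a \<Rightarrow> bool" for thr where
  act: "(\<And>b. thr b a \<Longrightarrow> status thr False b) \<Longrightarrow> status thr True a"
| pre: "thr b a \<Longrightarrow> status thr True b \<Longrightarrow> status thr False a"

text \<open>An acting element has only preempted threats, while preemption exhibits an acting
  threat; for that threat the induction hypothesis excludes having both statuses.\<close>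

lemma status_exclusive: "status thr s a \<Longrightarrow> \<not> status thr (\<not> s) a"
proof (induction rule: status.induct)
  case (act a)
  then show ?case by (auto elim: status.cases)
next
  case (pre b a)
  then show ?case by (auto elim: status.cases)
qed

text \<open>If no threat of \<open>a\<close> acts, all of them are preempted by induction, so
  \<open>a\<close> acts. Along an infinite descending chain neither status need be
  derivable.\<close>

lemma status_total: "wf {(b, a). thr b a} \<Longrightarrow> status thr True a \<or> status thr False a"
proof (induction a rule: wf_induct_rule)
  case (less a)
  show ?case
  proof (cases "\<exists>b. thr b a \<and> status thr True b")
    case True
    then show ?thesis by (blast intro: status.pre)
  next
    case False
    then have "status thr True a" using less.IH by (intro status.act) auto
    then show ?thesis ..
  qed
qed

lemma status_bisim_imp:
  assumes bis: "\<And>a a'. r a a' \<Longrightarrow>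
      (\<forall>b. thr b a \<longrightarrow> (\<exists>b'. thr' b' a' \<and> r b b')) \<and> (\<forall>b'. thr' b' a' \<longrightarrow> (\<exists>b. thr b a \<and> r b b'))"
  shows "status thr s a \<Longrightarrow> r a a' \<Longrightarrow> status thr' s a'"
proof (induction arbitrary: a' rule: status.induct)
  case (act a)
  show ?case
    by (rule status.act) (use bis[OF act.prems] act.IH in blast)
next
  case (pre b a)
  then show ?case using bis[OF pre.prems] by (blast intro: status.pre)
qed

text \<open>A status depends only on the tree of threats below an element, so elements related back
  and forth share it. Index shifts, reflections, translations and the passage from domains to
  indices are all instances, and none of them needs well-foundedness.\<close>

lemma status_bisim:
  assumes bis: "\<And>a a'. r a a' \<Longrightarrow>
      (\<forall>b. thr b a \<longrightarrow> (\<exists>b'. thr' b' a' \<and> r b b')) \<and> (\<forall>b'. thr' b' a' \<longrightarrow> (\<exists>b. thr b a \<and> r b b'))"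
    and r: "r a a'"
  shows "status thr s a \<longleftrightarrow> status thr' s a'"
proof
  assume "status thr s a"
  then show "status thr' s a'" using status_bisim_imp[of r thr thr', OF bis] r by blast
next
  have bis': "\<And>a a'. r\<inverse>\<inverse> a a' \<Longrightarrow>
      (\<forall>b. thr' b a \<longrightarrow> (\<exists>b'. thr b' a' \<and> r\<inverse>\<inverse> b b')) \<and> (\<forall>b'. thr b' a' \<longrightarrow> (\<exists>b. thr' b a \<and> r\<inverse>\<inverse> b b'))"
    using bis by (metis conversep_iff)
  assume "status thr' s a'"
  then show "status thr s a" using status_bisim_imp[of "r\<inverse>\<inverse>" thr' thr, OF bis'] r by blast
qed

section \<open>Finite approximations of the status\<close>

primrec status_iter :: "('a \<Rightarrow> 'a \<Rightarrow> bool) \<Rightarrow> nat \<Rightarrow> bool \<Rightarrow> 'a \<Rightarrow> bool" where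
  "status_iter thr 0 s a \<longleftrightarrow> False"
| "status_iter thr (Suc n) s a \<longleftrightarrow>
     (if s then \<forall>b. thr b a \<longrightarrow> status_iter thr n False b
      else \<exists>b. thr b a \<and> status_iter thr n True b)"

lemma status_iter_mono: "status_iter thr n s a \<Longrightarrow> n \<le> n' \<Longrightarrow> status_iter thr n' s a"
proof (induction n arbitrary: n' s a)
  case (Suc n)
  then obtain m where "n' = Suc m" "n \<le> m" by (cases n') auto
  then show ?case using Suc by (auto split: if_splits)
qed simp

lemma status_iter_imp: "status_iter thr n s a \<Longrightarrow> status thr s a"
proof (induction n arbitrary: s a)
  case (Suc n)
  then show ?case by (cases s) (auto intro: status.intros)
qed simp

text \<open>With finitely many threats per element the least fixed point is reached after countably
  many steps: the premises for acting need finitely many stages, whose maximum suffices. This makes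
  \<open>status\<close> a countable union of events.\<close>

lemma status_iff_iter:
  assumes fin: "\<And>a. finite {b. thr b a}"
  shows "status thr s a \<longleftrightarrow> (\<exists>n. status_iter thr n s a)"
proof
  assume "status thr s a"
  then show "\<exists>n. status_iter thr n s a"
  proof (induction rule: status.induct)
    case (act a)
    then obtain f where f: "\<And>b. thr b a \<Longrightarrow> status_iter thr (f b) False b" by metis
    obtain N where N: "\<And>b. thr b a \<Longrightarrow> f b \<le> N"
      using finite_imageI[OF fin[of a], of f] by (metis (mono_tags) Max_ge imageI mem_Collect_eq)
    have "status_iter thr (Suc N) True a" using f N by (auto intro: status_iter_mono)
    then show ?case by blast
  next
    case (pre b a)
    then obtain n where "status_iter thr n True b" by blast
    then have "status_iter thr (Suc n) False a" using pre by auto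
    then show ?case by blast
  qed
qed (blast intro: status_iter_imp)

text \<open>\<open>threatens\<close> already confines both arguments to domains. Only the root of a
  derivation has to be required to be a domain, since \<open>status\<close> lets every unthreatened
  pair act.\<close>

lemma acts_iff_status:
  "acts \<xi> m \<Delta> \<longleftrightarrow> \<Delta> \<in> domains \<xi> \<and> status (threatens \<xi> m) True \<Delta>"
proof -
  have "(acts \<xi> m \<Delta> \<longrightarrow> \<Delta> \<in> domains \<xi> \<and> status (threatens \<xi> m) True \<Delta>) \<and>
      (preempted \<xi> m \<Delta>' \<longrightarrow> status (threatens \<xi> m) False \<Delta>')" for \<Delta>'
  proof (rule acts_preempted.induct, goal_cases)
    case (1 \<Delta>) then show ?case by (auto intro: status.act)
  next
    case (2 \<Delta>' \<Delta>) then show ?case by (auto intro: status.pre)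
  qed
  moreover have "status (threatens \<xi> m) s \<Delta> \<Longrightarrow> \<Delta> \<in> domains \<xi> \<Longrightarrow>
      (if s then acts \<xi> m \<Delta> else preempted \<xi> m \<Delta>)" for s \<Delta>
  proof (induction rule: status.induct)
    case (act \<Delta>)
    then show ?case by (auto intro!: acts_preempted.acts simp: threatens_def)
  next
    case (pre \<Delta>' \<Delta>)
    then show ?case by (auto intro!: acts_preempted.preempted simp: threatens_def)
  qed
  ultimately show ?thesis by (metis (full_types))
qed

text \<open>One formula serves finite and infinite times: a point is missing at time
  \<open>\<infinity>\<close> iff it was deleted at a finite time, and for finite \<open>t\<close>
  the bound on the clock is automatic.\<close>

lemma ocp_path_eq:
  "ocp_path \<xi> m t = {x \<in> \<xi>. \<not> (\<exists>\<Delta>. acts \<xi> m \<Delta> \<and> clock m \<Delta> \<le> t \<and> clock m \<Delta> < \<infinity> \<and> victim m \<Delta> = ereal x)}"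
proof (cases "t = \<infinity>")
  case True
  have "0 < (\<infinity>::ennreal)" by simp
  then show ?thesis using True unfolding ocp_path_def alive_def by (fastforce simp del: infinity_ennreal_def)
next
  case False
  then have "t < \<infinity>" by (simp add: less_top)
  then show ?thesis using False
    by (auto simp: ocp_path_def alive_def intro: le_less_trans)
qed

lemma ocp_path_subset: "ocp_path \<xi> m t \<subseteq> \<xi>"
  by (auto simp: ocp_path_eq)

section \<open>The process on indices\<close>

type_synonym mark = "ennreal \<times> bool"

text \<open>Index \<open>i\<close> stands for the domain between the points number \<open>i\<close> and \<open>i + 1\<close>. An infinite clock
  makes a domain inert, so that absent domains are encoded by infinite clocks.\<close>

definition ithr :: "(int \<Rightarrow> mark) \<Rightarrow> int \<Rightarrow> int \<Rightarrow> bool" where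
  "ithr y j i \<longleftrightarrow> fst (y j) < fst (y i) \<and> (j = i - 1 \<and> \<not> snd (y j) \<or> j = i + 1 \<and> snd (y j))"

definition ivic :: "(int \<Rightarrow> mark) \<Rightarrow> int \<Rightarrow> int" where
  "ivic y i = (if snd (y i) then i else i + 1)"

definition idel :: "(int \<Rightarrow> mark) \<Rightarrow> ennreal \<Rightarrow> int \<Rightarrow> bool" where
  "idel y t k \<longleftrightarrow> (\<exists>i. status (ithr y) True i \<and> fst (y i) \<le> t \<and> fst (y i) < \<infinity> \<and> ivic y i = k)"

text \<open>Domains outside \<open>I\<close> become inert instead of being removed, so that
  half-lines and finite blocks live on the same index set. Their coins are kept, which is harmless
  because an inert domain never uses its coin.\<close>

definition restr :: "int set \<Rightarrow> (int \<Rightarrow> mark) \<Rightarrow> int \<Rightarrow> mark" where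
  "restr I y i = (if i \<in> I then fst (y i) else \<infinity>, snd (y i))"

definition flip :: "mark \<Rightarrow> mark" where
  "flip c = (fst c, \<not> snd c)"

text \<open>Reflecting point \<open>k\<close> to \<open>- k\<close> sends the domain between
  \<open>i\<close> and \<open>i + 1\<close> to the one between \<open>- i - 1\<close> and
  \<open>- i\<close>, whose number is \<open>- 1 - i\<close>, and exchanges the meaning of the
  coins.\<close>

definition mirror :: "(int \<Rightarrow> mark) \<Rightarrow> int \<Rightarrow> mark" where
  "mirror y i = flip (y (- 1 - i))"

lemma flip_simps [simp]: "fst (flip c) = fst c" "snd (flip c) \<longleftrightarrow> \<not> snd c" "flip (flip c) = c"
  by (auto simp: flip_def)

lemma restr_simps [simp]: "snd (restr I y i) = snd (y i)"
    "i \<in> I \<Longrightarrow> fst (restr I y i) = fst (y i)" "i \<notin> I \<Longrightarrow> fst (restr I y i) = top"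
  by (auto simp: restr_def)

lemma idel_cases:
  "idel y t k \<longleftrightarrow>
     status (ithr y) True k \<and> snd (y k) \<and> fst (y k) \<le> t \<and> fst (y k) < \<infinity> \<or>
     status (ithr y) True (k - 1) \<and> \<not> snd (y (k - 1)) \<and> fst (y (k - 1)) \<le> t \<and> fst (y (k - 1)) < \<infinity>"
proof -
  have "ivic y i = k \<longleftrightarrow> i = k \<and> snd (y i) \<or> i = k - 1 \<and> \<not> snd (y i)" for i
    by (auto simp: ivic_def)
  then show ?thesis unfolding idel_def
    by (simp only: conj_disj_distribL ex_disj_distrib) auto
qed

lemma idel_mono: "idel y s k \<Longrightarrow> s \<le> t \<Longrightarrow> idel y t k"
  by (auto simp: idel_def intro: order_trans)

lemma idel_infty: "idel y \<infinity> k \<Longrightarrow> \<exists>s<\<infinity>. idel y s k"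
  unfolding idel_def by blast

text \<open>A domain that threatens has a clock below another one, and a domain that deletes has a
  finite clock by definition. So coins of inert domains are never read.\<close>

lemma idel_cong:
  assumes "\<And>i. fst (y i) = fst (y' i)" "\<And>i. fst (y i) < \<infinity> \<Longrightarrow> snd (y i) = snd (y' i)"
  shows "idel y t k \<longleftrightarrow> idel y' t k"
proof -
  have 1: "ithr y j i \<longleftrightarrow> ithr y' j i" for i j
  proof -
    have "fst (y' j) < fst (y' i) \<Longrightarrow> snd (y j) = snd (y' j)"
      using assms(1)[of j] assms(2)[of j] by (simp add: order_less_le_trans)
    then show ?thesis
      unfolding ithr_def using assms(1) by auto
  qed
  have "ithr y = ithr y'" by (intro ext) (rule 1)
  then show ?thesis unfolding idel_cases using assms by metis
qed

section \<open>Translation and reflection of indices\<close>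

lemma status_shift:
  assumes "\<And>i. y' i = y (i + c)"
  shows "status (ithr y') s i \<longleftrightarrow> status (ithr y) s (i + c)"
proof (rule status_bisim[where r = "\<lambda>a b. b = a + c"])
  fix a a' :: int assume a: "a' = a + c"
  have "ithr y' b a \<longleftrightarrow> ithr y (b + c) (a + c)" for b by (auto simp: ithr_def assms)
  moreover have "\<exists>b. b' = b + c" for b' by (rule exI[of _ "b' - c"]) simp
  ultimately show "(\<forall>b. ithr y' b a \<longrightarrow> (\<exists>b'. ithr y b' a' \<and> b' = b + c)) \<and>
      (\<forall>b'. ithr y b' a' \<longrightarrow> (\<exists>b. ithr y' b a \<and> b' = b + c))"
    using a by metis
qed simp

lemma idel_shift:
  assumes "\<And>i. y' i = y (i + c)"
  shows "idel y' t k \<longleftrightarrow> idel y t (k + c)"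
  unfolding idel_cases status_shift[of y' y, OF assms] assms by (simp add: algebra_simps)

lemma status_mirror: "status (ithr (mirror y)) s i \<longleftrightarrow> status (ithr y) s (- 1 - i)"
proof (rule status_bisim[where r = "\<lambda>a b. b = - 1 - a"])
  fix a a' :: int assume a: "a' = - 1 - a"
  have "ithr (mirror y) b a \<longleftrightarrow> ithr y (- 1 - b) (- 1 - a)" for b by (auto simp: ithr_def mirror_def)
  moreover have "\<exists>b. b' = - 1 - b" for b' :: int by (rule exI[of _ "- 1 - b'"]) simp
  ultimately show "(\<forall>b. ithr (mirror y) b a \<longrightarrow> (\<exists>b'. ithr y b' a' \<and> b' = - 1 - b)) \<and>
      (\<forall>b'. ithr y b' a' \<longrightarrow> (\<exists>b. ithr (mirror y) b a \<and> b' = - 1 - b))"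
    using a by metis
qed simp

lemma idel_mirror: "idel (mirror y) t k \<longleftrightarrow> idel y t (- k)"
proof -
  have e: "- 1 - (k - 1) = - k" "- 1 - k = - k - 1" by auto
  show ?thesis unfolding idel_cases status_mirror mirror_def e by auto
qed

text \<open>The two sides of a point do not influence each other as long as the point is there.\<close>

lemma status_restr_imp:
  assumes "status (ithr y) b i" "k \<le> i" "fst (y i) \<le> s"
    and "\<not> (status (ithr y) True (k - 1) \<and> \<not> snd (y (k - 1)) \<and> fst (y (k - 1)) < s)"
  shows "status (ithr (restr {k..} y)) b i"
  using assms(1-3)
proof (induction rule: status.induct)
  case (act i)
  show ?case
  proof (rule status.act)
    fix j assume j: "ithr (restr {k..} y) j i"
    \<comment> \<open>Threats from the left of \<open>k\<close> are inert in the restricted process,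
      so for acting there are fewer premises to check.\<close>
    then have "k \<le> j" by (auto simp: ithr_def restr_def split: if_splits)
    with j act.prems have thr: "ithr y j i" by (auto simp: ithr_def)
    have "fst (y j) \<le> s" using thr act.prems by (auto simp: ithr_def)
    then show "status (ithr (restr {k..} y)) False j"
      using act.IH[OF thr] \<open>k \<le> j\<close> by blast
  qed
next
  case (pre j i)
  have lt: "fst (y j) < s" using pre by (auto simp: ithr_def)
  \<comment> \<open>The only threat that crosses the point \<open>k\<close> is domain
    \<open>k - 1\<close> deleting it, and the last assumption forbids that before time
    \<open>s\<close>.\<close>
  have "k \<le> j"
  proof (rule ccontr)
    assume "\<not> k \<le> j"
    then have "j = k - 1" "\<not> snd (y j)" using pre by (auto simp: ithr_def)
    then show False using pre.hyps lt assms(4) by auto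
  qed
  moreover have "status (ithr (restr {k..} y)) True j"
    using pre.IH \<open>k \<le> j\<close> lt by simp
  moreover have "ithr (restr {k..} y) j i"
    using pre.hyps(1) pre.prems(1) \<open>k \<le> j\<close> by (auto simp: ithr_def)
  ultimately show ?case by (metis status.pre)
qed

text \<open>The converse needs totality: one of the two statuses holds in the full process, passes
  to the restriction, and excludes the other one there.\<close>

lemma status_restr_iff:
  assumes wf: "wf {(b, a). ithr y b a}" and "k \<le> i" "fst (y i) \<le> s"
    and "\<not> (status (ithr y) True (k - 1) \<and> \<not> snd (y (k - 1)) \<and> fst (y (k - 1)) < s)"
  shows "status (ithr (restr {k..} y)) b i \<longleftrightarrow> status (ithr y) b i"
proof -
  have imp: "status (ithr (restr {k..} y)) b i" if "status (ithr y) b i" for b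
    using status_restr_imp[OF that assms(2-4)] .
  have "status (ithr y) b i \<or> status (ithr y) (\<not> b) i"
    using status_total[OF wf, of i] by (cases b) auto
  then show ?thesis using imp status_exclusive[of "ithr (restr {k..} y)" b i] by blast
qed

text \<open>Survival of \<open>k\<close> up to time \<open>t\<close> is what
  \<open>status_restr_iff\<close> asks for with \<open>s = t\<close>.\<close>

lemma idel_right:
  assumes wf: "wf {(b, a). ithr y b a}" and "\<not> idel y t k" "k \<le> p"
  shows "idel (restr {k..} y) t p \<longleftrightarrow> idel y t p"
proof -
  have H: "\<not> (status (ithr y) True (k - 1) \<and> \<not> snd (y (k - 1)) \<and> fst (y (k - 1)) < t)"
    using assms(2) unfolding idel_cases by (auto intro: order_less_le_trans)
  have *: "status (ithr (restr {k..} y)) True i \<longleftrightarrow> status (ithr y) True i" if "k \<le> i" "fst (y i) \<le> t" for i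
    using status_restr_iff[OF wf that H] .
  show ?thesis
  proof (cases "p = k")
    case True
    then show ?thesis using assms(2) * unfolding idel_cases by auto
  next
    case False
    then have "k \<le> p - 1" "k \<le> p" using assms by auto
    then show ?thesis unfolding idel_cases using * by auto
  qed
qed

lemma mirror_restr: "mirror (restr I y) = restr ((\<lambda>i. - 1 - i) ` I) (mirror y)"
proof
  fix i
  have "-1 - i \<in> I \<longleftrightarrow> i \<in> (\<lambda>i. - 1 - i) ` I"
    by (auto intro!: image_eqI[of _ _ "-1 - i"])
  then show "mirror (restr I y) i = restr ((\<lambda>i. - 1 - i) ` I) (mirror y) i"
    by (auto simp: mirror_def restr_def flip_def)
qed

lemma mirror_lessThan: "(\<lambda>i. - 1 - i) ` {..<k} = {- k :: int..}"
  by (auto intro!: image_eqI[of _ _ "-1 - _"])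

lemma ithr_mirror: "ithr (mirror y) b a \<longleftrightarrow> ithr y (- 1 - b) (- 1 - a)"
  by (auto simp: ithr_def mirror_def)

lemma wf_mirror: "wf {(b, a). ithr y b a} \<Longrightarrow> wf {(b, a). ithr (mirror y) b a}"
  by (drule wf_inv_image[where f = "\<lambda>i. - 1 - i"])
    (simp add: inv_image_def ithr_mirror)

lemma idel_left:
  assumes wf: "wf {(b, a). ithr y b a}" and "\<not> idel y t k" "p \<le> k"
  shows "idel (restr {..<k} y) t p \<longleftrightarrow> idel y t p"
  using idel_right[OF wf_mirror[OF wf], of t "- k" "- p"] assms(2,3)
  by (simp add: idel_mirror mirror_lessThan flip: mirror_restr) (metis idel_mirror minus_minus mirror_lessThan mirror_restr)

text \<open>If the left neighbour has not deleted \<open>k\<close> strictly before domain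
  \<open>k\<close> does, the right half-line reproduces the deletion:
  \<open>status_restr_iff\<close> is applied with \<open>s\<close> equal to the clock of
  \<open>k\<close>.\<close>

lemma idel_join_aux:
  assumes wf: "wf {(b, a). ithr y b a}"
    and k: "status (ithr y) True k" "snd (y k)" "fst (y k) \<le> t" "fst (y k) < \<infinity>"
    and H: "\<not> (status (ithr y) True (k - 1) \<and> \<not> snd (y (k - 1)) \<and> fst (y (k - 1)) < fst (y k))"
  shows "idel (restr {k..} y) t k"
  unfolding idel_cases using status_restr_iff[OF wf _ _ H, of k] k by auto

lemma idel_join_aux_left:
  assumes wf: "wf {(b, a). ithr y b a}"
    and k: "status (ithr y) True (k - 1)" "\<not> snd (y (k - 1))" "fst (y (k - 1)) \<le> t" "fst (y (k - 1)) < \<infinity>"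
    and H: "\<not> (status (ithr y) True k \<and> snd (y k) \<and> fst (y k) < fst (y (k - 1)))"
  shows "idel (restr {..<k} y) t k"
proof -
  have e: "- 1 - (- k) = k - 1" "- 1 - (- k - 1) = k" by auto
  have "idel (restr {- k..} (mirror y)) t (- k)"
  proof (rule idel_join_aux[OF wf_mirror[OF wf]])
    show "status (ithr (mirror y)) True (- k)" using k by (simp only: status_mirror e)
    show "snd (mirror y (- k))" "fst (mirror y (- k)) \<le> t" "fst (mirror y (- k)) < \<infinity>"
      using k by (simp_all only: mirror_def e flip_simps) simp_all
    show "\<not> (status (ithr (mirror y)) True (- k - 1) \<and> \<not> snd (mirror y (- k - 1)) \<and>
        fst (mirror y (- k - 1)) < fst (mirror y (- k)))"
      using H by (simp only: status_mirror mirror_def e flip_simps) simp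
  qed
  then show ?thesis by (metis idel_mirror minus_minus mirror_lessThan mirror_restr)
qed

text \<open>If both half-lines spare \<open>k\<close>, then each of the two adjacent domains could
  delete \<open>k\<close> only if the other one had deleted it strictly earlier. Each clock would be
  smaller than the other.\<close>

lemma idel_join:
  assumes wf: "wf {(b, a). ithr y b a}" and R: "\<not> idel (restr {k..} y) t k" and L: "\<not> idel (restr {..<k} y) t k"
  shows "\<not> idel y t k"
proof
  assume d: "idel y t k"
  let ?A = "status (ithr y) True k \<and> snd (y k) \<and> fst (y k) \<le> t \<and> fst (y k) < \<infinity>"
  let ?B = "status (ithr y) True (k - 1) \<and> \<not> snd (y (k - 1)) \<and> fst (y (k - 1)) \<le> t \<and> fst (y (k - 1)) < \<infinity>"
  have A: "?B \<and> fst (y (k - 1)) < fst (y k)" if ?A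
  proof -
    have *: "status (ithr y) True (k - 1) \<and> \<not> snd (y (k - 1)) \<and> fst (y (k - 1)) < fst (y k)"
      using idel_join_aux[OF wf, of k t] R that by blast
    moreover have "fst (y (k - 1)) \<le> t" "fst (y (k - 1)) < \<infinity>"
      using * that by (metis order_trans less_imp_le, metis less_trans)
    ultimately show ?thesis by blast
  qed
  have B: "?A \<and> fst (y k) < fst (y (k - 1))" if ?B
  proof -
    have *: "status (ithr y) True k \<and> snd (y k) \<and> fst (y k) < fst (y (k - 1))"
      using idel_join_aux_left[OF wf, of k t] L that by blast
    moreover have "fst (y k) \<le> t" "fst (y k) < \<infinity>"
      using * that by (metis order_trans less_imp_le, metis less_trans)
    ultimately show ?thesis by blast
  qed
  show False
  proof (cases ?A)
    case True
    with A B have "fst (y k) < fst (y k)" by (meson less_trans)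
    then show False by simp
  next
    case False
    then have ?B using d unfolding idel_cases by blast
    with A B have "fst (y k) < fst (y k)" by (meson less_trans)
    then show False by simp
  qed
qed

lemma idel_split:
  assumes "wf {(b, a). ithr y b a}"
  shows "\<not> idel y t k \<longleftrightarrow> \<not> idel (restr {k..} y) t k \<and> \<not> idel (restr {..<k} y) t k"
  using idel_right[OF assms] idel_left[OF assms] idel_join[OF assms] by (metis order_refl)

subsection \<open>Blocks without survivors\<close>

text \<open>The alternatives are the traces of deletions spreading to the right and to the left of
  the middle one of the nine points inside ten domains. Only disjoint pairs of clocks are recorded,
  so that the two comparisons in an alternative are independent.\<close>

definition Bad :: "(nat \<Rightarrow> mark) \<Rightarrow> bool" where
  "Bad c \<longleftrightarrow> fst (c 6) \<le> fst (c 7) \<and> fst (c 7) < \<infinity> \<and> fst (c 8) \<le> fst (c 9) \<and> fst (c 9) < \<infinity> \<or>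
     fst (c 1) \<le> fst (c 0) \<and> fst (c 0) < \<infinity> \<and> fst (c 3) \<le> fst (c 2) \<and> fst (c 2) < \<infinity>"

text \<open>Two acting domains do not threaten each other, so the one that deletes the common
  endpoint cannot ring strictly first.\<close>

lemma acts_neighbours:
  assumes "status (ithr y) True i" "status (ithr y) True (i + 1)"
  shows "snd (y (i + 1)) \<Longrightarrow> fst (y i) \<le> fst (y (i + 1))"
    and "\<not> snd (y i) \<Longrightarrow> fst (y (i + 1)) \<le> fst (y i)"
proof -
  have no: "\<not> ithr y b a" if "status (ithr y) True b" "status (ithr y) True a" for a b
    using status_exclusive[OF that(2)] status.pre[of "ithr y", OF _ that(1)] by auto
  show "snd (y (i + 1)) \<Longrightarrow> fst (y i) \<le> fst (y (i + 1))"
    using no[OF assms(2,1)] by (auto simp: ithr_def)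
  show "\<not> snd (y i) \<Longrightarrow> fst (y (i + 1)) \<le> fst (y i)"
    using no[OF assms] by (auto simp: ithr_def)
qed

text \<open>Every deleted point is deleted by an adjacent domain, and a domain deletes only one point. So
  if the domain to the right of the middle point deletes it, all domains further right delete their
  left endpoints; as each of them acts, none was preempted, and their clocks are ordered.\<close>

lemma all_deleted_Bad:
  assumes del: "\<And>j. a + 1 \<le> j \<Longrightarrow> j \<le> a + 9 \<Longrightarrow> idel y \<infinity> j"
  shows "Bad (\<lambda>n. y (a + int n))"
proof (cases "status (ithr y) True (a + 5) \<and> snd (y (a + 5)) \<and> fst (y (a + 5)) < \<infinity>")
  case True
  define P where "P i \<longleftrightarrow> status (ithr y) True i \<and> snd (y i) \<and> fst (y i) < \<infinity>" for i
  have step: "P (a + 4 + int n)" if "1 \<le> n" "n \<le> 5" for n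
    using that
  proof (induction n rule: nat_induct_at_least)
    case base
    then show ?case using True by (simp add: P_def add.commute)
  next
    case (Suc n)
    then have "P (a + 4 + int n)" by simp
    moreover have "idel y \<infinity> (a + 4 + int n + 1)" using Suc by (intro del) auto
    ultimately show ?case unfolding P_def idel_cases by (auto simp: algebra_simps)
  qed
  have "P (a + 6)" "P (a + 7)" "P (a + 8)" "P (a + 9)"
    using step[of 2] step[of 3] step[of 4] step[of 5] by (simp_all add: add.commute)
  then have "fst (y (a + 6)) \<le> fst (y (a + 7))" "fst (y (a + 8)) \<le> fst (y (a + 9))"
      "fst (y (a + 7)) < \<infinity>" "fst (y (a + 9)) < \<infinity>"
    using acts_neighbours(1)[of y "a + 6"] acts_neighbours(1)[of y "a + 8"]
    unfolding P_def by (simp_all add: add.assoc)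
  then show ?thesis by (simp add: Bad_def)
next
  \<comment> \<open>The middle point is not deleted by domain \<open>a + 5\<close>, hence by
    \<open>a + 4\<close>; the argument then runs leftwards down to domain \<open>a\<close>.\<close>
  case False
  define P where "P i \<longleftrightarrow> status (ithr y) True i \<and> \<not> snd (y i) \<and> fst (y i) < \<infinity>" for i
  have step: "P (a + 5 - int n)" if "1 \<le> n" "n \<le> 5" for n
    using that
  proof (induction n rule: nat_induct_at_least)
    case base
    have "idel y \<infinity> (a + 5)" by (rule del) auto
    then show ?case using False unfolding P_def idel_cases by auto
  next
    case (Suc n)
    then have "P (a + 5 - int n)" by simp
    moreover have "idel y \<infinity> (a + 5 - int n)" using Suc by (intro del) auto
    ultimately show ?case unfolding P_def idel_cases by (auto simp: algebra_simps)
  qed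
  have "P (a + 0)" "P (a + 1)" "P (a + 2)" "P (a + 3)"
    using step[of 2] step[of 3] step[of 4] step[of 5] by (simp_all add: add.commute)
  then have "fst (y (a + 1)) \<le> fst (y (a + 0))" "fst (y (a + 3)) \<le> fst (y (a + 2))"
      "fst (y (a + 0)) < \<infinity>" "fst (y (a + 2)) < \<infinity>"
    using acts_neighbours(2)[of y a] acts_neighbours(2)[of y "a + 2"]
    unfolding P_def by (simp_all add: add.assoc)
  then show ?thesis by (simp add: Bad_def)
qed

definition sh :: "nat \<Rightarrow> (nat \<Rightarrow> 'a) \<Rightarrow> nat \<Rightarrow> 'a" where
  "sh k c i = c (i + k)"

text \<open>Infinitely many windows of ten domains are not \<open>Bad\<close>. This single
  deterministic condition, stable under shifts, yields both well-foundedness and infinitely many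
  survivors.\<close>

definition Good :: "(nat \<Rightarrow> mark) \<Rightarrow> bool" where
  "Good c \<longleftrightarrow> (\<forall>n. \<exists>i\<ge>n. \<not> Bad (sh i c))"

lemma sh_0 [simp]: "sh 0 c = c" and sh_sh [simp]: "sh k (sh l c) = sh (k + l) c"
  by (auto simp: sh_def algebra_simps)

lemma Good_sh: "Good c \<Longrightarrow> Good (sh k c)"
  unfolding Good_def by (metis le_add_diff_inverse2 le_add_same_cancel1 sh_sh add_le_imp_le_right trans_le_add2 zero_le add.commute)

text \<open>Both sides are numbered outwards from the origin, so index \<open>- 1\<close> carries
  \<open>d 0\<close>. The flip means that \<open>d\<close>, like \<open>c\<close>, is written in the
  coordinates of a half-line extending to the right.\<close>

definition two_sided :: "(nat \<Rightarrow> mark) \<Rightarrow> (nat \<Rightarrow> mark) \<Rightarrow> int \<Rightarrow> mark" where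
  "two_sided c d i = (if 0 \<le> i then c (nat i) else flip (d (nat (- 1 - i))))"

lemma mirror_two_sided: "mirror (two_sided c d) = two_sided d c"
  by (auto simp: mirror_def two_sided_def)

text \<open>Strictly decreasing clocks satisfy the second alternative of \<open>Bad\<close> in every
  late window.\<close>

lemma no_descent:
  assumes G: "Good c" and dec: "\<And>n. fst (c (Suc (n + k))) < fst (c (n + k))"
  shows False
proof -
  \<comment> \<open>\<open>Suc k\<close> rather than \<open>k\<close>: the clock of domain
    \<open>i\<close> is finite because it lies below that of its predecessor.\<close>
  obtain i where i: "i \<ge> Suc k" "\<not> Bad (sh i c)" using G unfolding Good_def by blast
  have d: "fst (c (Suc j)) < fst (c j)" if "j \<ge> k" for j
    using dec[of "j - k"] that by simp
  have "fst (c i) < \<infinity>" using d[of "i - 1"] i(1) by (cases i) (auto simp: order_less_le_trans)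
  moreover have "fst (c (i + 2)) < \<infinity>"
    using d[of "i + 1"] i(1) by (simp add: order_less_le_trans)
  moreover have "fst (c (Suc i)) < fst (c i)" "fst (c (i + 3)) < fst (c (i + 2))"
    using d[of i] d[of "i + 2"] i(1) by (auto simp: eval_nat_numeral)
  ultimately have "Bad (sh i c)" unfolding Bad_def sh_def by (auto simp: algebra_simps)
  then show False using i by simp
qed

lemma wf_two_sided:
  assumes "Good c" "Good d"
  shows "wf {(b, a). ithr (two_sided c d) b a}"
  unfolding wf_iff_no_infinite_down_chain
proof
  let ?y = "two_sided c d"
  assume "\<exists>f. \<forall>i. (f (Suc i), f i) \<in> {(b, a). ithr ?y b a}"
  then obtain f where f: "\<And>i. ithr ?y (f (Suc i)) (f i)" by auto
  define e where "e = f 1 - f 0"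
  have e: "e = 1 \<or> e = - 1" using f[of 0] unfolding e_def ithr_def by auto
  \<comment> \<open>A chain of threats cannot turn back, because its clocks strictly decrease. So it
    runs in one direction and finally stays in one half-line.\<close>
  have dir: "f (Suc n) = f n + e" for n
  proof (induction n)
    case (Suc n)
    have "f (Suc (Suc n)) \<noteq> f n"
    proof
      assume "f (Suc (Suc n)) = f n"
      with f[of n] f[of "Suc n"] have "fst (?y (f n)) < fst (?y (f n))"
        unfolding ithr_def by (metis less_trans)
      then show False by simp
    qed
    moreover have "f (Suc (Suc n)) = f (Suc n) + 1 \<or> f (Suc (Suc n)) = f (Suc n) - 1"
      using f[of "Suc n"] unfolding ithr_def by auto
    ultimately show ?case using Suc e by auto
  qed (simp add: e_def)
  have lin: "f n = f 0 + int n * e" for n by (induction n) (auto simp: dir algebra_simps)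
  have dec: "fst (?y (f (Suc n))) < fst (?y (f n))" for n using f[of n] by (simp add: ithr_def)
  from e show False
  proof
    assume e: "e = 1"
    \<comment> \<open>After \<open>m\<close> steps the chain has reached a nonnegative
      index.\<close>
    define m where "m = nat (- f 0)"
    have "fst (c (Suc n + nat (f m))) < fst (c (n + nat (f m)))" for n
    proof -
      have "f (n + m) = f m + int n" "f (Suc (n + m)) = f m + int n + 1" "f m \<ge> 0"
        using lin[of "n + m"] lin[of "Suc (n + m)"] lin[of m] e by (auto simp: m_def)
      then have "?y (f (n + m)) = c (n + nat (f m))" "?y (f (Suc (n + m))) = c (Suc (n + nat (f m)))"
        by (auto simp: two_sided_def nat_add_distrib add.commute Suc_nat_eq_nat_zadd1 intro!: arg_cong[of _ _ c])
      with dec[of "n + m"] show ?thesis by simp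
    qed
    then show False using no_descent[OF assms(1), of "nat (f m)"] by simp
  next
    assume e: "e = - 1"
    \<comment> \<open>After \<open>m\<close> steps the chain is at a negative index, and
      \<open>l\<close> is the corresponding position in \<open>d\<close>.\<close>
    define m where "m = nat (f 0 + 1)"
    define l where "l = nat (- 1 - f m)"
    have "fst (d (Suc n + l)) < fst (d (n + l))" for n
    proof -
      have "f (n + m) = f m - int n" "f (Suc (n + m)) = f m - int n - 1" "f m \<le> - 1"
        using lin[of "n + m"] lin[of "Suc (n + m)"] lin[of m] e by (auto simp: m_def)
      moreover from this have "nat (- 1 - f (n + m)) = n + l" "nat (- 1 - f (Suc (n + m))) = Suc (n + l)"
        unfolding l_def by linarith+
      ultimately have "?y (f (n + m)) = flip (d (n + l))" "?y (f (Suc (n + m))) = flip (d (Suc (n + l)))"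
        unfolding two_sided_def by auto
      with dec[of "n + m"] show ?thesis by simp
    qed
    then show False using no_descent[OF assms(2), of l] by simp
  qed
qed

subsection \<open>The process on the half-line\<close>

definition half :: "(nat \<Rightarrow> mark) \<Rightarrow> int \<Rightarrow> mark" where
  "half c i = (if 0 \<le> i then c (nat i) else (\<infinity>, True))"

definition surv :: "ennreal \<Rightarrow> (nat \<Rightarrow> mark) \<Rightarrow> nat \<Rightarrow> bool" where
  "surv t c k \<longleftrightarrow> \<not> idel (half c) t (int k)"

text \<open>Only the first \<open>n\<close> domains are active, everything on either side of them
  being inert. The event is therefore a function of \<open>c\<close> below \<open>n\<close>.\<close>

definition surv_upto :: "ennreal \<Rightarrow> nat \<Rightarrow> (nat \<Rightarrow> mark) \<Rightarrow> nat \<Rightarrow> bool" where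
  "surv_upto t n c k \<longleftrightarrow> \<not> idel (restr {..<int n} (half c)) t (int k)"

lemma idel_half_two_sided: "idel (restr {0..} (two_sided c d)) t k \<longleftrightarrow> idel (half c) t k"
  by (rule idel_cong) (auto simp: restr_def half_def two_sided_def)

lemma Good_const: "Good (\<lambda>_. (\<infinity>, b))"
  by (auto simp: Good_def Bad_def sh_def)

lemma wf_half: "Good c \<Longrightarrow> wf {(b, a). ithr (half c) b a}"
proof -
  assume "Good c"
  moreover have "half c = two_sided c (\<lambda>_. (\<infinity>, False))"
    by (auto simp: half_def two_sided_def flip_def)
  ultimately show ?thesis using wf_two_sided[OF _ Good_const] by simp
qed

lemma idel_restr_half: "idel (restr {int k..} (half c)) t (int k + i) \<longleftrightarrow> idel (half (sh k c)) t i"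
proof -
  have "idel (\<lambda>j. restr {int k..} (half c) (j + int k)) t i \<longleftrightarrow> idel (restr {int k..} (half c)) t (i + int k)"
    by (rule idel_shift) simp
  moreover have "idel (\<lambda>j. restr {int k..} (half c) (j + int k)) t i \<longleftrightarrow> idel (half (sh k c)) t i"
    by (rule idel_cong) (auto simp: restr_def half_def sh_def nat_add_distrib)
  ultimately show ?thesis by (simp add: add.commute)
qed

text \<open>This is the renewal property: cut at \<open>k\<close>, the process consists of the first
  \<open>k\<close> domains alone and of a shifted copy of the whole half-line.\<close>

lemma surv_split:
  assumes "Good c"
  shows "surv t c k \<longleftrightarrow> surv_upto t k c k \<and> surv t (sh k c) 0"
  using idel_split[OF wf_half[OF assms], of t "int k"] idel_restr_half[of k c t 0]
  by (auto simp: surv_def surv_upto_def)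

lemma surv_right:
  assumes "Good c" "surv t c k"
  shows "surv t c (k + j) \<longleftrightarrow> surv t (sh k c) j"
  using idel_right[OF wf_half[OF assms(1)], of t "int k" "int (k + j)"] idel_restr_half[of k c t "int j"] assms(2)
  by (auto simp: surv_def)

lemma surv_left:
  assumes "Good c" "surv t c k" "j \<le> k"
  shows "surv t c j \<longleftrightarrow> surv_upto t k c j"
  using idel_left[OF wf_half[OF assms(1)], of t "int k" "int j"] assms(2,3)
  by (auto simp: surv_def surv_upto_def)

lemma surv_upto_cong:
  assumes "\<And>i. i < n \<Longrightarrow> c i = c' i"
  shows "surv_upto t n c k \<longleftrightarrow> surv_upto t n c' k"
proof -
  have "c (nat i) = c' (nat i)" if "0 \<le> i" "i < int n" for i
    using assms[of "nat i"] that by (auto simp: nat_less_iff)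
  then show ?thesis unfolding surv_upto_def
    by (subst idel_cong[of _ "restr {..<int n} (half c')"])
      (auto simp: restr_def half_def split: if_splits)
qed

lemma surv_antimono: "surv t c k \<Longrightarrow> s \<le> t \<Longrightarrow> surv s c k"
  by (auto simp: surv_def dest: idel_mono)

lemma surv_infty: "\<not> surv \<infinity> c k \<Longrightarrow> \<exists>s<\<infinity>. \<not> surv s c k"
  unfolding surv_def using idel_infty by blast

text \<open>The nine points inside a window that is not \<open>Bad\<close> cannot all be deleted,
  and such windows start arbitrarily far out.\<close>

lemma surv_exists:
  assumes "Good c"
  shows "\<exists>k\<ge>n. surv t c k"
proof (rule ccontr)
  assume no: "\<not> (\<exists>k\<ge>n. surv t c k)"
  obtain i where i: "i \<ge> n" "\<not> Bad (sh i c)" using assms unfolding Good_def by blast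
  have "Bad (\<lambda>m. half c (int i + int m))"
  proof (rule all_deleted_Bad)
    fix j assume "int i + 1 \<le> j" "j \<le> int i + 9"
    then have "\<not> surv t c (nat j)" using no i by auto
    then show "idel (half c) \<infinity> j"
      using \<open>int i + 1 \<le> j\<close> by (auto simp: surv_def intro: idel_mono)
  qed
  moreover have "(\<lambda>m. half c (int i + int m)) = sh i c"
    by (auto simp: half_def sh_def fun_eq_iff nat_add_distrib add.commute)
  ultimately show False using i by simp
qed

text \<open>The form used for the tail of a gap. Nothing is assumed about the first point
  \<open>a\<close> of the block, which may be the surviving origin.\<close>

lemma deleted_block_Bad:
  assumes "\<And>j. a < j \<Longrightarrow> j < a + 10 \<Longrightarrow> \<not> surv t c j"
  shows "Bad (sh a c)"
proof -
  have "Bad (\<lambda>m. half c (int a + int m))"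
  proof (rule all_deleted_Bad)
    fix j assume "int a + 1 \<le> j" "j \<le> int a + 9"
    then have "\<not> surv t c (nat j)" by (intro assms) auto
    then show "idel (half c) \<infinity> j"
      using \<open>int a + 1 \<le> j\<close> by (auto simp: surv_def intro: idel_mono)
  qed
  moreover have "(\<lambda>m. half c (int a + int m)) = sh a c"
    by (auto simp: half_def sh_def fun_eq_iff nat_add_distrib add.commute)
  ultimately show ?thesis by simp
qed

lemma two_sided_exists:
  assumes "Good c"
  shows "\<exists>k\<ge>0. \<not> idel (two_sided c d) t k"
proof (rule ccontr)
  assume no: "\<not> ?thesis"
  obtain i where i: "\<not> Bad (sh i c)" using assms unfolding Good_def by blast
  have "Bad (\<lambda>m. two_sided c d (int i + int m))"
  proof (rule all_deleted_Bad)
    fix j assume "int i + 1 \<le> j"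
    then have "idel (two_sided c d) t j" using no by auto
    then show "idel (two_sided c d) \<infinity> j" by (rule idel_mono) simp
  qed
  moreover have "(\<lambda>m. two_sided c d (int i + int m)) = sh i c"
    by (auto simp: two_sided_def sh_def fun_eq_iff nat_add_distrib add.commute)
  ultimately show False using i by simp
qed

lemma two_sided_split:
  assumes "Good c" "Good d"
  shows "\<not> idel (two_sided c d) t 0 \<longleftrightarrow> surv t c 0 \<and> surv t d 0"
    and "surv t c 0 \<Longrightarrow> surv t d 0 \<Longrightarrow> \<not> idel (two_sided c d) t (int k) \<longleftrightarrow> surv t c k"
    and "surv t c 0 \<Longrightarrow> surv t d 0 \<Longrightarrow> \<not> idel (two_sided c d) t (- int k) \<longleftrightarrow> surv t d k"
proof -
  let ?y = "two_sided c d"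
  note wf = wf_two_sided[OF assms]
  \<comment> \<open>Reflection turns the left half of the process into a half-line to the right with
    marks \<open>d\<close>.\<close>
  have L: "idel (restr {..<0} ?y) t (- k) \<longleftrightarrow> idel (half d) t k" for k
  proof -
    have "idel (restr {..<0} ?y) t (- k) \<longleftrightarrow> idel (mirror (restr {..<0} ?y)) t k"
      by (simp add: idel_mirror)
    also have "mirror (restr {..<0} ?y) = restr {0..} (two_sided d c)"
      by (simp add: mirror_restr mirror_lessThan mirror_two_sided)
    finally show ?thesis by (simp add: idel_half_two_sided)
  qed
  show 0: "\<not> idel ?y t 0 \<longleftrightarrow> surv t c 0 \<and> surv t d 0"
    using idel_split[OF wf, of t 0] L[of 0] by (auto simp: idel_half_two_sided surv_def)
  assume s: "surv t c 0" "surv t d 0"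
  show "\<not> idel ?y t (int k) \<longleftrightarrow> surv t c k"
    using idel_right[OF wf, of t 0 "int k"] 0 s by (auto simp: idel_half_two_sided surv_def)
  show "\<not> idel ?y t (- int k) \<longleftrightarrow> surv t d k"
    using idel_left[OF wf, of t 0 "- int k"] L[of "int k"] 0 s by (auto simp: surv_def)
qed

text \<open>Reversing the first \<open>n\<close> domains is the reflection at the origin followed by
  the translation by \<open>n\<close>, so point \<open>k\<close> becomes point
  \<open>n - k\<close>.\<close>

lemma surv_upto_flip:
  assumes "k \<le> n" "\<And>i. i < n \<Longrightarrow> c' i = flip (c (n - 1 - i))"
  shows "surv_upto t n c' k \<longleftrightarrow> surv_upto t n c (n - k)"
proof -
  have "idel (restr {..<int n} (half c')) t (int k) \<longleftrightarrow>
      idel (\<lambda>i. mirror (restr {..<int n} (half c)) (i + (- int n))) t (int k)"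
    by (rule idel_cong)
      (auto simp: restr_def half_def mirror_def assms(2) flip_def nat_less_iff nat_diff_distrib
        of_nat_diff intro!: arg_cong[of _ _ c] arg_cong[of _ _ fst] arg_cong[of _ _ snd])
  also have "\<dots> \<longleftrightarrow> idel (mirror (restr {..<int n} (half c))) t (int k + (- int n))"
    by (rule idel_shift) simp
  also have "\<dots> \<longleftrightarrow> idel (restr {..<int n} (half c)) t (int (n - k))"
    using assms(1) by (simp add: idel_mirror of_nat_diff)
  finally show ?thesis by (simp add: surv_upto_def)
qed

subsection \<open>Measurability\<close>

lemma emeasure_distr_indicator:
  "f \<in> measurable N K \<Longrightarrow> A \<in> sets K \<Longrightarrow> emeasure (distr N K f) A = (\<integral>\<^sup>+x. indicator A (f x) \<partial>N)"
  by (subst nn_integral_indicator[symmetric], simp, subst nn_integral_distr) auto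

lemma pred_ennreal_le [measurable (raw)]:
  fixes f g :: "'a \<Rightarrow> ennreal"
  shows "f \<in> borel_measurable N \<Longrightarrow> g \<in> borel_measurable N \<Longrightarrow> Measurable.pred N (\<lambda>x. f x \<le> g x)"
  unfolding not_less[symmetric] by measurable

text \<open>Finiteness of the threats makes the status a countable union of its iterates, and
  countability of the index type keeps the quantifiers inside each iterate countable.\<close>

lemma pred_status:
  fixes thr :: "'w \<Rightarrow> 'a::countable \<Rightarrow> 'a \<Rightarrow> bool"
  assumes thr [measurable]: "\<And>a b. Measurable.pred N (\<lambda>\<omega>. thr \<omega> a b)"
    and fin: "\<And>\<omega> b. \<omega> \<in> space N \<Longrightarrow> finite {a. thr \<omega> a b}"
  shows "Measurable.pred N (\<lambda>\<omega>. status (thr \<omega>) s a)"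
proof -
  have iter: "Measurable.pred N (\<lambda>\<omega>. status_iter (thr \<omega>) n s a)" for n s a
  proof (induction n arbitrary: s a)
    case (Suc n)
    note Suc[measurable]
    show ?case by (cases s) simp_all
  qed simp
  note iter[measurable]
  have "Measurable.pred N (\<lambda>\<omega>. \<exists>n. status_iter (thr \<omega>) n s a)"
    by measurable
  then show ?thesis
    by (rule measurable_cong[THEN iffD1, rotated]) (simp add: status_iff_iter[OF fin])
qed

lemma pred_idel:
  assumes y [measurable]: "\<And>i. (\<lambda>\<omega>. y \<omega> i) \<in> measurable N (borel \<Otimes>\<^sub>M count_space UNIV)"
  shows "Measurable.pred N (\<lambda>\<omega>. idel (y \<omega>) t k)"
proof -
  have [measurable]: "Measurable.pred N (\<lambda>\<omega>. snd (y \<omega> i))" for i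
    using measurable_snd'[OF y[of i]] by simp
  have [measurable]: "(\<lambda>\<omega>. fst (y \<omega> i)) \<in> borel_measurable N" for i
    by measurable
  have [measurable]: "Measurable.pred N (\<lambda>\<omega>. status (ithr (y \<omega>)) s i)" for s i
    by (rule pred_status) (auto simp: ithr_def)
  show ?thesis unfolding idel_cases by measurable
qed

lemma pred_surv:
  assumes [measurable]: "\<And>n. (\<lambda>\<omega>. c \<omega> n) \<in> measurable N (borel \<Otimes>\<^sub>M count_space UNIV)"
  shows "Measurable.pred N (\<lambda>\<omega>. surv t (c \<omega>) k)"
proof -
  have [measurable]: "Measurable.pred N (\<lambda>\<omega>. idel (half (c \<omega>)) t (int k))"
    by (rule pred_idel) (auto simp: half_def)
  show ?thesis unfolding surv_def by measurable
qed

lemma pred_surv_upto: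
  assumes c [measurable]: "\<And>n. (\<lambda>\<omega>. c \<omega> n) \<in> measurable N (borel \<Otimes>\<^sub>M count_space UNIV)"
  shows "Measurable.pred N (\<lambda>\<omega>. surv_upto t n (c \<omega>) k)"
proof -
  have [measurable]: "Measurable.pred N (\<lambda>\<omega>. snd (c \<omega> i))" for i
    using measurable_snd'[OF c[of i]] by simp
  have [measurable]: "(\<lambda>\<omega>. fst (c \<omega> i)) \<in> borel_measurable N" for i
    by measurable
  have [measurable]: "Measurable.pred N (\<lambda>\<omega>. idel (restr {..<int n} (half (c \<omega>))) t (int k))"
  proof (rule pred_idel)
    fix i
    show "(\<lambda>\<omega>. restr {..<int n} (half (c \<omega>)) i) \<in> N \<rightarrow>\<^sub>M borel \<Otimes>\<^sub>M count_space UNIV"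
      by (cases "0 \<le> i"; cases "i < int n") (simp_all add: half_def restr_def)
  qed
  show ?thesis unfolding surv_upto_def by measurable
qed

section \<open>Regeneration at surviving points\<close>

text \<open>The ignored set \<open>D\<close> is \<open>{}\<close> for the first survivor and
  \<open>{0}\<close> for the next survivor after the origin; one regeneration argument covers
  both.\<close>

definition first_surv :: "nat set \<Rightarrow> ennreal \<Rightarrow> (nat \<Rightarrow> mark) \<Rightarrow> nat" where
  "first_surv D t c = (LEAST k. k \<notin> D \<and> surv t c k)"

text \<open>For \<open>D = {0}\<close> the first \<open>k\<close> domains make up exactly one gap;
  for \<open>D = {}\<close> they all lie to the left of the first survivor. Using
  \<open>surv_upto\<close> makes this an event of these \<open>k\<close> domains alone.\<close>

definition block_event :: "nat set \<Rightarrow> ennreal \<Rightarrow> nat \<Rightarrow> (nat \<Rightarrow> mark) \<Rightarrow> bool" where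
  "block_event D t k c \<longleftrightarrow> k \<notin> D \<and> (\<forall>j\<le>k. surv_upto t k c j \<longleftrightarrow> j \<in> insert k D)"

lemma first_surv:
  assumes "Good c"
  shows "surv t c (first_surv {} t c)" "surv t c (first_surv {0} t c)" "0 < first_surv {0} t c"
    "j < first_surv {} t c \<Longrightarrow> \<not> surv t c j"
    "0 < j \<Longrightarrow> j < first_surv {0} t c \<Longrightarrow> \<not> surv t c j"
proof -
  obtain k where k: "k \<ge> 1" "surv t c k" using surv_exists[OF assms] by blast
  show "surv t c (first_surv {} t c)"
    unfolding first_surv_def by (rule LeastI2[of _ k]) (use k in auto)
  have "first_surv {0} t c \<notin> {0} \<and> surv t c (first_surv {0} t c)"
    unfolding first_surv_def by (rule LeastI[of _ k]) (use k in auto)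
  then show "surv t c (first_surv {0} t c)" "0 < first_surv {0} t c" by auto
  show "j < first_surv {} t c \<Longrightarrow> \<not> surv t c j"
    "0 < j \<Longrightarrow> j < first_surv {0} t c \<Longrightarrow> \<not> surv t c j"
    unfolding first_surv_def by (auto dest: not_less_Least)
qed

text \<open>The process is cut at the surviving point \<open>k\<close>: everything up to
  \<open>k\<close> is read off from the first \<open>k\<close> domains, and what remains is survival
  of the origin for the shifted sequence.\<close>

lemma first_surv_iff:
  assumes G: "Good c" and D: "D = {} \<or> D = {0}"
  shows "(\<forall>j\<in>D. surv t c j) \<and> first_surv D t c = k \<longleftrightarrow> block_event D t k c \<and> surv t (sh k c) 0"
proof -
  have "(\<forall>j\<in>D. surv t c j) \<and> first_surv D t c = k \<longleftrightarrow>
      k \<notin> D \<and> surv t c k \<and> (\<forall>j\<le>k. surv t c j \<longleftrightarrow> j \<in> insert k D)"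
  proof
    assume "(\<forall>j\<in>D. surv t c j) \<and> first_surv D t c = k"
    then show "k \<notin> D \<and> surv t c k \<and> (\<forall>j\<le>k. surv t c j \<longleftrightarrow> j \<in> insert k D)"
      using D first_surv[OF G, where t = t] by (auto simp: le_less)
  next
    assume k: "k \<notin> D \<and> surv t c k \<and> (\<forall>j\<le>k. surv t c j \<longleftrightarrow> j \<in> insert k D)"
    then have "first_surv D t c = k"
      unfolding first_surv_def by (intro Least_equality) (auto intro: leI)
    then show "(\<forall>j\<in>D. surv t c j) \<and> first_surv D t c = k" using k D by auto
  qed
  also have "\<dots> \<longleftrightarrow> block_event D t k c \<and> surv t (sh k c) 0"
    using surv_split[OF G, where t = t and k = k] surv_left[OF G, where t = t and k = k] unfolding block_event_def by auto
  finally show ?thesis .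
qed

lemma block_event_cong:
  "(\<And>i. i < k \<Longrightarrow> c i = c' i) \<Longrightarrow> block_event D t k c \<longleftrightarrow> block_event D t k c'"
  unfolding block_event_def by (metis surv_upto_cong)

text \<open>The set \<open>{0, k}\<close> of required survivors is invariant under the reversal
  \<open>j \<mapsto> k - j\<close>.\<close>

lemma block_event_flip:
  assumes "\<And>i. i < k \<Longrightarrow> c' i = flip (c (k - 1 - i))"
  shows "block_event {0} t k c' \<longleftrightarrow> block_event {0} t k c"
proof -
  have *: "surv_upto t k c' j \<longleftrightarrow> surv_upto t k c (k - j)" if "j \<le> k" for j
    by (rule surv_upto_flip[OF that]) (rule assms)
  show ?thesis
  proof (cases "k = 0")
    case False
    have "(\<forall>j\<le>k. surv_upto t k c' j \<longleftrightarrow> j \<in> {k, 0}) \<longleftrightarrow> (\<forall>j\<le>k. surv_upto t k c (k - j) \<longleftrightarrow> k - j \<in> {k, 0})"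
      using * by auto
    also have "\<dots> \<longleftrightarrow> (\<forall>j\<le>k. surv_upto t k c j \<longleftrightarrow> j \<in> {k, 0})"
      by (metis diff_diff_cancel diff_le_self)
    finally show ?thesis using False by (simp add: block_event_def)
  qed (simp add: block_event_def)
qed

text \<open>The elements of \<open>M\<close> are abstract domains with length \<open>gp\<close> and mark \<open>mk\<close>.\<close>

locale marked_renewal = prob_space M for M :: "'a measure" +
  fixes gp :: "'a \<Rightarrow> real" and mk :: "'a \<Rightarrow> mark" and dmin :: real
  assumes gp_measurable [measurable]: "gp \<in> borel_measurable M"
    and mk_measurable [measurable]: "mk \<in> measurable M (borel \<Otimes>\<^sub>M count_space UNIV)"
    and diffuse: "\<And>a. a < \<infinity> \<Longrightarrow> emeasure M {x \<in> space M. fst (mk x) = a} = 0"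
    and dmin_pos: "0 < dmin"
    and gp_ge: "AE x in M. dmin \<le> gp x"
begin

sublocale seq: sequence_space M ..

abbreviation "S \<equiv> \<Pi>\<^sub>M i\<in>(UNIV :: nat set). M"

definition marks_of :: "(nat \<Rightarrow> 'a) \<Rightarrow> nat \<Rightarrow> mark" where
  "marks_of y n = mk (y n)"

definition psum :: "(nat \<Rightarrow> 'a) \<Rightarrow> nat \<Rightarrow> real" where
  "psum y k = (\<Sum>i<k. gp (y i))"

lemma marks_of_sh: "marks_of (sh k y) = sh k (marks_of y)"
  by (auto simp: marks_of_def sh_def)

lemma marks_of_measurable [measurable]:
  "(\<lambda>y. marks_of y n) \<in> measurable S (borel \<Otimes>\<^sub>M count_space UNIV)"
  unfolding marks_of_def by measurable

lemma psum_measurable [measurable]: "(\<lambda>y. psum y k) \<in> borel_measurable S"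
  unfolding psum_def by measurable

lemma sh_measurable [measurable]: "sh k \<in> measurable S S"
  by (rule measurable_PiM_single') (auto simp: sh_def space_PiM PiE_def)

lemma surv_measurable [measurable]: "Measurable.pred S (\<lambda>y. surv t (marks_of y) k)"
  by (rule pred_surv) measurable

lemma first_surv_measurable [measurable]:
  "(\<lambda>y. first_surv D t (marks_of y)) \<in> measurable S (count_space UNIV)"
  unfolding first_surv_def by measurable

lemma block_event_measurable [measurable]: "Measurable.pred S (\<lambda>y. block_event D t k (marks_of y))"
proof -
  have [measurable]: "Measurable.pred S (\<lambda>y. surv_upto t k (marks_of y) j)" for j
    by (rule pred_surv_upto) measurable
  show ?thesis unfolding block_event_def by measurable
qed

lemma Bad_measurable [measurable]: "Measurable.pred S (\<lambda>y. Bad (marks_of y))"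
proof -
  have [measurable]: "(\<lambda>y. fst (marks_of y i)) \<in> borel_measurable S" for i by measurable
  show ?thesis unfolding Bad_def by measurable
qed

lemma distr_sh: "distr S S (sh k) = S"
proof -
  have "distr S S (sh k) = distr (distr (S \<Otimes>\<^sub>M S) S (\<lambda>(\<omega>, \<omega>'). comb_seq k \<omega> \<omega>')) S (sh k)"
    by (simp only: seq.PiM_comb_seq)
  also have "\<dots> = distr (S \<Otimes>\<^sub>M S) S snd"
    by (subst distr_distr) (auto intro!: distr_cong simp: sh_def comb_seq_def fun_eq_iff)
  also have "\<dots> = S"
  proof (rule measure_eqI)
    fix A assume "A \<in> sets (distr (S \<Otimes>\<^sub>M S) S snd)"
    then have A: "A \<in> sets S" by simp
    then have "snd -` A \<inter> space (S \<Otimes>\<^sub>M S) = space S \<times> A"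
      by (auto simp: space_pair_measure dest: sets.sets_into_space)
    then show "emeasure (distr (S \<Otimes>\<^sub>M S) S snd) A = emeasure S A"
      using A by (simp add: emeasure_distr seq.emeasure_pair_measure_Times seq.P.emeasure_space_1)
  qed simp
  finally show ?thesis .
qed

lemma nn_integral_sh:
  "h \<in> borel_measurable S \<Longrightarrow> (\<integral>\<^sup>+y. h (sh k y) \<partial>S) = (\<integral>\<^sup>+y. h y \<partial>S)"
  by (subst (2) distr_sh[of k, symmetric]) (simp add: nn_integral_distr)

lemma AE_sh: "AE y in S. P y \<Longrightarrow> AE y in S. P (sh k y)"
proof -
  assume "AE y in S. P y"
  then have "AE y in distr S S (sh k). P y" by (simp only: distr_sh)
  then show "AE y in S. P (sh k y)" by (rule AE_distrD[OF sh_measurable])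
qed

text \<open>Independence of the first \<open>k\<close> coordinates from the rest, through the map
  \<open>comb_seq\<close>, which glues a prefix of one sequence to another sequence and preserves
  the product measure.\<close>

lemma nn_integral_split:
  assumes [measurable]: "f \<in> borel_measurable S" "h \<in> borel_measurable S"
    and f: "\<And>y y'. (\<And>i. i < k \<Longrightarrow> y i = y' i) \<Longrightarrow> f y = f y'"
  shows "(\<integral>\<^sup>+y. f y * h (sh k y) \<partial>S) = (\<integral>\<^sup>+y. f y \<partial>S) * (\<integral>\<^sup>+y. h y \<partial>S :: ennreal)"
proof -
  have "(\<integral>\<^sup>+y. f y * h (sh k y) \<partial>S)
      = (\<integral>\<^sup>+y. f y * h (sh k y) \<partial>distr (S \<Otimes>\<^sub>M S) S (\<lambda>(\<omega>, \<omega>'). comb_seq k \<omega> \<omega>'))"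
    by (simp only: seq.PiM_comb_seq)
  also have "\<dots> = (\<integral>\<^sup>+p. f (fst p) * h (snd p) \<partial>(S \<Otimes>\<^sub>M S))"
  proof (subst nn_integral_distr)
    have "f (comb_seq k a b) = f a" "sh k (comb_seq k a b) = b" for a b
      by (rule f) (auto simp: comb_seq_def sh_def fun_eq_iff)
    then show "(\<integral>\<^sup>+x. f (case x of (\<omega>, \<omega>') \<Rightarrow> comb_seq k \<omega> \<omega>') * h (sh k (case x of (\<omega>, \<omega>') \<Rightarrow> comb_seq k \<omega> \<omega>')) \<partial>(S \<Otimes>\<^sub>M S))
        = (\<integral>\<^sup>+p. f (fst p) * h (snd p) \<partial>(S \<Otimes>\<^sub>M S))"
      by (auto intro!: nn_integral_cong simp: case_prod_beta)
  qed measurable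
  also have "\<dots> = (\<integral>\<^sup>+a. \<integral>\<^sup>+b. f a * h b \<partial>S \<partial>S)"
    by (subst seq.nn_integral_fst[symmetric]) auto
  also have "\<dots> = (\<integral>\<^sup>+y. f y \<partial>S) * (\<integral>\<^sup>+y. h y \<partial>S)"
    by (simp add: nn_integral_cmult nn_integral_multc)
  finally show ?thesis .
qed

subsection \<open>Blocks without survivors are rare\<close>

definition ordered :: "nat \<Rightarrow> nat \<Rightarrow> (nat \<Rightarrow> 'a) \<Rightarrow> bool" where
  "ordered i j y \<longleftrightarrow> fst (mk (y i)) \<le> fst (mk (y j)) \<and> fst (mk (y j)) < \<infinity>"

lemma ordered_measurable [measurable]: "Measurable.pred S (ordered i j)"
  unfolding ordered_def by measurable

text \<open>Swapping two independent copies reverses the order of the clocks. The event and its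
  mirror image overlap only in ties, which are null because no finite clock value is an atom; so
  twice the probability is at most one.\<close>

lemma emeasure_ordered_pair:
  "emeasure (M \<Otimes>\<^sub>M M) {p \<in> space (M \<Otimes>\<^sub>M M). fst (mk (fst p)) \<le> fst (mk (snd p)) \<and> fst (mk (snd p)) < \<infinity>} \<le> ennreal (1 / 2)"
    (is "emeasure ?P ?A \<le> _")
proof -
  interpret P: pair_prob_space M M ..
  let ?B = "{p \<in> space ?P. fst (mk (snd p)) \<le> fst (mk (fst p)) \<and> fst (mk (fst p)) < \<infinity>}"
  have [measurable]: "?A \<in> sets ?P" "?B \<in> sets ?P" by measurable
  have "emeasure ?P ?A = emeasure (distr ?P ?P (\<lambda>(x, y). (y, x))) ?A"
    using P.distr_pair_swap by simp
  also have "\<dots> = emeasure ?P ?B"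
  proof (subst emeasure_distr)
    show "emeasure ?P ((\<lambda>(x, y). (y, x)) -` ?A \<inter> space ?P) = emeasure ?P ?B"
      by (rule arg_cong[of _ _ "emeasure ?P"]) (auto simp: space_pair_measure)
  qed measurable
  finally have eq: "emeasure ?P ?A = emeasure ?P ?B" .
  have null: "emeasure ?P (?A \<inter> ?B) = 0"
  proof -
    have "emeasure ?P (?A \<inter> ?B) = (\<integral>\<^sup>+x. emeasure M (Pair x -` (?A \<inter> ?B)) \<partial>M)"
      by (rule emeasure_pair_measure_alt) measurable
    also have "\<dots> = (\<integral>\<^sup>+x. 0 \<partial>M)"
    proof (rule nn_integral_cong)
      fix x assume x: "x \<in> space M"
      show "emeasure M (Pair x -` (?A \<inter> ?B)) = 0"
      proof (cases "fst (mk x) < \<infinity>")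
        case True
        have "emeasure M (Pair x -` (?A \<inter> ?B)) \<le> emeasure M {z \<in> space M. fst (mk z) = fst (mk x)}"
          by (rule emeasure_mono) (auto simp: space_pair_measure)
        then show ?thesis using diffuse[OF True] by simp
      next
        case False
        then have "Pair x -` (?A \<inter> ?B) = {}" by auto
        then show ?thesis by simp
      qed
    qed
    finally show ?thesis by simp
  qed
  have "2 * emeasure ?P ?A = emeasure ?P ?A + emeasure ?P ?B"
    by (subst eq[symmetric]) (rule mult_2)
  also have "\<dots> = emeasure ?P (?A \<union> ?B) + emeasure ?P (?A \<inter> ?B)"
    by (rule emeasure_Un_Int) measurable
  also have "\<dots> \<le> 1" using P.emeasure_le_1 null by simp
  finally have *: "2 * emeasure ?P ?A \<le> 1" .
  have "ennreal (1 / 2) * ennreal 2 = 1" by (subst ennreal_mult[symmetric]) auto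
  then have "emeasure ?P ?A = ennreal (1 / 2) * ennreal 2 * emeasure ?P ?A"
    by (simp only: mult_1)
  also have "\<dots> = ennreal (1 / 2) * (2 * emeasure ?P ?A)"
    by (simp add: mult.assoc)
  also have "\<dots> \<le> ennreal (1 / 2) * 1" using * by (rule mult_left_mono) simp
  finally show ?thesis by simp
qed

lemma nn_integral_two:
  assumes [measurable]: "f \<in> borel_measurable (M \<Otimes>\<^sub>M M)"
  shows "(\<integral>\<^sup>+y. f (y 0, y 1) \<partial>S) = (\<integral>\<^sup>+p. f p \<partial>(M \<Otimes>\<^sub>M M) :: ennreal)"
proof -
  interpret P: pair_prob_space M S ..
  have "(\<integral>\<^sup>+y. f (y 0, y 1) \<partial>S) = (\<integral>\<^sup>+y. f (y 0, y 1) \<partial>distr (M \<Otimes>\<^sub>M S) S (\<lambda>(s, \<omega>). case_nat s \<omega>))"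
    by (simp only: seq.PiM_iter)
  also have "\<dots> = (\<integral>\<^sup>+p. f (fst p, snd p 0) \<partial>(M \<Otimes>\<^sub>M S))"
    by (subst nn_integral_distr) (auto simp: case_prod_beta)
  also have "\<dots> = (\<integral>\<^sup>+a. \<integral>\<^sup>+y. f (a, y 0) \<partial>S \<partial>M)"
    by (subst seq.nn_integral_fst[symmetric]) auto
  also have "\<dots> = (\<integral>\<^sup>+a. \<integral>\<^sup>+b. f (a, b) \<partial>M \<partial>M)"
  proof (rule nn_integral_cong)
    fix a assume [measurable]: "a \<in> space M"
    have "(\<integral>\<^sup>+y. f (a, y 0) \<partial>S) = (\<integral>\<^sup>+b. f (a, b) \<partial>distr S M (\<lambda>y. y 0))"
      by (subst nn_integral_distr) auto
    also have "distr S M (\<lambda>y. y 0) = M"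
      using seq.PiM_component[of 0] by simp
    finally show "(\<integral>\<^sup>+y. f (a, y 0) \<partial>S) = (\<integral>\<^sup>+b. f (a, b) \<partial>M)" .
  qed
  also have "\<dots> = (\<integral>\<^sup>+p. f p \<partial>(M \<Otimes>\<^sub>M M))"
    by (subst nn_integral_fst) auto
  finally show ?thesis .
qed

lemma nn_integral_ordered: "(\<integral>\<^sup>+y. of_bool (ordered 0 1 y) \<partial>S) \<le> ennreal (1 / 2)" "(\<integral>\<^sup>+y. of_bool (ordered 1 0 y) \<partial>S) \<le> ennreal (1 / 2)"
proof -
  interpret P: pair_prob_space M M ..
  let ?A = "{p \<in> space (M \<Otimes>\<^sub>M M). fst (mk (fst p)) \<le> fst (mk (snd p)) \<and> fst (mk (snd p)) < \<infinity>}"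
  have "(\<integral>\<^sup>+y. of_bool (ordered 0 1 y) \<partial>S) = (\<integral>\<^sup>+p. of_bool (fst (mk (fst p)) \<le> fst (mk (snd p)) \<and> fst (mk (snd p)) < \<infinity>) \<partial>(M \<Otimes>\<^sub>M M))"
    using nn_integral_two[of "\<lambda>p. of_bool (fst (mk (fst p)) \<le> fst (mk (snd p)) \<and> fst (mk (snd p)) < \<infinity>)"]
    by (simp add: ordered_def)
  also have "\<dots> = (\<integral>\<^sup>+p. indicator ?A p \<partial>(M \<Otimes>\<^sub>M M))"
    by (rule nn_integral_cong) (auto simp: indicator_def)
  also have "\<dots> \<le> ennreal (1 / 2)" using emeasure_ordered_pair by simp
  finally show "(\<integral>\<^sup>+y. of_bool (ordered 0 1 y) \<partial>S) \<le> ennreal (1 / 2)" .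
  have "(\<integral>\<^sup>+y. of_bool (ordered 1 0 y) \<partial>S) = (\<integral>\<^sup>+p. of_bool (fst (mk (snd p)) \<le> fst (mk (fst p)) \<and> fst (mk (fst p)) < \<infinity>) \<partial>(M \<Otimes>\<^sub>M M))"
    using nn_integral_two[of "\<lambda>p. of_bool (fst (mk (snd p)) \<le> fst (mk (fst p)) \<and> fst (mk (fst p)) < \<infinity>)"]
    by (simp add: ordered_def)
  also have "\<dots> = (\<integral>\<^sup>+p. of_bool (fst (mk (snd p)) \<le> fst (mk (fst p)) \<and> fst (mk (fst p)) < \<infinity>) \<partial>(distr (M \<Otimes>\<^sub>M M) (M \<Otimes>\<^sub>M M) (\<lambda>(x, y). (y, x))))"
    using P.distr_pair_swap by simp
  also have "\<dots> = (\<integral>\<^sup>+p. indicator ?A p \<partial>(M \<Otimes>\<^sub>M M))"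
    by (subst nn_integral_distr) (auto intro!: nn_integral_cong simp: indicator_def case_prod_beta space_pair_measure simp del: nn_integral_indicator)
  also have "\<dots> \<le> ennreal (1 / 2)" using emeasure_ordered_pair by simp
  finally show "(\<integral>\<^sup>+y. of_bool (ordered 1 0 y) \<partial>S) \<le> ennreal (1 / 2)" .
qed

text \<open>Each alternative of \<open>Bad\<close> compares the clocks within two disjoint pairs of
  domains, hence has probability at most 1/4.\<close>

lemma nn_integral_Bad: "(\<integral>\<^sup>+y. of_bool (Bad (marks_of y)) \<partial>S) \<le> ennreal (1 / 2)"
proof -
  define U where "U y = (of_bool (ordered 0 1 y) :: ennreal)" for y
  define V where "V y = (of_bool (ordered 1 0 y) :: ennreal)" for y
  have [measurable]: "U \<in> borel_measurable S" "V \<in> borel_measurable S"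
    unfolding U_def V_def by measurable
  have 1: "(\<integral>\<^sup>+y. U (sh 6 y) * U (sh 8 y) \<partial>S) \<le> ennreal (1 / 4)"
  proof -
    have "(\<integral>\<^sup>+y. U (sh 6 y) * U (sh 8 y) \<partial>S) = (\<integral>\<^sup>+y. U (sh 6 y) * U (sh 2 (sh 6 y)) \<partial>S)"
      by simp
    also have "\<dots> = (\<integral>\<^sup>+y. U y * U (sh 2 y) \<partial>S)"
      using nn_integral_sh[of "\<lambda>y. U y * U (sh 2 y)" 6] by simp
    also have "\<dots> = (\<integral>\<^sup>+y. U y \<partial>S) * (\<integral>\<^sup>+y. U y \<partial>S)"
      by (rule nn_integral_split) (simp_all, simp add: U_def ordered_def)
    also have "\<dots> \<le> (ennreal (1 / 2)) * (ennreal (1 / 2))"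
      using nn_integral_ordered by (intro mult_mono) (auto simp: U_def)
    also have "\<dots> = ennreal (1 / 4)" by (subst ennreal_mult[symmetric]) auto
    finally show ?thesis .
  qed
  have 2: "(\<integral>\<^sup>+y. V y * V (sh 2 y) \<partial>S) \<le> ennreal (1 / 4)"
  proof -
    have "(\<integral>\<^sup>+y. V y * V (sh 2 y) \<partial>S) = (\<integral>\<^sup>+y. V y \<partial>S) * (\<integral>\<^sup>+y. V y \<partial>S)"
      by (rule nn_integral_split) (simp_all, simp add: V_def ordered_def)
    also have "\<dots> \<le> (ennreal (1 / 2)) * (ennreal (1 / 2))"
      using nn_integral_ordered by (intro mult_mono) (auto simp: V_def)
    also have "\<dots> = ennreal (1 / 4)" by (subst ennreal_mult[symmetric]) auto
    finally show ?thesis .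
  qed
  have "(\<integral>\<^sup>+y. of_bool (Bad (marks_of y)) \<partial>S) \<le> (\<integral>\<^sup>+y. U (sh 6 y) * U (sh 8 y) + V y * V (sh 2 y) \<partial>S)"
  proof (rule nn_integral_mono)
    fix y
    have "Bad (marks_of y) \<longleftrightarrow> ordered 0 1 (sh 6 y) \<and> ordered 0 1 (sh 8 y) \<or> ordered 1 0 y \<and> ordered 1 0 (sh 2 y)"
      by (simp add: Bad_def ordered_def sh_def marks_of_def conj_assoc numeral_2_eq_2 numeral_3_eq_3)
    then show "of_bool (Bad (marks_of y)) \<le> U (sh 6 y) * U (sh 8 y) + V y * V (sh 2 y)"
      by (simp add: U_def V_def of_bool_def)
  qed
  also have "\<dots> = (\<integral>\<^sup>+y. U (sh 6 y) * U (sh 8 y) \<partial>S) + (\<integral>\<^sup>+y. V y * V (sh 2 y) \<partial>S)"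
    by (rule nn_integral_add) measurable
  also have "\<dots> \<le> ennreal (1 / 4) + ennreal (1 / 4)" using 1 2 by (rule add_mono)
  also have "\<dots> = ennreal (1 / 2)" by (simp flip: ennreal_plus)
  finally show ?thesis .
qed

text \<open>Windows that start at multiples of ten involve disjoint sets of domains, hence are
  independent.\<close>

lemma nn_integral_Bad_blocks:
  "(\<integral>\<^sup>+y. of_bool (\<forall>b<m. Bad (marks_of (sh (10 * b) y))) \<partial>S) \<le> (ennreal (1 / 2)) ^ m"
proof (induction m)
  case 0
  then show ?case by (simp add: seq.P.emeasure_space_1)
next
  case (Suc m)
  have *: "(of_bool (\<forall>b<Suc m. Bad (marks_of (sh (10 * b) y))) :: ennreal) =
      of_bool (Bad (marks_of y)) * of_bool (\<forall>b<m. Bad (marks_of (sh (10 * b) (sh 10 y))))" for y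
    unfolding All_less_Suc2 by (simp add: add.commute)
  have "(\<integral>\<^sup>+y. of_bool (\<forall>b<Suc m. Bad (marks_of (sh (10 * b) y))) \<partial>S) =
      (\<integral>\<^sup>+y. of_bool (Bad (marks_of y)) \<partial>S) * (\<integral>\<^sup>+y. of_bool (\<forall>b<m. Bad (marks_of (sh (10 * b) y))) \<partial>S)"
    unfolding * by (rule nn_integral_split) (auto simp: Bad_def marks_of_def)
  also have "\<dots> \<le> ennreal (1 / 2) * (ennreal (1 / 2)) ^ m"
    by (intro mult_mono nn_integral_Bad Suc) auto
  finally show ?case by simp
qed

text \<open>Almost surely some window at a multiple of ten is not \<open>Bad\<close>. Applied to all
  shifts of the sequence, this produces such windows arbitrarily far out.\<close>

lemma AE_Good: "AE y in S. Good (marks_of y)"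
proof -
  have "AE y in S. \<exists>i\<ge>n. \<not> Bad (sh i (marks_of y))" for n
  proof -
    have "AE y in S. \<exists>b. \<not> Bad (marks_of (sh (10 * b) y))"
    proof -
      have "(\<integral>\<^sup>+y. of_bool (\<forall>b. Bad (marks_of (sh (10 * b) y))) \<partial>S) \<le> (ennreal (1 / 2)) ^ m" for m
        by (rule order_trans[OF nn_integral_mono nn_integral_Bad_blocks]) auto
      moreover have "(\<lambda>m. ennreal (1 / 2) ^ m) \<longlonglongrightarrow> 0"
      proof -
        have "(\<lambda>m. ennreal ((1 / 2) ^ m)) \<longlonglongrightarrow> ennreal 0"
          by (intro tendsto_ennrealI) (simp add: LIMSEQ_power_zero)
        then show ?thesis by (simp only: ennreal_power[symmetric] ennreal_0)
      qed
      ultimately have "(\<integral>\<^sup>+y. of_bool (\<forall>b. Bad (marks_of (sh (10 * b) y))) \<partial>S) \<le> 0"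
        by (intro LIMSEQ_le_const) auto
      then have "(\<integral>\<^sup>+y. of_bool (\<forall>b. Bad (marks_of (sh (10 * b) y))) \<partial>S) = (0::ennreal)" by simp
      then have "AE y in S. (of_bool (\<forall>b. Bad (marks_of (sh (10 * b) y))) :: ennreal) = 0"
        by (subst (asm) nn_integral_0_iff_AE) auto
      then show ?thesis by (rule AE_mp) (auto intro!: AE_I2)
    qed
    then have "AE y in S. \<exists>b. \<not> Bad (marks_of (sh (10 * b) (sh n y)))"
      by (rule AE_sh)
    then show ?thesis
      by (rule AE_mp) (auto intro!: AE_I2 simp: marks_of_sh, meson le_add2)
  qed
  then show ?thesis unfolding Good_def by (simp add: AE_all_countable)
qed

subsection \<open>Regeneration\<close>

abbreviation "surv0 t \<equiv> {y \<in> space S. surv t (marks_of y) 0}"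

text \<open>If the origin died almost surely, then by shift invariance and \<open>surv_split\<close>
  so would every point, against the existence of survivors.\<close>

lemma emeasure_surv0_pos: "emeasure S (surv0 t) > 0"
proof (rule ccontr)
  assume "\<not> emeasure S (surv0 t) > 0"
  then have "AE y in S. y \<notin> surv0 t" by (intro AE_not_in) (simp add: null_sets_def)
  then have "AE y in S. \<not> surv t (marks_of y) 0" by (rule AE_mp) (auto intro!: AE_I2)
  then have "AE y in S. \<forall>k. \<not> surv t (marks_of (sh k y)) 0"
    unfolding AE_all_countable by (intro allI AE_sh)
  with AE_Good have "AE y in S. False"
  proof eventually_elim
    case (elim y)
    then show False using surv_exists[of "marks_of y" 0 t] by (auto simp: marks_of_sh surv_split)
  qed
  then show False by (simp add: seq.P.AE_const)
qed

text \<open>The integral is decomposed according to the index \<open>k\<close> of the survivor. Each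
  part is a function of the first \<open>k\<close> domains times a function of the shifted sequence,
  and the integral of the latter does not depend on \<open>k\<close>.\<close>

lemma first_surv_split:
  assumes D: "D = {} \<or> D = {0}"
    and [measurable]: "\<And>k. f k \<in> borel_measurable S" "h \<in> borel_measurable S"
    and f: "\<And>k y y'. (\<And>i. i < k \<Longrightarrow> y i = y' i) \<Longrightarrow> f k y = f k y'"
  shows "(\<integral>\<^sup>+y. of_bool (\<forall>j\<in>D. surv t (marks_of y) j) * f (first_surv D t (marks_of y)) y
            * h (sh (first_surv D t (marks_of y)) y) \<partial>S)
      = (\<Sum>k. \<integral>\<^sup>+y. of_bool (block_event D t k (marks_of y)) * f k y \<partial>S) *
        (\<integral>\<^sup>+y. of_bool (surv t (marks_of y) 0) * h y \<partial>S :: ennreal)"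
proof -
  let ?I = "\<lambda>k y. of_bool (block_event D t k (marks_of y)) * f k y *
        (of_bool (surv t (marks_of (sh k y)) 0) * h (sh k y))"
  have "(\<integral>\<^sup>+y. of_bool (\<forall>j\<in>D. surv t (marks_of y) j) * f (first_surv D t (marks_of y)) y
            * h (sh (first_surv D t (marks_of y)) y) \<partial>S) = (\<integral>\<^sup>+y. (\<Sum>k. ?I k y) \<partial>S)"
  proof (rule nn_integral_cong_AE)
    show "AE y in S. of_bool (\<forall>j\<in>D. surv t (marks_of y) j) * f (first_surv D t (marks_of y)) y
            * h (sh (first_surv D t (marks_of y)) y) = (\<Sum>k. ?I k y)"
      using AE_Good
    proof eventually_elim
      case (elim y)
      let ?K = "first_surv D t (marks_of y)"
      \<comment> \<open>The product of the two events singles out the actual survivor, so one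
        summand of the series remains.\<close>
      have *: "of_bool (block_event D t k (marks_of y)) * of_bool (surv t (marks_of (sh k y)) 0) =
          (of_bool ((\<forall>j\<in>D. surv t (marks_of y) j) \<and> ?K = k) :: ennreal)" for k
        using first_surv_iff[OF elim D, of t k] by (simp add: marks_of_sh of_bool_conj[symmetric])
      have "?I k y = (of_bool (block_event D t k (marks_of y)) * of_bool (surv t (marks_of (sh k y)) 0)) * (f k y * h (sh k y))" for k
        by (simp add: ac_simps)
      then have "?I k y = (if k = ?K then of_bool (\<forall>j\<in>D. surv t (marks_of y) j) * f k y * h (sh k y) else 0)" for k
        unfolding * by (auto simp: ac_simps)
      then have "(\<Sum>k. ?I k y) = (\<Sum>k. if k = ?K then of_bool (\<forall>j\<in>D. surv t (marks_of y) j) * f k y * h (sh k y) else 0)"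
        by simp
      also have "\<dots> = (\<Sum>k\<in>{?K}. if k = ?K then of_bool (\<forall>j\<in>D. surv t (marks_of y) j) * f k y * h (sh k y) else 0)"
        by (rule suminf_finite) auto
      finally show ?case by simp
    qed
  qed
  also have "\<dots> = (\<Sum>k. \<integral>\<^sup>+y. ?I k y \<partial>S)"
    by (rule nn_integral_suminf) measurable
  also have "\<dots> = (\<Sum>k. (\<integral>\<^sup>+y. of_bool (block_event D t k (marks_of y)) * f k y \<partial>S) *
      (\<integral>\<^sup>+y. of_bool (surv t (marks_of y) 0) * h y \<partial>S))"
  proof (intro suminf_cong, rule nn_integral_split)
    fix k and y y' :: "nat \<Rightarrow> 'a" assume eq: "\<And>i. i < k \<Longrightarrow> y i = y' i"
    have "block_event D t k (marks_of y) \<longleftrightarrow> block_event D t k (marks_of y')"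
      by (rule block_event_cong) (simp add: marks_of_def eq)
    moreover have "f k y = f k y'" by (rule f) (rule eq)
    ultimately show "of_bool (block_event D t k (marks_of y)) * f k y = of_bool (block_event D t k (marks_of y')) * f k y'"
      by simp
  qed measurable
  finally show ?thesis by simp
qed

section \<open>The law conditioned on survival of the origin\<close>

definition SR :: "ennreal \<Rightarrow> (nat \<Rightarrow> 'a) measure" where
  "SR t = uniform_measure S (surv0 t)"

lemma sets_SR [measurable_cong, simp]: "sets (SR t) = sets S"
  by (simp add: SR_def)

lemma space_SR [simp]: "space (SR t) = space S"
  by (simp add: SR_def)

lemma prob_space_SR: "prob_space (SR t)"
  unfolding SR_def using emeasure_surv0_pos[of t] by (intro prob_space_uniform_measure) auto

lemma emeasure_surv0_eq: "emeasure S (surv0 t) = (\<integral>\<^sup>+y. of_bool (surv t (marks_of y) 0) \<partial>S)"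
proof -
  have "emeasure S (surv0 t) = (\<integral>\<^sup>+y. indicator (surv0 t) y \<partial>S)" by simp
  also have "\<dots> = (\<integral>\<^sup>+y. of_bool (surv t (marks_of y) 0) \<partial>S)"
    by (rule nn_integral_cong) (auto simp: indicator_def)
  finally show ?thesis .
qed

lemma nn_integral_SR:
  assumes [measurable]: "h \<in> borel_measurable S"
  shows "(\<integral>\<^sup>+y. h y \<partial>SR t) = (\<integral>\<^sup>+y. of_bool (surv t (marks_of y) 0) * h y \<partial>S) / emeasure S (surv0 t)"
  unfolding SR_def
  by (subst nn_integral_uniform_measure)
    (auto intro!: arg_cong[of _ _ "\<lambda>a. a / _"] nn_integral_cong simp: indicator_def)

lemma nn_integral_surv0:
  assumes [measurable]: "h \<in> borel_measurable S"
  shows "(\<integral>\<^sup>+y. of_bool (surv t (marks_of y) 0) * h y \<partial>S) = (\<integral>\<^sup>+y. h y \<partial>SR t) * emeasure S (surv0 t)"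
proof -
  have "emeasure S (surv0 t) / emeasure S (surv0 t) = 1"
    using emeasure_surv0_pos[of t] by (intro ennreal_divide_self) (auto simp: less_top[symmetric])
  then show ?thesis
    by (simp add: nn_integral_SR divide_ennreal_def mult.assoc) (simp add: mult.commute)
qed

lemma AE_SR: "AE y in S. P y \<Longrightarrow> AE y in SR t. P y"
  unfolding SR_def by (rule AE_uniform_measureI) auto

lemma AE_SR_Good: "AE y in SR t. Good (marks_of y)"
  by (rule AE_SR[OF AE_Good])

text \<open>The case \<open>h = 1\<close> identifies the series in \<open>first_surv_split\<close>,
  and the survival probability is absorbed into the conditional law. So the sequence seen from the
  survivor has law \<open>SR t\<close> and is independent of what precedes it.\<close>

lemma first_surv_indep:
  assumes D: "D = {} \<or> D = {0}"
    and [measurable]: "\<And>k. f k \<in> borel_measurable S" "h \<in> borel_measurable S"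
    and f: "\<And>k y y'. (\<And>i. i < k \<Longrightarrow> y i = y' i) \<Longrightarrow> f k y = f k y'"
  shows "(\<integral>\<^sup>+y. of_bool (\<forall>j\<in>D. surv t (marks_of y) j) * f (first_surv D t (marks_of y)) y
            * h (sh (first_surv D t (marks_of y)) y) \<partial>S)
      = (\<integral>\<^sup>+y. of_bool (\<forall>j\<in>D. surv t (marks_of y) j) * f (first_surv D t (marks_of y)) y \<partial>S) *
        (\<integral>\<^sup>+y. h y \<partial>SR t :: ennreal)"
proof -
  have 1: "(\<integral>\<^sup>+y. of_bool (\<forall>j\<in>D. surv t (marks_of y) j) * f (first_surv D t (marks_of y)) y \<partial>S)
      = (\<Sum>k. \<integral>\<^sup>+y. of_bool (block_event D t k (marks_of y)) * f k y \<partial>S) * emeasure S (surv0 t)"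
    using first_surv_split[where f = f and h = "\<lambda>_. 1" and t = t, OF D _ _ f] by (simp add: emeasure_surv0_eq)
  have 2: "(\<integral>\<^sup>+y. of_bool (\<forall>j\<in>D. surv t (marks_of y) j) * f (first_surv D t (marks_of y)) y
            * h (sh (first_surv D t (marks_of y)) y) \<partial>S)
      = (\<Sum>k. \<integral>\<^sup>+y. of_bool (block_event D t k (marks_of y)) * f k y \<partial>S) *
        ((\<integral>\<^sup>+y. h y \<partial>SR t) * emeasure S (surv0 t))"
    by (subst nn_integral_surv0[symmetric]) (simp_all add: first_surv_split[where f = f and h = h and t = t, OF D _ _ f])
  show ?thesis
    by (subst 2, subst 1) (simp only: ac_simps)
qed

section \<open>Successive survivors and their gaps\<close>

definition gap_of :: "ennreal \<Rightarrow> (nat \<Rightarrow> 'a) \<Rightarrow> real" where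
  "gap_of t y = psum y (first_surv {0} t (marks_of y))"

text \<open>The state of the regeneration scheme: the initial domains as seen from the next survivor
  after the origin. Its iterates list the gaps.\<close>

definition nxt :: "ennreal \<Rightarrow> (nat \<Rightarrow> 'a) \<Rightarrow> nat \<Rightarrow> 'a" where
  "nxt t y = sh (first_surv {0} t (marks_of y)) y"

definition start :: "ennreal \<Rightarrow> (nat \<Rightarrow> 'a) \<Rightarrow> nat \<Rightarrow> 'a" where
  "start t y = sh (first_surv {} t (marks_of y)) y"

definition first_pos :: "ennreal \<Rightarrow> (nat \<Rightarrow> 'a) \<Rightarrow> real" where
  "first_pos t y = psum y (first_surv {} t (marks_of y))"

definition gaps_of :: "ennreal \<Rightarrow> (nat \<Rightarrow> 'a) \<Rightarrow> nat \<Rightarrow> real" where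
  "gaps_of t y n = gap_of t ((nxt t ^^ n) y)"

definition gap_law :: "ennreal \<Rightarrow> real measure" where
  "gap_law t = distr (SR t) borel (gap_of t)"

lemma gap_of_measurable [measurable]: "gap_of t \<in> borel_measurable S"
  unfolding gap_of_def by (rule measurable_compose_countable) measurable

lemma first_pos_measurable [measurable]: "first_pos t \<in> borel_measurable S"
  unfolding first_pos_def by (rule measurable_compose_countable) measurable

lemma nxt_measurable [measurable]: "nxt t \<in> measurable S S"
  unfolding nxt_def by (rule measurable_compose_countable) measurable

lemma start_measurable [measurable]: "start t \<in> measurable S S"
  unfolding start_def by (rule measurable_compose_countable) measurable

lemma gaps_of_measurable_component [measurable]: "(\<lambda>y. gaps_of t y n) \<in> borel_measurable S"
proof -
  have "(nxt t ^^ n) \<in> measurable S S"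
    by (induction n) (simp_all add: id_def)
  then show ?thesis unfolding gaps_of_def by measurable
qed

lemma gaps_of_measurable [measurable]: "gaps_of t \<in> measurable S (\<Pi>\<^sub>M i\<in>(UNIV :: nat set). borel)"
  by (rule measurable_PiM_single') auto

lemma gaps_of_0: "gaps_of t y 0 = gap_of t y"
  and gaps_of_Suc: "gaps_of t y (Suc n) = gaps_of t (nxt t y) n"
  by (simp_all add: gaps_of_def funpow_swap1)

lemma prob_space_gap_law: "prob_space (gap_law t)"
  unfolding gap_law_def by (rule prob_space.prob_space_distr[OF prob_space_SR]) measurable

lemma sets_gap_law [measurable_cong, simp]: "sets (gap_law t) = sets borel"
  and space_gap_law [simp]: "space (gap_law t) = UNIV"
  by (simp_all add: gap_law_def)

lemma psum_cong: "(\<And>i. i < k \<Longrightarrow> y i = y' i) \<Longrightarrow> f (psum y k) = f (psum y' k)"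
  by (simp add: psum_def)

lemma nn_integral_start:
  assumes [measurable]: "f \<in> borel_measurable borel" "h \<in> borel_measurable S"
  shows "(\<integral>\<^sup>+y. f (first_pos t y) * h (start t y) \<partial>S) = (\<integral>\<^sup>+y. f (first_pos t y) \<partial>S) * (\<integral>\<^sup>+y. h y \<partial>SR t :: ennreal)"
  using first_surv_indep[where D = "{}" and f = "\<lambda>k y. f (psum y k)" and h = h and t = t, OF _ _ _ psum_cong]
  by (simp add: start_def first_pos_def)

lemma nn_integral_nxt:
  assumes [measurable]: "f \<in> borel_measurable borel" "h \<in> borel_measurable S"
  shows "(\<integral>\<^sup>+y. f (gap_of t y) * h (nxt t y) \<partial>SR t) = (\<integral>\<^sup>+x. f x \<partial>gap_law t) * (\<integral>\<^sup>+y. h y \<partial>SR t :: ennreal)"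
proof -
  have "(\<integral>\<^sup>+x. f x \<partial>gap_law t) = (\<integral>\<^sup>+y. f (gap_of t y) \<partial>SR t)"
    unfolding gap_law_def by (subst nn_integral_distr) auto
  moreover have "(\<integral>\<^sup>+y. of_bool (surv t (marks_of y) 0) * (f (gap_of t y) * h (nxt t y)) \<partial>S) =
      (\<integral>\<^sup>+y. of_bool (surv t (marks_of y) 0) * f (gap_of t y) \<partial>S) * (\<integral>\<^sup>+y. h y \<partial>SR t)"
    using first_surv_indep[where D = "{0}" and f = "\<lambda>k y. f (psum y k)" and h = h and t = t, OF _ _ _ psum_cong]
    by (simp add: nxt_def gap_of_def mult.assoc)
  ultimately have "(\<integral>\<^sup>+y. f (gap_of t y) * h (nxt t y) \<partial>SR t) =
      (\<integral>\<^sup>+y. of_bool (surv t (marks_of y) 0) * f (gap_of t y) \<partial>S) * (\<integral>\<^sup>+y. h y \<partial>SR t) / emeasure S (surv0 t)"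
    by (subst nn_integral_SR) auto
  also have "\<dots> = (\<integral>\<^sup>+y. f (gap_of t y) \<partial>SR t) * (\<integral>\<^sup>+y. h y \<partial>SR t)"
    by (subst nn_integral_SR[of "\<lambda>y. f (gap_of t y)"]) (auto simp: divide_ennreal_def ac_simps)
  finally show ?thesis using \<open>(\<integral>\<^sup>+x. f x \<partial>gap_law t) = _\<close> by simp
qed

text \<open>The sequence seen from the first survivor has law \<open>SR t\<close>. This puts the gap
  law on the fixed space \<open>S\<close>, without a conditioning event that varies with
  \<open>t\<close>, which the limit of large times requires.\<close>

lemma gap_law_eq_start: "gap_law t = distr S borel (\<lambda>y. gap_of t (start t y))"
proof (rule measure_eqI)
  fix A assume "A \<in> sets (gap_law t)"
  then have [measurable]: "A \<in> sets borel" by simp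
  have "emeasure (gap_law t) A = (\<integral>\<^sup>+y. indicator A (gap_of t y) \<partial>SR t)"
    unfolding gap_law_def
    by (subst emeasure_distr_indicator) (auto intro!: nn_integral_cong simp: indicator_def)
  also have "\<dots> = (\<integral>\<^sup>+y. indicator A (gap_of t (start t y)) \<partial>S)"
    using nn_integral_start[where f = "\<lambda>_. 1" and h = "\<lambda>y. indicator A (gap_of t y)" and t = t]
    by (simp add: seq.P.emeasure_space_1)
  also have "\<dots> = emeasure (distr S borel (\<lambda>y. gap_of t (start t y))) A"
    by (subst emeasure_distr_indicator) (auto intro!: nn_integral_cong simp: indicator_def)
  finally show "emeasure (gap_law t) A = emeasure (distr S borel (\<lambda>y. gap_of t (start t y))) A" .
qed simp

text \<open>Induction with \<open>nn_integral_nxt\<close>: under \<open>SR t\<close> the first gap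
  is independent of the sequence seen from the next survivor, whose law is \<open>SR t\<close>
  again.\<close>

lemma nn_integral_gaps:
  assumes "\<And>i. f i \<in> borel_measurable borel"
  shows "(\<integral>\<^sup>+y. (\<Prod>i<n. f i (gaps_of t y i)) \<partial>SR t) = (\<Prod>i<n. \<integral>\<^sup>+x. f i x \<partial>gap_law t :: ennreal)"
  using assms
proof (induction n arbitrary: f)
  case 0
  show ?case using prob_space.emeasure_space_1[OF prob_space_SR[of t]] by simp
next
  case (Suc n)
  note Suc.prems[measurable]
  have "(\<integral>\<^sup>+y. (\<Prod>i<Suc n. f i (gaps_of t y i)) \<partial>SR t) =
      (\<integral>\<^sup>+y. f 0 (gap_of t y) * (\<Prod>i<n. f (Suc i) (gaps_of t (nxt t y) i)) \<partial>SR t)"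
    unfolding prod.lessThan_Suc_shift by (simp add: gaps_of_0 gaps_of_Suc)
  also have "\<dots> = (\<integral>\<^sup>+x. f 0 x \<partial>gap_law t) * (\<integral>\<^sup>+y. (\<Prod>i<n. f (Suc i) (gaps_of t y i)) \<partial>SR t)"
    using nn_integral_nxt[where f = "f 0" and h = "\<lambda>y. \<Prod>i<n. f (Suc i) (gaps_of t y i)" and t = t] by simp
  also have "\<dots> = (\<Prod>i<Suc n. \<integral>\<^sup>+x. f i x \<partial>gap_law t)"
    unfolding prod.lessThan_Suc_shift by (subst Suc.IH) auto
  finally show ?case .
qed

lemma distr_gaps: "distr (SR t) (\<Pi>\<^sub>M i\<in>(UNIV :: nat set). borel) (gaps_of t) = (\<Pi>\<^sub>M i\<in>(UNIV :: nat set). gap_law t)"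
proof -
  interpret G: product_prob_space "\<lambda>_. gap_law t" "UNIV :: nat set"
    by (intro product_prob_spaceI prob_space_gap_law)
  have cong: "sets (\<Pi>\<^sub>M i\<in>(UNIV :: nat set). gap_law t) = sets (\<Pi>\<^sub>M i\<in>(UNIV :: nat set). borel)"
    by (rule sets_PiM_cong) auto
  show ?thesis
  proof (rule G.PiM_eq)
    show "sets (distr (SR t) (\<Pi>\<^sub>M i\<in>UNIV. borel) (gaps_of t)) = sets (\<Pi>\<^sub>M i\<in>(UNIV :: nat set). gap_law t)"
      by (simp add: cong)
    fix J and E :: "nat \<Rightarrow> real set"
    assume J: "finite J" "J \<subseteq> UNIV" and E: "\<And>j. j \<in> J \<Longrightarrow> E j \<in> sets (gap_law t)"
    obtain n where n: "J \<subseteq> {..<n}" using J(1) by (meson finite_nat_iff_bounded)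
    \<comment> \<open>Coordinates outside \<open>J\<close> get the constant 1, which turns the
      cylinder into a product over an initial segment.\<close>
    define f :: "nat \<Rightarrow> real \<Rightarrow> ennreal" where "f i = (if i \<in> J then indicator (E i) else (\<lambda>_. 1))" for i
    have [measurable]: "f i \<in> borel_measurable borel" for i using E by (auto simp: f_def)
    have pe: "prod_emb UNIV (\<lambda>_. gap_law t) J (Pi\<^sub>E J E) = {x. \<forall>j\<in>J. x j \<in> E j}"
      by (auto simp: prod_emb_def PiE_iff)
    have "emeasure (distr (SR t) (\<Pi>\<^sub>M i\<in>UNIV. borel) (gaps_of t)) (prod_emb UNIV (\<lambda>_. gap_law t) J (Pi\<^sub>E J E))
        = emeasure (SR t) {y \<in> space S. \<forall>j\<in>J. gaps_of t y j \<in> E j}"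
    proof (subst emeasure_distr)
      show "prod_emb UNIV (\<lambda>_. gap_law t) J (Pi\<^sub>E J E) \<in> sets (\<Pi>\<^sub>M i\<in>UNIV. borel)"
        using sets_PiM_I[OF J, of E "\<lambda>_. gap_law t"] E by (simp add: cong)
      show "emeasure (SR t) (gaps_of t -` prod_emb UNIV (\<lambda>_. gap_law t) J (Pi\<^sub>E J E) \<inter> space (SR t)) =
          emeasure (SR t) {y \<in> space S. \<forall>j\<in>J. gaps_of t y j \<in> E j}"
        unfolding pe by (intro arg_cong2[of _ _ _ _ emeasure]) auto
    qed measurable
    also have "\<dots> = (\<integral>\<^sup>+y. (\<Prod>i<n. f i (gaps_of t y i)) \<partial>SR t)"
    proof -
      have [measurable]: "{y \<in> space S. \<forall>j\<in>J. gaps_of t y j \<in> E j} \<in> sets S"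
        using E J(1) by measurable
      have "(\<Prod>i<n. f i (gaps_of t y i)) = indicator {y \<in> space S. \<forall>j\<in>J. gaps_of t y j \<in> E j} y" if "y \<in> space S" for y
      proof -
        have "(\<Prod>i<n. f i (gaps_of t y i)) = (\<Prod>i\<in>J. indicator (E i) (gaps_of t y i))"
          using n by (intro prod.mono_neutral_cong_right) (auto simp: f_def)
        also have "\<dots> = indicator {y \<in> space S. \<forall>j\<in>J. gaps_of t y j \<in> E j} y"
          using J(1) that by (auto simp: indicator_def prod_zero_iff)
        finally show ?thesis .
      qed
      then have "(\<integral>\<^sup>+y. (\<Prod>i<n. f i (gaps_of t y i)) \<partial>SR t) = (\<integral>\<^sup>+y. indicator {y \<in> space S. \<forall>j\<in>J. gaps_of t y j \<in> E j} y \<partial>SR t)"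
        by (intro nn_integral_cong) simp
      then show ?thesis by simp
    qed
    also have "\<dots> = (\<Prod>i<n. \<integral>\<^sup>+x. f i x \<partial>gap_law t)"
      by (rule nn_integral_gaps) measurable
    also have "\<dots> = (\<Prod>j\<in>J. emeasure (gap_law t) (E j))"
      using n E prob_space.emeasure_space_1[OF prob_space_gap_law[of t]]
      by (intro prod.mono_neutral_cong_right) (auto simp: f_def)
    finally show "emeasure (distr (SR t) (\<Pi>\<^sub>M i\<in>UNIV. borel) (gaps_of t)) (prod_emb UNIV (\<lambda>_. gap_law t) J (Pi\<^sub>E J E)) =
        (\<Prod>j\<in>J. emeasure (gap_law t) (E j))" .
  qed
qed

text \<open>A series over the number \<open>k\<close> of initial domains that form the gap. Survival
  of the right end has the same probability as the conditioning event, so the two cancel and only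
  events of finite blocks remain.\<close>

lemma emeasure_gap_law:
  assumes [measurable]: "A \<in> sets borel"
  shows "emeasure (gap_law t) A = (\<Sum>k. \<integral>\<^sup>+y. of_bool (block_event {0} t k (marks_of y)) * indicator A (psum y k) \<partial>S)"
proof -
  have ne: "emeasure S (surv0 t) / emeasure S (surv0 t) = 1"
    using emeasure_surv0_pos[of t] by (intro ennreal_divide_self) (auto simp: less_top[symmetric])
  have "emeasure (gap_law t) A = (\<integral>\<^sup>+y. indicator A (gap_of t y) \<partial>SR t)"
    unfolding gap_law_def
    by (subst emeasure_distr_indicator) (auto intro!: nn_integral_cong simp: indicator_def)
  also have "\<dots> = (\<integral>\<^sup>+y. of_bool (surv t (marks_of y) 0) * indicator A (gap_of t y) \<partial>S) / emeasure S (surv0 t)"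
    by (rule nn_integral_SR) measurable
  also have "(\<integral>\<^sup>+y. of_bool (surv t (marks_of y) 0) * indicator A (gap_of t y) \<partial>S) =
      (\<Sum>k. \<integral>\<^sup>+y. of_bool (block_event {0} t k (marks_of y)) * indicator A (psum y k) \<partial>S) * emeasure S (surv0 t)"
    using first_surv_split[where D = "{0}" and f = "\<lambda>k y. indicator A (psum y k)" and h = "\<lambda>_. 1" and t = t, OF _ _ _ psum_cong]
    by (simp add: gap_of_def emeasure_surv0_eq)
  finally show ?thesis using ne by (simp add: divide_ennreal_def mult.assoc)
qed

section \<open>Invariance of the gap law under exchange of left and right\<close>

lemma marked_renewal_flip: "marked_renewal M gp (\<lambda>x. flip (mk x)) dmin"
proof
  have [measurable]: "Measurable.pred M (\<lambda>x. snd (mk x))"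
    using measurable_snd'[OF mk_measurable] by simp
  have "(\<lambda>x. (fst (mk x), \<not> snd (mk x))) \<in> M \<rightarrow>\<^sub>M borel \<Otimes>\<^sub>M count_space UNIV"
    by measurable
  then show "(\<lambda>x. flip (mk x)) \<in> M \<rightarrow>\<^sub>M borel \<Otimes>\<^sub>M count_space UNIV"
    by (simp add: flip_def)
qed (use diffuse dmin_pos gp_ge in auto)

text \<open>Reversing the order of the first \<open>k\<close> domains maps blocks between consecutive survivors to
  blocks of the process with left and right exchanged.\<close>

lemma gap_law_flip: "marked_renewal.gap_law M gp (\<lambda>x. flip (mk x)) t = gap_law t"
proof -
  interpret F: marked_renewal M gp "\<lambda>x. flip (mk x)" dmin by (rule marked_renewal_flip)
  \<comment> \<open>Reverses the first \<open>k\<close> coordinates and fixes all others; as an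
    injective relabelling it preserves the product measure.\<close>
  define rv where "rv k i = (if i < k then k - 1 - i else i)" for k i :: nat
  have inj: "inj (rv k)" for k
    unfolding rv_def inj_on_def by (auto split: if_splits)
  have dist: "distr S S (\<lambda>y. y \<circ> rv k) = S" for k
    using distr_PiM_reindex[of UNIV "\<lambda>_. M" "rv k" UNIV] inj[of k]
    by (simp add: prob_space_axioms restrict_UNIV comp_def)
  have [measurable]: "(\<lambda>y. y \<circ> rv k) \<in> measurable S S" for k
    by (rule measurable_PiM_single') (auto simp: space_PiM PiE_def comp_def)
  show ?thesis
  proof (rule measure_eqI)
    fix A assume "A \<in> sets (F.gap_law t)"
    then have [measurable]: "A \<in> sets borel" by simp
    have "(\<integral>\<^sup>+y. of_bool (block_event {0} t k (F.marks_of y)) * indicator A (psum y k) \<partial>S)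
        = (\<integral>\<^sup>+y. of_bool (block_event {0} t k (marks_of y)) * indicator A (psum y k) \<partial>S :: ennreal)" for k
    proof -
      have "(\<integral>\<^sup>+y. of_bool (block_event {0} t k (marks_of y)) * indicator A (psum y k) \<partial>S) =
        (\<integral>\<^sup>+y. of_bool (block_event {0} t k (marks_of y)) * indicator A (psum y k) \<partial>distr S S (\<lambda>y. y \<circ> rv k))"
        by (simp only: dist)
      also have "\<dots> = (\<integral>\<^sup>+y. of_bool (block_event {0} t k (marks_of (y \<circ> rv k))) * indicator A (psum (y \<circ> rv k) k) \<partial>S)"
        by (rule nn_integral_distr) measurable
      also have "\<dots> = (\<integral>\<^sup>+y. of_bool (block_event {0} t k (F.marks_of y)) * indicator A (psum y k) \<partial>S)"
      proof (rule nn_integral_cong)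
        fix y
        have "psum (y \<circ> rv k) k = (\<Sum>i<k. gp (y (k - Suc i)))"
          by (auto simp: psum_def rv_def intro!: sum.cong)
        also have "\<dots> = psum y k"
          unfolding psum_def by (rule sum.nat_diff_reindex)
        finally have "psum (y \<circ> rv k) k = psum y k" .
        moreover have "block_event {0} t k (F.marks_of y) \<longleftrightarrow> block_event {0} t k (marks_of (y \<circ> rv k))"
          by (rule block_event_flip) (auto simp: F.marks_of_def marks_of_def rv_def)
        ultimately show "of_bool (block_event {0} t k (marks_of (y \<circ> rv k))) * indicator A (psum (y \<circ> rv k) k)
          = (of_bool (block_event {0} t k (F.marks_of y)) * indicator A (psum y k) :: ennreal)" by simp
      qed
      finally show ?thesis by simp
    qed
    then show "emeasure (F.gap_law t) A = emeasure (gap_law t) A"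
      by (simp add: emeasure_gap_law F.emeasure_gap_law)
  qed simp
qed

subsection \<open>The surviving points\<close>

lemma psum_add: "psum y (k + j) = psum y k + psum (sh k y) j"
  by (induction j) (simp_all add: psum_def sh_def add.commute)

text \<open>\<open>nxt\<close> visits the survivors one by one. Every survivor is reached, by strong
  induction on its index, and every partial sum of gaps is a survivor, by induction on the number of
  gaps.\<close>

lemma surv_points_eq:
  assumes G: "Good (marks_of y)" and s0: "surv t (marks_of y) 0"
  shows "{psum y k |k. surv t (marks_of y) k} = range (\<lambda>n. \<Sum>i<n. gaps_of t y i)"
proof -
  have step: "Good (marks_of (nxt t y))" "surv t (marks_of (nxt t y)) 0"
      "0 < first_surv {0} t (marks_of y)"
    and step': "psum y (first_surv {0} t (marks_of y) + j) = gap_of t y + psum (nxt t y) j"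
      "surv t (marks_of y) (first_surv {0} t (marks_of y) + j) \<longleftrightarrow> surv t (marks_of (nxt t y)) j"
    if "Good (marks_of y)" "surv t (marks_of y) 0" for y j
    using that first_surv(2,3)[OF that(1), where t = t] surv_right[OF that(1) first_surv(2)[OF that(1)], where j = 0]
      surv_right[OF that(1) first_surv(2)[OF that(1)], where j = j]
    by (auto simp: nxt_def marks_of_sh Good_sh psum_add gap_of_def)
  have 1: "\<exists>n. psum y k = (\<Sum>i<n. gaps_of t y i)"
    if "surv t (marks_of y) k" "Good (marks_of y)" "surv t (marks_of y) 0" for y k
    using that
  proof (induction k arbitrary: y rule: less_induct)
    case (less k)
    show ?case
    proof (cases "k = 0")
      case True
      then show ?thesis by (intro exI[of _ 0]) (simp add: psum_def)
    next
      case False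
      let ?K = "first_surv {0} t (marks_of y)"
      have "?K \<le> k" using first_surv(5)[OF less.prems(2), where j = k and t = t] False less.prems(1) by (meson not_less neq0_conv)
      then obtain j where j: "k = ?K + j" by (metis le_Suc_ex)
      then have "j < k" using step(3)[OF less.prems(2,3)] by simp
      then obtain n where "psum (nxt t y) j = (\<Sum>i<n. gaps_of t (nxt t y) i)"
        using less.IH[of j "nxt t y"] step(1,2)[OF less.prems(2,3)] step'[OF less.prems(2,3), of j] less.prems(1) j by auto
      then have "psum y k = (\<Sum>i<Suc n. gaps_of t y i)"
        using step'(1)[OF less.prems(2,3), of j] j
        unfolding sum.lessThan_Suc_shift by (simp add: gaps_of_0 gaps_of_Suc)
      then show ?thesis ..
    qed
  qed
  have 2: "\<exists>k. surv t (marks_of y) k \<and> psum y k = (\<Sum>i<n. gaps_of t y i)"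
    if "Good (marks_of y)" "surv t (marks_of y) 0" for y n
    using that
  proof (induction n arbitrary: y)
    case 0
    then show ?case by (intro exI[of _ 0]) (simp add: psum_def)
  next
    case (Suc n)
    then obtain k where "surv t (marks_of (nxt t y)) k" "psum (nxt t y) k = (\<Sum>i<n. gaps_of t (nxt t y) i)"
      using step[OF Suc.prems] by metis
    then have "surv t (marks_of y) (first_surv {0} t (marks_of y) + k) \<and>
        psum y (first_surv {0} t (marks_of y) + k) = (\<Sum>i<Suc n. gaps_of t y i)"
      using step'[OF Suc.prems, of k] unfolding sum.lessThan_Suc_shift by (simp add: gaps_of_0 gaps_of_Suc)
    then show ?case by blast
  qed
  show ?thesis
  proof (intro set_eqI iffI)
    fix x assume "x \<in> {psum y k |k. surv t (marks_of y) k}"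
    then obtain k where k: "x = psum y k" "surv t (marks_of y) k" by blast
    from 1[OF k(2) G s0] k(1) show "x \<in> range (\<lambda>n. \<Sum>i<n. gaps_of t y i)" by auto
  next
    fix x assume "x \<in> range (\<lambda>n. \<Sum>i<n. gaps_of t y i)"
    then obtain n where n: "x = (\<Sum>i<n. gaps_of t y i)" by blast
    from 2[OF G s0, of n] obtain k where "surv t (marks_of y) k" "psum y k = (\<Sum>i<n. gaps_of t y i)" by blast
    then show "x \<in> {psum y k |k. surv t (marks_of y) k}" unfolding n by (metis (mono_tags, lifting) mem_Collect_eq)
  qed
qed

lemma surv_start:
  assumes "Good (marks_of y)"
  shows "Good (marks_of (start t y))" "surv t (marks_of (start t y)) 0"
  using assms first_surv(1)[OF assms, where t = t] surv_right[OF assms first_surv(1)[OF assms], where j = 0]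
  by (auto simp: start_def marks_of_sh Good_sh)

lemma surv_points_eq_start:
  assumes G: "Good (marks_of y)"
  shows "{psum y k |k. surv t (marks_of y) k} = range (\<lambda>n. first_pos t y + (\<Sum>i<n. gaps_of t (start t y) i))"
proof -
  let ?K = "first_surv {} t (marks_of y)"
  have "{psum y k |k. surv t (marks_of y) k} = {psum y (?K + j) |j. surv t (marks_of y) (?K + j)}"
  proof -
    have "surv t (marks_of y) k \<Longrightarrow> \<exists>j. k = ?K + j" for k
      using first_surv(4)[OF G, where j = k and t = t] by (metis le_Suc_ex not_less)
    then show ?thesis by blast
  qed
  also have "\<dots> = {first_pos t y + psum (start t y) j |j. surv t (marks_of (start t y)) j}"
    using surv_right[OF G first_surv(1)[OF G]] by (simp add: psum_add first_pos_def start_def marks_of_sh)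
  also have "\<dots> = (\<lambda>x. first_pos t y + x) ` {psum (start t y) j |j. surv t (marks_of (start t y)) j}"
    by auto
  also have "\<dots> = range (\<lambda>n. first_pos t y + (\<Sum>i<n. gaps_of t (start t y) i))"
    unfolding surv_points_eq[OF surv_start[OF G]] by (simp add: image_image)
  finally show ?thesis .
qed

lemma AE_gp: "AE y in S. \<forall>i. dmin \<le> gp (y i)"
  unfolding AE_all_countable using gp_ge by (intro allI seq.AE_component) auto

text \<open>A gap is the total length of a random positive number of initial domains, so it inherits
  whatever holds for all such sums.\<close>

lemma AE_gap_law:
  assumes [measurable]: "Measurable.pred borel P" and imp: "AE y in S. \<forall>k>0. P (psum y k)"
  shows "AE x in gap_law t. P x"
proof -
  have "AE y in SR t. P (gap_of t y)"
    using AE_SR[OF imp] AE_SR_Good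
    by eventually_elim (simp add: gap_of_def first_surv)
  then show ?thesis unfolding gap_law_def by (subst AE_distr_iff) auto
qed

lemma gap_law_ge: "AE x in gap_law t. dmin \<le> x"
proof (rule AE_gap_law)
  show "AE y in S. \<forall>k>0. dmin \<le> psum y k"
    using AE_gp
  proof eventually_elim
    case (elim y)
    have "0 \<le> gp (y i)" for i using elim dmin_pos by (meson less_imp_le order_trans)
    then have "0 \<le> psum y k" for k unfolding psum_def by (intro sum_nonneg) auto
    then have "psum y (Suc k) \<ge> dmin" for k
      using elim by (auto simp: psum_def intro: add_increasing)
    then show ?case by (metis gr0_conv_Suc)
  qed
qed measurable

lemma gap_law_nat:
  assumes "AE x in M. gp x \<in> \<nat> \<and> 1 \<le> gp x"
  shows "AE x in gap_law t. x \<in> \<nat> \<and> 1 \<le> x"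
proof (rule AE_gap_law)
  have "AE y in S. \<forall>i. gp (y i) \<in> \<nat> \<and> 1 \<le> gp (y i)"
    unfolding AE_all_countable using assms by (intro allI seq.AE_component) auto
  then show "AE y in S. \<forall>k>0. psum y k \<in> \<nat> \<and> 1 \<le> psum y k"
  proof eventually_elim
    case (elim y)
    have "0 \<le> psum y k \<and> psum y k \<in> \<nat>" for k
      using elim by (induction k) (auto simp: psum_def intro: add_nonneg_nonneg order_trans[OF zero_le_one])
    then have "psum y (Suc k) \<in> \<nat> \<and> 1 \<le> psum y (Suc k)" for k
      using elim by (auto simp: psum_def intro: add_increasing)
    then show ?case by (metis gr0_conv_Suc)
  qed
next
  have "(\<nat>::real set) \<in> sets borel" unfolding Nats_def by (rule sets.countable) auto
  then show "Measurable.pred borel (\<lambda>x::real. x \<in> \<nat> \<and> 1 \<le> x)" by measurable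
qed

lemma real_distribution_gap_law: "real_distribution (gap_law t)"
  using prob_space_gap_law by (simp add: real_distribution_def real_distribution_axioms_def)

subsection \<open>Finite mean\<close>

text \<open>Comparison with the geometric series of ratio \<open>q\<close>, where
  \<open>q ^ 10 = 1 / 2\<close>; the factor \<open>q ^ 9\<close> pays for rounding \<open>i\<close>
  down to a multiple of ten.\<close>

lemma suminf_half_blocks: "(\<Sum>i. ennreal ((1 / 2) ^ (i div 10))) < \<infinity>"
proof -
  define q :: real where "q = root 10 (1 / 2)"
  have q: "0 < q" "q < 1" "q ^ 10 = 1 / 2"
    by (auto simp: q_def)
  have le: "(1 / 2 :: real) ^ (i div 10) \<le> q ^ i / q ^ 9" for i :: nat
  proof -
    have "i \<le> 10 * (i div 10) + 9" by presburger
    then have "q ^ (10 * (i div 10) + 9) \<le> q ^ i"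
      using q by (intro power_decreasing) auto
    then show ?thesis using q by (simp add: power_add power_mult field_simps)
  qed
  have "summable (\<lambda>i. q ^ i / q ^ 9)"
    using q by (intro summable_divide summable_geometric) auto
  then have "summable (\<lambda>i. (1 / 2 :: real) ^ (i div 10))"
    by (rule summable_comparison_test_ev[rotated]) (use le in auto)
  then show ?thesis by (subst suminf_ennreal2) auto
qed

text \<open>Domain \<open>i\<close> belongs to the gap after the origin only if all complete blocks
  of ten before it are \<open>Bad\<close>. These blocks do not involve domain \<open>i\<close>, so
  its mean length enters with the weight \<open>(1 / 2) ^ (i div 10)\<close>.\<close>

lemma gap_law_integrable:
  assumes "integrable M gp"
  shows "integrable (gap_law t) (\<lambda>x. x)"
proof -
  define G where "G x = ennreal (gp x)" for x
  have [measurable]: "G \<in> borel_measurable M" unfolding G_def by measurable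
  have EG: "(\<integral>\<^sup>+x. G x \<partial>M) < \<infinity>"
  proof -
    have "(\<integral>\<^sup>+x. G x \<partial>M) \<le> (\<integral>\<^sup>+x. ennreal (norm (gp x)) \<partial>M)"
      by (rule nn_integral_mono) (simp add: G_def ennreal_leI)
    also have "\<dots> < \<infinity>" using assms by (simp add: integrable_iff_bounded)
    finally show ?thesis .
  qed
  have one: "(\<integral>\<^sup>+y. of_bool (\<forall>b < i div 10. Bad (marks_of (sh (10 * b) y))) * G (y i) \<partial>S)
      \<le> ennreal ((1 / 2) ^ (i div 10)) * (\<integral>\<^sup>+x. G x \<partial>M)" for i
  proof -
    have "(\<integral>\<^sup>+y. of_bool (\<forall>b < i div 10. Bad (marks_of (sh (10 * b) y))) * G (y i) \<partial>S)
        = (\<integral>\<^sup>+y. of_bool (\<forall>b < i div 10. Bad (marks_of (sh (10 * b) y))) * G (sh i y 0) \<partial>S)"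
      by (simp add: sh_def)
    also have "\<dots> = (\<integral>\<^sup>+y. of_bool (\<forall>b < i div 10. Bad (marks_of (sh (10 * b) y))) \<partial>S) * (\<integral>\<^sup>+y. G (y 0) \<partial>S)"
    proof (rule nn_integral_split)
      fix y y' :: "nat \<Rightarrow> 'a" assume eq: "\<And>j. j < i \<Longrightarrow> y j = y' j"
      have "Bad (marks_of (sh (10 * b) y)) \<longleftrightarrow> Bad (marks_of (sh (10 * b) y'))" if "b < i div 10" for b
      proof -
        \<comment> \<open>A block with number below \<open>i div 10\<close> ends before domain
          \<open>i\<close>.\<close>
        have "10 * Suc b \<le> 10 * (i div 10)" using that by simp
        also have "\<dots> \<le> i" by simp
        finally have "10 * b + 10 \<le> i" by simp
        then have "marks_of (sh (10 * b) y) j = marks_of (sh (10 * b) y') j" if "j < 10" for j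
          using that eq[of "j + 10 * b"] by (simp add: marks_of_def sh_def)
        then show ?thesis unfolding Bad_def by simp
      qed
      then show "of_bool (\<forall>b < i div 10. Bad (marks_of (sh (10 * b) y))) =
          (of_bool (\<forall>b < i div 10. Bad (marks_of (sh (10 * b) y'))) :: ennreal)"
        by (intro arg_cong[of _ _ of_bool]) blast
    qed measurable
    also have "(\<integral>\<^sup>+y. G (y 0) \<partial>S) = (\<integral>\<^sup>+x. G x \<partial>distr S M (\<lambda>y. y 0))"
      by (subst nn_integral_distr) auto
    also have "distr S M (\<lambda>y. y 0) = M"
      using seq.PiM_component[of 0] by simp
    finally have "(\<integral>\<^sup>+y. of_bool (\<forall>b < i div 10. Bad (marks_of (sh (10 * b) y))) * G (y i) \<partial>S)
        = (\<integral>\<^sup>+y. of_bool (\<forall>b < i div 10. Bad (marks_of (sh (10 * b) y))) \<partial>S) * (\<integral>\<^sup>+x. G x \<partial>M)" .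
    also have "\<dots> \<le> ennreal (1 / 2) ^ (i div 10) * (\<integral>\<^sup>+x. G x \<partial>M)"
      by (intro mult_right_mono nn_integral_Bad_blocks) auto
    also have "ennreal (1 / 2) ^ (i div 10) = ennreal ((1 / 2) ^ (i div 10))"
      by (rule ennreal_power) simp
    finally show ?thesis .
  qed
  have "(\<integral>\<^sup>+y. of_bool (surv t (marks_of y) 0) * ennreal (gap_of t y) \<partial>S)
      \<le> (\<integral>\<^sup>+y. (\<Sum>i. of_bool (\<forall>b < i div 10. Bad (marks_of (sh (10 * b) y))) * G (y i)) \<partial>S)"
  proof (rule nn_integral_mono_AE)
    show "AE y in S. of_bool (surv t (marks_of y) 0) * ennreal (gap_of t y)
        \<le> (\<Sum>i. of_bool (\<forall>b < i div 10. Bad (marks_of (sh (10 * b) y))) * G (y i))"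
      using AE_Good AE_gp
    proof eventually_elim
      case (elim y)
      let ?K = "first_surv {0} t (marks_of y)"
      have bad: "Bad (marks_of (sh (10 * b) y))" if "i < ?K" "b < i div 10" for i b
        unfolding marks_of_sh
      proof (rule deleted_block_Bad)
        \<comment> \<open>The point \<open>10 * b\<close> itself is left out because for
          \<open>b = 0\<close> it is the surviving origin.\<close>
        fix j assume "10 * b < j" "j < 10 * b + 10"
        have "10 * Suc b \<le> 10 * (i div 10)" using that by simp
        also have "\<dots> \<le> i" by simp
        finally have "j < i" using \<open>j < 10 * b + 10\<close> by simp
        with \<open>10 * b < j\<close> show "\<not> surv t (marks_of y) j"
          using that by (intro first_surv(5)[OF elim(1)]) auto
      qed
      have "ennreal (gap_of t y) = (\<Sum>i<?K. G (y i))"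
        unfolding gap_of_def psum_def G_def
        using elim(2) dmin_pos by (intro sum_ennreal[symmetric]) (meson less_imp_le order_trans)
      also have "\<dots> = (\<Sum>i<?K. of_bool (\<forall>b < i div 10. Bad (marks_of (sh (10 * b) y))) * G (y i))"
        using bad by (intro sum.cong) auto
      also have "\<dots> \<le> (\<Sum>i. of_bool (\<forall>b < i div 10. Bad (marks_of (sh (10 * b) y))) * G (y i))"
        by (rule sum_le_suminf) auto
      finally show ?case by (auto simp: of_bool_def)
    qed
  qed
  also have "\<dots> = (\<Sum>i. \<integral>\<^sup>+y. of_bool (\<forall>b < i div 10. Bad (marks_of (sh (10 * b) y))) * G (y i) \<partial>S)"
    by (rule nn_integral_suminf) measurable
  also have "\<dots> \<le> (\<Sum>i. ennreal ((1 / 2) ^ (i div 10)) * (\<integral>\<^sup>+x. G x \<partial>M))"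
    by (intro suminf_le one) auto
  also have "\<dots> < \<infinity>"
    using suminf_half_blocks EG by (simp add: ennreal_mult_less_top)
  finally have "(\<integral>\<^sup>+y. ennreal (gap_of t y) \<partial>SR t) < \<infinity>"
    using emeasure_surv0_pos[of t] by (subst nn_integral_SR) (auto simp: ennreal_divide_eq_top_iff less_top[symmetric])
  then have "(\<integral>\<^sup>+x. ennreal x \<partial>gap_law t) < \<infinity>"
    unfolding gap_law_def by (subst nn_integral_distr) auto
  moreover have "AE x in gap_law t. ennreal (norm x) = ennreal x"
    using gap_law_ge[of t] dmin_pos by (auto elim!: eventually_mono)
  then have "(\<integral>\<^sup>+x. ennreal (norm x) \<partial>gap_law t) = (\<integral>\<^sup>+x. ennreal x \<partial>gap_law t)"
    by (rule nn_integral_cong_AE)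
  ultimately show ?thesis by (simp add: integrable_iff_bounded)
qed

subsection \<open>Time zero and the limit of large times\<close>

lemma surv_0: "(\<And>i. 0 < fst (c i)) \<Longrightarrow> surv 0 c k"
proof -
  assume c: "\<And>i. 0 < fst (c i)"
  have "0 < fst (half c i)" for i using c by (auto simp: half_def)
  then show ?thesis unfolding surv_def idel_def by (meson not_le)
qed

lemma AE_surv_0: "AE y in S. \<forall>k. surv 0 (marks_of y) k"
proof -
  have "AE x in M. 0 < fst (mk x)"
  proof -
    have "AE x in M. x \<notin> {x \<in> space M. fst (mk x) = 0}"
      using diffuse[of 0] by (intro AE_not_in) (auto simp: null_sets_def)
    then show ?thesis by (rule AE_mp) (auto intro!: AE_I2 simp: zero_less_iff_neq_zero)
  qed
  then have "AE y in S. \<forall>i. 0 < fst (mk (y i))"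
    unfolding AE_all_countable by (intro allI seq.AE_component) auto
  then show ?thesis
    by eventually_elim (auto intro: surv_0 simp: marks_of_def)
qed

lemma first_pos_0: "AE y in S. first_pos 0 y = 0"
  using AE_surv_0 by eventually_elim (auto simp: first_pos_def first_surv_def psum_def)

lemma gap_law_0: "gap_law 0 = distr M borel gp"
proof -
  have "gap_law 0 = distr S borel (\<lambda>y. gap_of 0 (start 0 y))" by (rule gap_law_eq_start)
  also have "\<dots> = distr S borel (\<lambda>y. gp (y 0))"
  proof (rule distr_cong_AE)
    show "AE y in S. gap_of 0 (start 0 y) = gp (y 0)"
      using AE_surv_0
    proof eventually_elim
      case (elim y)
      then have "first_surv {} 0 (marks_of y) = 0" by (auto simp: first_surv_def)
      then have "start 0 y = y" by (simp add: start_def)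
      moreover have "first_surv {0} 0 (marks_of y) = 1"
        unfolding first_surv_def by (rule Least_equality) (use elim in auto)
      ultimately show ?case by (simp add: gap_of_def psum_def)
    qed
  qed auto
  also have "\<dots> = distr (distr S M (\<lambda>y. y 0)) borel gp"
    by (subst distr_distr) (auto simp: comp_def)
  also have "distr S M (\<lambda>y. y 0) = M"
    using seq.PiM_component[of 0] by simp
  finally show ?thesis .
qed

text \<open>Survival of a fixed point decreases in time, and a point missing at time
  \<open>\<infinity>\<close> is missing from some finite time on. The first survivor is decided by
  finitely many points, so it becomes constant.\<close>

lemma first_surv_eventually:
  assumes G: "Good c"
  shows "\<forall>\<^sub>F s :: real in at_top. first_surv {} (ennreal s) c = first_surv {} \<infinity> c"
    and "\<forall>\<^sub>F s :: real in at_top. first_surv {0} (ennreal s) c = first_surv {0} \<infinity> c"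
proof -
  have ev: "\<forall>\<^sub>F s :: real in at_top. surv (ennreal s) c k \<longleftrightarrow> surv \<infinity> c k" for k
  proof (cases "surv \<infinity> c k")
    case True
    then have "surv (ennreal s) c k" for s by (rule surv_antimono) simp
    then show ?thesis using True by simp
  next
    case False
    then obtain s0 where s0: "s0 < \<infinity>" "\<not> surv s0 c k" using surv_infty by blast
    then obtain r where r: "s0 = ennreal r" "r \<ge> 0" by (cases s0) auto
    have "\<not> surv (ennreal s) c k" if "s \<ge> r" for s
      using s0(2) surv_antimono[of "ennreal s" c k s0] r that by (auto simp: ennreal_leI)
    then show ?thesis
      using False by (auto intro!: eventually_mono[OF eventually_ge_at_top[of r]])
  qed
  have gen: "\<forall>\<^sub>F s :: real in at_top. first_surv D (ennreal s) c = k"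
    if "k \<notin> D" "surv \<infinity> c k" "\<And>j. j < k \<Longrightarrow> j \<notin> D \<Longrightarrow> \<not> surv \<infinity> c j" for D k
  proof -
    have "\<forall>\<^sub>F s :: real in at_top. \<forall>j\<in>{..k}. surv (ennreal s) c j \<longleftrightarrow> surv \<infinity> c j"
      using ev by (intro eventually_ball_finite) auto
    then show ?thesis
    proof eventually_elim
      case (elim s)
      then show ?case unfolding first_surv_def
        using that by (intro Least_equality) (auto simp: not_less[symmetric])
    qed
  qed
  show "\<forall>\<^sub>F s :: real in at_top. first_surv {} (ennreal s) c = first_surv {} \<infinity> c"
    using first_surv[OF G] by (intro gen) auto
  show "\<forall>\<^sub>F s :: real in at_top. first_surv {0} (ennreal s) c = first_surv {0} \<infinity> c"
    using first_surv[OF G] by (intro gen) auto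
qed

lemma gap_law_tendsto: "weak_limit (\<lambda>s::real. gap_law (ennreal s)) (gap_law \<infinity>) at_top"
  unfolding weak_limit_def
proof (intro allI impI)
  fix f :: "real \<Rightarrow> real" assume f: "continuous_on UNIV f \<and> bounded (range f)"
  then have [measurable]: "f \<in> borel_measurable borel" by (intro borel_measurable_continuous_onI) auto
  obtain B where B: "\<And>x. norm (f x) \<le> B" using f by (auto simp: bounded_iff)
  have e: "(\<integral>x. f x \<partial>gap_law t) = (\<integral>y. f (gap_of t (start t y)) \<partial>S)" for t
    unfolding gap_law_eq_start by (rule integral_distr) measurable
  show "((\<lambda>s. \<integral>x. f x \<partial>gap_law (ennreal s)) \<longlongrightarrow> (\<integral>x. f x \<partial>gap_law \<infinity>)) at_top"
    unfolding e
  proof (rule integral_dominated_convergence_at_top[where w = "\<lambda>_. B"])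
    show "AE y in S. ((\<lambda>s. f (gap_of (ennreal s) (start (ennreal s) y))) \<longlongrightarrow> f (gap_of \<infinity> (start \<infinity> y))) at_top"
      using AE_Good
    proof eventually_elim
      case (elim y)
      have "\<forall>\<^sub>F s :: real in at_top. f (gap_of (ennreal s) (start (ennreal s) y)) = f (gap_of \<infinity> (start \<infinity> y))"
        \<comment> \<open>Once the first survivor has stabilised, \<open>start\<close> has its value
          at \<open>\<infinity>\<close>; the second fact is then applied to this fixed
          sequence.\<close>
        using first_surv_eventually(1)[OF elim] first_surv_eventually(2)[OF surv_start(1)[OF elim, of \<infinity>]]
        by eventually_elim (simp add: gap_of_def start_def)
      then show ?case by (rule tendsto_eventually)
    qed
  qed (use B in auto)
qed

section \<open>The first survivor for an arbitrary starting law\<close>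

definition start_law :: "real measure \<Rightarrow> ennreal \<Rightarrow> real measure" where
  "start_law \<nu> t = distr (\<nu> \<Otimes>\<^sub>M S) borel (\<lambda>(x, y). x + first_pos t y)"

context
  fixes \<nu> :: "real measure" assumes \<nu>: "real_distribution \<nu>"
begin

interpretation \<nu>: real_distribution \<nu> by (rule \<nu>)

interpretation pair_prob_space \<nu> S ..

lemma real_distribution_start_law: "real_distribution (start_law \<nu> t)"
  unfolding start_law_def real_distribution_def real_distribution_axioms_def
  by (auto intro!: P.prob_space_distr)

lemma AE_pair_snd: "AE y in S. Q y \<Longrightarrow> AE p in \<nu> \<Otimes>\<^sub>M S. Q (snd p)"
proof -
  assume Q: "AE y in S. Q y"
  have d: "distr (\<nu> \<Otimes>\<^sub>M S) S snd = S"
  proof (rule measure_eqI)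
    fix A assume "A \<in> sets (distr (\<nu> \<Otimes>\<^sub>M S) S snd)"
    then have A: "A \<in> sets S" by simp
    then have "snd -` A \<inter> space (\<nu> \<Otimes>\<^sub>M S) = space \<nu> \<times> A"
      by (auto simp: space_pair_measure dest: sets.sets_into_space)
    then show "emeasure (distr (\<nu> \<Otimes>\<^sub>M S) S snd) A = emeasure S A"
      using A \<nu>.emeasure_space_1 by (simp add: emeasure_distr seq.emeasure_pair_measure_Times)
  qed simp
  have "AE y in distr (\<nu> \<Otimes>\<^sub>M S) S snd. Q y" by (simp only: d Q)
  then show ?thesis by (rule AE_distrD[rotated]) measurable
qed

lemma start_law_0: "start_law \<nu> 0 = \<nu>"
proof -
  have "start_law \<nu> 0 = distr (\<nu> \<Otimes>\<^sub>M S) borel fst"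
    unfolding start_law_def
  proof (rule distr_cong_AE)
    show "AE p in \<nu> \<Otimes>\<^sub>M S. (case p of (x, y) \<Rightarrow> x + first_pos 0 y) = fst p"
      using AE_pair_snd[OF first_pos_0] by eventually_elim auto
  qed measurable
  also have "\<dots> = distr (\<nu> \<Otimes>\<^sub>M S) \<nu> fst"
    by (rule distr_cong) auto
  also have "\<dots> = \<nu>" by (rule seq.P.distr_pair_fst)
  finally show ?thesis .
qed

lemma start_law_tendsto: "weak_limit (\<lambda>s::real. start_law \<nu> (ennreal s)) (start_law \<nu> \<infinity>) at_top"
  unfolding weak_limit_def
proof (intro allI impI)
  fix f :: "real \<Rightarrow> real" assume f: "continuous_on UNIV f \<and> bounded (range f)"
  then have [measurable]: "f \<in> borel_measurable borel" by (intro borel_measurable_continuous_onI) auto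
  obtain B where B: "\<And>x. norm (f x) \<le> B" using f by (auto simp: bounded_iff)
  have e: "(\<integral>x. f x \<partial>start_law \<nu> t) = (\<integral>p. f (fst p + first_pos t (snd p)) \<partial>(\<nu> \<Otimes>\<^sub>M S))" for t
    unfolding start_law_def by (subst integral_distr) (auto simp: case_prod_beta)
  show "((\<lambda>s. \<integral>x. f x \<partial>start_law \<nu> (ennreal s)) \<longlongrightarrow> (\<integral>x. f x \<partial>start_law \<nu> \<infinity>)) at_top"
    unfolding e
  proof (rule integral_dominated_convergence_at_top[where w = "\<lambda>_. B"])
    show "AE p in \<nu> \<Otimes>\<^sub>M S. ((\<lambda>s. f (fst p + first_pos (ennreal s) (snd p))) \<longlongrightarrow> f (fst p + first_pos \<infinity> (snd p))) at_top"
      using AE_pair_snd[OF AE_Good]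
    proof eventually_elim
      case (elim p)
      have "\<forall>\<^sub>F s :: real in at_top. f (fst p + first_pos (ennreal s) (snd p)) = f (fst p + first_pos \<infinity> (snd p))"
        using first_surv_eventually(1)[OF elim]
        by eventually_elim (simp add: first_pos_def)
      then show ?case by (rule tendsto_eventually)
    qed
  qed (use B in auto)
qed

text \<open>For a fixed starting point, \<open>nn_integral_start\<close> separates the first
  survivor from the later gaps, and the factor for the gaps does not depend on that point.
  Comparison on rectangles then suffices.\<close>

lemma distr_start_gaps:
  "distr (\<nu> \<Otimes>\<^sub>M S) (borel \<Otimes>\<^sub>M (\<Pi>\<^sub>M i\<in>(UNIV :: nat set). borel)) (\<lambda>(x, y). (x + first_pos t y, gaps_of t (start t y)))
    = start_law \<nu> t \<Otimes>\<^sub>M (\<Pi>\<^sub>M i\<in>(UNIV :: nat set). gap_law t)" (is "?D = _")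
proof (rule sym, rule pair_measure_eqI)
  interpret L: real_distribution "start_law \<nu> t" by (rule real_distribution_start_law)
  show "sigma_finite_measure (start_law \<nu> t)" ..
  interpret G: product_prob_space "\<lambda>_. gap_law t" "UNIV :: nat set"
    by (intro product_prob_spaceI prob_space_gap_law)
  show "sigma_finite_measure (\<Pi>\<^sub>M i\<in>(UNIV :: nat set). gap_law t)" ..
  have cong: "sets (\<Pi>\<^sub>M i\<in>(UNIV :: nat set). gap_law t) = sets (\<Pi>\<^sub>M i\<in>(UNIV :: nat set). borel)"
    by (rule sets_PiM_cong) auto
  show "sets (start_law \<nu> t \<Otimes>\<^sub>M (\<Pi>\<^sub>M i\<in>(UNIV :: nat set). gap_law t)) = sets ?D"
    by (simp, rule sets_pair_measure_cong) (auto simp: cong)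
  fix A B assume "A \<in> sets (start_law \<nu> t)" "B \<in> sets (\<Pi>\<^sub>M i\<in>(UNIV :: nat set). gap_law t)"
  then have [measurable]: "A \<in> sets borel" "B \<in> sets (\<Pi>\<^sub>M i\<in>(UNIV :: nat set). borel)"
    by (auto simp: cong)
  have "emeasure ?D (A \<times> B) = (\<integral>\<^sup>+p. indicator A (fst p + first_pos t (snd p)) * indicator B (gaps_of t (start t (snd p))) \<partial>(\<nu> \<Otimes>\<^sub>M S))"
    by (subst emeasure_distr_indicator) (auto intro!: nn_integral_cong simp: indicator_def)
  also have "\<dots> = (\<integral>\<^sup>+x. \<integral>\<^sup>+y. indicator A (x + first_pos t y) * indicator B (gaps_of t (start t y)) \<partial>S \<partial>\<nu>)"
    by (subst seq.nn_integral_fst[symmetric]) auto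
  also have "\<dots> = (\<integral>\<^sup>+x. (\<integral>\<^sup>+y. indicator A (x + first_pos t y) \<partial>S) * (\<integral>\<^sup>+y. indicator B (gaps_of t y) \<partial>SR t) \<partial>\<nu>)"
  proof (rule nn_integral_cong)
    fix x
    show "(\<integral>\<^sup>+y. indicator A (x + first_pos t y) * indicator B (gaps_of t (start t y)) \<partial>S) =
      (\<integral>\<^sup>+y. indicator A (x + first_pos t y) \<partial>S) * (\<integral>\<^sup>+y. indicator B (gaps_of t y) \<partial>SR t)"
      by (rule nn_integral_start[where f = "\<lambda>z. indicator A (x + z)" and h = "\<lambda>y. indicator B (gaps_of t y)"]) measurable
  qed
  also have "\<dots> = (\<integral>\<^sup>+p. indicator A (fst p + first_pos t (snd p)) \<partial>(\<nu> \<Otimes>\<^sub>M S)) * (\<integral>\<^sup>+y. indicator B (gaps_of t y) \<partial>SR t)"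
    by (subst nn_integral_multc) (auto simp: seq.nn_integral_fst[symmetric])
  also have "(\<integral>\<^sup>+p. indicator A (fst p + first_pos t (snd p)) \<partial>(\<nu> \<Otimes>\<^sub>M S)) = emeasure (start_law \<nu> t) A"
    unfolding start_law_def
    by (subst emeasure_distr_indicator) (auto intro!: nn_integral_cong simp: indicator_def)
  also have "(\<integral>\<^sup>+y. indicator B (gaps_of t y) \<partial>SR t) = emeasure (\<Pi>\<^sub>M i\<in>(UNIV :: nat set). gap_law t) B"
    unfolding distr_gaps[symmetric]
    by (subst emeasure_distr_indicator) (auto intro!: nn_integral_cong simp: indicator_def)
  finally show "emeasure (start_law \<nu> t) A * emeasure (\<Pi>\<^sub>M i\<in>(UNIV :: nat set). gap_law t) B = emeasure ?D (A \<times> B)" ..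
qed

end

end

section \<open>The space of configurations\<close>

lemma space_config_space: "space config_space = {\<xi>. locally_finite \<xi>}"
  unfolding config_space_def space_Sup_eq_UN by (auto intro!: exI[of _ "{}"])

lemma card_measurable:
  assumes "A \<in> sets borel" "bounded A"
  shows "(\<lambda>\<xi>. card (\<xi> \<inter> A)) \<in> measurable config_space (count_space UNIV)"
  unfolding config_space_def
  by (rule measurable_SUP1[of A]) (use assms in \<open>auto intro!: measurable_vimage_algebra1\<close>)

lemma card_measurable' [measurable (raw)]:
  assumes "f \<in> measurable N config_space" "A \<in> sets borel" "bounded A"
  shows "(\<lambda>\<omega>. card (f \<omega> \<inter> A)) \<in> measurable N (count_space UNIV)"
  by (rule measurable_compose[OF assms(1) card_measurable[OF assms(2,3)]])

lemma measurable_config_spaceI: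
  assumes "\<And>\<omega>. \<omega> \<in> space N \<Longrightarrow> locally_finite (f \<omega>)"
    and "\<And>A. A \<in> sets borel \<Longrightarrow> bounded A \<Longrightarrow> (\<lambda>\<omega>. card (f \<omega> \<inter> A)) \<in> measurable N (count_space UNIV)"
  shows "f \<in> measurable N config_space"
  unfolding config_space_def
  by (rule measurable_SUP2) (use assms in \<open>auto intro!: measurable_vimage_algebra2\<close>)

lemma locally_finite_bounded: "locally_finite \<xi> \<Longrightarrow> bounded A \<Longrightarrow> finite (\<xi> \<inter> A)"
proof -
  assume lf: "locally_finite \<xi>" and "bounded A"
  then obtain B where "\<And>x. x \<in> A \<Longrightarrow> \<bar>x\<bar> \<le> B" by (auto simp: bounded_iff)
  then have "\<xi> \<inter> A \<subseteq> \<xi> \<inter> {- B..B}" by (auto simp: abs_le_iff) (metis neg_le_iff_le minus_minus abs_le_iff)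
  moreover have "finite (\<xi> \<inter> {- B..B})" using lf by (simp add: locally_finite_def)
  ultimately show ?thesis by (rule finite_subset)
qed

lemma locally_finite_subset: "locally_finite \<xi> \<Longrightarrow> \<eta> \<subseteq> \<xi> \<Longrightarrow> locally_finite \<eta>"
  unfolding locally_finite_def by (meson Int_mono finite_subset order_refl)

lemma locally_finite_image_add: "locally_finite \<xi> \<Longrightarrow> locally_finite ((\<lambda>y. y + a) ` \<xi>)"
  unfolding locally_finite_def
proof (intro allI)
  fix u v assume *: "\<forall>a b. finite (\<xi> \<inter> {a..b})"
  have "(\<lambda>y. y + a) ` \<xi> \<inter> {u..v} \<subseteq> (\<lambda>y. y + a) ` (\<xi> \<inter> {u - a..v - a})" by auto
  then show "finite ((\<lambda>y. y + a) ` \<xi> \<inter> {u..v})" using * by (meson finite_imageI finite_subset)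
qed

section \<open>Counting points in random windows\<close>

lemma measurable_nat_from_ennreal:
  fixes f :: "'w \<Rightarrow> nat"
  assumes [measurable]: "(\<lambda>\<omega>. of_nat (f \<omega>) :: ennreal) \<in> borel_measurable N"
  shows "f \<in> measurable N (count_space UNIV)"
proof -
  have "f -` {n} \<inter> space N \<in> sets N" for n
  proof -
    have "{\<omega> \<in> space N. (of_nat (f \<omega>) :: ennreal) = of_nat n} \<in> sets N" by measurable
    also have "{\<omega> \<in> space N. (of_nat (f \<omega>) :: ennreal) = of_nat n} = f -` {n} \<inter> space N"
      by auto
    finally show ?thesis .
  qed
  then show ?thesis by (subst measurable_count_space_eq2_countable) auto
qed

text \<open>The region in which points are counted may vary with the outcome. Dynkin induction on
  \<open>D\<close>: rectangles reduce to counts in Borel sets, complements to differences, disjoint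
  unions to sums. The bounded window keeps the counts finite, so that differences are
  legitimate.\<close>

lemma count_measurable_aux:
  assumes \<Xi> [measurable]: "\<Xi> \<in> measurable N config_space" and D: "D \<in> sets (borel \<Otimes>\<^sub>M N)"
  shows "(\<lambda>\<omega>. emeasure (count_space UNIV) {y \<in> \<Xi> \<omega>. y \<in> {- c..c :: real} \<and> (y, \<omega>) \<in> D}) \<in> borel_measurable N"
proof -
  have lf: "locally_finite (\<Xi> \<omega>)" if "\<omega> \<in> space N" for \<omega>
    using measurable_space[OF \<Xi> that] by (simp add: space_config_space)
  then have fin: "finite {y \<in> \<Xi> \<omega>. y \<in> {- c..c} \<and> P y}" if "\<omega> \<in> space N" for \<omega> P
    using that unfolding locally_finite_def
    by (rule_tac finite_subset[of _ "\<Xi> \<omega> \<inter> {- c..c}"]) auto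
  have D': "D \<in> sigma_sets (space borel \<times> space N) {a \<times> b |a b. a \<in> sets borel \<and> b \<in> sets N}"
    using D by (simp add: sets_pair_measure)
  have sub: "{a \<times> b |a b. a \<in> sets borel \<and> b \<in> sets N} \<subseteq> Pow (space borel \<times> space N)"
    using sets.sets_into_space[of _ N] by auto
  show ?thesis
    using Int_stable_pair_measure_generator sub D'
  proof (induction rule: sigma_sets_induct_disjoint)
    case (basic A)
    then obtain a b where A: "A = a \<times> b" and [measurable]: "a \<in> sets borel" "b \<in> sets N" by auto
    have "bounded ({- c..c} \<inter> a)" by (rule bounded_subset[OF bounded_closed_interval]) auto
    then have [measurable]: "(\<lambda>\<omega>. card (\<Xi> \<omega> \<inter> ({- c..c} \<inter> a))) \<in> measurable N (count_space UNIV)"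
      by measurable
    have "(\<lambda>\<omega>. if \<omega> \<in> b then of_nat (card (\<Xi> \<omega> \<inter> ({- c..c} \<inter> a))) else 0 :: ennreal) \<in> borel_measurable N"
      by measurable
    then show ?case
    proof (rule measurable_cong[THEN iffD1, rotated])
      fix \<omega> assume "\<omega> \<in> space N"
      have "{y \<in> \<Xi> \<omega>. y \<in> {- c..c} \<and> (y, \<omega>) \<in> A} = (if \<omega> \<in> b then \<Xi> \<omega> \<inter> ({- c..c} \<inter> a) else {})"
        by (auto simp: A)
      then show "(if \<omega> \<in> b then of_nat (card (\<Xi> \<omega> \<inter> ({- c..c} \<inter> a))) else 0) =
          emeasure (count_space UNIV) {y \<in> \<Xi> \<omega>. y \<in> {- c..c} \<and> (y, \<omega>) \<in> A}"
        using fin[OF \<open>\<omega> \<in> space N\<close>, of "\<lambda>y. (y, \<omega>) \<in> A"] by (auto simp: emeasure_count_space)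
    qed
  next
    case empty
    then show ?case by simp
  next
    case (compl A)
    have "(\<lambda>\<omega>. of_nat (card (\<Xi> \<omega> \<inter> {- c..c})) - emeasure (count_space UNIV) {y \<in> \<Xi> \<omega>. y \<in> {- c..c} \<and> (y, \<omega>) \<in> A}) \<in> borel_measurable N"
      using compl.IH by measurable
    then show ?case
    proof (rule measurable_cong[THEN iffD1, rotated])
      fix \<omega> assume w: "\<omega> \<in> space N"
      let ?B = "{y \<in> \<Xi> \<omega>. y \<in> {- c..c} \<and> (y, \<omega>) \<in> A}"
      have "{y \<in> \<Xi> \<omega>. y \<in> {- c..c} \<and> (y, \<omega>) \<in> space borel \<times> space N - A} = (\<Xi> \<omega> \<inter> {- c..c}) - ?B"
        using w by auto
      moreover have "emeasure (count_space UNIV) ((\<Xi> \<omega> \<inter> {- c..c}) - ?B) =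
          emeasure (count_space UNIV) (\<Xi> \<omega> \<inter> {- c..c}) - emeasure (count_space UNIV) ?B"
        using fin[OF w] by (intro emeasure_Diff) (auto simp: emeasure_count_space)
      moreover have "emeasure (count_space UNIV) (\<Xi> \<omega> \<inter> {- c..c}) = of_nat (card (\<Xi> \<omega> \<inter> {- c..c}))"
        using lf[OF w] by (simp add: locally_finite_def emeasure_count_space)
      ultimately show "of_nat (card (\<Xi> \<omega> \<inter> {- c..c})) - emeasure (count_space UNIV) ?B =
          emeasure (count_space UNIV) {y \<in> \<Xi> \<omega>. y \<in> {- c..c} \<and> (y, \<omega>) \<in> space borel \<times> space N - A}"
        by simp
    qed
  next
    case (union A)
    have "(\<lambda>\<omega>. \<Sum>i. emeasure (count_space UNIV) {y \<in> \<Xi> \<omega>. y \<in> {- c..c} \<and> (y, \<omega>) \<in> A i}) \<in> borel_measurable N"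
      using union.IH by measurable
    then show ?case
    proof (rule measurable_cong[THEN iffD1, rotated])
      fix \<omega>
      have "{y \<in> \<Xi> \<omega>. y \<in> {- c..c} \<and> (y, \<omega>) \<in> \<Union> (range A)} = (\<Union>i. {y \<in> \<Xi> \<omega>. y \<in> {- c..c} \<and> (y, \<omega>) \<in> A i})"
        by auto
      moreover have "(\<Sum>i. emeasure (count_space UNIV) {y \<in> \<Xi> \<omega>. y \<in> {- c..c} \<and> (y, \<omega>) \<in> A i}) =
          emeasure (count_space UNIV) (\<Union>i. {y \<in> \<Xi> \<omega>. y \<in> {- c..c} \<and> (y, \<omega>) \<in> A i})"
        using union.hyps(1) by (intro suminf_emeasure) (auto simp: disjoint_family_on_def)
      ultimately show "(\<Sum>i. emeasure (count_space UNIV) {y \<in> \<Xi> \<omega>. y \<in> {- c..c} \<and> (y, \<omega>) \<in> A i}) =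
          emeasure (count_space UNIV) {y \<in> \<Xi> \<omega>. y \<in> {- c..c} \<and> (y, \<omega>) \<in> \<Union> (range A)}"
        by simp
    qed
  qed
qed

lemma count_measurable:
  assumes \<Xi>: "\<Xi> \<in> measurable N config_space" and D: "D \<in> sets (borel \<Otimes>\<^sub>M N)"
  shows "(\<lambda>\<omega>. card {y \<in> \<Xi> \<omega>. y \<in> {- c..c :: real} \<and> (y, \<omega>) \<in> D}) \<in> measurable N (count_space UNIV)"
proof (rule measurable_nat_from_ennreal)
  show "(\<lambda>\<omega>. of_nat (card {y \<in> \<Xi> \<omega>. y \<in> {- c..c} \<and> (y, \<omega>) \<in> D}) :: ennreal) \<in> borel_measurable N"
  proof (rule measurable_cong[THEN iffD1, OF _ count_measurable_aux[OF assms, of c]])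
    fix \<omega> assume "\<omega> \<in> space N"
    then have "finite (\<Xi> \<omega> \<inter> {- c..c})"
      using measurable_space[OF \<Xi>] by (auto simp: space_config_space locally_finite_def)
    then have "finite {y \<in> \<Xi> \<omega>. y \<in> {- c..c} \<and> (y, \<omega>) \<in> D}"
      by (rule finite_subset[rotated]) auto
    then show "emeasure (count_space UNIV) {y \<in> \<Xi> \<omega>. y \<in> {- c..c} \<and> (y, \<omega>) \<in> D} =
        of_nat (card {y \<in> \<Xi> \<omega>. y \<in> {- c..c} \<and> (y, \<omega>) \<in> D})"
      by (simp add: emeasure_count_space)
  qed
qed

text \<open>Joint measurability in the translation and the configuration is what Palm measures need,
  since there a configuration is translated by its own points. The points that land in
  \<open>A\<close> are counted through a region \<open>D\<close> that depends on the
  translation.\<close>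

lemma shift_measurable_pair:
  "(\<lambda>(x, \<xi>). (\<lambda>y. y - x) ` \<xi>) \<in> measurable (borel \<Otimes>\<^sub>M config_space) config_space"
proof (rule measurable_config_spaceI)
  fix p :: "real \<times> real set" assume "p \<in> space (borel \<Otimes>\<^sub>M config_space)"
  then show "locally_finite (case p of (x, \<xi>) \<Rightarrow> (\<lambda>y. y - x) ` \<xi>)"
    using locally_finite_image_add[of "snd p" "- fst p"]
    by (auto simp: space_pair_measure space_config_space case_prod_beta)
next
  fix A :: "real set" assume [measurable]: "A \<in> sets borel" and b: "bounded A"
  then obtain B where B: "\<And>x. x \<in> A \<Longrightarrow> \<bar>x\<bar> \<le> B" by (auto simp: bounded_iff)
  let ?N = "borel \<Otimes>\<^sub>M config_space :: (real \<times> real set) measure"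
  let ?D = "{q \<in> space (borel \<Otimes>\<^sub>M ?N). fst q - fst (snd q) \<in> A}"
  have D: "?D \<in> sets (borel \<Otimes>\<^sub>M ?N)" by measurable
  have 1: "(\<lambda>p. card {y \<in> snd p. y \<in> {- real k..real k} \<and> (y, p) \<in> ?D}) \<in> measurable ?N (count_space UNIV)" for k
    by (rule count_measurable[OF _ D]) simp
  \<comment> \<open>\<open>B\<close> bounds \<open>A\<close>, so every point that is translated into
    \<open>A\<close> lies in a symmetric window of this integer size.\<close>
  have 2: "(\<lambda>p :: real \<times> real set. nat \<lceil>\<bar>fst p\<bar> + B\<rceil>) \<in> measurable ?N (count_space UNIV)"
    by measurable
  have "(\<lambda>p. card {y \<in> snd p. y \<in> {- real (nat \<lceil>\<bar>fst p\<bar> + B\<rceil>)..real (nat \<lceil>\<bar>fst p\<bar> + B\<rceil>)} \<and> (y, p) \<in> ?D}) \<in> measurable ?N (count_space UNIV)"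
    by (rule measurable_compose_countable[OF 1 2])
  then show "(\<lambda>p. card ((case p of (x, \<xi>) \<Rightarrow> (\<lambda>y. y - x) ` \<xi>) \<inter> A)) \<in> measurable ?N (count_space UNIV)"
  proof (rule measurable_cong[THEN iffD1, rotated])
    fix p assume p: "p \<in> space ?N"
    let ?k = "real (nat \<lceil>\<bar>fst p\<bar> + B\<rceil>)"
    have k: "\<bar>fst p\<bar> + B \<le> ?k" by linarith
    have "(case p of (x, \<xi>) \<Rightarrow> (\<lambda>y. y - x) ` \<xi>) \<inter> A = (\<lambda>y. y - fst p) ` {y \<in> snd p. y - fst p \<in> A}"
      by (auto simp: case_prod_beta)
    also have "{y \<in> snd p. y - fst p \<in> A} = {y \<in> snd p. y \<in> {- ?k..?k} \<and> (y, p) \<in> ?D}"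
    proof -
      have "y \<in> {- ?k..?k}" if "y - fst p \<in> A" for y
        using B[OF that] k unfolding atLeastAtMost_iff by linarith
      then show ?thesis using p by (auto simp: space_pair_measure)
    qed
    finally show "card {y \<in> snd p. y \<in> {- ?k..?k} \<and> (y, p) \<in> ?D} = card ((case p of (x, \<xi>) \<Rightarrow> (\<lambda>y. y - x) ` \<xi>) \<inter> A)"
      by (simp add: card_image)
  qed
qed

lemma shift_diff_measurable [measurable]: "(\<lambda>\<xi>. (\<lambda>y. y - x) ` \<xi>) \<in> measurable config_space config_space" for x :: real
  using measurable_compose[OF measurable_Pair1'[of x borel config_space] shift_measurable_pair] by simp

lemma shift_add_measurable [measurable]: "(\<lambda>\<xi>. (\<lambda>y. y + x) ` \<xi>) \<in> measurable config_space config_space" for x :: real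
  using shift_diff_measurable[of "- x"] by simp

lemma mem_config_measurable [measurable]: "Measurable.pred config_space (\<lambda>\<xi>. x \<in> \<xi>)" for x :: real
proof -
  have "Measurable.pred config_space (\<lambda>\<xi>. card (\<xi> \<inter> {x}) = 1)"
    by measurable
  then show ?thesis by (rule measurable_cong[THEN iffD1, rotated]) (auto simp: Int_insert_right)
qed

lemma empty_config_measurable [measurable]: "Measurable.pred config_space (\<lambda>\<xi>. \<xi> = {})"
proof -
  have "Measurable.pred config_space (\<lambda>\<xi>. \<forall>n::nat. card (\<xi> \<inter> {- real n..real n}) = 0)"
    by measurable
  then show ?thesis
  proof (rule measurable_cong[THEN iffD1, rotated])
    fix \<xi> assume "\<xi> \<in> space config_space"
    then have fin: "finite (\<xi> \<inter> {- real n..real n})" for n by (simp add: space_config_space locally_finite_def)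
    have "\<exists>n::nat. x \<in> {- real n..real n}" for x
    proof -
      obtain n :: nat where "\<bar>x\<bar> \<le> real n" using real_arch_simple by blast
      then show ?thesis by (intro exI[of _ n]) auto
    qed
    then show "(\<forall>n::nat. card (\<xi> \<inter> {- real n..real n}) = 0) \<longleftrightarrow> \<xi> = {}"
      using fin by (auto, blast)
  qed
qed

section \<open>Configurations with separated points\<close>

lemma domain_next:
  assumes "locally_finite \<xi>" "x \<in> \<xi>" "y \<in> \<xi>" "x < y"
  shows "\<exists>z\<in>\<xi>. x < z \<and> z \<le> y \<and> (ereal x, ereal z) \<in> domains \<xi>"
proof -
  let ?F = "\<xi> \<inter> {x..y} - {x}"
  have fin: "finite ?F" "?F \<noteq> {}" using assms by (auto simp: locally_finite_def)
  then have m: "Min ?F \<in> ?F" by (rule Min_in)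
  have "\<not> (x < z \<and> z < Min ?F)" if "z \<in> \<xi>" for z
  proof
    assume z: "x < z \<and> z < Min ?F"
    then have "z \<in> ?F" using that m by auto
    then have "Min ?F \<le> z" using fin by (intro Min_le)
    then show False using z by simp
  qed
  then have "(ereal x, ereal (Min ?F)) \<in> domains \<xi>"
    using m assms(2) by (auto simp: domains_def ext_points_def)
  then show ?thesis using m by (intro bexI[of _ "Min ?F"]) (auto simp: less_le)
qed

text \<open>For two points \<open>x < y\<close> the domain starting at \<open>x\<close> is no longer
  than \<open>y - x\<close>. Unbounded domains have infinite length and impose no condition.\<close>

lemma min_configs_iff:
  "\<xi> \<in> min_configs d \<longleftrightarrow> locally_finite \<xi> \<and> (\<forall>x\<in>\<xi>. \<forall>y\<in>\<xi>. x < y \<longrightarrow> d \<le> y - x)"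
proof
  assume \<xi>: "\<xi> \<in> min_configs d"
  then have lf: "locally_finite \<xi>" by (simp add: min_configs_def space_config_space)
  moreover have "d \<le> y - x" if xy: "x \<in> \<xi>" "y \<in> \<xi>" "x < y" for x y
  proof -
    obtain z where z: "z \<in> \<xi>" "z \<le> y" "(ereal x, ereal z) \<in> domains \<xi>"
      using domain_next[OF lf xy] by blast
    then have "ereal d \<le> dom_length (ereal x, ereal z)"
      using \<xi> xy by (auto simp: min_configs_def endpoints_def)
    then show ?thesis using z by (simp add: dom_length_def)
  qed
  ultimately show "locally_finite \<xi> \<and> (\<forall>x\<in>\<xi>. \<forall>y\<in>\<xi>. x < y \<longrightarrow> d \<le> y - x)" by blast
next
  assume *: "locally_finite \<xi> \<and> (\<forall>x\<in>\<xi>. \<forall>y\<in>\<xi>. x < y \<longrightarrow> d \<le> y - x)"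
  then show "\<xi> \<in> min_configs d"
    by (auto simp: min_configs_def space_config_space domains_def ext_points_def dom_length_def)
qed

text \<open>Two points at distance below \<open>d\<close> fit into a rational interval of length
  below \<open>d\<close>, so separation amounts to countably many conditions on counts.\<close>

lemma min_configs_sets [measurable]: "min_configs d \<in> sets config_space"
proof -
  have "min_configs d = {\<xi> \<in> space config_space. \<forall>p q :: rat. of_rat q - of_rat p < d \<longrightarrow> card (\<xi> \<inter> {of_rat p..of_rat q}) \<le> 1}"
  proof (intro set_eqI iffI)
    fix \<xi> assume \<xi>: "\<xi> \<in> min_configs d"
    have "card (\<xi> \<inter> {of_rat p..of_rat q}) \<le> 1" if "of_rat q - of_rat p < d" for p q :: rat
    proof (rule ccontr)
      assume "\<not> ?thesis"
      then have "1 < card (\<xi> \<inter> {of_rat p..of_rat q})" by simp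
      then obtain x y where "x \<in> \<xi> \<inter> {of_rat p..of_rat q}" "y \<in> \<xi> \<inter> {of_rat p..of_rat q}" "x < y"
        by (metis card_le_Suc0_iff_eq One_nat_def card.infinite leD linorder_neqE zero_less_one order_less_imp_not_less)
      then show False using \<xi> that by (fastforce simp: min_configs_iff)
    qed
    then show "\<xi> \<in> {\<xi> \<in> space config_space. \<forall>p q :: rat. of_rat q - of_rat p < d \<longrightarrow> card (\<xi> \<inter> {of_rat p..of_rat q}) \<le> 1}"
      using \<xi> by (auto simp: min_configs_iff space_config_space)
  next
    fix \<xi> assume \<xi>: "\<xi> \<in> {\<xi> \<in> space config_space. \<forall>p q :: rat. of_rat q - of_rat p < d \<longrightarrow> card (\<xi> \<inter> {of_rat p..of_rat q}) \<le> 1}"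
    have "d \<le> y - x" if xy: "x \<in> \<xi>" "y \<in> \<xi>" "x < y" for x y
    proof (rule ccontr)
      assume "\<not> d \<le> y - x"
      \<comment> \<open>Less than half of the deficit is spent on either side, so the rational
        interval remains shorter than \<open>d\<close>.\<close>
      then have e: "0 < (d - (y - x)) / 2" by simp
      obtain p where p: "x - (d - (y - x)) / 2 < of_rat p" "of_rat p < x"
        using of_rat_dense[of "x - (d - (y - x)) / 2" x] e by auto
      obtain q where q: "y < of_rat q" "of_rat q < y + (d - (y - x)) / 2"
        using of_rat_dense[of y "y + (d - (y - x)) / 2"] e by auto
      have "of_rat q - of_rat p < d" using p q by (simp add: field_simps)
      then have "card (\<xi> \<inter> {of_rat p..of_rat q}) \<le> 1" using \<xi> by blast
      moreover have "card {x, y} \<le> card (\<xi> \<inter> {of_rat p..of_rat q})"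
        using \<xi> xy p q by (intro card_mono) (auto simp: space_config_space locally_finite_def)
      ultimately show False using xy by simp
    qed
    then show "\<xi> \<in> min_configs d" using \<xi> by (auto simp: min_configs_iff space_config_space)
  qed
  also have "\<dots> \<in> sets config_space" by measurable auto
  finally show ?thesis .
qed

lemma min_configs_subset: "\<xi> \<in> min_configs d \<Longrightarrow> \<eta> \<subseteq> \<xi> \<Longrightarrow> \<eta> \<in> min_configs d"
  by (auto simp: min_configs_iff intro: locally_finite_subset)

lemma min_configs_shift: "\<xi> \<in> min_configs d \<Longrightarrow> (\<lambda>y. y + a) ` \<xi> \<in> min_configs d"
  by (auto simp: min_configs_iff locally_finite_image_add)

subsection \<open>Enumeration of the domains\<close>

text \<open>Every interval of length at most \<open>dmin\<close> contains at most one point of a configuration in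
  \<open>min_configs dmin\<close>. This allows to enumerate points and domains in a measurable way: a domain is
  numbered by the cell of a grid containing its left endpoint, or by \<open>None\<close> if it is unbounded to
  the left.\<close>

locale grid = fixes dmin :: real assumes dmin_pos: "0 < dmin"
begin

definition cell :: "int \<Rightarrow> real set" where
  "cell i = {of_int i * dmin..<(of_int i + 1) * dmin}"

definition occ :: "int \<Rightarrow> real set \<Rightarrow> bool" where
  "occ i \<xi> \<longleftrightarrow> card (\<xi> \<inter> cell i) \<noteq> 0"

text \<open>A cell is half-open of length \<open>dmin\<close>, so an occupied cell of a
  configuration in \<open>min_configs dmin\<close> holds exactly one point. The value
  \<open>0\<close> for empty cells is arbitrary.\<close>

definition pt :: "int \<Rightarrow> real set \<Rightarrow> real" where
  "pt i \<xi> = (if occ i \<xi> then THE x. x \<in> \<xi> \<inter> cell i else 0)"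

definition lft :: "int option \<Rightarrow> real set \<Rightarrow> ereal" where
  "lft n \<xi> = (case n of None \<Rightarrow> - \<infinity> | Some i \<Rightarrow> ereal (pt i \<xi>))"

text \<open>A countable infimum, hence measurable. By \<open>rgt_mem\<close> it is attained or
  infinite on the configurations of interest.\<close>

definition rgt :: "int option \<Rightarrow> real set \<Rightarrow> ereal" where
  "rgt n \<xi> = (INF j. if occ j \<xi> \<and> lft n \<xi> < ereal (pt j \<xi>) then ereal (pt j \<xi>) else \<infinity>)"

text \<open>The strict inequality matters for \<open>None\<close>: if the configuration is unbounded
  to the left, the infimum is \<open>- \<infinity>\<close> and no domain starts there.\<close>

definition valid :: "int option \<Rightarrow> real set \<Rightarrow> bool" where
  "valid n \<xi> \<longleftrightarrow> (case n of None \<Rightarrow> True | Some i \<Rightarrow> occ i \<xi>) \<and> lft n \<xi> < rgt n \<xi>"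

definition dom :: "int option \<Rightarrow> real set \<Rightarrow> ereal \<times> ereal" where
  "dom n \<xi> = (lft n \<xi>, rgt n \<xi>)"

lemma bounded_cell: "bounded (cell i)"
  by (rule bounded_subset[OF bounded_closed_interval[of "of_int i * dmin" "(of_int i + 1) * dmin"]]) (auto simp: cell_def)

lemma cell_floor: "x \<in> cell \<lfloor>x / dmin\<rfloor>"
proof -
  have "of_int \<lfloor>x / dmin\<rfloor> \<le> x / dmin" "x / dmin < of_int \<lfloor>x / dmin\<rfloor> + 1" by linarith+
  then have "of_int \<lfloor>x / dmin\<rfloor> * dmin \<le> x" "x < (of_int \<lfloor>x / dmin\<rfloor> + 1) * dmin"
    using dmin_pos by (simp_all only: pos_le_divide_eq pos_divide_less_eq)
  then show ?thesis by (simp add: cell_def)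
qed

lemma cell_unique: "x \<in> cell i \<Longrightarrow> i = \<lfloor>x / dmin\<rfloor>"
  using dmin_pos by (intro floor_unique[symmetric]) (auto simp: cell_def field_simps)

context
  fixes \<xi> assumes \<xi>: "\<xi> \<in> min_configs dmin"
begin

lemma lf: "locally_finite \<xi>" using \<xi> by (simp add: min_configs_iff)

lemma occ_iff: "occ i \<xi> \<longleftrightarrow> \<xi> \<inter> cell i \<noteq> {}"
  using locally_finite_bounded[OF lf bounded_cell, of i] by (auto simp: occ_def)

lemma cell_point: "x \<in> \<xi> \<Longrightarrow> x \<in> cell i \<Longrightarrow> occ i \<xi> \<and> pt i \<xi> = x"
proof
  assume x: "x \<in> \<xi>" "x \<in> cell i"
  show o: "occ i \<xi>" using x by (auto simp: occ_iff)
  have "(THE x. x \<in> \<xi> \<inter> cell i) = x"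
  proof (rule the_equality)
    fix y assume y: "y \<in> \<xi> \<inter> cell i"
    show "y = x"
    proof (rule ccontr)
      assume "y \<noteq> x"
      then have "dmin \<le> \<bar>y - x\<bar>" using \<xi> x y by (cases x y rule: linorder_cases) (auto simp: min_configs_iff)
      then show False using x y by (auto simp: cell_def algebra_simps abs_if split: if_splits)
    qed
  qed (use x in auto)
  then show "pt i \<xi> = x" using o by (simp add: pt_def)
qed

lemma pt_mem: "occ i \<xi> \<Longrightarrow> pt i \<xi> \<in> \<xi> \<and> pt i \<xi> \<in> cell i"
  using cell_point by (auto simp: occ_iff)

lemma points_eq: "\<xi> = {pt i \<xi> |i. occ i \<xi>}"
  using pt_mem cell_point[OF _ cell_floor] by force

lemma pt_inj: "occ i \<xi> \<Longrightarrow> occ j \<xi> \<Longrightarrow> pt i \<xi> = pt j \<xi> \<Longrightarrow> i = j"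
  using pt_mem cell_unique by metis

lemma rgt_le: "x \<in> \<xi> \<Longrightarrow> lft n \<xi> < ereal x \<Longrightarrow> rgt n \<xi> \<le> ereal x"
  using cell_point[OF _ cell_floor, of x] unfolding rgt_def
  by (intro INF_lower2[of "\<lfloor>x / dmin\<rfloor>"]) auto

lemma rgt_eq:
  assumes "x' = \<infinity> \<or> x' \<in> ereal ` \<xi>" "lft n \<xi> < x'" "\<And>x. x \<in> \<xi> \<Longrightarrow> lft n \<xi> < ereal x \<Longrightarrow> x' \<le> ereal x"
  shows "rgt n \<xi> = x'"
proof (rule antisym)
  show "rgt n \<xi> \<le> x'" using assms rgt_le by auto
  show "x' \<le> rgt n \<xi>" unfolding rgt_def using assms(3) pt_mem by (intro INF_greatest) auto
qed

text \<open>Local finiteness leaves a positive distance \<open>e\<close> between a real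
  \<open>r\<close> that is not a point and the points above it, so \<open>r\<close> is not an
  infimum of such points.\<close>

lemma rgt_mem:
  assumes "lft n \<xi> < rgt n \<xi>"
  shows "rgt n \<xi> \<in> ext_points \<xi>"
proof (cases "rgt n \<xi>")
  case (real r)
  have "r \<in> \<xi>"
  proof (rule ccontr)
    assume "r \<notin> \<xi>"
    have "\<exists>e>0. \<forall>x\<in>\<xi>. r \<le> x \<longrightarrow> r + e \<le> x"
    proof (cases "\<xi> \<inter> {r..r + 1} = {}")
      case True
      then show ?thesis by (intro exI[of _ 1]) (auto simp: not_le disjoint_iff)
    next
      case False
      let ?F = "\<xi> \<inter> {r..r + 1}"
      have fin: "finite ?F" using lf by (simp add: locally_finite_def)
      have m: "Min ?F \<in> ?F" using fin False by (rule Min_in)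
      have "r < Min ?F" using m \<open>r \<notin> \<xi>\<close> by (auto simp: le_less)
      moreover have "Min ?F \<le> x" if "x \<in> \<xi>" "r \<le> x" for x
        using that fin m by (cases "x \<le> r + 1") (auto intro: Min_le)
      ultimately show ?thesis by (intro exI[of _ "Min ?F - r"]) auto
    qed
    then obtain e where e: "e > 0" "\<And>x. x \<in> \<xi> \<Longrightarrow> r \<le> x \<Longrightarrow> r + e \<le> x" by blast
    have "ereal (r + e) \<le> rgt n \<xi>"
      unfolding rgt_def
    proof (rule INF_greatest)
      fix j
      have "ereal (r + e) \<le> ereal (pt j \<xi>)" if "occ j \<xi>" "lft n \<xi> < ereal (pt j \<xi>)"
        using rgt_le[of "pt j \<xi>" n] pt_mem[OF that(1)] that e(2)[of "pt j \<xi>"] real by auto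
      then show "ereal (r + e) \<le> (if occ j \<xi> \<and> lft n \<xi> < ereal (pt j \<xi>) then ereal (pt j \<xi>) else \<infinity>)" by simp
    qed
    then show False using real e(1) by simp
  qed
  then show ?thesis using real by (simp add: ext_points_def)
next
  case MInf then show ?thesis using assms by (auto simp: ext_points_def)
next
  case PInf then show ?thesis using assms by (auto simp: ext_points_def)
qed

lemma domains_eq: "domains \<xi> = {dom n \<xi> |n. valid n \<xi>}"
proof (intro set_eqI iffI)
  fix \<Delta> assume "\<Delta> \<in> domains \<xi>"
  then obtain x x' where \<Delta>: "\<Delta> = (x, x')" "x \<in> ext_points \<xi>" "x' \<in> ext_points \<xi>" "x < x'"
      "{x<..<x'} \<inter> ext_points \<xi> = {}"
    by (auto simp: domains_def)
  define n where "n = (case x of ereal r \<Rightarrow> Some \<lfloor>r / dmin\<rfloor> | _ \<Rightarrow> None)"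
  have l: "lft n \<xi> = x \<and> (case n of None \<Rightarrow> True | Some i \<Rightarrow> occ i \<xi>)"
  proof (cases x)
    case (real r)
    then have "r \<in> \<xi>" using \<Delta> by (auto simp: ext_points_def)
    then show ?thesis using cell_point[OF _ cell_floor, of r] real by (simp add: n_def lft_def)
  next
    case PInf then show ?thesis using \<Delta> by auto
  next
    case MInf then show ?thesis by (simp add: n_def lft_def)
  qed
  have "rgt n \<xi> = x'"
  proof (rule rgt_eq)
    show "x' = \<infinity> \<or> x' \<in> ereal ` \<xi>" using \<Delta> by (auto simp: ext_points_def)
    show "lft n \<xi> < x'" using l \<Delta> by simp
    fix y assume "y \<in> \<xi>" "lft n \<xi> < ereal y"
    then have "ereal y \<in> ext_points \<xi>" "x < ereal y" using l by (auto simp: ext_points_def)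
    then show "x' \<le> ereal y" using \<Delta>(5) by (meson disjoint_iff greaterThanLessThan_iff not_le)
  qed
  then show "\<Delta> \<in> {dom n \<xi> |n. valid n \<xi>}" using l \<Delta> by (auto simp: dom_def valid_def intro!: exI[of _ n])
next
  fix \<Delta> assume "\<Delta> \<in> {dom n \<xi> |n. valid n \<xi>}"
  then obtain n where n: "\<Delta> = dom n \<xi>" "valid n \<xi>" by blast
  have "lft n \<xi> \<in> ext_points \<xi>"
    using n(2) pt_mem by (auto simp: valid_def lft_def ext_points_def split: option.splits)
  moreover have "z \<notin> ext_points \<xi>" if lr: "lft n \<xi> < z" "z < rgt n \<xi>" for z
  proof
    assume "z \<in> ext_points \<xi>"
    then obtain x where "x \<in> \<xi>" "z = ereal x" using lr by (cases z) (auto simp: ext_points_def)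
    then show False using rgt_le[of x n] lr by simp
  qed
  ultimately show "\<Delta> \<in> domains \<xi>"
    using n rgt_mem[of n] by (auto simp: domains_def dom_def valid_def)
qed

lemma lft_inj: "valid a \<xi> \<Longrightarrow> valid b \<xi> \<Longrightarrow> lft a \<xi> = lft b \<xi> \<Longrightarrow> a = b"
  by (auto simp: valid_def lft_def split: option.splits intro: pt_inj)

text \<open>If \<open>a\<close> starts strictly to the left of \<open>b\<close>, it ends at the
  latest where \<open>b\<close> starts, hence strictly before \<open>b\<close> ends. This includes a
  common right end \<open>\<infinity>\<close>.\<close>

lemma rgt_inj:
  assumes "valid a \<xi>" "valid b \<xi>" "rgt a \<xi> = rgt b \<xi>"
  shows "a = b"
proof -
  have *: "\<not> lft a \<xi> < lft b \<xi>" if "valid a \<xi>" "valid b \<xi>" "rgt a \<xi> = rgt b \<xi>" for a b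
  proof
    assume l: "lft a \<xi> < lft b \<xi>"
    then obtain i where "b = Some i" by (cases b) (auto simp: lft_def)
    then have "rgt a \<xi> \<le> lft b \<xi>"
      using rgt_le[of "pt i \<xi>" a] pt_mem[of i] that l by (auto simp: valid_def lft_def)
    then show False using that by (auto simp: valid_def)
  qed
  show ?thesis using *[of a b] *[of b a] assms by (intro lft_inj) (auto simp: not_less)
qed

end

abbreviation "MC \<equiv> restrict_space config_space (min_configs dmin)"

lemma space_MC: "space MC = min_configs dmin"
  by (auto simp: space_restrict_space min_configs_def)

lemma card_MC [measurable (raw)]:
  "f \<in> measurable N MC \<Longrightarrow> A \<in> sets borel \<Longrightarrow> bounded A \<Longrightarrow> (\<lambda>\<omega>. card (f \<omega> \<inter> A)) \<in> measurable N (count_space UNIV)"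
  by (rule card_measurable'[rotated]) (auto simp: measurable_restrict_space2_iff)

lemma occ_measurable [measurable]: "Measurable.pred MC (occ i)"
proof -
  have [measurable]: "cell i \<in> sets borel" by (simp add: cell_def)
  have [measurable]: "(\<lambda>\<xi>. card (\<xi> \<inter> cell i)) \<in> measurable MC (count_space UNIV)"
    by (rule card_MC) (auto simp: bounded_cell)
  show ?thesis unfolding occ_def by measurable
qed

lemma pt_measurable [measurable]: "pt i \<in> borel_measurable MC"
  unfolding borel_measurable_iff_le
proof
  fix a
  have [measurable]: "(\<lambda>\<xi>. card (\<xi> \<inter> (cell i \<inter> {..a}))) \<in> measurable MC (count_space UNIV)"
    by (rule card_MC) (auto simp: cell_def intro: bounded_subset[OF bounded_cell[unfolded cell_def, of i]])
  have "{\<xi> \<in> space MC. pt i \<xi> \<le> a} =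
      {\<xi> \<in> space MC. occ i \<xi> \<and> card (\<xi> \<inter> (cell i \<inter> {..a})) \<noteq> 0 \<or> \<not> occ i \<xi> \<and> 0 \<le> a}"
  proof (rule Collect_cong, rule conj_cong, rule refl)
    fix \<xi> assume "\<xi> \<in> space MC"
    then have \<xi>: "\<xi> \<in> min_configs dmin" by (simp add: space_MC)
    have fin: "finite (\<xi> \<inter> (cell i \<inter> {..a}))"
      by (rule locally_finite_bounded[OF lf[OF \<xi>]]) (auto intro: bounded_subset[OF bounded_cell])
    show "pt i \<xi> \<le> a \<longleftrightarrow> occ i \<xi> \<and> card (\<xi> \<inter> (cell i \<inter> {..a})) \<noteq> 0 \<or> \<not> occ i \<xi> \<and> 0 \<le> a"
    proof (cases "occ i \<xi>")
      case True
      then have "\<xi> \<inter> (cell i \<inter> {..a}) \<noteq> {} \<longleftrightarrow> pt i \<xi> \<le> a"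
        using pt_mem[OF \<xi> True] cell_point[OF \<xi>] by auto
      then show ?thesis using True fin by simp
    qed (simp add: pt_def)
  qed
  also have "\<dots> \<in> sets MC" by measurable
  finally show "{\<xi> \<in> space MC. pt i \<xi> \<le> a} \<in> sets MC" .
qed

lemma lft_measurable [measurable]: "lft n \<in> borel_measurable MC"
  unfolding lft_def by (cases n) simp_all

lemma rgt_measurable [measurable]: "rgt n \<in> borel_measurable MC"
  unfolding rgt_def by measurable

lemma valid_measurable [measurable]: "Measurable.pred MC (valid n)"
  unfolding valid_def by (cases n) simp_all

text \<open>Covers fixed and random configurations and arbitrary measurable marks at once. The
  process is transported from the domains, whose set varies, to the fixed countable index set of the
  grid, where measurability of the status applies.\<close>

lemma ocp_path_measurable:
  assumes \<Xi> [measurable]: "\<Xi> \<in> measurable N MC"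
    and c: "\<And>n. (\<lambda>\<omega>. if valid n (\<Xi> \<omega>) then m \<omega> (dom n (\<Xi> \<omega>)) else (\<infinity>, True)) \<in> measurable N (borel \<Otimes>\<^sub>M count_space UNIV)"
  shows "(\<lambda>\<omega>. ocp_path (\<Xi> \<omega>) (m \<omega>) t) \<in> measurable N config_space"
proof -
  define c where "c n \<omega> = (if valid n (\<Xi> \<omega>) then m \<omega> (dom n (\<Xi> \<omega>)) else (\<infinity>, True))" for n \<omega>
  have c_m: "c n \<in> measurable N (borel \<Otimes>\<^sub>M count_space UNIV)" for n
    using c unfolding c_def .
  have [measurable]: "Measurable.pred N (\<lambda>\<omega>. snd (c n \<omega>))" for n
    using measurable_snd'[OF c_m[of n]] by simp
  have [measurable]: "(\<lambda>\<omega>. fst (c n \<omega>)) \<in> borel_measurable N" for n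
    using measurable_fst'[OF c_m[of n]] by simp
  have [measurable]: "Measurable.pred N (\<lambda>\<omega>. valid n (\<Xi> \<omega>))" "Measurable.pred N (\<lambda>\<omega>. occ i (\<Xi> \<omega>))"
    "(\<lambda>\<omega>. lft n (\<Xi> \<omega>)) \<in> borel_measurable N" "(\<lambda>\<omega>. rgt n (\<Xi> \<omega>)) \<in> borel_measurable N"
    "(\<lambda>\<omega>. pt i (\<Xi> \<omega>)) \<in> borel_measurable N" for n i
    by (rule measurable_compose[OF \<Xi>], measurable)+
  define v where "v n \<omega> = (if snd (c n \<omega>) then lft n (\<Xi> \<omega>) else rgt n (\<Xi> \<omega>))" for n \<omega>
  have [measurable]: "v n \<in> borel_measurable N" for n unfolding v_def by measurable
  define thr where "thr \<omega> a b \<longleftrightarrow> valid a (\<Xi> \<omega>) \<and> valid b (\<Xi> \<omega>) \<and> fst (c a \<omega>) < fst (c b \<omega>) \<and>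
      (v a \<omega> = lft b (\<Xi> \<omega>) \<or> v a \<omega> = rgt b (\<Xi> \<omega>))" for \<omega> a b
  have mem: "\<Xi> \<omega> \<in> min_configs dmin" if "\<omega> \<in> space N" for \<omega>
    using measurable_space[OF \<Xi> that] by (simp add: space_MC)
  \<comment> \<open>The victim of a threat to \<open>b\<close> is an endpoint of \<open>b\<close>,
    and a given endpoint is the left end of at most one valid domain and the right end of at most
    one.\<close>
  have fin: "finite {a. thr \<omega> a b}" if w: "\<omega> \<in> space N" for \<omega> b
  proof -
    let ?E = "{lft b (\<Xi> \<omega>), rgt b (\<Xi> \<omega>)}"
    have "finite {a. valid a (\<Xi> \<omega>) \<and> lft a (\<Xi> \<omega>) \<in> ?E}"
      by (rule inj_on_finite[of "\<lambda>a. lft a (\<Xi> \<omega>)" _ ?E]) (auto simp: inj_on_def intro: lft_inj[OF mem[OF w]])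
    moreover have "finite {a. valid a (\<Xi> \<omega>) \<and> rgt a (\<Xi> \<omega>) \<in> ?E}"
      by (rule inj_on_finite[of "\<lambda>a. rgt a (\<Xi> \<omega>)" _ ?E]) (auto simp: inj_on_def intro: rgt_inj[OF mem[OF w]])
    moreover have "{a. thr \<omega> a b} \<subseteq> {a. valid a (\<Xi> \<omega>) \<and> lft a (\<Xi> \<omega>) \<in> ?E} \<union> {a. valid a (\<Xi> \<omega>) \<and> rgt a (\<Xi> \<omega>) \<in> ?E}"
      by (auto simp: thr_def v_def split: if_splits)
    ultimately show ?thesis by (meson finite_Un finite_subset)
  qed
  have st [measurable]: "Measurable.pred N (\<lambda>\<omega>. status (thr \<omega>) s n)" for s n
    by (rule pred_status[OF _ fin]) (auto simp: thr_def)
  have st_eq: "status (threatens (\<Xi> \<omega>) (m \<omega>)) s (dom n (\<Xi> \<omega>)) \<longleftrightarrow> status (thr \<omega>) s n"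
    if w: "\<omega> \<in> space N" and "valid n (\<Xi> \<omega>)" for \<omega> s n
  proof (rule status_bisim[where r = "\<lambda>\<Delta> n. valid n (\<Xi> \<omega>) \<and> \<Delta> = dom n (\<Xi> \<omega>)"])
    fix \<Delta> b assume b: "valid b (\<Xi> \<omega>) \<and> \<Delta> = dom b (\<Xi> \<omega>)"
    have "threatens (\<Xi> \<omega>) (m \<omega>) (dom a (\<Xi> \<omega>)) \<Delta> \<longleftrightarrow> thr \<omega> a b" if "valid a (\<Xi> \<omega>)" for a
      using b that unfolding threatens_def thr_def domains_eq[OF mem[OF w]]
      by (auto simp: clock_def victim_def c_def v_def endpoints_def dom_def)
    moreover have "threatens (\<Xi> \<omega>) (m \<omega>) \<Delta>' \<Delta> \<Longrightarrow> \<exists>a. valid a (\<Xi> \<omega>) \<and> \<Delta>' = dom a (\<Xi> \<omega>)" for \<Delta>'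
      unfolding threatens_def domains_eq[OF mem[OF w]] by blast
    moreover have "thr \<omega> a b \<Longrightarrow> valid a (\<Xi> \<omega>)" for a by (simp add: thr_def)
    ultimately show "(\<forall>\<Delta>'. threatens (\<Xi> \<omega>) (m \<omega>) \<Delta>' \<Delta> \<longrightarrow> (\<exists>a. thr \<omega> a b \<and> valid a (\<Xi> \<omega>) \<and> \<Delta>' = dom a (\<Xi> \<omega>))) \<and>
        (\<forall>a. thr \<omega> a b \<longrightarrow> (\<exists>\<Delta>'. threatens (\<Xi> \<omega>) (m \<omega>) \<Delta>' \<Delta> \<and> valid a (\<Xi> \<omega>) \<and> \<Delta>' = dom a (\<Xi> \<omega>)))"
      by metis
  qed (use that in simp)
  define del where "del j \<omega> \<longleftrightarrow> (\<exists>n. valid n (\<Xi> \<omega>) \<and> status (thr \<omega>) True n \<and> fst (c n \<omega>) \<le> t \<and> fst (c n \<omega>) < \<infinity> \<and>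
      v n \<omega> = ereal (pt j (\<Xi> \<omega>)))" for j \<omega>
  have [measurable]: "Measurable.pred N (del j)" for j
    unfolding del_def by measurable
  have path: "ocp_path (\<Xi> \<omega>) (m \<omega>) t = {pt j (\<Xi> \<omega>) |j. occ j (\<Xi> \<omega>) \<and> \<not> del j \<omega>}" if w: "\<omega> \<in> space N" for \<omega>
  proof -
    have "(\<exists>\<Delta>. acts (\<Xi> \<omega>) (m \<omega>) \<Delta> \<and> clock (m \<omega>) \<Delta> \<le> t \<and> clock (m \<omega>) \<Delta> < \<infinity> \<and> victim (m \<omega>) \<Delta> = ereal (pt j (\<Xi> \<omega>))) \<longleftrightarrow> del j \<omega>" for j
    proof -
      have "(\<exists>\<Delta>. acts (\<Xi> \<omega>) (m \<omega>) \<Delta> \<and> clock (m \<omega>) \<Delta> \<le> t \<and> clock (m \<omega>) \<Delta> < \<infinity> \<and> victim (m \<omega>) \<Delta> = ereal (pt j (\<Xi> \<omega>))) \<longleftrightarrow>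
        (\<exists>n. valid n (\<Xi> \<omega>) \<and> status (threatens (\<Xi> \<omega>) (m \<omega>)) True (dom n (\<Xi> \<omega>)) \<and> clock (m \<omega>) (dom n (\<Xi> \<omega>)) \<le> t \<and>
          clock (m \<omega>) (dom n (\<Xi> \<omega>)) < \<infinity> \<and> victim (m \<omega>) (dom n (\<Xi> \<omega>)) = ereal (pt j (\<Xi> \<omega>)))"
        unfolding acts_iff_status domains_eq[OF mem[OF w]] by blast
      also have "\<dots> \<longleftrightarrow> del j \<omega>"
        unfolding del_def using st_eq[OF w, of _ True]
        by (intro ex_cong1 conj_cong refl) (auto simp: clock_def victim_def c_def v_def dom_def)
      finally show ?thesis .
    qed
    then show ?thesis
      unfolding ocp_path_eq by (subst points_eq[OF mem[OF w]]) auto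
  qed
  show ?thesis
  proof (rule measurable_config_spaceI)
    fix \<omega> assume "\<omega> \<in> space N"
    then show "locally_finite (ocp_path (\<Xi> \<omega>) (m \<omega>) t)"
      by (rule locally_finite_subset[OF lf[OF mem] ocp_path_subset])
  next
    fix A :: "real set" assume [measurable]: "A \<in> sets borel" and "bounded A"
    \<comment> \<open>Surviving indices are coded as natural numbers because cardinalities of random
      sets of naturals are known to be measurable.\<close>
    have "(\<lambda>\<omega>. card {k :: nat. \<exists>j. k = to_nat j \<and> occ j (\<Xi> \<omega>) \<and> \<not> del j \<omega> \<and> pt j (\<Xi> \<omega>) \<in> A}) \<in> measurable N (count_space UNIV)"
      by measurable
    then show "(\<lambda>\<omega>. card (ocp_path (\<Xi> \<omega>) (m \<omega>) t \<inter> A)) \<in> measurable N (count_space UNIV)"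
    proof (rule measurable_cong[THEN iffD1, rotated])
      fix \<omega> assume w: "\<omega> \<in> space N"
      let ?J = "{j. occ j (\<Xi> \<omega>) \<and> \<not> del j \<omega> \<and> pt j (\<Xi> \<omega>) \<in> A}"
      have "ocp_path (\<Xi> \<omega>) (m \<omega>) t \<inter> A = (\<lambda>j. pt j (\<Xi> \<omega>)) ` ?J"
        unfolding path[OF w] by auto
      then have "card (ocp_path (\<Xi> \<omega>) (m \<omega>) t \<inter> A) = card ?J"
        using pt_inj[OF mem[OF w]] by (simp add: card_image inj_on_def)
      also have "\<dots> = card (to_nat ` ?J)" by (simp add: card_image inj_on_def)
      also have "to_nat ` ?J = {k :: nat. \<exists>j. k = to_nat j \<and> occ j (\<Xi> \<omega>) \<and> \<not> del j \<omega> \<and> pt j (\<Xi> \<omega>) \<in> A}"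
        by auto
      finally show "card {k :: nat. \<exists>j. k = to_nat j \<and> occ j (\<Xi> \<omega>) \<and> \<not> del j \<omega> \<and> pt j (\<Xi> \<omega>) \<in> A} =
          card (ocp_path (\<Xi> \<omega>) (m \<omega>) t \<inter> A)" by simp
    qed
  qed
qed

end

section \<open>The transition kernel\<close>

abbreviation mark_space :: "mark measure" where
  "mark_space \<equiv> borel \<Otimes>\<^sub>M count_space UNIV"

text \<open>The noise of one domain: a standard exponential variable for the clock and an
  independent uniform variable for the coin. Its law does not involve the length of the
  domain.\<close>

definition W :: "(real \<times> real) measure" where
  "W = density lborel (exponential_density 1) \<Otimes>\<^sub>M uniform_measure lborel {0..1}"

lemma prob_space_uniform01: "prob_space (uniform_measure lborel {0..1::real})"
  by (rule prob_space_uniform_measure) auto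

lemma prob_space_exp1: "prob_space (density lborel (exponential_density 1))"
  by (rule prob_space_exponential_density) simp

lemma prob_space_W: "prob_space W"
proof -
  interpret E: prob_space "density lborel (exponential_density 1)" by (rule prob_space_exp1)
  interpret U: prob_space "uniform_measure lborel {0..1::real}" by (rule prob_space_uniform01)
  interpret P: pair_prob_space "density lborel (exponential_density 1)" "uniform_measure lborel {0..1::real}" ..
  show ?thesis unfolding W_def by (rule P.prob_space_axioms)
qed

lemma sets_W [measurable_cong]: "sets W = sets (borel \<Otimes>\<^sub>M borel)"
  unfolding W_def by (rule sets_pair_measure_cong) auto

lemma exponential_scale:
  assumes r: "0 < r"
  shows "distr (density lborel (exponential_density 1)) borel (\<lambda>e. e / r) = density lborel (exponential_density r)"
proof (rule measure_eqI)
  fix A assume "A \<in> sets (distr (density lborel (exponential_density 1)) borel (\<lambda>e. e / r))"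
  then have [measurable]: "A \<in> sets borel" by simp
  have "emeasure (distr (density lborel (exponential_density 1)) borel (\<lambda>e. e / r)) A =
      (\<integral>\<^sup>+e. indicator A (e / r) \<partial>density lborel (exponential_density 1))"
    by (rule emeasure_distr_indicator) measurable
  also have "\<dots> = (\<integral>\<^sup>+e. ennreal (exponential_density 1 e) * indicator A (e / r) \<partial>lborel)"
    by (subst nn_integral_density) auto
  also have "\<dots> = ennreal \<bar>r\<bar> * (\<integral>\<^sup>+x. ennreal (exponential_density 1 (0 + r * x)) * indicator A ((0 + r * x) / r) \<partial>lborel)"
    using r by (intro nn_integral_real_affine) auto
  also have "\<dots> = (\<integral>\<^sup>+x. ennreal \<bar>r\<bar> * (ennreal (exponential_density 1 (0 + r * x)) * indicator A ((0 + r * x) / r)) \<partial>lborel)"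
    by (rule nn_integral_cmult[symmetric]) measurable
  also have "\<dots> = (\<integral>\<^sup>+x. ennreal (exponential_density r x) * indicator A x \<partial>lborel)"
  proof (rule nn_integral_cong)
    fix x
    have "r * exponential_density 1 (r * x) = exponential_density r x"
      using r by (simp add: exponential_density_def mult_less_0_iff mult.commute)
    then have "ennreal r * ennreal (exponential_density 1 (r * x)) = ennreal (exponential_density r x)"
      using r by (simp flip: ennreal_mult')
    then show "ennreal \<bar>r\<bar> * (ennreal (exponential_density 1 (0 + r * x)) * indicator A ((0 + r * x) / r)) = ennreal (exponential_density r x) * indicator A x"
      using r by (simp flip: mult.assoc)
  qed
  also have "\<dots> = emeasure (density lborel (exponential_density r)) A"
    by (subst emeasure_density) auto
  finally show "emeasure (distr (density lborel (exponential_density 1)) borel (\<lambda>e. e / r)) A =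
      emeasure (density lborel (exponential_density r)) A" .
qed simp

lemma bernoulli_uniform:
  assumes p: "0 \<le> p" "p \<le> 1"
  shows "distr (uniform_measure lborel {0..1::real}) (count_space UNIV) (\<lambda>v. v < p) = measure_pmf (bernoulli_pmf p)"
proof (rule measure_eqI_countable[of _ UNIV])
  interpret U: prob_space "uniform_measure lborel {0..1::real}" by (rule prob_space_uniform01)
  fix b :: bool
  have m [measurable]: "(\<lambda>v::real. v < p) \<in> measurable (uniform_measure lborel {0..1}) (count_space UNIV)"
    by measurable
  have "emeasure (distr (uniform_measure lborel {0..1::real}) (count_space UNIV) (\<lambda>v. v < p)) {b} =
      emeasure (uniform_measure lborel {0..1::real}) (if b then {..<p} else {p..})"
  proof -
    have A: "(\<lambda>v. v < p) -` {b} \<inter> space (uniform_measure lborel {0..1::real}) = (if b then {..<p} else {p..})"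
      by (cases b) (simp_all add: set_eq_iff not_less)
    have B: "emeasure (distr (uniform_measure lborel {0..1::real}) (count_space UNIV) (\<lambda>v. v < p)) {b} =
        emeasure (uniform_measure lborel {0..1::real}) ((\<lambda>v. v < p) -` {b} \<inter> space (uniform_measure lborel {0..1::real}))"
      by (rule emeasure_distr[OF m]) simp
    show ?thesis unfolding B A ..
  qed
  also have "\<dots> = emeasure lborel ({0..1} \<inter> (if b then {..<p} else {p..})) / emeasure lborel {0..1::real}"
    by (rule emeasure_uniform_measure) auto
  also have "{0..1} \<inter> (if b then {..<p} else {p..}) = (if b then {0..<p} else {p..1})"
    using p by auto
  also have "emeasure lborel (if b then {0..<p} else {p..1}) / emeasure lborel {0..1::real} = ennreal (pmf (bernoulli_pmf p) b)"
    using p by (auto simp: divide_ennreal_def)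
  also have "\<dots> = emeasure (measure_pmf (bernoulli_pmf p)) {b}"
    by (simp add: emeasure_pmf_single)
  finally show "emeasure (distr (uniform_measure lborel {0..1::real}) (count_space UNIV) (\<lambda>v. v < p)) {b} =
      emeasure (measure_pmf (bernoulli_pmf p)) {b}" .
qed auto

locale ocp = grid +
  fixes dmax :: real and rl rr :: "ereal \<Rightarrow> real"
  assumes rl_measurable: "rl \<in> borel_measurable (restrict_space borel {ereal dmin..})"
    and rr_measurable: "rr \<in> borel_measurable (restrict_space borel {ereal dmin..})"
    and rl_nonneg: "\<And>d. ereal dmin \<le> d \<Longrightarrow> 0 \<le> rl d"
    and rr_nonneg: "\<And>d. ereal dmin \<le> d \<Longrightarrow> 0 \<le> rr d"
    and rate_pos_iff: "\<And>d. ereal dmin \<le> d \<Longrightarrow> 0 < rl d + rr d \<longleftrightarrow> d \<in> {ereal dmin..<ereal dmax}"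
begin

text \<open>Extension of the rate by zero, measurable on all extended reals and unchanged on the
  lengths from \<open>dmin\<close> on.\<close>

definition rl0 :: "ereal \<Rightarrow> real" where "rl0 d = indicator {ereal dmin..} d * rl d"
definition rr0 :: "ereal \<Rightarrow> real" where "rr0 d = indicator {ereal dmin..} d * rr d"

lemma rl0_measurable [measurable]: "rl0 \<in> borel_measurable borel"
  using rl_measurable unfolding rl0_def by (subst (asm) borel_measurable_restrict_space_iff) auto

lemma rr0_measurable [measurable]: "rr0 \<in> borel_measurable borel"
  using rr_measurable unfolding rr0_def by (subst (asm) borel_measurable_restrict_space_iff) auto

text \<open>Scaling a standard exponential variable produces every positive rate, and comparing a
  uniform variable with the ratio of the rates produces the coin.\<close>

definition hm :: "ereal \<Rightarrow> real \<times> real \<Rightarrow> mark" where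
  "hm d w = (if 0 < rl0 d + rr0 d then ennreal (fst w / (rl0 d + rr0 d)) else \<infinity>,
     snd w < rr0 d / (rl0 d + rr0 d))"

lemma hm_measurable_pair [measurable]: "(\<lambda>p. hm (fst p) (snd p)) \<in> measurable (borel \<Otimes>\<^sub>M W) mark_space"
  unfolding hm_def by measurable

lemma hm_measurable' [measurable (raw)]:
  "f \<in> borel_measurable N \<Longrightarrow> g \<in> measurable N W \<Longrightarrow> (\<lambda>x. hm (f x) (g x)) \<in> measurable N mark_space"
  using measurable_compose[OF measurable_Pair hm_measurable_pair, of f N g] by simp

lemma distr_hm:
  assumes d: "ereal dmin \<le> d"
  shows "distr W mark_space (hm d) = mark_law rl rr d"
proof -
  define r where "r = rl d + rr d"
  have r0: "rl0 d + rr0 d = r" "rr0 d = rr d" using d by (auto simp: rl0_def rr0_def r_def)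
  have r: "0 \<le> r" "rr d \<le> r" using rl_nonneg[OF d] rr_nonneg[OF d] by (auto simp: r_def)
  \<comment> \<open>For \<open>r = 0\<close> the quotient is \<open>0\<close> by convention, the
    same value that \<open>mark_law\<close> uses.\<close>
  have p: "0 \<le> rr d / r" "rr d / r \<le> 1" using r rr_nonneg[OF d] by (auto simp: divide_le_eq_1)
  have clock: "distr (density lborel (exponential_density 1)) borel (\<lambda>e. if 0 < r then ennreal (e / r) else \<infinity>) = clock_law r"
  proof (cases "0 < r")
    case True
    then have "clock_law r = distr (distr (density lborel (exponential_density 1)) borel (\<lambda>e. e / r)) borel ennreal"
      by (simp add: clock_law_def exponential_scale)
    also have "\<dots> = distr (density lborel (exponential_density 1)) borel (\<lambda>e. ennreal (e / r))"
      by (subst distr_distr) (auto simp: comp_def)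
    finally show ?thesis using True by simp
  next
    case False
    interpret E: prob_space "density lborel (exponential_density 1)" by (rule prob_space_exp1)
    show ?thesis using False by (simp add: clock_law_def E.distr_const)
  qed
  have "hm d = (\<lambda>(e, v). (if 0 < r then ennreal (e / r) else \<infinity>, v < rr d / r))"
    by (simp only: fun_eq_iff hm_def r0(1) case_prod_beta) (simp add: r0(2))
  then have "distr W mark_space (hm d) = distr W mark_space (\<lambda>(e, v). (if 0 < r then ennreal (e / r) else \<infinity>, v < rr d / r))"
    by simp
  also have "\<dots> = distr (density lborel (exponential_density 1)) borel (\<lambda>e. if 0 < r then ennreal (e / r) else \<infinity>) \<Otimes>\<^sub>M
      distr (uniform_measure lborel {0..1::real}) (count_space UNIV) (\<lambda>v. v < rr d / r)"
    unfolding W_def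
  proof (rule pair_measure_distr[symmetric])
    show "sigma_finite_measure (distr (uniform_measure lborel {0..1::real}) (count_space UNIV) (\<lambda>v. v < rr d / r))"
      unfolding bernoulli_uniform[OF p] by (rule prob_space_imp_sigma_finite) (rule prob_space_measure_pmf)
  qed measurable
  also have "\<dots> = mark_law rl rr d"
    unfolding bernoulli_uniform[OF p] clock mark_law_def by (simp add: r_def)
  finally show ?thesis .
qed

lemma hm_inert: "ereal dmin \<le> d \<Longrightarrow> \<not> d < ereal dmax \<Longrightarrow> fst (hm d w) = \<infinity>"
  using rate_pos_iff[of d] by (auto simp: hm_def rl0_def rr0_def)

lemma prob_space_mark_law: "ereal dmin \<le> d \<Longrightarrow> prob_space (mark_law rl rr d)"
  unfolding distr_hm[symmetric] by (rule prob_space.prob_space_distr[OF prob_space_W]) measurable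

lemma sets_mark_law [measurable_cong]: "sets (mark_law rl rr d) = sets mark_space"
  unfolding mark_law_def by (rule sets_pair_measure_cong) (auto simp: clock_law_def)

lemma dom_length_ge:
  assumes "\<xi> \<in> min_configs dmin" "\<Delta> \<in> domains \<xi>"
  shows "ereal dmin \<le> dom_length \<Delta>"
proof (cases "endpoints \<Delta> \<inter> ereal ` \<xi> = {}")
  case True
  then have "\<Delta> = (-\<infinity>, \<infinity>)"
    using assms(2) by (auto simp: domains_def endpoints_def ext_points_def)
  then show ?thesis by (simp add: dom_length_def)
next
  case False
  then show ?thesis using assms by (auto simp: min_configs_def)
qed

text \<open>The product measure in \<open>ocp_kernel\<close> lives on functions with a fixed value
  off \<open>domains \<xi>\<close>; the path never reads those values.\<close>

lemma ocp_path_restrict: "ocp_path \<xi> (restrict m (domains \<xi>)) t = ocp_path \<xi> m t"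
proof -
  have "threatens \<xi> (restrict m (domains \<xi>)) = threatens \<xi> m"
    by (auto simp: threatens_def clock_def victim_def fun_eq_iff)
  then show ?thesis
    unfolding ocp_path_eq acts_iff_status by (auto simp: clock_def victim_def)
qed

lemma ocp_path_measurable_fixed:
  assumes \<xi>: "\<xi> \<in> min_configs dmin"
  shows "(\<lambda>m. ocp_path \<xi> m t) \<in> measurable (\<Pi>\<^sub>M \<Delta>\<in>domains \<xi>. mark_space) config_space"
proof (rule ocp_path_measurable)
  show "(\<lambda>_. \<xi>) \<in> measurable (\<Pi>\<^sub>M \<Delta>\<in>domains \<xi>. mark_space) MC"
    using \<xi> by (intro measurable_const) (simp add: space_MC)
  fix n
  show "(\<lambda>m. if valid n \<xi> then m (dom n \<xi>) else (\<infinity>, True)) \<in> measurable (\<Pi>\<^sub>M \<Delta>\<in>domains \<xi>. mark_space) mark_space"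
  proof (cases "valid n \<xi>")
    case True
    then have "dom n \<xi> \<in> domains \<xi>" using domains_eq[OF \<xi>] by blast
    then show ?thesis using True by (simp add: measurable_component_singleton)
  qed simp
qed

text \<open>Distinct labels give independent noise, so the induced marks agree with the product of
  mark laws on finite cylinders. The freedom in \<open>lab\<close> is used for three purposes: grid
  cells for measurability, indices for renewal configurations, domains for translations.\<close>

lemma ocp_kernel_labels:
  fixes lab :: "ereal \<times> ereal \<Rightarrow> 'l"
  assumes \<xi>: "\<xi> \<in> min_configs dmin" and lab: "inj_on lab (domains \<xi>)"
  shows "ocp_kernel rl rr t \<xi> =
    distr (\<Pi>\<^sub>M l\<in>(UNIV :: 'l set). W) config_space (\<lambda>u. ocp_path \<xi> (\<lambda>\<Delta>. hm (dom_length \<Delta>) (u (lab \<Delta>))) t)"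
proof -
  let ?D = "domains \<xi>"
  let ?P = "\<Pi>\<^sub>M l\<in>(UNIV :: 'l set). W"
  let ?M = "\<lambda>\<Delta>. mark_law rl rr (dom_length \<Delta>)"
  let ?f = "\<lambda>u. \<lambda>\<Delta>\<in>?D. hm (dom_length \<Delta>) (u (lab \<Delta>))"
  note ge = dom_length_ge[OF \<xi>]
  interpret WP: product_prob_space "\<lambda>_. W" "UNIV :: 'l set"
    by (intro product_prob_spaceI prob_space_W)
  have sM: "sets (PiM ?D ?M) = sets (\<Pi>\<^sub>M \<Delta>\<in>?D. mark_space)"
    by (rule sets_PiM_cong) (auto simp: sets_mark_law)
  have f [measurable]: "?f \<in> measurable ?P (\<Pi>\<^sub>M \<Delta>\<in>?D. mark_space)"
    by (rule measurable_restrict) measurable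
  have eq: "PiM ?D ?M = distr ?P (\<Pi>\<^sub>M \<Delta>\<in>?D. mark_space) ?f"
  proof (rule measure_eqI_PiM_infinite)
    show "sets (PiM ?D ?M) = sets (PiM ?D ?M)" ..
    show "sets (distr ?P (\<Pi>\<^sub>M \<Delta>\<in>?D. mark_space) ?f) = sets (PiM ?D ?M)" by (simp add: sM)
    show "finite_measure (PiM ?D ?M)"
      by (intro prob_space.finite_measure prob_space_PiM prob_space_mark_law ge)
    fix A and J assume J: "finite J" "J \<subseteq> ?D" and A: "\<And>\<Delta>. \<Delta> \<in> J \<Longrightarrow> A \<Delta> \<in> sets (?M \<Delta>)"
    let ?E = "prod_emb ?D ?M J (Pi\<^sub>E J A)"
    have A' [measurable]: "A \<Delta> \<in> sets mark_space" if "\<Delta> \<in> J" for \<Delta> using A[OF that] by (simp add: sets_mark_law)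
    have "emeasure (PiM ?D ?M) ?E = (\<Prod>\<Delta>\<in>J. emeasure (?M \<Delta>) (A \<Delta>))"
      using J A by (intro emeasure_PiM_emb prob_space_mark_law ge) auto
    also have "\<dots> = (\<Prod>\<Delta>\<in>J. emeasure W (hm (dom_length \<Delta>) -` A \<Delta> \<inter> space W))"
    proof (rule prod.cong)
      fix \<Delta> assume \<Delta>: "\<Delta> \<in> J"
      have "?M \<Delta> = distr W mark_space (hm (dom_length \<Delta>))"
        using distr_hm[OF ge[OF subsetD[OF J(2) \<Delta>]]] by simp
      then show "emeasure (?M \<Delta>) (A \<Delta>) = emeasure W (hm (dom_length \<Delta>) -` A \<Delta> \<inter> space W)"
        using A'[OF \<Delta>] by (simp add: emeasure_distr)
    qed simp
    \<comment> \<open>The factors are reindexed by labels, so that the product becomes the measure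
      of a cylinder for the noise.\<close>
    also have "\<dots> = (\<Prod>l\<in>lab ` J. emeasure W (hm (dom_length (the_inv_into ?D lab l)) -` A (the_inv_into ?D lab l) \<inter> space W))"
    proof -
      have "inj_on lab J" using lab J by (auto intro: inj_on_subset)
      moreover have "the_inv_into ?D lab (lab \<Delta>) = \<Delta>" if "\<Delta> \<in> J" for \<Delta>
        using lab J that by (auto intro: the_inv_into_f_f)
      ultimately show ?thesis by (simp add: prod.reindex)
    qed
    also have "\<dots> = emeasure ?P {u \<in> space ?P. \<forall>l\<in>lab ` J. u l \<in> hm (dom_length (the_inv_into ?D lab l)) -` A (the_inv_into ?D lab l) \<inter> space W}"
    proof (rule WP.emeasure_PiM_Collect[symmetric])
      fix l assume "l \<in> lab ` J"
      then have "the_inv_into ?D lab l \<in> J" using lab J by (auto simp: the_inv_into_f_f subsetD)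
      then have [measurable]: "A (the_inv_into ?D lab l) \<in> sets mark_space" by (rule A')
      show "hm (dom_length (the_inv_into ?D lab l)) -` A (the_inv_into ?D lab l) \<inter> space W \<in> sets W"
        by measurable
    qed (use J in auto)
    also have "{u \<in> space ?P. \<forall>l\<in>lab ` J. u l \<in> hm (dom_length (the_inv_into ?D lab l)) -` A (the_inv_into ?D lab l) \<inter> space W}
        = ?f -` ?E \<inter> space ?P"
      using lab J by (auto simp: prod_emb_def PiE_iff space_PiM the_inv_into_f_f subset_eq mark_law_def space_pair_measure clock_law_def)
    also have "emeasure ?P (?f -` ?E \<inter> space ?P) = emeasure (distr ?P (\<Pi>\<^sub>M \<Delta>\<in>?D. mark_space) ?f) ?E"
      using J A sets_PiM_I[of J ?D A ?M] by (subst emeasure_distr) (auto simp: sM)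
    finally show "emeasure (PiM ?D ?M) ?E = emeasure (distr ?P (\<Pi>\<^sub>M \<Delta>\<in>?D. mark_space) ?f) ?E" .
  qed
  show ?thesis
    unfolding ocp_kernel_def eq
    by (subst distr_distr[OF ocp_path_measurable_fixed[OF \<xi>] f])
      (simp add: comp_def ocp_path_restrict)
qed

text \<open>Numbering the domains by the grid realizes the kernel with randomness that does not depend on
  the configuration.\<close>

definition dom_label :: "ereal \<times> ereal \<Rightarrow> int option" where
  "dom_label \<Delta> = (if fst \<Delta> = -\<infinity> then None else Some \<lfloor>real_of_ereal (fst \<Delta>) / dmin\<rfloor>)"

lemma dom_label_dom: "\<xi> \<in> min_configs dmin \<Longrightarrow> valid n \<xi> \<Longrightarrow> dom_label (dom n \<xi>) = n"
  using cell_unique[OF conjunct2[OF pt_mem]] by (cases n) (auto simp: dom_label_def dom_def lft_def valid_def)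

lemma dom_label_inj: "\<xi> \<in> min_configs dmin \<Longrightarrow> inj_on dom_label (domains \<xi>)"
proof (rule inj_onI)
  fix x y assume \<xi>: "\<xi> \<in> min_configs dmin" and xy: "x \<in> domains \<xi>" "y \<in> domains \<xi>" "dom_label x = dom_label y"
  obtain n k where "x = dom n \<xi>" "valid n \<xi>" "y = dom k \<xi>" "valid k \<xi>"
    using xy(1,2) unfolding domains_eq[OF \<xi>] by blast
  then show "x = y" using xy(3) \<xi> by (simp add: dom_label_dom)
qed

text \<open>With grid labels one probability space serves all configurations, which reduces the
  claim to joint measurability of the path in configuration and noise.\<close>

lemma ocp_kernel_measurable: "ocp_kernel rl rr t \<in> measurable MC (subprob_algebra config_space)"
proof -
  let ?P = "\<Pi>\<^sub>M l\<in>(UNIV :: int option set). W"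
  let ?F = "\<lambda>\<xi> u. ocp_path \<xi> (\<lambda>\<Delta>. hm (dom_length \<Delta>) (u (dom_label \<Delta>))) t"
  have P: "prob_space ?P" by (intro prob_space_PiM prob_space_W)
  have "(\<lambda>p. ?F (fst p) (snd p)) \<in> measurable (MC \<Otimes>\<^sub>M ?P) config_space"
  proof (rule ocp_path_measurable)
    show "fst \<in> measurable (MC \<Otimes>\<^sub>M ?P) MC" by measurable
    fix n
    have [measurable]: "(\<lambda>p. dom_length (dom n (fst p))) \<in> borel_measurable (MC \<Otimes>\<^sub>M ?P)"
      unfolding dom_length_def dom_def by simp
    have "(\<lambda>p. if valid n (fst p) then hm (dom_length (dom n (fst p))) (snd p n) else (\<infinity>, True)) \<in>
        measurable (MC \<Otimes>\<^sub>M ?P) mark_space"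
      by measurable
    \<comment> \<open>The label of a valid domain is its own index, so the noise is only evaluated
      at fixed coordinates.\<close>
    then show "(\<lambda>p. if valid n (fst p) then hm (dom_length (dom n (fst p))) (snd p (dom_label (dom n (fst p)))) else (\<infinity>, True)) \<in>
        measurable (MC \<Otimes>\<^sub>M ?P) mark_space"
      by (rule measurable_cong[THEN iffD1, rotated]) (auto simp: space_pair_measure space_MC dom_label_dom)
  qed
  then have "(\<lambda>\<xi>. distr ?P config_space (?F \<xi>)) \<in> measurable MC (subprob_algebra config_space)"
    using P by (intro measurable_distr2[where M = ?P] measurable_const)
      (auto simp: case_prod_beta space_subprob_algebra prob_space_imp_subprob_space)
  then show ?thesis
    by (rule measurable_cong[THEN iffD1, rotated]) (simp add: space_MC ocp_kernel_labels[OF _ dom_label_inj])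
qed

lemma prob_space_kernel:
  assumes "\<xi> \<in> min_configs dmin"
  shows "prob_space (ocp_kernel rl rr t \<xi>)"
proof -
  interpret D: prob_space "\<Pi>\<^sub>M \<Delta>\<in>domains \<xi>. mark_law rl rr (dom_length \<Delta>)"
    by (intro prob_space_PiM prob_space_mark_law dom_length_ge[OF assms])
  have "sets (\<Pi>\<^sub>M \<Delta>\<in>domains \<xi>. mark_law rl rr (dom_length \<Delta>)) = sets (\<Pi>\<^sub>M \<Delta>\<in>domains \<xi>. mark_space)"
    by (rule sets_PiM_cong) (auto simp: sets_mark_law)
  then show ?thesis unfolding ocp_kernel_def
    by (intro D.prob_space_distr) (subst measurable_cong_sets[OF _ refl], assumption, rule ocp_path_measurable_fixed[OF assms])
qed

lemma sets_kernel_config [simp]: "sets (ocp_kernel rl rr t \<xi>) = sets config_space"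
  and space_kernel_config [simp]: "space (ocp_kernel rl rr t \<xi>) = space config_space"
  by (simp_all add: ocp_kernel_def)

lemma nn_integral_kernel:
  fixes lab :: "ereal \<times> ereal \<Rightarrow> 'l"
  assumes "\<xi> \<in> min_configs dmin" "inj_on lab (domains \<xi>)" "f \<in> borel_measurable config_space"
  shows "(\<integral>\<^sup>+\<eta>. f \<eta> \<partial>ocp_kernel rl rr t \<xi>) =
    (\<integral>\<^sup>+u. f (ocp_path \<xi> (\<lambda>\<Delta>. hm (dom_length \<Delta>) (u (lab \<Delta>))) t) \<partial>(\<Pi>\<^sub>M l\<in>(UNIV :: 'l set). W))"
    and "(\<lambda>u. ocp_path \<xi> (\<lambda>\<Delta>. hm (dom_length \<Delta>) (u (lab \<Delta>))) t) \<in> measurable (\<Pi>\<^sub>M l\<in>(UNIV :: 'l set). W) config_space"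
proof -
  let ?D = "domains \<xi>"
  let ?f = "\<lambda>u. \<lambda>\<Delta>\<in>?D. hm (dom_length \<Delta>) (u (lab \<Delta>))"
  have f: "?f \<in> measurable (\<Pi>\<^sub>M l\<in>(UNIV :: 'l set). W) (\<Pi>\<^sub>M \<Delta>\<in>?D. mark_space)"
    by (rule measurable_restrict) measurable
  show m: "(\<lambda>u. ocp_path \<xi> (\<lambda>\<Delta>. hm (dom_length \<Delta>) (u (lab \<Delta>))) t) \<in> measurable (\<Pi>\<^sub>M l\<in>(UNIV :: 'l set). W) config_space"
    using measurable_compose[OF f ocp_path_measurable_fixed[OF assms(1)]] by (simp add: ocp_path_restrict)
  show "(\<integral>\<^sup>+\<eta>. f \<eta> \<partial>ocp_kernel rl rr t \<xi>) =
    (\<integral>\<^sup>+u. f (ocp_path \<xi> (\<lambda>\<Delta>. hm (dom_length \<Delta>) (u (lab \<Delta>))) t) \<partial>(\<Pi>\<^sub>M l\<in>(UNIV :: 'l set). W))"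
    unfolding ocp_kernel_labels[OF assms(1,2)] using m assms(3) by (simp add: nn_integral_distr)
qed

section \<open>The evolved law\<close>

context
  fixes Q assumes Q: "is_spp_law Q" and min: "AE \<xi> in Q. \<xi> \<in> min_configs dmin"
begin

lemma setsQ [measurable_cong]: "sets Q = sets config_space" using Q by (simp add: is_spp_law_def)
lemma spaceQ: "space Q = space config_space" using setsQ by (rule sets_eq_imp_space_eq)

lemma restrict_Q:
  "space (restrict_space Q (min_configs dmin)) = min_configs dmin"
  "sets (restrict_space Q (min_configs dmin)) = sets MC"
  "space (restrict_space Q (min_configs dmin)) \<noteq> {}"
  "ocp_kernel rl rr t \<in> measurable (restrict_space Q (min_configs dmin)) (subprob_algebra config_space)"
proof -
  show 1: "space (restrict_space Q (min_configs dmin)) = min_configs dmin"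
    by (auto simp: space_restrict_space spaceQ min_configs_def)
  show 2: "sets (restrict_space Q (min_configs dmin)) = sets MC"
    by (rule sets_restrict_space_cong) (rule setsQ)
  have "{} \<in> min_configs dmin" by (simp add: min_configs_iff locally_finite_def)
  then show "space (restrict_space Q (min_configs dmin)) \<noteq> {}" using 1 by (metis empty_iff)
  show "ocp_kernel rl rr t \<in> measurable (restrict_space Q (min_configs dmin)) (subprob_algebra config_space)"
    by (subst measurable_cong_sets[OF 2 refl]) (rule ocp_kernel_measurable)
qed

lemma sets_ocp_law [simp]: "sets (ocp_law dmin rl rr Q t) = sets config_space"
  unfolding ocp_law_def by (rule sets_bind[OF _ restrict_Q(3)]) simp

lemma space_ocp_law [simp]: "space (ocp_law dmin rl rr Q t) = space config_space"
  using sets_ocp_law by (rule sets_eq_imp_space_eq)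

lemma nn_integral_ocp_law:
  assumes [measurable]: "f \<in> borel_measurable config_space"
  shows "(\<integral>\<^sup>+\<eta>. f \<eta> \<partial>ocp_law dmin rl rr Q t) = (\<integral>\<^sup>+\<xi>. (\<integral>\<^sup>+\<eta>. f \<eta> \<partial>ocp_kernel rl rr t \<xi>) * indicator (min_configs dmin) \<xi> \<partial>Q)"
proof -
  have "min_configs dmin \<inter> space Q \<in> sets Q" by measurable
  then show ?thesis
    unfolding ocp_law_def nn_integral_bind[OF assms restrict_Q(4)]
    by (rule nn_integral_restrict_space)
qed

text \<open>The kernel is known to be measurable only on \<open>min_configs dmin\<close>; the
  indicator extends its integrals to all configurations.\<close>

lemma kernel_integral_measurable:
  assumes [measurable]: "f \<in> borel_measurable config_space"
  shows "(\<lambda>\<xi>. (\<integral>\<^sup>+\<eta>. f \<eta> \<partial>ocp_kernel rl rr t \<xi>) * indicator (min_configs dmin) \<xi>) \<in> borel_measurable config_space"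
proof -
  have "(\<lambda>\<xi>. \<integral>\<^sup>+\<eta>. f \<eta> \<partial>ocp_kernel rl rr t \<xi>) \<in> borel_measurable MC"
    by (rule measurable_compose[OF ocp_kernel_measurable nn_integral_measurable_subprob_algebra]) measurable
  then show ?thesis by (subst (asm) borel_measurable_restrict_space_iff_ennreal) auto
qed

lemma nn_integral_ocp_law_AE:
  assumes [measurable]: "f \<in> borel_measurable config_space"
  shows "(\<integral>\<^sup>+\<eta>. f \<eta> \<partial>ocp_law dmin rl rr Q t) = (\<integral>\<^sup>+\<xi>. (\<integral>\<^sup>+\<eta>. f \<eta> \<partial>ocp_kernel rl rr t \<xi>) \<partial>Q)"
  unfolding nn_integral_ocp_law[OF assms]
  by (rule nn_integral_cong_AE) (use min in \<open>auto elim!: eventually_mono\<close>)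

lemma prob_space_ocp_law: "prob_space (ocp_law dmin rl rr Q t)"
proof
  interpret Q: prob_space Q using Q by (simp add: is_spp_law_def)
  have "emeasure (ocp_law dmin rl rr Q t) (space (ocp_law dmin rl rr Q t)) = (\<integral>\<^sup>+\<eta>. 1 \<partial>ocp_law dmin rl rr Q t)"
    by simp
  also have "\<dots> = (\<integral>\<^sup>+\<xi>. (\<integral>\<^sup>+\<eta>. 1 \<partial>ocp_kernel rl rr t \<xi>) \<partial>Q)"
    by (rule nn_integral_ocp_law_AE) simp
  also have "\<dots> = (\<integral>\<^sup>+\<xi>. 1 \<partial>Q)"
    by (rule nn_integral_cong_AE) (use min prob_space.emeasure_space_1[OF prob_space_kernel] in \<open>auto elim!: eventually_mono\<close>)
  also have "\<dots> = 1" by (simp add: Q.emeasure_space_1)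
  finally show "emeasure (ocp_law dmin rl rr Q t) (space (ocp_law dmin rl rr Q t)) = 1" .
qed

lemma is_spp_law_ocp_law: "is_spp_law (ocp_law dmin rl rr Q t)"
  by (simp add: is_spp_law_def prob_space_ocp_law)

end

subsection \<open>Translations\<close>

definition sft :: "real \<Rightarrow> ereal \<times> ereal \<Rightarrow> ereal \<times> ereal" where
  "sft a \<Delta> = (fst \<Delta> + ereal a, snd \<Delta> + ereal a)"

lemma add_ereal_cancel: "x + ereal a + ereal (- a) = x" "x + ereal (- a) + ereal a = x"
  by (cases x; simp)+

lemma add_ereal_eq_iff: "x + ereal a = y + ereal a \<longleftrightarrow> x = y"
  by (metis add_ereal_cancel(1))

lemma sft_inverse [simp]: "sft a (sft (- a) \<Delta>) = \<Delta>" "sft (- a) (sft a \<Delta>) = \<Delta>"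
  by (auto simp: sft_def add_ereal_cancel)

lemma ext_points_shift: "x + ereal a \<in> ext_points ((\<lambda>y. y + a) ` \<xi>) \<longleftrightarrow> x \<in> ext_points \<xi>"
  by (cases x) (auto simp: ext_points_def)

lemma sft_domains: "sft a \<Delta> \<in> domains ((\<lambda>y. y + a) ` \<xi>) \<longleftrightarrow> \<Delta> \<in> domains \<xi>"
proof -
  have lt: "x + ereal a < y + ereal a \<longleftrightarrow> x < y" for x y :: ereal
    by (cases x; cases y) auto
  have "{fst \<Delta> + ereal a<..<snd \<Delta> + ereal a} \<inter> ext_points ((\<lambda>y. y + a) ` \<xi>) = {} \<longleftrightarrow>
      {fst \<Delta><..<snd \<Delta>} \<inter> ext_points \<xi> = {}"
  proof -
    have "z \<in> {fst \<Delta><..<snd \<Delta>} \<inter> ext_points \<xi> \<longleftrightarrow>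
       z + ereal a \<in> {fst \<Delta> + ereal a<..<snd \<Delta> + ereal a} \<inter> ext_points ((\<lambda>y. y + a) ` \<xi>)" for z
      by (simp add: lt ext_points_shift)
    then show ?thesis by (metis add_ereal_cancel(2) all_not_in_conv)
  qed
  then show ?thesis by (cases \<Delta>) (simp add: sft_def domains_def lt ext_points_shift)
qed

lemma ocp_path_shift: "ocp_path ((\<lambda>y. y + a) ` \<xi>) m t = (\<lambda>y. y + a) ` ocp_path \<xi> (m \<circ> sft a) t"
proof -
  have thr: "threatens ((\<lambda>y. y + a) ` \<xi>) m (sft a \<Delta>') (sft a \<Delta>) \<longleftrightarrow> threatens \<xi> (m \<circ> sft a) \<Delta>' \<Delta>" for \<Delta> \<Delta>'
    by (auto simp: threatens_def sft_domains clock_def victim_def endpoints_def)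
      (auto simp: sft_def add_ereal_eq_iff split: if_splits)
  have "status (threatens \<xi> (m \<circ> sft a)) s \<Delta> \<longleftrightarrow> status (threatens ((\<lambda>y. y + a) ` \<xi>) m) s (sft a \<Delta>)" for s \<Delta>
    by (rule status_bisim[where r = "\<lambda>\<Delta> \<Delta>'. \<Delta>' = sft a \<Delta>"]) (use thr sft_inverse in metis)+
  then have acts: "acts ((\<lambda>y. y + a) ` \<xi>) m (sft a \<Delta>) \<longleftrightarrow> acts \<xi> (m \<circ> sft a) \<Delta>" for \<Delta>
    by (simp add: acts_iff_status sft_domains)
  define del where "del z \<longleftrightarrow> (\<exists>\<Delta>. acts ((\<lambda>y. y + a) ` \<xi>) m \<Delta> \<and> clock m \<Delta> \<le> t \<and> clock m \<Delta> < \<infinity> \<and> victim m \<Delta> = ereal z)" for z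
  have "del (x + a) \<longleftrightarrow>
      (\<exists>\<Delta>. acts \<xi> (m \<circ> sft a) \<Delta> \<and> clock (m \<circ> sft a) \<Delta> \<le> t \<and> clock (m \<circ> sft a) \<Delta> < \<infinity> \<and> victim (m \<circ> sft a) \<Delta> = ereal x)" for x
  proof -
    have "victim m (sft a \<Delta>) = ereal (x + a) \<longleftrightarrow> victim (m \<circ> sft a) \<Delta> = ereal x" for \<Delta>
      using add_ereal_eq_iff[of _ a "ereal x"] by (auto simp: victim_def sft_def)
    moreover have "clock m (sft a \<Delta>) = clock (m \<circ> sft a) \<Delta>" for \<Delta> by (simp add: clock_def)
    ultimately have "(acts ((\<lambda>y. y + a) ` \<xi>) m (sft a \<Delta>) \<and> clock m (sft a \<Delta>) \<le> t \<and> clock m (sft a \<Delta>) < \<infinity> \<and> victim m (sft a \<Delta>) = ereal (x + a)) \<longleftrightarrow>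
      (acts \<xi> (m \<circ> sft a) \<Delta> \<and> clock (m \<circ> sft a) \<Delta> \<le> t \<and> clock (m \<circ> sft a) \<Delta> < \<infinity> \<and> victim (m \<circ> sft a) \<Delta> = ereal x)" for \<Delta>
      using acts by simp
    then show ?thesis unfolding del_def by (metis (no_types, lifting) sft_inverse(1))
  qed
  then have "(\<lambda>y. y + a) ` ocp_path \<xi> (m \<circ> sft a) t = {z \<in> (\<lambda>y. y + a) ` \<xi>. \<not> del z}"
    unfolding ocp_path_eq by (auto simp del: split_paired_Ex)
  then show ?thesis unfolding ocp_path_eq del_def by simp
qed

text \<open>The domains of the translate are labelled by the domains they come from. Both
  configurations then use the same noise, and equal lengths give equal marks.\<close>

lemma ocp_kernel_shift:
  assumes \<xi>: "\<xi> \<in> min_configs dmin" and f [measurable]: "f \<in> borel_measurable config_space"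
  shows "(\<integral>\<^sup>+\<eta>. f \<eta> \<partial>ocp_kernel rl rr t ((\<lambda>y. y + a) ` \<xi>)) = (\<integral>\<^sup>+\<eta>. f ((\<lambda>y. y + a) ` \<eta>) \<partial>ocp_kernel rl rr t \<xi>)"
proof -
  have "dom_length (sft a \<Delta>) = dom_length \<Delta>" for \<Delta>
    by (cases "fst \<Delta>"; cases "snd \<Delta>") (auto simp: dom_length_def sft_def)
  then have 1: "(\<lambda>\<Delta>. hm (dom_length \<Delta>) (u (sft (- a) \<Delta>))) \<circ> sft a = (\<lambda>\<Delta>. hm (dom_length \<Delta>) (u \<Delta>))" for u
    by (simp add: comp_def)
  have inj: "inj_on (sft (- a)) A" for A by (metis inj_onI sft_inverse(1))
  have "(\<integral>\<^sup>+\<eta>. f \<eta> \<partial>ocp_kernel rl rr t ((\<lambda>y. y + a) ` \<xi>)) =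
    (\<integral>\<^sup>+u. f (ocp_path ((\<lambda>y. y + a) ` \<xi>) (\<lambda>\<Delta>. hm (dom_length \<Delta>) (u (sft (- a) \<Delta>))) t) \<partial>(\<Pi>\<^sub>M l\<in>(UNIV :: (ereal \<times> ereal) set). W))"
    by (rule nn_integral_kernel[OF min_configs_shift[OF \<xi>] inj f])
  also have "\<dots> = (\<integral>\<^sup>+u. f ((\<lambda>y. y + a) ` ocp_path \<xi> (\<lambda>\<Delta>. hm (dom_length \<Delta>) (u \<Delta>)) t) \<partial>(\<Pi>\<^sub>M l\<in>(UNIV :: (ereal \<times> ereal) set). W))"
    unfolding ocp_path_shift 1 ..
  also have "\<dots> = (\<integral>\<^sup>+\<eta>. f ((\<lambda>y. y + a) ` \<eta>) \<partial>ocp_kernel rl rr t \<xi>)"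
    by (rule nn_integral_kernel(1)[OF \<xi> inj_on_id2, symmetric]) measurable
  finally show ?thesis .
qed

text \<open>The kernel commutes with translations and \<open>min_configs dmin\<close> is translation
  invariant, so the translation moves from the evolved to the initial configuration.\<close>

lemma invariant_ocp_law:
  assumes Q: "is_spp_law Q" "AE \<xi> in Q. \<xi> \<in> min_configs dmin" and inv: "invariant_under a Q"
  shows "invariant_under a (ocp_law dmin rl rr Q t)"
  unfolding invariant_under_def
proof (rule measure_eqI)
  note [measurable_cong] = setsQ[OF Q] sets_ocp_law[OF Q]
  let ?Qt = "ocp_law dmin rl rr Q t" and ?s = "\<lambda>\<xi>. (\<lambda>y. y + a) ` \<xi>"
  have inv': "distr Q Q ?s = Q"
    using inv unfolding invariant_under_def by (subst distr_cong[OF refl setsQ[OF Q] refl])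
  show "sets (distr ?Qt config_space ?s) = sets ?Qt" by (simp add: sets_ocp_law[OF Q])
  fix A assume "A \<in> sets (distr ?Qt config_space ?s)"
  then have [measurable]: "A \<in> sets config_space" by simp
  have "emeasure (distr ?Qt config_space ?s) A = (\<integral>\<^sup>+\<eta>. indicator A (?s \<eta>) \<partial>?Qt)"
    by (rule emeasure_distr_indicator) (simp_all add: measurable_cong_sets[OF sets_ocp_law[OF Q] refl])
  also have "\<dots> = (\<integral>\<^sup>+\<xi>. (\<integral>\<^sup>+\<eta>. indicator A (?s \<eta>) \<partial>ocp_kernel rl rr t \<xi>) * indicator (min_configs dmin) \<xi> \<partial>Q)"
    by (rule nn_integral_ocp_law[OF Q]) measurable
  also have "\<dots> = (\<integral>\<^sup>+\<xi>. (\<integral>\<^sup>+\<eta>. indicator A \<eta> \<partial>ocp_kernel rl rr t (?s \<xi>)) * indicator (min_configs dmin) (?s \<xi>) \<partial>Q)"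
  proof (rule nn_integral_cong)
    fix \<xi>
    have "?s \<xi> \<in> min_configs dmin \<longleftrightarrow> \<xi> \<in> min_configs dmin"
      using min_configs_shift[of \<xi> dmin a] min_configs_shift[of "?s \<xi>" dmin "- a"] by (auto simp: image_image)
    then show "(\<integral>\<^sup>+\<eta>. indicator A (?s \<eta>) \<partial>ocp_kernel rl rr t \<xi>) * indicator (min_configs dmin) \<xi> =
        (\<integral>\<^sup>+\<eta>. indicator A \<eta> \<partial>ocp_kernel rl rr t (?s \<xi>)) * indicator (min_configs dmin) (?s \<xi>)"
      using ocp_kernel_shift[of \<xi> "indicator A" t a] by (auto simp: indicator_def)
  qed
  also have "\<dots> = (\<integral>\<^sup>+\<xi>. (\<integral>\<^sup>+\<eta>. indicator A \<eta> \<partial>ocp_kernel rl rr t \<xi>) * indicator (min_configs dmin) \<xi> \<partial>distr Q Q ?s)"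
  proof (rule nn_integral_distr[symmetric])
    show "?s \<in> measurable Q Q"
      unfolding measurable_cong_sets[OF setsQ[OF Q] setsQ[OF Q]] by (rule shift_add_measurable)
    show "(\<lambda>\<xi>. (\<integral>\<^sup>+\<eta>. indicator A \<eta> \<partial>ocp_kernel rl rr t \<xi>) * indicator (min_configs dmin) \<xi>) \<in> borel_measurable (distr Q Q ?s)"
      unfolding measurable_distr_eq1 measurable_cong_sets[OF setsQ[OF Q] refl] by (rule kernel_integral_measurable[OF Q]) measurable
  qed
  also have "\<dots> = (\<integral>\<^sup>+\<eta>. indicator A \<eta> \<partial>?Qt)"
    unfolding inv' by (rule nn_integral_ocp_law[OF Q, symmetric]) measurable
  also have "\<dots> = emeasure ?Qt A" by (rule nn_integral_indicator) (simp add: sets_ocp_law[OF Q])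
  finally show "emeasure (distr ?Qt config_space ?s) A = emeasure ?Qt A" .
qed

end

section \<open>Labelled configurations\<close>

lemma strict_mono_int: "(\<And>k. x k < x (k + 1)) \<Longrightarrow> strict_mono (x :: int \<Rightarrow> real)"
proof (rule strict_monoI)
  fix i j :: int assume *: "\<And>k. x k < x (k + 1)" and "i < j"
  from \<open>i < j\<close> show "x i < x j"
  proof (induction j rule: int_gr_induct)
    case base show ?case by (rule *)
  next
    case (step j) then show ?case using *[of j] by simp
  qed
qed

text \<open>The relation \<open>x k \<le> a\<close> for a labelling \<open>x\<close>, expressed by
  counts. For \<open>k \<ge> 1\<close> the interval from \<open>0\<close> to \<open>a\<close> must
  hold at least \<open>k\<close> points; for \<open>k \<le> 0\<close> the points above
  \<open>a\<close> and up to \<open>0\<close> must be among the numbers \<open>k + 1\<close> to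
  \<open>0\<close>, of which there are \<open>- k\<close>.\<close>

definition point_le :: "int \<Rightarrow> real \<Rightarrow> real set \<Rightarrow> bool" where
  "point_le k a \<xi> \<longleftrightarrow>
     (if 1 \<le> k then 0 < a \<and> k \<le> int (card (\<xi> \<inter> {0<..a})) else 0 \<le> a \<or> int (card (\<xi> \<inter> {a<..0})) \<le> - k)"

lemma point_le:
  assumes x: "is_labelling \<xi> x" and lf: "locally_finite \<xi>"
  shows "point_le k a \<xi> \<longleftrightarrow> x k \<le> a"
proof -
  have sm: "strict_mono x" and rg: "range x = \<xi>" and 0: "x 0 \<le> 0" "0 < x 1"
    using x by (auto simp: is_labelling_def)
  have le: "x i \<le> x j \<longleftrightarrow> i \<le> j" "x i < x j \<longleftrightarrow> i < j" for i j
    using sm by (auto simp: strict_mono_less_eq strict_mono_less)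
  have inj: "inj_on x A" for A using sm by (meson inj_on_subset strict_mono_imp_inj_on subset_UNIV)
  have fin: "finite (\<xi> \<inter> {b<..c})" for b c
    by (rule locally_finite_bounded[OF lf]) auto
  have pos: "0 < x i \<longleftrightarrow> 1 \<le> i" for i
  proof
    assume "0 < x i" show "1 \<le> i"
    proof (rule ccontr)
      assume "\<not> 1 \<le> i" then have "x i \<le> x 0" by (simp add: le)
      then show False using 0 \<open>0 < x i\<close> by simp
    qed
  next
    assume "1 \<le> i" then have "x 1 \<le> x i" by (simp add: le)
    then show "0 < x i" using 0 by simp
  qed
  show ?thesis
  proof (cases "1 \<le> k")
    case True
    have "k \<le> int (card (\<xi> \<inter> {0<..a})) \<longleftrightarrow> x k \<le> a"
    proof
      assume k: "k \<le> int (card (\<xi> \<inter> {0<..a}))"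
      show "x k \<le> a"
      proof (rule ccontr)
        assume "\<not> x k \<le> a"
        then have "x i \<le> a \<Longrightarrow> i < k" for i using le(2)[of i k] by auto
        then have "\<xi> \<inter> {0<..a} \<subseteq> x ` {1..k - 1}" using rg pos by fastforce
        then have "card (\<xi> \<inter> {0<..a}) \<le> card (x ` {1..k - 1})" by (intro card_mono) auto
        then show False using k True by (simp add: card_image[OF inj])
      qed
    next
      assume "x k \<le> a"
      then have "x i \<le> a" if "i \<le> k" for i using le(1)[of i k] that by simp
      then have "x ` {1..k} \<subseteq> \<xi> \<inter> {0<..a}" using rg pos by auto
      then have "card (x ` {1..k}) \<le> card (\<xi> \<inter> {0<..a})" by (intro card_mono fin)
      then show "k \<le> int (card (\<xi> \<inter> {0<..a}))" using True by (simp add: card_image[OF inj])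
    qed
    moreover have "x k \<le> a \<Longrightarrow> 0 < a" using pos[of k] True by simp
    ultimately show ?thesis using True by (auto simp: point_le_def)
  next
    case False
    then have xk: "x k \<le> 0" using pos[of k] by simp
    have *: "int (card (\<xi> \<inter> {a<..0})) \<le> - k \<longleftrightarrow> x k \<le> a" if "a < 0"
    proof
      assume k: "int (card (\<xi> \<inter> {a<..0})) \<le> - k"
      show "x k \<le> a"
      proof (rule ccontr)
        assume "\<not> x k \<le> a"
        then have "x ` {k..0} \<subseteq> \<xi> \<inter> {a<..0}" using rg pos le(1)[of k] by (fastforce simp: not_less[symmetric])
        then have "card (x ` {k..0}) \<le> card (\<xi> \<inter> {a<..0})" by (intro card_mono fin)
        then show False using k False by (simp add: card_image[OF inj])
      qed
    next
      assume a: "x k \<le> a"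
      have "x i > a \<Longrightarrow> k < i" for i using a le(1)[of i k] by (auto simp: not_less[symmetric])
      then have "\<xi> \<inter> {a<..0} \<subseteq> x ` {k + 1..0}" using rg pos by (fastforce simp: not_less[symmetric])
      then have "card (\<xi> \<inter> {a<..0}) \<le> card (x ` {k + 1..0})" by (intro card_mono) auto
      then show "int (card (\<xi> \<inter> {a<..0})) \<le> - k" using False by (simp add: card_image[OF inj])
    qed
    show ?thesis
    proof (cases "a < 0")
      case True then show ?thesis using False * by (simp add: point_le_def)
    next
      case a: False then show ?thesis using False xk by (simp add: point_le_def)
    qed
  qed
qed

text \<open>By \<open>point_le\<close> the configuration alone decides which \<open>a\<close> lie
  above the \<open>k\<close>-th point, so the labelling is unique.\<close>

lemma point_eq:
  assumes "is_labelling \<xi> x" "locally_finite \<xi>"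
  shows "point \<xi> = x"
  unfolding point_def
proof (rule the_equality)
  fix x' assume x': "is_labelling \<xi> x'"
  show "x' = x"
    using point_le[OF x' assms(2)] point_le[OF assms] by (metis antisym order_refl ext)
qed (rule assms)

text \<open>A measurable substitute for \<open>point\<close>, which is a definite description: an
  infimum over rational thresholds that is correct whenever a labelling exists.\<close>

definition point_approx :: "int \<Rightarrow> real set \<Rightarrow> real" where
  "point_approx k \<xi> = real_of_ereal (INF q :: rat. if point_le k (of_rat q) \<xi> then ereal (of_rat q) else \<infinity>)"

lemma point_approx:
  assumes "is_labelling \<xi> x" "locally_finite \<xi>"
  shows "point_approx k \<xi> = x k"
proof -
  have "(INF q :: rat. if point_le k (of_rat q) \<xi> then ereal (of_rat q) else \<infinity>) = ereal (x k)"
  proof (rule antisym)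
    show "ereal (x k) \<le> (INF q :: rat. if point_le k (of_rat q) \<xi> then ereal (of_rat q) else \<infinity>)"
      by (intro INF_greatest) (auto simp: point_le[OF assms])
    show "(INF q :: rat. if point_le k (of_rat q) \<xi> then ereal (of_rat q) else \<infinity>) \<le> ereal (x k)"
    proof (rule ereal_le_epsilon2)
      fix e :: real assume "0 < e"
      then obtain q where q: "x k < of_rat q" "of_rat q < x k + e"
        using of_rat_dense[of "x k" "x k + e"] by auto
      then have "(INF q :: rat. if point_le k (of_rat q) \<xi> then ereal (of_rat q) else \<infinity>) \<le> ereal (of_rat q)"
        by (intro INF_lower2[of q]) (auto simp: point_le[OF assms])
      also have "\<dots> \<le> ereal (x k) + ereal e" using q by simp
      finally show "(INF q :: rat. if point_le k (of_rat q) \<xi> then ereal (of_rat q) else \<infinity>) \<le> ereal (x k) + ereal e" .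
    qed
  qed
  then show ?thesis by (simp add: point_approx_def)
qed

lemma point_approx_measurable [measurable]: "point_approx k \<in> borel_measurable config_space"
proof -
  have [measurable]: "Measurable.pred config_space (point_le k a)" for a
  proof -
    have card: "Measurable.pred config_space (\<lambda>\<xi>. P (card (\<xi> \<inter> {b<..c})))" for b c :: real and P
      by (rule measurable_compose[OF card_measurable]) auto
    show ?thesis
    proof (cases "1 \<le> k")
      case True
      then have "point_le k a = (\<lambda>\<xi>. 0 < a \<and> k \<le> int (card (\<xi> \<inter> {0<..a})))"
        by (auto simp: fun_eq_iff point_le_def)
      then show ?thesis using card[of "\<lambda>n. 0 < a \<and> k \<le> int n" 0 a] by (simp only:)
    next
      case False
      then have "point_le k a = (\<lambda>\<xi>. 0 \<le> a \<or> int (card (\<xi> \<inter> {a<..0})) \<le> - k)"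
        by (auto simp: fun_eq_iff point_le_def)
      then show ?thesis using card[of "\<lambda>n. 0 \<le> a \<or> int n \<le> - k" a 0] by (simp only:)
    qed
  qed
  have "(\<lambda>\<xi>. if point_le k (of_rat q) \<xi> then ereal (of_rat q) else \<infinity>) \<in> borel_measurable config_space" for q
    using \<open>\<And>a. Measurable.pred config_space (point_le k a)\<close>[of "of_rat q"]
    by (intro measurable_If measurable_const) (simp_all add: pred_def)
  then show ?thesis unfolding point_approx_def
    by (intro borel_measurable_real_of_ereal borel_measurable_INF) auto
qed

lemma pred_nat_eq:
  fixes f g :: "'a \<Rightarrow> nat"
  shows "f \<in> measurable N (count_space UNIV) \<Longrightarrow> g \<in> measurable N (count_space UNIV) \<Longrightarrow> Measurable.pred N (\<lambda>x. f x = g x)"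
proof -
  assume [measurable]: "f \<in> measurable N (count_space UNIV)" "g \<in> measurable N (count_space UNIV)"
  have "Measurable.pred N (\<lambda>x. \<exists>n. f x = n \<and> g x = n)" by measurable
  then show ?thesis by (rule measurable_cong[THEN iffD1, rotated]) auto
qed

definition labelled :: "real set \<Rightarrow> bool" where
  "labelled \<xi> \<longleftrightarrow> (\<exists>x. is_labelling \<xi> x)"

text \<open>The existential over labellings is removed by testing the only candidate,
  \<open>point_approx\<close>: it must increase, be normalised at the origin, consist of points of
  \<open>\<xi>\<close>, and exhaust \<open>\<xi>\<close>. Exhaustion is tested by comparing counts
  in all windows.\<close>

lemma labelled_measurable [measurable]: "Measurable.pred config_space labelled"
proof -
  let ?p = "\<lambda>\<xi> k. point_approx k \<xi>"
  have D: "{q \<in> space (borel \<Otimes>\<^sub>M config_space). fst q = point_approx k (snd q)} \<in> sets (borel \<Otimes>\<^sub>M config_space)" for k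
    by measurable
  have [measurable]: "Measurable.pred config_space (\<lambda>\<xi>. ?p \<xi> k \<in> \<xi>)" for k
  proof -
    have "(\<lambda>\<xi>. card {y \<in> \<xi>. y \<in> {- real n..real n} \<and> (y, \<xi>) \<in> {q \<in> space (borel \<Otimes>\<^sub>M config_space). fst q = point_approx k (snd q)}})
        \<in> measurable config_space (count_space UNIV)" for n
      by (rule count_measurable[OF _ D]) simp
    note this[measurable]
    have "Measurable.pred config_space (\<lambda>\<xi>. \<exists>n. card {y \<in> \<xi>. y \<in> {- real n..real n} \<and> (y, \<xi>) \<in> {q \<in> space (borel \<Otimes>\<^sub>M config_space). fst q = point_approx k (snd q)}} = 1)"
      by measurable
    then show ?thesis
    proof (rule measurable_cong[THEN iffD1, rotated])
      fix \<xi> :: "real set" assume \<xi>: "\<xi> \<in> space config_space"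
      obtain n :: nat where n: "\<bar>?p \<xi> k\<bar> \<le> real n" using real_arch_simple by blast
      have "{y \<in> \<xi>. y \<in> {- real n..real n} \<and> (y, \<xi>) \<in> {q \<in> space (borel \<Otimes>\<^sub>M config_space). fst q = point_approx k (snd q)}} =
          (if ?p \<xi> k \<in> \<xi> \<and> \<bar>?p \<xi> k\<bar> \<le> real n then {?p \<xi> k} else {})" for n
        using \<xi> by (auto simp: space_pair_measure)
      then show "(\<exists>n. card {y \<in> \<xi>. y \<in> {- real n..real n} \<and> (y, \<xi>) \<in> {q \<in> space (borel \<Otimes>\<^sub>M config_space). fst q = point_approx k (snd q)}} = 1)
          \<longleftrightarrow> ?p \<xi> k \<in> \<xi>"
        using n by auto
    qed
  qed
  have "Measurable.pred config_space (\<lambda>\<xi>. (\<forall>k. ?p \<xi> k < ?p \<xi> (k + 1)) \<and> ?p \<xi> 0 \<le> 0 \<and> 0 < ?p \<xi> 1 \<and> (\<forall>k. ?p \<xi> k \<in> \<xi>) \<and>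
      (\<forall>n::nat. card (\<xi> \<inter> {- real n..real n}) = card {j :: nat. \<exists>k :: int. j = to_nat k \<and> ?p \<xi> k \<in> {- real n..real n}}))"
  proof -
    have [measurable]: "(\<lambda>\<xi>. card (\<xi> \<inter> {- real n..real n})) \<in> measurable config_space (count_space UNIV)" for n
      by (rule card_measurable) auto
    have [measurable]: "(\<lambda>\<xi>. card {j :: nat. \<exists>k :: int. j = to_nat k \<and> ?p \<xi> k \<in> {- real n..real n}}) \<in> measurable config_space (count_space UNIV)" for n
      by measurable
    have [measurable]: "Measurable.pred config_space (\<lambda>\<xi>. card (\<xi> \<inter> {- real n..real n}) = card {j :: nat. \<exists>k :: int. j = to_nat k \<and> ?p \<xi> k \<in> {- real n..real n}})" for n
      by (rule pred_nat_eq) measurable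
    have [measurable]: "Measurable.pred config_space (\<lambda>\<xi>. ?p \<xi> k < ?p \<xi> (k + 1))" for k
      by measurable
    show ?thesis by measurable
  qed
  then show ?thesis
  proof (rule measurable_cong[THEN iffD1, rotated])
    fix \<xi> :: "real set" assume "\<xi> \<in> space config_space"
    then have lf: "locally_finite \<xi>" by (simp add: space_config_space)
    have card_eq: "card {j :: nat. \<exists>k :: int. j = to_nat k \<and> ?p \<xi> k \<in> {- real n..real n}} = card (?p \<xi> ` {k. ?p \<xi> k \<in> {- real n..real n}})"
      if "strict_mono (?p \<xi>)" for n
    proof -
      have "{j :: nat. \<exists>k :: int. j = to_nat k \<and> ?p \<xi> k \<in> {- real n..real n}} = to_nat ` {k. ?p \<xi> k \<in> {- real n..real n}}"
        by auto
      moreover have "inj_on (?p \<xi>) A" for A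
        using that by (meson inj_on_subset strict_mono_imp_inj_on subset_UNIV)
      ultimately show ?thesis by (simp add: card_image)
    qed
    have sm: "strict_mono (?p \<xi>) \<longleftrightarrow> (\<forall>k. ?p \<xi> k < ?p \<xi> (k + 1))"
    proof
      assume "\<forall>k. ?p \<xi> k < ?p \<xi> (k + 1)"
      then show "strict_mono (?p \<xi>)" by (intro strict_mono_int) auto
    qed (auto simp: strict_mono_def)
    show "((\<forall>k. ?p \<xi> k < ?p \<xi> (k + 1)) \<and> ?p \<xi> 0 \<le> 0 \<and> 0 < ?p \<xi> 1 \<and> (\<forall>k. ?p \<xi> k \<in> \<xi>) \<and>
      (\<forall>n::nat. card (\<xi> \<inter> {- real n..real n}) = card {j :: nat. \<exists>k :: int. j = to_nat k \<and> ?p \<xi> k \<in> {- real n..real n}}))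
      \<longleftrightarrow> labelled \<xi>" (is "?L \<longleftrightarrow> _")
    proof
      assume L: ?L
      then have s: "strict_mono (?p \<xi>)" using sm by blast
      have "y \<in> range (?p \<xi>)" if "y \<in> \<xi>" for y
      proof -
        obtain n :: nat where n: "\<bar>y\<bar> \<le> real n" using real_arch_simple by blast
        have "?p \<xi> ` {k. ?p \<xi> k \<in> {- real n..real n}} = \<xi> \<inter> {- real n..real n}"
        proof (rule card_subset_eq)
          show "finite (\<xi> \<inter> {- real n..real n})" using lf by (simp add: locally_finite_def)
          show "?p \<xi> ` {k. ?p \<xi> k \<in> {- real n..real n}} \<subseteq> \<xi> \<inter> {- real n..real n}" using L by auto
          show "card (?p \<xi> ` {k. ?p \<xi> k \<in> {- real n..real n}}) = card (\<xi> \<inter> {- real n..real n})"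
            using L card_eq[OF s] by simp
        qed
        moreover have "y \<in> \<xi> \<inter> {- real n..real n}" using that n by auto
        ultimately show ?thesis by blast
      qed
      then have "range (?p \<xi>) = \<xi>" using L by auto
      then show "labelled \<xi>" using L s unfolding labelled_def is_labelling_def by blast
    next
      assume "labelled \<xi>"
      then obtain x where x: "is_labelling \<xi> x" by (auto simp: labelled_def)
      have p: "?p \<xi> k = x k" for k using point_approx[OF x lf] .
      have s: "strict_mono (?p \<xi>)" unfolding p using x by (simp add: is_labelling_def)
      have "\<xi> \<inter> {- real n..real n} = ?p \<xi> ` {k. ?p \<xi> k \<in> {- real n..real n}}" for n
        unfolding p using x by (auto simp: is_labelling_def)
      then show ?L using x s sm card_eq[OF s] unfolding p by (auto simp: is_labelling_def)
    qed
  qed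
qed

lemma gap_measurable [measurable]: "gap k \<in> borel_measurable config_space"
proof -
  \<comment> \<open>Without a labelling \<open>point \<xi>\<close> is the description of an empty
    predicate: unknown, but the same for all such \<open>\<xi>\<close>.\<close>
  have "(\<lambda>\<xi>. if labelled \<xi> then point_approx k \<xi> - point_approx (k - 1) \<xi>
      else The (\<lambda>_. False) k - The (\<lambda>_. False) (k - 1)) \<in> borel_measurable config_space"
    by measurable
  then show ?thesis
  proof (rule measurable_cong[THEN iffD1, rotated])
    fix \<xi> assume "\<xi> \<in> space config_space"
    then have lf: "locally_finite \<xi>" by (simp add: space_config_space)
    show "(if labelled \<xi> then point_approx k \<xi> - point_approx (k - 1) \<xi>
      else The (\<lambda>_. False) k - The (\<lambda>_. False) (k - 1)) = gap k \<xi>"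
    proof (cases "labelled \<xi>")
      case True
      then obtain x where x: "is_labelling \<xi> x" by (auto simp: labelled_def)
      then show ?thesis using True by (simp add: gap_def point_eq[OF x lf] point_approx[OF x lf])
    next
      case False
      then have "is_labelling \<xi> = (\<lambda>_. False)" by (auto simp: labelled_def)
      then show ?thesis using False by (simp add: gap_def point_def)
    qed
  qed
qed

section \<open>Configurations assembled from two sequences of gaps\<close>

definition comb :: "(nat \<Rightarrow> 'b) \<Rightarrow> (nat \<Rightarrow> 'b) \<Rightarrow> int \<Rightarrow> 'b" where
  "comb a b k = (if 1 \<le> k then a (nat (k - 1)) else b (nat (- k)))"

text \<open>Positions when one point sits at the origin and \<open>a\<close>, \<open>b\<close> are
  the gaps to its right and left, counted outwards. Gap \<open>k\<close> lies between the points
  \<open>k - 1\<close> and \<open>k\<close>, so \<open>b 0\<close> is gap \<open>0\<close>; this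
  explains the offsets in \<open>comb\<close>.\<close>

definition pos2 :: "(nat \<Rightarrow> real) \<Rightarrow> (nat \<Rightarrow> real) \<Rightarrow> int \<Rightarrow> real" where
  "pos2 a b k = (if 0 \<le> k then \<Sum>i<nat k. a i else - (\<Sum>i<nat (- k). b i))"

lemma pos2_diff: "pos2 a b k - pos2 a b (k - 1) = comb a b k"
proof -
  consider "1 \<le> k" | "k = 0" | "k < 0" by linarith
  then show ?thesis
  proof cases
    case 1
    then have "nat k = Suc (nat (k - 1))" by simp
    then show ?thesis using 1 by (simp add: pos2_def comb_def)
  next
    case 2 then show ?thesis by (simp add: pos2_def comb_def)
  next
    case 3
    then have "nat (- (k - 1)) = Suc (nat (- k))" by simp
    then show ?thesis using 3 by (simp add: pos2_def comb_def)
  qed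
qed

lemma pos2_0 [simp]: "pos2 a b 0 = 0" by (simp add: pos2_def)

lemma pos2_strict_mono:
  assumes "\<And>n. 0 < a n" "\<And>n. 0 < b n"
  shows "strict_mono (pos2 a b)"
proof (rule strict_mono_int)
  fix k
  have "0 < comb a b (k + 1)" using assms by (simp add: comb_def)
  then show "pos2 a b k < pos2 a b (k + 1)" using pos2_diff[of a b "k + 1"] by simp
qed

lemma labelling_pos2:
  assumes "\<And>n. 0 < a n" "\<And>n. 0 < b n"
  shows "is_labelling (range (pos2 a b)) (pos2 a b)"
  using pos2_strict_mono[OF assms] assms(1)[of 0] by (simp add: is_labelling_def pos2_def)

lemma range_pos2: "range (pos2 a b) = range (\<lambda>n. \<Sum>i<n. a i) \<union> range (\<lambda>n. - (\<Sum>i<n. b i))"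
proof -
  have "range (pos2 a b) = pos2 a b ` range int \<union> pos2 a b ` range (\<lambda>n. - int n)"
  proof -
    have "k \<in> range int \<union> range (\<lambda>n. - int n)" for k
      by (cases k rule: int_cases2) auto
    then have "UNIV = range int \<union> range (\<lambda>n. - int n)" by blast
    then show ?thesis by (metis image_Un)
  qed
  also have "pos2 a b ` range int = range (\<lambda>n. \<Sum>i<n. a i)"
    unfolding image_image by (simp add: pos2_def)
  also have "pos2 a b ` range (\<lambda>n. - int n) = range (\<lambda>n. - (\<Sum>i<n. b i))"
  proof -
    have "pos2 a b (- int n) = - (\<Sum>i<n. b i)" for n by (cases n) (auto simp: pos2_def simp del: of_nat_Suc)
    then show ?thesis unfolding image_image by simp
  qed
  finally show ?thesis .
qed

text \<open>Dividing by \<open>d\<close> and rounding down is injective on separated points and maps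
  a bounded window into finitely many integers.\<close>

lemma separated_locally_finite:
  assumes d: "0 < d" and sep: "\<And>x y. x \<in> \<xi> \<Longrightarrow> y \<in> \<xi> \<Longrightarrow> x < y \<Longrightarrow> d \<le> y - (x::real)"
  shows "locally_finite \<xi>"
  unfolding locally_finite_def
proof (intro allI)
  fix a b
  have "inj_on (\<lambda>x. \<lfloor>x / d\<rfloor>) (\<xi> \<inter> {a..b})"
  proof (rule inj_onI, rule ccontr)
    fix x y assume xy: "x \<in> \<xi> \<inter> {a..b}" "y \<in> \<xi> \<inter> {a..b}" "\<lfloor>x / d\<rfloor> = \<lfloor>y / d\<rfloor>" "x \<noteq> y"
    have *: False if "x \<in> \<xi>" "y \<in> \<xi>" "\<lfloor>x / d\<rfloor> = \<lfloor>y / d\<rfloor>" "x < y" for x y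
    proof -
      have "(x + d) / d \<le> y / d" using sep[OF that(1,2,4)] d by (intro divide_right_mono) auto
      then have "x / d + 1 \<le> y / d" using d by (simp add: add_divide_distrib)
      then show False using that(3) by linarith
    qed
    show False using xy *[of x y] *[of y x] by (cases x y rule: linorder_cases) auto
  qed
  moreover have "(\<lambda>x. \<lfloor>x / d\<rfloor>) ` (\<xi> \<inter> {a..b}) \<subseteq> {\<lfloor>a / d\<rfloor>..\<lfloor>b / d\<rfloor>}"
    using d by (auto intro!: floor_mono divide_right_mono)
  ultimately show "finite (\<xi> \<inter> {a..b})"
    by (meson finite_atLeastAtMost_int inj_on_finite)
qed

lemma separated_min_configs:
  assumes "0 < d" "\<And>x y. x \<in> \<xi> \<Longrightarrow> y \<in> \<xi> \<Longrightarrow> x < y \<Longrightarrow> d \<le> y - (x::real)"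
  shows "\<xi> \<in> min_configs d"
  using separated_locally_finite[OF assms] assms(2) by (auto simp: min_configs_iff)

lemma gaps_separated:
  assumes d: "0 < d" and gap: "\<And>k. d \<le> x (k + 1) - x (k :: int)" and "x i < x j"
  shows "d \<le> x j - (x i :: real)"
proof -
  have sm: "strict_mono x" by (rule strict_mono_int) (use gap d in \<open>smt (verit)\<close>)
  then have "i < j" using assms(3) by (simp add: strict_mono_less)
  then have "x (i + 1) \<le> x j" using sm by (simp add: strict_mono_less_eq)
  then show ?thesis using gap[of i] by simp
qed

lemma labelled_min_configs:
  assumes "0 < d" "is_labelling \<xi> x" "\<And>k. d \<le> x (k + 1) - x k"
  shows "\<xi> \<in> min_configs d"
  using assms(2) gaps_separated[of d x, OF assms(1,3)]
  by (intro separated_min_configs[OF assms(1)]) (auto simp: is_labelling_def)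

section \<open>The process in terms of indices\<close>

lemma domains_range:
  assumes sm: "strict_mono (x :: int \<Rightarrow> real)"
  shows "domains (range x) = {(ereal (x i), ereal (x (i + 1))) |i. True}"
proof -
  have lt: "x i < x j \<longleftrightarrow> i < j" for i j using sm by (simp add: strict_mono_less)
  have ext: "z \<in> ext_points (range x) \<longleftrightarrow> z = - \<infinity> \<or> z = \<infinity> \<or> (\<exists>i. z = ereal (x i))" for z
    by (auto simp: ext_points_def)
  show ?thesis
  proof (intro set_eqI iffI)
    fix \<Delta> assume "\<Delta> \<in> domains (range x)"
    then obtain l r where \<Delta>: "\<Delta> = (l, r)" "l \<in> ext_points (range x)" "r \<in> ext_points (range x)" "l < r"
      and gp: "{l<..<r} \<inter> ext_points (range x) = {}"
      by (auto simp: domains_def)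
    have \<Delta>5: "\<not> (l < ereal (x i) \<and> ereal (x i) < r)" for i using gp ext[of "ereal (x i)"] by auto
    have "l \<noteq> - \<infinity>"
    proof
      assume "l = - \<infinity>"
      then have "r \<noteq> \<infinity>" using \<Delta>5[of 0] by auto
      then obtain j where "r = ereal (x j)" using \<Delta>(3,4) by (auto simp: ext)
      then show False using \<open>l = - \<infinity>\<close> \<Delta>5[of "j - 1"] by (auto simp: lt)
    qed
    then obtain i where i: "l = ereal (x i)" using \<Delta> by (auto simp: ext)
    have "r \<noteq> \<infinity>" using \<Delta>5[of "i + 1"] i by (auto simp: lt)
    then obtain j where j: "r = ereal (x j)" using \<Delta> by (auto simp: ext)
    have "i < j" using \<Delta>(4) i j by (simp add: lt)
    moreover have "\<not> i + 1 < j" using \<Delta>5[of "i + 1"] i j by (simp add: lt)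
    ultimately have "j = i + 1" by simp
    then show "\<Delta> \<in> {(ereal (x i), ereal (x (i + 1))) |i. True}" using \<Delta> i j by blast
  next
    fix \<Delta> assume "\<Delta> \<in> {(ereal (x i), ereal (x (i + 1))) |i. True}"
    then obtain i where "\<Delta> = (ereal (x i), ereal (x (i + 1)))" by blast
    then show "\<Delta> \<in> domains (range x)" by (auto simp: domains_def ext lt)
  qed
qed

text \<open>Index \<open>- 1\<close> stands for the unbounded domain to the left of the first
  point.\<close>

lemma domains_half_range:
  assumes sm: "strict_mono (x :: int \<Rightarrow> real)"
  shows "domains (x ` {0..}) = {(if i \<in> {0..} then ereal (x i) else - \<infinity>, ereal (x (i + 1))) |i. i + 1 \<in> {0..}}"
proof -
  have lt: "x i < x j \<longleftrightarrow> i < j" for i j using sm by (simp add: strict_mono_less)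
  have ext: "z \<in> ext_points (x ` {0..}) \<longleftrightarrow> z = - \<infinity> \<or> z = \<infinity> \<or> (\<exists>i\<ge>0. z = ereal (x i))" for z
    by (auto simp: ext_points_def)
  show ?thesis
  proof (intro set_eqI iffI)
    fix \<Delta> assume "\<Delta> \<in> domains (x ` {0..})"
    then obtain l r where \<Delta>: "\<Delta> = (l, r)" "l \<in> ext_points (x ` {0..})" "r \<in> ext_points (x ` {0..})" "l < r"
      and gp: "{l<..<r} \<inter> ext_points (x ` {0..}) = {}"
      by (auto simp: domains_def)
    have \<Delta>5: "\<not> (l < ereal (x i) \<and> ereal (x i) < r)" if "0 \<le> i" for i
      using gp ext[of "ereal (x i)"] that by auto
    show "\<Delta> \<in> {(if i \<in> {0..} then ereal (x i) else - \<infinity>, ereal (x (i + 1))) |i. i + 1 \<in> {0..}}"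
    proof (cases "l = - \<infinity>")
      case True
      then have "r \<noteq> \<infinity>" using \<Delta>5[of 0] by auto
      then obtain j where j: "0 \<le> j" "r = ereal (x j)" using \<Delta> by (auto simp: ext)
      have "\<not> 0 < j" using \<Delta>5[of 0] True j by (auto simp: lt)
      then have "\<Delta> = (if - 1 \<in> {0 :: int..} then ereal (x (- 1)) else - \<infinity>, ereal (x (- 1 + 1))) \<and> - 1 + 1 \<in> {0 :: int..}"
        using True j \<Delta> by auto
      then show ?thesis by blast
    next
      case False
      then obtain i where i: "0 \<le> i" "l = ereal (x i)" using \<Delta> by (auto simp: ext)
      have "r \<noteq> \<infinity>" using \<Delta>5[of "i + 1"] i by (auto simp: lt)
      then obtain j where j: "r = ereal (x j)" using \<Delta> by (auto simp: ext)
      have "i < j" using \<Delta>(4) i j by (simp add: lt)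
      moreover have "\<not> i + 1 < j" using \<Delta>5[of "i + 1"] i j by (simp add: lt)
      ultimately have "j = i + 1" by simp
      then have "\<Delta> = (if i \<in> {0..} then ereal (x i) else - \<infinity>, ereal (x (i + 1))) \<and> i + 1 \<in> {0..}" using \<Delta> i j by auto
      then show ?thesis by blast
    qed
  next
    fix \<Delta> assume "\<Delta> \<in> {(if i \<in> {0..} then ereal (x i) else - \<infinity>, ereal (x (i + 1))) |i. i + 1 \<in> {0..}}"
    then obtain i where i: "\<Delta> = (if i \<in> {0..} then ereal (x i) else - \<infinity>, ereal (x (i + 1)))" "i + 1 \<in> {0..}" by blast
    show "\<Delta> \<in> domains (x ` {0..})"
    proof (cases "0 \<le> i")
      case True
      then have "ereal (x i) \<in> ext_points (x ` {0..})" "ereal (x (i + 1)) \<in> ext_points (x ` {0..})"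
        by (auto simp: ext_points_def)
      moreover have "{ereal (x i)<..<ereal (x (i + 1))} \<inter> ext_points (x ` {0..}) = {}"
        by (auto simp: ext lt)
      ultimately show ?thesis using i True by (simp add: domains_def lt)
    next
      case False
      then have "i = - 1" using i by simp
      then show ?thesis using i by (auto simp: domains_def ext lt)
    qed
  qed
qed

text \<open>Meant for \<open>J\<close> the integers or the nonnegative integers. The condition
  \<open>i + 1 \<in> J\<close> admits the unbounded domain \<open>i = - 1\<close> of a half-line,
  which is present but inert and gets the left endpoint \<open>- \<infinity>\<close> from
  \<open>X\<close>. The core is a bisimulation between \<open>ithr\<close> and
  \<open>threatens\<close>.\<close>

lemma ocp_path_index:
  fixes x :: "int \<Rightarrow> real" and J :: "int set" and X :: "int \<Rightarrow> ereal"
  assumes X_def: "X = (\<lambda>i. if i \<in> J then ereal (x i) else - \<infinity>)"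
    and dom: "domains \<xi> = {(X i, X (i + 1)) |i. i + 1 \<in> J}"
    and sm: "strict_mono x" and \<xi>: "\<xi> = x ` J" and up: "\<And>i. i \<in> J \<Longrightarrow> i + 1 \<in> J"
    and y: "\<And>i. i \<in> J \<Longrightarrow> y i = m (X i, X (i + 1))" and inert: "\<And>i. i \<notin> J \<Longrightarrow> fst (y i) = \<infinity>"
    and inert': "\<And>i. i \<notin> J \<Longrightarrow> i + 1 \<in> J \<Longrightarrow> clock m (X i, X (i + 1)) = \<infinity>"
  shows "ocp_path \<xi> m t = {x k |k. k \<in> J \<and> \<not> idel y t k}"
proof -
  have Xeq: "X i = X j \<longleftrightarrow> i = j" if "i \<in> J" for i j
    using that sm by (auto simp: X_def strict_mono_eq)
  \<comment> \<open>Whatever threatens or deletes has a finite clock, hence an index in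
    \<open>J\<close>.\<close>
  have act_J: "i \<in> J" if "fst (y i) < c" for i c
  proof (rule ccontr)
    assume "i \<notin> J"
    then show False using inert[of i] that by simp
  qed
  have clk: "clock m (X i, X (i + 1)) = fst (y i)" if "i + 1 \<in> J" for i
    using y[of i] inert[of i] inert'[of i] that by (cases "i \<in> J") (auto simp: clock_def)
  have coin: "snd (m (X i, X (i + 1))) = snd (y i)" if "i \<in> J" for i
    using y[OF that] by simp
  define r where "r i \<Delta> \<longleftrightarrow> i + 1 \<in> J \<and> \<Delta> = (X i, X (i + 1))" for i \<Delta>
  have thr: "threatens \<xi> m (X j, X (j + 1)) (X i, X (i + 1)) \<longleftrightarrow> ithr y j i" if "j + 1 \<in> J" "i + 1 \<in> J" for i j
  proof (cases "fst (y j) < fst (y i)")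
    case True
    then have j: "j \<in> J" by (rule act_J)
    have "victim m (X j, X (j + 1)) \<in> endpoints (X i, X (i + 1)) \<longleftrightarrow> (j = i - 1 \<and> \<not> snd (y j) \<or> j = i + 1 \<and> snd (y j))"
    proof (cases "snd (y j)")
      case c: True
      have "j \<noteq> i" using True by auto
      moreover have "victim m (X j, X (j + 1)) = X j" using c coin[OF j] by (simp add: victim_def)
      ultimately show ?thesis using c Xeq[OF j, of i] Xeq[OF j, of "i + 1"] by (simp add: endpoints_def)
    next
      case c: False
      have "j \<noteq> i" using True by auto
      moreover have "victim m (X j, X (j + 1)) = X (j + 1)" using c coin[OF j] by (simp add: victim_def)
      ultimately show ?thesis using c Xeq[OF that(1), of i] Xeq[OF that(1), of "i + 1"] by (auto simp: endpoints_def)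
    qed
    moreover have "(X j, X (j + 1)) \<in> domains \<xi>" "(X i, X (i + 1)) \<in> domains \<xi>" using that dom by blast+
    ultimately show ?thesis using True by (simp add: threatens_def ithr_def clk[OF that(1)] clk[OF that(2)])
  next
    case False
    then show ?thesis by (simp add: threatens_def ithr_def clk[OF that(1)] clk[OF that(2)])
  qed
  have st: "status (ithr y) s i \<longleftrightarrow> status (threatens \<xi> m) s (X i, X (i + 1))" if "i + 1 \<in> J" for s i
  proof (rule status_bisim[where r = r])
    fix i \<Delta> assume ri: "r i \<Delta>"
    show "(\<forall>j. ithr y j i \<longrightarrow> (\<exists>\<Delta>'. threatens \<xi> m \<Delta>' \<Delta> \<and> r j \<Delta>')) \<and>
        (\<forall>\<Delta>'. threatens \<xi> m \<Delta>' \<Delta> \<longrightarrow> (\<exists>j. ithr y j i \<and> r j \<Delta>'))"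
    proof (intro conjI allI impI)
      fix j assume j: "ithr y j i"
      then have "fst (y j) < fst (y i)" by (simp add: ithr_def)
      then have "j \<in> J" by (rule act_J)
      then have "j + 1 \<in> J" by (rule up)
      then show "\<exists>\<Delta>'. threatens \<xi> m \<Delta>' \<Delta> \<and> r j \<Delta>'"
        using j ri thr[of j i] by (auto simp: r_def)
    next
      fix \<Delta>' assume \<Delta>': "threatens \<xi> m \<Delta>' \<Delta>"
      then obtain j where "\<Delta>' = (X j, X (j + 1))" "j + 1 \<in> J" using dom by (auto simp: threatens_def)
      then show "\<exists>j. ithr y j i \<and> r j \<Delta>'" using \<Delta>' ri thr[of j i] by (auto simp: r_def)
    qed
  qed (use that in \<open>simp add: r_def\<close>)
  have "(\<exists>\<Delta>. acts \<xi> m \<Delta> \<and> clock m \<Delta> \<le> t \<and> clock m \<Delta> < \<infinity> \<and> victim m \<Delta> = ereal (x k)) \<longleftrightarrow> idel y t k" if k: "k \<in> J" for k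
  proof
    assume "\<exists>\<Delta>. acts \<xi> m \<Delta> \<and> clock m \<Delta> \<le> t \<and> clock m \<Delta> < \<infinity> \<and> victim m \<Delta> = ereal (x k)"
    then obtain \<Delta> where \<Delta>: "acts \<xi> m \<Delta>" "clock m \<Delta> \<le> t" "clock m \<Delta> < \<infinity>" "victim m \<Delta> = ereal (x k)" by blast
    then obtain i where i: "\<Delta> = (X i, X (i + 1))" "i + 1 \<in> J" using dom by (auto simp: acts_iff_status)
    then have "fst (y i) < \<infinity>" using \<Delta>(3) clk[of i] by simp
    then have "i \<in> J" by (rule act_J)
    then have "ivic y i = k"
      using \<Delta>(4) coin[of i] Xeq[of i k] Xeq[of "i + 1" k] i k by (auto simp: victim_def ivic_def X_def split: if_splits)
    then show "idel y t k" unfolding idel_def using \<Delta> i st[OF i(2)] clk[OF i(2)] by (auto simp: acts_iff_status)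
  next
    assume "idel y t k"
    then obtain i where i: "status (ithr y) True i" "fst (y i) \<le> t" "fst (y i) < \<infinity>" "ivic y i = k"
      unfolding idel_def by blast
    then have J: "i \<in> J" by (auto intro: act_J)
    then have J': "i + 1 \<in> J" by (rule up)
    have "victim m (X i, X (i + 1)) = ereal (x k)"
      using i(4) coin[OF J] J J' by (auto simp: victim_def ivic_def X_def split: if_splits)
    then show "\<exists>\<Delta>. acts \<xi> m \<Delta> \<and> clock m \<Delta> \<le> t \<and> clock m \<Delta> < \<infinity> \<and> victim m \<Delta> = ereal (x k)"
      using i clk[OF J'] st[OF J'] J' dom
      by (intro exI[of _ "(X i, X (i + 1))"]) (auto simp: acts_iff_status)
  qed
  then show ?thesis unfolding ocp_path_eq \<xi> by auto
qed

section \<open>Infinite products of probability measures\<close>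

lemma comb_measurable [measurable]:
  "(\<lambda>p. comb (fst p) (snd p)) \<in> measurable ((\<Pi>\<^sub>M i\<in>(UNIV :: nat set). N) \<Otimes>\<^sub>M (\<Pi>\<^sub>M i\<in>(UNIV :: nat set). N)) (\<Pi>\<^sub>M i\<in>(UNIV :: int set). N)"
proof (rule measurable_PiM_single')
  fix k
  show "(\<lambda>p. comb (fst p) (snd p) k) \<in> measurable ((\<Pi>\<^sub>M i\<in>(UNIV :: nat set). N) \<Otimes>\<^sub>M (\<Pi>\<^sub>M i\<in>(UNIV :: nat set). N)) N"
    unfolding comb_def by (cases "1 \<le> k") simp_all
qed (auto simp: comb_def space_pair_measure space_PiM PiE_def Pi_iff)

text \<open>Positive indices read the first sequence and the others read the second, so a cylinder
  over the integers is a product of two cylinders.\<close>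

lemma distr_comb:
  assumes N: "prob_space N"
  shows "distr ((\<Pi>\<^sub>M i\<in>(UNIV :: nat set). N) \<Otimes>\<^sub>M (\<Pi>\<^sub>M i\<in>(UNIV :: nat set). N)) (\<Pi>\<^sub>M i\<in>(UNIV :: int set). N)
      (\<lambda>p. comb (fst p) (snd p)) = (\<Pi>\<^sub>M i\<in>(UNIV :: int set). N)" (is "distr (?A \<Otimes>\<^sub>M ?A) ?B _ = _")
proof -
  interpret A: product_prob_space "\<lambda>_. N" "UNIV :: nat set" by (intro product_prob_spaceI N)
  interpret B: product_prob_space "\<lambda>_. N" "UNIV :: int set" by (intro product_prob_spaceI N)
  show ?thesis
  proof (rule B.PiM_eq)
    fix J and E :: "int \<Rightarrow> 'a set"
    assume J: "finite J" "J \<subseteq> UNIV" and E: "\<And>j. j \<in> J \<Longrightarrow> E j \<in> sets N"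
    let ?X = "prod_emb UNIV (\<lambda>_. N) J (Pi\<^sub>E J E)"
    let ?J1 = "(\<lambda>j. nat (j - 1)) ` (J \<inter> {1..})" and ?J2 = "(\<lambda>j. nat (- j)) ` (J \<inter> {..0})"
    have inj: "inj_on (\<lambda>j. nat (j - 1)) (J \<inter> {1..})" "inj_on (\<lambda>j. nat (- j)) (J \<inter> {..0})"
      by (auto simp: inj_on_def)
    have Es: "e \<in> E j \<Longrightarrow> j \<in> J \<Longrightarrow> e \<in> space N" for e j using E sets.sets_into_space by blast
    have "emeasure (distr (?A \<Otimes>\<^sub>M ?A) ?B (\<lambda>p. comb (fst p) (snd p))) ?X =
        emeasure (?A \<Otimes>\<^sub>M ?A) ((\<lambda>p. comb (fst p) (snd p)) -` ?X \<inter> space (?A \<Otimes>\<^sub>M ?A))"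
      using J E by (intro emeasure_distr comb_measurable sets_PiM_I) auto
    also have "(\<lambda>p. comb (fst p) (snd p)) -` ?X \<inter> space (?A \<Otimes>\<^sub>M ?A) =
        {a \<in> space ?A. \<forall>i\<in>?J1. a i \<in> E (int i + 1)} \<times> {b \<in> space ?A. \<forall>i\<in>?J2. b i \<in> E (- int i)}"
    proof -
      have "(\<forall>j\<in>J. comb a b j \<in> E j) \<longleftrightarrow> (\<forall>j\<in>J \<inter> {1..}. a (nat (j - 1)) \<in> E j) \<and> (\<forall>j\<in>J \<inter> {..0}. b (nat (- j)) \<in> E j)" for a b :: "nat \<Rightarrow> 'a"
        unfolding comb_def by (auto simp: not_le)
      moreover have "comb a b \<in> space ?B" if "a \<in> space ?A" "b \<in> space ?A" for a b
        using that by (auto simp: comb_def space_PiM PiE_def Pi_iff)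
      ultimately show ?thesis
        by (auto simp: prod_emb_def PiE_iff space_pair_measure space_PiM)
    qed
    also have "emeasure (?A \<Otimes>\<^sub>M ?A) \<dots> = emeasure ?A {a \<in> space ?A. \<forall>i\<in>?J1. a i \<in> E (int i + 1)} * emeasure ?A {b \<in> space ?A. \<forall>i\<in>?J2. b i \<in> E (- int i)}"
    proof (rule A.P.emeasure_pair_measure_Times)
      have "(\<lambda>a. a i) \<in> measurable ?A N" for i by measurable
      show "{a \<in> space ?A. \<forall>i\<in>?J1. a i \<in> E (int i + 1)} \<in> sets ?A"
        using J E by (intro sets.sets_Collect_finite_All) (auto intro!: measurable_sets_Collect[OF measurable_component_singleton])
      show "{b \<in> space ?A. \<forall>i\<in>?J2. b i \<in> E (- int i)} \<in> sets ?A"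
        using J E by (intro sets.sets_Collect_finite_All) (auto intro!: measurable_sets_Collect[OF measurable_component_singleton])
    qed
    also have "emeasure ?A {a \<in> space ?A. \<forall>i\<in>?J1. a i \<in> E (int i + 1)} = (\<Prod>i\<in>?J1. emeasure N (E (int i + 1)))"
      using J E by (intro A.emeasure_PiM_Collect) auto
    also have "\<dots> = (\<Prod>j\<in>J \<inter> {1..}. emeasure N (E j))"
      by (subst prod.reindex[OF inj(1)]) (auto intro!: prod.cong)
    also have "emeasure ?A {b \<in> space ?A. \<forall>i\<in>?J2. b i \<in> E (- int i)} = (\<Prod>i\<in>?J2. emeasure N (E (- int i)))"
      using J E by (intro A.emeasure_PiM_Collect) auto
    also have "\<dots> = (\<Prod>j\<in>J \<inter> {..0}. emeasure N (E j))"
      by (subst prod.reindex[OF inj(2)]) (auto intro!: prod.cong)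
    also have "(\<Prod>j\<in>J \<inter> {1..}. emeasure N (E j)) * (\<Prod>j\<in>J \<inter> {..0}. emeasure N (E j)) = (\<Prod>j\<in>J. emeasure N (E j))"
    proof -
      have "J = (J \<inter> {1..}) \<union> (J \<inter> {..0})" by auto
      then show ?thesis using J by (subst (3) \<open>J = _\<close>, subst prod.union_disjoint) auto
    qed
    finally show "emeasure (distr (?A \<Otimes>\<^sub>M ?A) ?B (\<lambda>p. comb (fst p) (snd p))) ?X = (\<Prod>j\<in>J. emeasure N (E j))" .
  qed simp
qed

lemma (in product_prob_space) nn_integral_PiM_prod:
  assumes J: "finite J" "J \<subseteq> I" and f: "\<And>j. j \<in> J \<Longrightarrow> f j \<in> borel_measurable (M j)"
  shows "(\<integral>\<^sup>+x. (\<Prod>j\<in>J. f j (x j)) \<partial>PiM I M) = (\<Prod>j\<in>J. \<integral>\<^sup>+x. f j x \<partial>M j :: ennreal)"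
proof -
  have "(\<integral>\<^sup>+x. (\<Prod>j\<in>J. f j (x j)) \<partial>PiM I M) = (\<integral>\<^sup>+x. (\<Prod>j\<in>J. f j (restrict x J j)) \<partial>PiM I M)"
    by (intro nn_integral_cong prod.cong) auto
  also have "\<dots> = (\<integral>\<^sup>+x. (\<Prod>j\<in>J. f j (x j)) \<partial>distr (PiM I M) (PiM J M) (\<lambda>x. restrict x J))"
  proof (rule nn_integral_distr[symmetric])
    show "(\<lambda>x. restrict x J) \<in> measurable (PiM I M) (PiM J M)" using J by (intro measurable_restrict_subset)
    show "(\<lambda>x. \<Prod>j\<in>J. f j (x j)) \<in> borel_measurable (distr (PiM I M) (PiM J M) (\<lambda>x. restrict x J))"
      unfolding measurable_distr_eq1
      using f by (intro borel_measurable_prod_ennreal) (auto intro!: measurable_compose[OF measurable_component_singleton])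
  qed
  also have "\<dots> = (\<integral>\<^sup>+x. (\<Prod>j\<in>J. f j (x j)) \<partial>PiM J M)"
    using distr_PiM_restrict_finite[OF J] by simp
  also have "\<dots> = (\<Prod>j\<in>J. \<integral>\<^sup>+x. f j x \<partial>M j)"
    using J f by (intro product_nn_integral_prod) auto
  finally show ?thesis .
qed

text \<open>Two independent i.i.d. sequences form one i.i.d. sequence of pairs, which attaches noise
  to the gaps. The cylinder is sectioned along the first sequence, and the resulting product over
  coordinates is integrated factor by factor.\<close>

lemma distr_zip:
  assumes A: "prob_space A" and B: "prob_space B"
  shows "distr ((\<Pi>\<^sub>M i\<in>(UNIV :: nat set). A) \<Otimes>\<^sub>M (\<Pi>\<^sub>M i\<in>(UNIV :: nat set). B)) (\<Pi>\<^sub>M i\<in>(UNIV :: nat set). A \<Otimes>\<^sub>M B)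
      (\<lambda>p i. (fst p i, snd p i)) = (\<Pi>\<^sub>M i\<in>(UNIV :: nat set). A \<Otimes>\<^sub>M B)" (is "distr (?A \<Otimes>\<^sub>M ?B) ?C ?z = _")
    and "(\<lambda>p i. (fst p i, snd p i)) \<in> measurable ((\<Pi>\<^sub>M i\<in>(UNIV :: nat set). A) \<Otimes>\<^sub>M (\<Pi>\<^sub>M i\<in>(UNIV :: nat set). B)) (\<Pi>\<^sub>M i\<in>(UNIV :: nat set). A \<Otimes>\<^sub>M B)"
proof -
  show z: "?z \<in> measurable (?A \<Otimes>\<^sub>M ?B) ?C"
    by (rule measurable_PiM_single') (auto simp: space_pair_measure space_PiM PiE_def Pi_iff)
  interpret A: prob_space A by (rule A)
  interpret B: prob_space B by (rule B)
  interpret AB: pair_prob_space A B ..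
  interpret PA: product_prob_space "\<lambda>_. A" "UNIV :: nat set" by (intro product_prob_spaceI A)
  interpret PB: product_prob_space "\<lambda>_. B" "UNIV :: nat set" by (intro product_prob_spaceI B)
  interpret PC: product_prob_space "\<lambda>_. A \<Otimes>\<^sub>M B" "UNIV :: nat set" by (intro product_prob_spaceI AB.prob_space_axioms)
  show "distr (?A \<Otimes>\<^sub>M ?B) ?C ?z = ?C"
  proof (rule PC.PiM_eq)
    fix J and E :: "nat \<Rightarrow> ('a \<times> 'b) set"
    assume J: "finite J" "J \<subseteq> UNIV" and E: "\<And>j. j \<in> J \<Longrightarrow> E j \<in> sets (A \<Otimes>\<^sub>M B)"
    let ?X = "prod_emb UNIV (\<lambda>_. A \<Otimes>\<^sub>M B) J (Pi\<^sub>E J E)"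
    have X: "?X \<in> sets ?C" using J E by (intro sets_PiM_I) auto
    have "emeasure (distr (?A \<Otimes>\<^sub>M ?B) ?C ?z) ?X = emeasure (?A \<Otimes>\<^sub>M ?B) (?z -` ?X \<inter> space (?A \<Otimes>\<^sub>M ?B))"
      by (rule emeasure_distr[OF z X])
    also have "\<dots> = (\<integral>\<^sup>+a. emeasure ?B (Pair a -` (?z -` ?X \<inter> space (?A \<Otimes>\<^sub>M ?B))) \<partial>?A)"
      by (rule PB.P.emeasure_pair_measure_alt) (rule measurable_sets[OF z X])
    also have "\<dots> = (\<integral>\<^sup>+a. (\<Prod>j\<in>J. emeasure B (Pair (a j) -` E j)) \<partial>?A)"
    proof (rule nn_integral_cong)
      fix a assume a: "a \<in> space ?A"
      have Es: "p \<in> E j \<Longrightarrow> j \<in> J \<Longrightarrow> p \<in> space (A \<Otimes>\<^sub>M B)" for p j using E sets.sets_into_space by blast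
      have "Pair a -` (?z -` ?X \<inter> space (?A \<Otimes>\<^sub>M ?B)) = {b \<in> space ?B. \<forall>j\<in>J. b j \<in> Pair (a j) -` E j}"
        using a by (auto simp: prod_emb_def PiE_iff space_pair_measure space_PiM Pi_iff)
      then show "emeasure ?B (Pair a -` (?z -` ?X \<inter> space (?A \<Otimes>\<^sub>M ?B))) = (\<Prod>j\<in>J. emeasure B (Pair (a j) -` E j))"
        using J E PB.emeasure_PiM_Collect[of J "\<lambda>j. Pair (a j) -` E j"] by (simp add: sets_Pair1)
    qed
    also have "\<dots> = (\<Prod>j\<in>J. \<integral>\<^sup>+x. emeasure B (Pair x -` E j) \<partial>A)"
      using J E by (intro PA.nn_integral_PiM_prod) (auto intro: B.measurable_emeasure_Pair)
    also have "\<dots> = (\<Prod>j\<in>J. emeasure (A \<Otimes>\<^sub>M B) (E j))"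
      using E by (intro prod.cong refl B.emeasure_pair_measure_alt[symmetric])
    finally show "emeasure (distr (?A \<Otimes>\<^sub>M ?B) ?C ?z) ?X = (\<Prod>j\<in>J. emeasure (A \<Otimes>\<^sub>M B) (E j))" .
  qed simp
qed

text \<open>Live indices have distinct values, so counting points in \<open>A\<close> means counting
  live indices with value in \<open>A\<close>.\<close>

lemma points_measurable:
  fixes X :: "'i::countable \<Rightarrow> 'w \<Rightarrow> real"
  assumes [measurable]: "\<And>i. X i \<in> borel_measurable N" "\<And>i. Measurable.pred N (live i)" "Measurable.pred N good"
    and lf: "\<And>\<omega>. \<omega> \<in> space N \<Longrightarrow> good \<omega> \<Longrightarrow> locally_finite {X i \<omega> |i. live i \<omega>}"
    and inj: "\<And>\<omega> i j. \<omega> \<in> space N \<Longrightarrow> good \<omega> \<Longrightarrow> live i \<omega> \<Longrightarrow> live j \<omega> \<Longrightarrow> X i \<omega> = X j \<omega> \<Longrightarrow> i = j"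
  shows "(\<lambda>\<omega>. if good \<omega> then {X i \<omega> |i. live i \<omega>} else {}) \<in> measurable N config_space"
proof (rule measurable_config_spaceI)
  fix \<omega> assume "\<omega> \<in> space N"
  then show "locally_finite (if good \<omega> then {X i \<omega> |i. live i \<omega>} else {})"
    using lf by (auto simp: locally_finite_def)
next
  fix A :: "real set" assume [measurable]: "A \<in> sets borel" and "bounded A"
  have "(\<lambda>\<omega>. if good \<omega> then card {k :: nat. \<exists>i. k = to_nat i \<and> live i \<omega> \<and> X i \<omega> \<in> A} else 0) \<in> measurable N (count_space UNIV)"
    by measurable
  then show "(\<lambda>\<omega>. card ((if good \<omega> then {X i \<omega> |i. live i \<omega>} else {}) \<inter> A)) \<in> measurable N (count_space UNIV)"
  proof (rule measurable_cong[THEN iffD1, rotated])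
    fix \<omega> assume w: "\<omega> \<in> space N"
    show "(if good \<omega> then card {k :: nat. \<exists>i. k = to_nat i \<and> live i \<omega> \<and> X i \<omega> \<in> A} else 0) =
        card ((if good \<omega> then {X i \<omega> |i. live i \<omega>} else {}) \<inter> A)"
    proof (cases "good \<omega>")
      case True
      have "{X i \<omega> |i. live i \<omega>} \<inter> A = (\<lambda>i. X i \<omega>) ` {i. live i \<omega> \<and> X i \<omega> \<in> A}" by auto
      moreover have "{k :: nat. \<exists>i. k = to_nat i \<and> live i \<omega> \<and> X i \<omega> \<in> A} = to_nat ` {i. live i \<omega> \<and> X i \<omega> \<in> A}" by auto
      moreover have "inj_on (\<lambda>i. X i \<omega>) {i. live i \<omega> \<and> X i \<omega> \<in> A}"
        using inj[OF w True] by (auto simp: inj_on_def)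
      ultimately show ?thesis using True by (simp add: card_image)
    qed simp
  qed
qed

section \<open>Renewal initial conditions\<close>

lemma distr_pair_snd:
  assumes "prob_space A" "prob_space B"
  shows "distr (A \<Otimes>\<^sub>M B) B snd = B"
proof (rule measure_eqI)
  interpret A: prob_space A by fact
  interpret B: prob_space B by fact
  fix X assume "X \<in> sets (distr (A \<Otimes>\<^sub>M B) B snd)"
  then have X: "X \<in> sets B" by simp
  then have "snd -` X \<inter> space (A \<Otimes>\<^sub>M B) = space A \<times> X"
    by (auto simp: space_pair_measure dest: sets.sets_into_space)
  then show "emeasure (distr (A \<Otimes>\<^sub>M B) B snd) X = emeasure B X"
    using X by (simp add: emeasure_distr B.emeasure_pair_measure_Times A.emeasure_space_1)
qed simp

lemma AE_pair_fst: "prob_space A \<Longrightarrow> prob_space B \<Longrightarrow> AE x in A. P x \<Longrightarrow> AE p in A \<Otimes>\<^sub>M B. P (fst p)"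
proof -
  assume "prob_space A" and B: "prob_space B" and P: "AE x in A. P x"
  have "AE x in distr (A \<Otimes>\<^sub>M B) A fst. P x"
    unfolding prob_space.distr_pair_fst[OF B] by (rule P)
  then show "AE p in A \<Otimes>\<^sub>M B. P (fst p)" by (rule AE_distrD[rotated]) measurable
qed

lemma AE_pair_snd: "prob_space A \<Longrightarrow> prob_space B \<Longrightarrow> AE x in B. P x \<Longrightarrow> AE p in A \<Otimes>\<^sub>M B. P (snd p)"
proof -
  assume A: "prob_space A" and B: "prob_space B" and P: "AE x in B. P x"
  have "AE x in distr (A \<Otimes>\<^sub>M B) B snd. P x"
    unfolding distr_pair_snd[OF A B] by (rule P)
  then show "AE p in A \<Otimes>\<^sub>M B. P (snd p)" by (rule AE_distrD[rotated]) measurable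
qed

lemma nn_integral_zip:
  assumes A: "prob_space A" and B: "prob_space B"
    and k [measurable]: "k \<in> borel_measurable (\<Pi>\<^sub>M i\<in>(UNIV :: nat set). A \<Otimes>\<^sub>M B)"
  shows "(\<integral>\<^sup>+a. \<integral>\<^sup>+u. k (\<lambda>i. (a i, u i)) \<partial>(\<Pi>\<^sub>M i\<in>(UNIV :: nat set). B) \<partial>(\<Pi>\<^sub>M i\<in>(UNIV :: nat set). A)) =
    (\<integral>\<^sup>+y. k y \<partial>(\<Pi>\<^sub>M i\<in>(UNIV :: nat set). A \<Otimes>\<^sub>M B))"
proof -
  interpret PB: prob_space "\<Pi>\<^sub>M i\<in>(UNIV :: nat set). B" by (intro prob_space_PiM B)
  note [measurable] = distr_zip(2)[OF A B]
  have "(\<integral>\<^sup>+y. k y \<partial>(\<Pi>\<^sub>M i\<in>(UNIV :: nat set). A \<Otimes>\<^sub>M B)) =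
      (\<integral>\<^sup>+p. k (\<lambda>i. (fst p i, snd p i)) \<partial>((\<Pi>\<^sub>M i\<in>(UNIV :: nat set). A) \<Otimes>\<^sub>M (\<Pi>\<^sub>M i\<in>(UNIV :: nat set). B)))"
    by (subst distr_zip(1)[OF A B, symmetric], rule nn_integral_distr) measurable
  also have "\<dots> = (\<integral>\<^sup>+a. \<integral>\<^sup>+u. k (\<lambda>i. (a i, u i)) \<partial>(\<Pi>\<^sub>M i\<in>(UNIV :: nat set). B) \<partial>(\<Pi>\<^sub>M i\<in>(UNIV :: nat set). A))"
    by (subst PB.nn_integral_fst[symmetric]) (use measurable_compose[OF distr_zip(2)[OF A B] k] in simp_all)
  finally show ?thesis ..
qed

definition ren_map :: "real \<times> (nat \<Rightarrow> real) \<Rightarrow> real set" where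
  "ren_map = (\<lambda>(x0, g). let \<xi> = range (\<lambda>k. x0 + (\<Sum>i<k. g i)) in if locally_finite \<xi> then \<xi> else {})"

lemma Ren_eq: "Ren \<nu> \<mu> = distr (\<nu> \<Otimes>\<^sub>M (\<Pi>\<^sub>M k\<in>(UNIV :: nat set). \<mu>)) config_space ren_map"
  unfolding Ren_def ren_map_def ..

lemma locally_finite_nat: "locally_finite \<xi> \<longleftrightarrow> (\<forall>n::nat. finite (\<xi> \<inter> {- real n..real n}))"
proof
  assume *: "\<forall>n::nat. finite (\<xi> \<inter> {- real n..real n})"
  show "locally_finite \<xi>"
    unfolding locally_finite_def
  proof (intro allI)
    fix a b :: real
    obtain n :: nat where "max \<bar>a\<bar> \<bar>b\<bar> \<le> real n" using real_arch_simple by blast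
    then have "\<xi> \<inter> {a..b} \<subseteq> \<xi> \<inter> {- real n..real n}" by auto
    then show "finite (\<xi> \<inter> {a..b})" using * by (meson finite_subset)
  qed
qed (simp add: locally_finite_def)

text \<open>Measurability is needed for arbitrary gaps, where partial sums may repeat and need not
  be locally finite. Each point is represented by the first index at which it occurs.\<close>

lemma ren_map_measurable [measurable]:
  "ren_map \<in> measurable (borel \<Otimes>\<^sub>M (\<Pi>\<^sub>M k\<in>(UNIV :: nat set). borel)) config_space" (is "_ \<in> measurable ?N _")
proof -
  define X :: "nat \<Rightarrow> real \<times> (nat \<Rightarrow> real) \<Rightarrow> real" where "X k p = fst p + (\<Sum>i<k. snd p i)" for k p
  have X [measurable]: "X k \<in> borel_measurable ?N" for k unfolding X_def by measurable
  \<comment> \<open>Finitely many values in \<open>A\<close> means that all of them occur up to some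
    index \<open>m\<close>; this form uses quantifiers over naturals only.\<close>
  have fin: "finite (range (\<lambda>k. X k p) \<inter> A) \<longleftrightarrow> (\<exists>m. \<forall>k. X k p \<in> A \<longrightarrow> (\<exists>j\<le>m. X j p = X k p))" for p A
  proof
    assume "finite (range (\<lambda>k. X k p) \<inter> A)"
    then have "\<exists>f. \<forall>z\<in>range (\<lambda>k. X k p) \<inter> A. X (f z) p = z" by (intro bchoice) auto
    then obtain f where f: "\<And>z. z \<in> range (\<lambda>k. X k p) \<inter> A \<Longrightarrow> X (f z) p = z" by blast
    have "f z \<le> Max (f ` (range (\<lambda>k. X k p) \<inter> A))" if "z \<in> range (\<lambda>k. X k p) \<inter> A" for z
      using \<open>finite _\<close> that by (intro Max_ge) auto
    then show "\<exists>m. \<forall>k. X k p \<in> A \<longrightarrow> (\<exists>j\<le>m. X j p = X k p)"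
      using f by (intro exI[of _ "Max (f ` (range (\<lambda>k. X k p) \<inter> A))"]) blast
  next
    assume "\<exists>m. \<forall>k. X k p \<in> A \<longrightarrow> (\<exists>j\<le>m. X j p = X k p)"
    then obtain m where m: "\<And>k. X k p \<in> A \<Longrightarrow> \<exists>j\<le>m. X j p = X k p" by blast
    have "range (\<lambda>k. X k p) \<inter> A \<subseteq> (\<lambda>k. X k p) ` {..m}"
    proof
      fix z assume "z \<in> range (\<lambda>k. X k p) \<inter> A"
      then obtain k where "z = X k p" "X k p \<in> A" by blast
      with m[of k] obtain j where "j \<le> m" "X j p = z" by blast
      then show "z \<in> (\<lambda>k. X k p) ` {..m}" by blast
    qed
    then show "finite (range (\<lambda>k. X k p) \<inter> A)" by (rule finite_subset) simp
  qed
  have good: "Measurable.pred ?N (\<lambda>p. locally_finite (range (\<lambda>k. X k p)))"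
    unfolding locally_finite_nat fin atLeastAtMost_iff
  proof -
    have [measurable]: "Measurable.pred ?N (\<lambda>p. X j p = X k p)" for j k by measurable
    show "Measurable.pred ?N (\<lambda>p. \<forall>n. \<exists>m. \<forall>k. - real n \<le> X k p \<and> X k p \<le> real n \<longrightarrow> (\<exists>j\<le>m. X j p = X k p))"
      by measurable
  qed
  have live: "Measurable.pred ?N (\<lambda>p. \<forall>j<k. X j p \<noteq> X k p)" for k by measurable
  have first: "{X k p |k. \<forall>j<k. X j p \<noteq> X k p} = range (\<lambda>k. X k p)" for p
  proof (intro set_eqI iffI)
    fix z assume "z \<in> range (\<lambda>k. X k p)"
    then obtain k where k: "X k p = z" by auto
    define l where "l = (LEAST k. X k p = z)"
    have "X l p = z" unfolding l_def by (rule LeastI[of _ k]) (rule k)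
    moreover have "X j p \<noteq> z" if "j < l" for j using that unfolding l_def by (rule not_less_Least)
    ultimately show "z \<in> {X k p |k. \<forall>j<k. X j p \<noteq> X k p}" by blast
  qed auto
  have "(\<lambda>p. if locally_finite (range (\<lambda>k. X k p)) then {X k p |k. \<forall>j<k. X j p \<noteq> X k p} else {}) \<in> measurable ?N config_space"
    by (rule points_measurable[OF X live good]) (auto simp: first, metis linorder_neqE_nat)
  moreover have "(\<lambda>p. if locally_finite (range (\<lambda>k. X k p)) then {X k p |k. \<forall>j<k. X j p \<noteq> X k p} else {}) = ren_map"
    unfolding first by (auto simp: ren_map_def X_def fun_eq_iff Let_def)
  ultimately show ?thesis by simp
qed

locale ocp_gap = ocp +
  fixes \<mu> :: "real measure"
  assumes \<mu>: "real_distribution \<mu>" and \<mu>_ge: "AE x in \<mu>. dmin \<le> x"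
begin

lemma prob_\<mu>: "prob_space \<mu>" using \<mu> by (simp add: real_distribution_def)

lemma sets_\<mu> [measurable_cong, simp]: "sets \<mu> = sets borel" using \<mu> by (simp add: real_distribution_def real_distribution_axioms_def)

lemma space_\<mu> [simp]: "space \<mu> = UNIV" using sets_eq_imp_space_eq[OF sets_\<mu>] by simp

definition mkf :: "real \<times> real \<times> real \<Rightarrow> mark" where
  "mkf p = hm (ereal (fst p)) (snd p)"

text \<open>A scaled exponential variable has no atoms, and the atom of an inert domain sits at
  \<open>\<infinity>\<close>.\<close>

lemma hm_diffuse: assumes a: "a < \<infinity>" shows "emeasure W {w \<in> space W. fst (hm d w) = a} = 0"
proof -
  let ?E = "density lborel (exponential_density 1)" and ?U = "uniform_measure lborel {0..1::real}"
  interpret U: prob_space ?U by (rule prob_space_uniform01)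
  define r where "r = rl0 d + rr0 d"
  define N where "N = {e::real. (if 0 < r then ennreal (e / r) else \<infinity>) = a}"
  obtain c where c: "a = ennreal c" "0 \<le> c" using a by (cases a) auto
  have [measurable]: "N \<in> sets borel" unfolding N_def by measurable
  have ae: "AE e in lborel. ennreal (exponential_density 1 e) * indicator N e = 0"
  proof -
    have "AE e in lborel. e \<noteq> (0::real)" "AE e in lborel. e \<noteq> r * c" by (rule AE_lborel_singleton)+
    then show "AE e in lborel. ennreal (exponential_density 1 e) * indicator N e = 0"
    proof eventually_elim
      case (elim e)
      show ?case
      \<comment> \<open>Negative values are truncated to \<open>0\<close> by \<open>ennreal\<close>
        and may lie in \<open>N\<close>, but there the density vanishes.\<close>
      proof (cases "e < 0")
        case True then show ?thesis by (simp add: exponential_density_def)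
      next
        case False
        have "e \<notin> N"
        proof
          assume "e \<in> N"
          then have r: "0 < r" "ennreal (e / r) = ennreal c" using a by (auto simp: N_def c split: if_splits)
          then have "e / r = c" using False c by simp
          then show False using elim r by (simp add: field_simps)
        qed
        then show ?thesis by simp
      qed
    qed
  qed
  have "emeasure ?E N = (\<integral>\<^sup>+e. ennreal (exponential_density 1 e) * indicator N e \<partial>lborel)"
    by (rule emeasure_density) auto
  also have "\<dots> = 0"
    using ae by (subst nn_integral_0_iff_AE) auto
  finally have "emeasure ?E N = 0" .
  moreover have "{w \<in> space W. fst (hm d w) = a} = N \<times> UNIV"
    by (auto simp: hm_def N_def r_def W_def space_pair_measure)
  ultimately show ?thesis
    unfolding W_def using U.emeasure_pair_measure_Times[of N ?E UNIV] by simp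
qed

lemma marked_renewal_mkf: "marked_renewal (\<mu> \<Otimes>\<^sub>M W) fst mkf dmin"
proof -
  interpret \<mu>: prob_space \<mu> by (rule prob_\<mu>)
  interpret W: prob_space W by (rule prob_space_W)
  interpret P: pair_prob_space \<mu> W ..
  have mk [measurable]: "mkf \<in> measurable (\<mu> \<Otimes>\<^sub>M W) mark_space"
    unfolding mkf_def by measurable
  show ?thesis
  proof
    show "fst \<in> borel_measurable (\<mu> \<Otimes>\<^sub>M W)" by measurable
    show "mkf \<in> measurable (\<mu> \<Otimes>\<^sub>M W) mark_space" by (rule mk)
    show "0 < dmin" by (rule dmin_pos)
    show "AE x in \<mu> \<Otimes>\<^sub>M W. dmin \<le> fst x" by (rule AE_pair_fst[OF prob_\<mu> prob_space_W \<mu>_ge])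
    fix a :: ennreal assume a: "a < \<infinity>"
    have [measurable]: "(\<lambda>x. fst (mkf x)) \<in> borel_measurable (\<mu> \<Otimes>\<^sub>M W)" by measurable
    have "{x \<in> space (\<mu> \<Otimes>\<^sub>M W). fst (mkf x) = a} \<in> sets (\<mu> \<Otimes>\<^sub>M W)" by measurable
    then have "emeasure (\<mu> \<Otimes>\<^sub>M W) {x \<in> space (\<mu> \<Otimes>\<^sub>M W). fst (mkf x) = a} =
        (\<integral>\<^sup>+g. emeasure W (Pair g -` {x \<in> space (\<mu> \<Otimes>\<^sub>M W). fst (mkf x) = a}) \<partial>\<mu>)"
      by (rule W.emeasure_pair_measure_alt)
    also have "\<dots> = (\<integral>\<^sup>+g. 0 \<partial>\<mu>)"
    proof (rule nn_integral_cong)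
      fix g
      have "Pair g -` {x \<in> space (\<mu> \<Otimes>\<^sub>M W). fst (mkf x) = a} = {w \<in> space W. fst (hm (ereal g) w) = a}"
        by (auto simp: space_pair_measure mkf_def)
      then show "emeasure W (Pair g -` {x \<in> space (\<mu> \<Otimes>\<^sub>M W). fst (mkf x) = a}) = 0"
        using hm_diffuse[OF a] by simp
    qed
    finally show "emeasure (\<mu> \<Otimes>\<^sub>M W) {x \<in> space (\<mu> \<Otimes>\<^sub>M W). fst (mkf x) = a} = 0" by simp
  qed
qed

sublocale R: marked_renewal "\<mu> \<Otimes>\<^sub>M W" fst mkf dmin by (rule marked_renewal_mkf)

text \<open>The half-line to the left, reflected so that it extends to the right; its domains are
  the same with the coins exchanged.\<close>

sublocale L: marked_renewal "\<mu> \<Otimes>\<^sub>M W" fst "\<lambda>x. flip (mkf x)" dmin by (rule R.marked_renewal_flip)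

abbreviation "PW \<equiv> \<Pi>\<^sub>M i\<in>(UNIV :: nat set). W"
abbreviation "P\<mu> \<equiv> \<Pi>\<^sub>M i\<in>(UNIV :: nat set). \<mu>"

lemma prob_PW: "prob_space PW" and prob_P\<mu>: "prob_space P\<mu>" and prob_S: "prob_space R.S"
  by (intro prob_space_PiM prob_space_W prob_\<mu> R.prob_space_axioms)+

definition okg :: "(nat \<Rightarrow> real \<times> real \<times> real) \<Rightarrow> bool" where
  "okg y \<longleftrightarrow> (\<forall>i. dmin \<le> fst (y i))"

lemma okg_measurable [measurable]: "Measurable.pred R.S okg"
  unfolding okg_def by measurable

lemma AE_okg: "AE y in R.S. okg y"
  using R.AE_gp by (simp add: okg_def)

subsection \<open>Half-line configurations\<close>

text \<open>\<open>OS\<close> is the set of survivors of a half-line configuration as a function of its first point, its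
  gaps and the noise; \<open>{}\<close> is a junk value off the almost sure event \<open>okg\<close>. Likewise \<open>TS\<close> below for
  configurations that are unbounded to both sides and contain the origin.\<close>

definition OS :: "ennreal \<Rightarrow> real \<times> (nat \<Rightarrow> real \<times> real \<times> real) \<Rightarrow> real set" where
  "OS t p = (if okg (snd p) then {fst p + R.psum (snd p) k |k. surv t (R.marks_of (snd p)) k} else {})"

lemma psum_strict_mono: "okg y \<Longrightarrow> strict_mono (R.psum y)"
  using dmin_pos by (intro strict_monoI_Suc) (auto simp: R.psum_def okg_def intro: less_le_trans)

lemma psum_separated: "okg y \<Longrightarrow> R.psum y i < R.psum y j \<Longrightarrow> dmin \<le> R.psum y j - R.psum y i"
proof -
  assume ok: "okg y" and lt: "R.psum y i < R.psum y j"
  then have "i < j" using psum_strict_mono[OF ok] by (simp add: strict_mono_less)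
  then have "R.psum y (Suc i) \<le> R.psum y j" using psum_strict_mono[OF ok] by (simp add: strict_mono_less_eq)
  moreover have "dmin \<le> R.psum y (Suc i) - R.psum y i" using ok by (simp add: R.psum_def okg_def)
  ultimately show ?thesis by simp
qed

lemma OS_min_configs: "OS t p \<in> min_configs dmin"
proof (cases "okg (snd p)")
  case True
  show ?thesis
    by (rule separated_min_configs[OF dmin_pos]) (use True psum_separated[OF True] in \<open>auto simp: OS_def\<close>)
qed (simp add: OS_def min_configs_iff locally_finite_def)

lemma OS_measurable [measurable]: "OS t \<in> measurable (borel \<Otimes>\<^sub>M R.S) config_space"
  unfolding OS_def
proof (rule points_measurable)
  show "(\<lambda>p. fst p + R.psum (snd p) k) \<in> borel_measurable (borel \<Otimes>\<^sub>M R.S)" for k by measurable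
  show "Measurable.pred (borel \<Otimes>\<^sub>M R.S) (\<lambda>p. surv t (R.marks_of (snd p)) k)" for k by measurable
  show "Measurable.pred (borel \<Otimes>\<^sub>M R.S) (\<lambda>p. okg (snd p))" by measurable
  fix p :: "real \<times> (nat \<Rightarrow> real \<times> real \<times> real)" assume ok: "okg (snd p)"
  show "locally_finite {fst p + R.psum (snd p) k |k. surv t (R.marks_of (snd p)) k}"
    using OS_min_configs[of t p] ok by (simp add: OS_def min_configs_iff)
  show "fst p + R.psum (snd p) i = fst p + R.psum (snd p) j \<Longrightarrow> i = j" for i j
    using psum_strict_mono[OF ok] by (simp add: strict_mono_eq)
qed

lemma nn_integral_comb:
  assumes [measurable]: "F \<in> borel_measurable (\<Pi>\<^sub>M i\<in>(UNIV :: int set). N)" and N: "prob_space N"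
  shows "(\<integral>\<^sup>+u. F u \<partial>(\<Pi>\<^sub>M i\<in>(UNIV :: int set). N)) =
    (\<integral>\<^sup>+a. \<integral>\<^sup>+b. F (comb a b) \<partial>(\<Pi>\<^sub>M i\<in>(UNIV :: nat set). N) \<partial>(\<Pi>\<^sub>M i\<in>(UNIV :: nat set). N))"
proof -
  interpret PN: prob_space "\<Pi>\<^sub>M i\<in>(UNIV :: nat set). N" by (intro prob_space_PiM N)
  have "(\<integral>\<^sup>+u. F u \<partial>(\<Pi>\<^sub>M i\<in>(UNIV :: int set). N)) = (\<integral>\<^sup>+p. F (comb (fst p) (snd p)) \<partial>((\<Pi>\<^sub>M i\<in>(UNIV :: nat set). N) \<Otimes>\<^sub>M (\<Pi>\<^sub>M i\<in>(UNIV :: nat set). N)))"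
    by (subst distr_comb[OF N, symmetric], rule nn_integral_distr) measurable
  also have "\<dots> = (\<integral>\<^sup>+a. \<integral>\<^sup>+b. F (comb a b) \<partial>(\<Pi>\<^sub>M i\<in>(UNIV :: nat set). N) \<partial>(\<Pi>\<^sub>M i\<in>(UNIV :: nat set). N))"
    by (subst PN.nn_integral_fst[symmetric]) (use measurable_compose[OF comb_measurable assms(1)] in simp_all)
  finally show ?thesis .
qed

text \<open>The domains are labelled by their indices. The path becomes an explicit function of gaps
  and noise, and integration against the kernel becomes integration over the noise.\<close>

lemma kernel_half:
  assumes g: "\<And>i. dmin \<le> g i" and f [measurable]: "f \<in> borel_measurable config_space"
  shows "range (\<lambda>k. x0 + (\<Sum>i<k. g i)) \<in> min_configs dmin"
    and "(\<integral>\<^sup>+\<eta>. f \<eta> \<partial>ocp_kernel rl rr t (range (\<lambda>k. x0 + (\<Sum>i<k. g i)))) = (\<integral>\<^sup>+u. f (OS t (x0, \<lambda>n. (g n, u n))) \<partial>PW)"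
proof -
  \<comment> \<open>The gaps \<open>dmin\<close> on the left are dummies that extend
    \<open>x\<close> to a strictly increasing map on the integers; only indices in \<open>J\<close>
    belong to \<open>\<xi>\<close>.\<close>
  define x where "x i = x0 + pos2 g (\<lambda>_. dmin) i" for i
  define J where "J = {0::int..}"
  define X where "X = (\<lambda>i. if i \<in> J then ereal (x i) else - \<infinity>)"
  define \<xi> where "\<xi> = range (\<lambda>k. x0 + (\<Sum>i<k. g i))"
  have gp: "0 < g i" for i using g[of i] dmin_pos by simp
  have dx: "dmin \<le> x (i + 1) - x i" for i
    using pos2_diff[of g "\<lambda>_. dmin" "i + 1"] g by (auto simp: x_def comb_def)
  have sm: "strict_mono x" by (rule strict_mono_int) (use dx dmin_pos in \<open>smt (verit)\<close>)
  have xn: "x (int n) = x0 + (\<Sum>i<n. g i)" for n by (simp add: x_def pos2_def)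
  have Jn: "J = range int" by (auto simp: J_def intro!: image_eqI[of _ int "nat _"])
  have \<xi>: "\<xi> = x ` J" unfolding Jn image_image xn \<xi>_def ..
  have min: "\<xi> \<in> min_configs dmin"
    unfolding \<xi> by (rule separated_min_configs[OF dmin_pos]) (use gaps_separated[of dmin x, OF dmin_pos dx] in auto)
  then show "range (\<lambda>k. x0 + (\<Sum>i<k. g i)) \<in> min_configs dmin" by (simp add: \<xi>_def)
  have dom: "domains \<xi> = {(X i, X (i + 1)) |i. i + 1 \<in> J}"
    unfolding \<xi> J_def X_def using domains_half_range[OF sm] by auto
  have Xeq: "X (i + 1) = X (j + 1) \<longleftrightarrow> i = j" if "i + 1 \<in> J" for i j
    using that sm by (auto simp: X_def strict_mono_eq)
  \<comment> \<open>The shift by one fits \<open>comb\<close>: domains with \<open>i \<ge> 0\<close>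
    get positive labels, the unbounded domain gets label \<open>0\<close>.\<close>
  define lab where "lab \<Delta> = (THE i. i + 1 \<in> J \<and> \<Delta> = (X i, X (i + 1))) + 1" for \<Delta>
  have lab: "lab (X i, X (i + 1)) = i + 1" if "i + 1 \<in> J" for i
    unfolding lab_def using that Xeq[of i] by (auto intro!: the_equality)
  have inj: "inj_on lab (domains \<xi>)"
    unfolding dom inj_on_def by (auto simp: lab)
  have path: "ocp_path \<xi> (\<lambda>\<Delta>. hm (dom_length \<Delta>) (u (lab \<Delta>))) t = OS t (x0, \<lambda>n. (g n, u (int n + 1)))" for u
  proof -
    let ?y = "\<lambda>n. (g n, u (int n + 1))"
    have "ocp_path \<xi> (\<lambda>\<Delta>. hm (dom_length \<Delta>) (u (lab \<Delta>))) t = {x k |k. k \<in> J \<and> \<not> idel (half (R.marks_of ?y)) t k}"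
    proof (rule ocp_path_index[OF X_def dom sm \<xi>])
      fix i assume i: "i \<in> J"
      then have "i + 1 \<in> J" by (simp add: J_def)
      have "x (i + 1) - x i = g (nat i)"
        using pos2_diff[of g "\<lambda>_. dmin" "i + 1"] i by (simp add: x_def comb_def J_def)
      then show "half (R.marks_of ?y) i = hm (dom_length (X i, X (i + 1))) (u (lab (X i, X (i + 1))))"
        using i \<open>i + 1 \<in> J\<close> lab[OF \<open>i + 1 \<in> J\<close>]
        by (simp add: half_def R.marks_of_def mkf_def J_def X_def dom_length_def)
    next
      fix i assume "i \<notin> J"
      then show "fst (half (R.marks_of ?y) i) = \<infinity>" by (simp add: half_def J_def)
    next
      fix i assume i: "i \<notin> J" "i + 1 \<in> J"
      then have "dom_length (X i, X (i + 1)) = \<infinity>" by (simp add: dom_length_def X_def)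
      then show "clock (\<lambda>\<Delta>. hm (dom_length \<Delta>) (u (lab \<Delta>))) (X i, X (i + 1)) = \<infinity>"
        unfolding clock_def by (subst hm_inert) auto
    qed (simp add: J_def)
    also have "\<dots> = {x0 + R.psum ?y k |k. surv t (R.marks_of ?y) k}"
      unfolding Jn surv_def by (force simp: xn R.psum_def)
    also have "\<dots> = OS t (x0, ?y)"
      using g by (simp add: OS_def okg_def)
    finally show ?thesis .
  qed
  have meas: "(\<lambda>u. f (OS t (x0, \<lambda>n. (g n, u (int n + 1))))) \<in> borel_measurable (\<Pi>\<^sub>M i\<in>(UNIV :: int set). W)"
    unfolding path[symmetric] by (rule measurable_compose[OF nn_integral_kernel(2)[OF min inj f] f])
  interpret PW: prob_space PW by (rule prob_PW)
  have "(\<integral>\<^sup>+\<eta>. f \<eta> \<partial>ocp_kernel rl rr t \<xi>) = (\<integral>\<^sup>+u. f (OS t (x0, \<lambda>n. (g n, u (int n + 1)))) \<partial>(\<Pi>\<^sub>M i\<in>(UNIV :: int set). W))"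
    using nn_integral_kernel(1)[OF min inj f, of t] by (simp only: path)
  also have "\<dots> = (\<integral>\<^sup>+a. \<integral>\<^sup>+b. f (OS t (x0, \<lambda>n. (g n, comb a b (int n + 1)))) \<partial>PW \<partial>PW)"
    by (rule nn_integral_comb[OF meas prob_space_W])
  also have "\<dots> = (\<integral>\<^sup>+u. f (OS t (x0, \<lambda>n. (g n, u n))) \<partial>PW)"
    \<comment> \<open>The path reads positive labels only, so the second noise sequence integrates
      to one.\<close>
    by (simp add: comb_def PW.emeasure_space_1)
  finally show "(\<integral>\<^sup>+\<eta>. f \<eta> \<partial>ocp_kernel rl rr t (range (\<lambda>k. x0 + (\<Sum>i<k. g i)))) = (\<integral>\<^sup>+u. f (OS t (x0, \<lambda>n. (g n, u n))) \<partial>PW)"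
    unfolding \<xi>_def .
qed

lemma AE_P\<mu>: "AE g in P\<mu>. \<forall>i. dmin \<le> g i"
proof -
  interpret product_prob_space "\<lambda>_. \<mu>" "UNIV :: nat set" by (intro product_prob_spaceI prob_\<mu>)
  show ?thesis unfolding AE_all_countable using \<mu>_ge by (intro allI AE_component) auto
qed

lemma ren_map_ok:
  assumes "\<And>i. dmin \<le> g i"
  shows "ren_map (x0, g) = range (\<lambda>k. x0 + (\<Sum>i<k. g i))" "ren_map (x0, g) \<in> min_configs dmin"
  using kernel_half(1)[OF assms, of "\<lambda>_. 0" x0] by (simp_all add: ren_map_def Let_def min_configs_iff)

context
  fixes \<nu> assumes \<nu>: "real_distribution \<nu>"
begin

lemma prob_\<nu>: "prob_space \<nu>" using \<nu> by (simp add: real_distribution_def)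

lemma sets_\<nu> [measurable_cong]: "sets \<nu> = sets borel"
  using \<nu> by (simp add: real_distribution_def real_distribution_axioms_def)

lemma sets_P\<mu> [measurable_cong]: "sets P\<mu> = sets (\<Pi>\<^sub>M i\<in>(UNIV :: nat set). borel)"
  by (rule sets_PiM_cong) auto

lemma AE_ren: "AE p in \<nu> \<Otimes>\<^sub>M P\<mu>. \<forall>i. dmin \<le> snd p i"
  by (rule AE_pair_snd[OF prob_\<nu> prob_P\<mu> AE_P\<mu>])

lemma is_spp_Ren: "is_spp_law (Ren \<nu> \<mu>)"
proof -
  interpret \<nu>: prob_space \<nu> by (rule prob_\<nu>)
  interpret P\<mu>: prob_space P\<mu> by (rule prob_P\<mu>)
  interpret P: pair_prob_space \<nu> P\<mu> ..
  show ?thesis unfolding is_spp_law_def Ren_eq by (simp add: P.prob_space_distr)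
qed

lemma Ren_min: "AE \<xi> in Ren \<nu> \<mu>. \<xi> \<in> min_configs dmin"
  unfolding Ren_eq
proof (subst AE_distr_iff)
  show "AE p in \<nu> \<Otimes>\<^sub>M P\<mu>. ren_map p \<in> min_configs dmin"
    using AE_ren by eventually_elim (metis prod.collapse ren_map_ok(2))
qed measurable

text \<open>The kernel integrated over renewal configurations is an iterated integral over starting
  point, gaps and noise; pairing each gap with its noise gives the space \<open>R.S\<close> of
  marked domains.\<close>

lemma ocp_half:
  assumes f [measurable]: "f \<in> borel_measurable config_space"
  shows "(\<integral>\<^sup>+\<eta>. f \<eta> \<partial>ocp_law dmin rl rr (Ren \<nu> \<mu>) t) = (\<integral>\<^sup>+p. f (OS t p) \<partial>(\<nu> \<Otimes>\<^sub>M R.S))"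
proof -
  interpret \<nu>: prob_space \<nu> by (rule prob_\<nu>)
  interpret P\<mu>: prob_space P\<mu> by (rule prob_P\<mu>)
  interpret PW: prob_space PW by (rule prob_PW)
  interpret S: prob_space R.S by (rule prob_S)
  note [measurable] = distr_zip(2)[OF prob_\<mu> prob_space_W]
  have OSm: "(\<lambda>p. f (OS t p)) \<in> borel_measurable (\<nu> \<Otimes>\<^sub>M R.S)" by measurable
  have "(\<integral>\<^sup>+\<eta>. f \<eta> \<partial>ocp_law dmin rl rr (Ren \<nu> \<mu>) t) =
      (\<integral>\<^sup>+\<xi>. (\<integral>\<^sup>+\<eta>. f \<eta> \<partial>ocp_kernel rl rr t \<xi>) * indicator (min_configs dmin) \<xi> \<partial>Ren \<nu> \<mu>)"
    by (rule nn_integral_ocp_law[OF is_spp_Ren Ren_min f])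
  also have "\<dots> = (\<integral>\<^sup>+p. (\<integral>\<^sup>+\<eta>. f \<eta> \<partial>ocp_kernel rl rr t (ren_map p)) * indicator (min_configs dmin) (ren_map p) \<partial>(\<nu> \<Otimes>\<^sub>M P\<mu>))"
    unfolding Ren_eq using kernel_integral_measurable[OF is_spp_Ren Ren_min f, of t]
    by (intro nn_integral_distr) simp_all
  also have "\<dots> = (\<integral>\<^sup>+p. (\<integral>\<^sup>+u. f (OS t (fst p, \<lambda>n. (snd p n, u n))) \<partial>PW) \<partial>(\<nu> \<Otimes>\<^sub>M P\<mu>))"
  proof (rule nn_integral_cong_AE)
    show "AE p in \<nu> \<Otimes>\<^sub>M P\<mu>. (\<integral>\<^sup>+\<eta>. f \<eta> \<partial>ocp_kernel rl rr t (ren_map p)) * indicator (min_configs dmin) (ren_map p) =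
        (\<integral>\<^sup>+u. f (OS t (fst p, \<lambda>n. (snd p n, u n))) \<partial>PW)"
      using AE_ren
    proof eventually_elim
      case (elim p)
      then have "\<And>i. dmin \<le> snd p i" by blast
      then show ?case
        using ren_map_ok[of "snd p" "fst p"] kernel_half(2)[of "snd p" f t "fst p"] by simp
    qed
  qed
  also have "\<dots> = (\<integral>\<^sup>+x0. \<integral>\<^sup>+g. (\<integral>\<^sup>+u. f (OS t (x0, \<lambda>n. (g n, u n))) \<partial>PW) \<partial>P\<mu> \<partial>\<nu>)"
  proof -
    have "(\<lambda>q. (fst (fst q), \<lambda>n. (snd (fst q) n, snd q n))) \<in> measurable ((\<nu> \<Otimes>\<^sub>M P\<mu>) \<Otimes>\<^sub>M PW) (\<nu> \<Otimes>\<^sub>M R.S)"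
      using measurable_compose[OF _ distr_zip(2)[OF prob_\<mu> prob_space_W], of "\<lambda>q. (snd (fst q), snd q)" "(\<nu> \<Otimes>\<^sub>M P\<mu>) \<Otimes>\<^sub>M PW"]
      by (intro measurable_Pair) simp_all
    then have "(\<lambda>q. f (OS t (fst (fst q), \<lambda>n. (snd (fst q) n, snd q n)))) \<in> borel_measurable ((\<nu> \<Otimes>\<^sub>M P\<mu>) \<Otimes>\<^sub>M PW)"
      by (rule measurable_compose[OF _ OSm])
    then have "(\<lambda>p. (\<integral>\<^sup>+u. f (OS t (fst p, \<lambda>n. (snd p n, u n))) \<partial>PW)) \<in> borel_measurable (\<nu> \<Otimes>\<^sub>M P\<mu>)"
      by (intro PW.borel_measurable_nn_integral) (simp add: case_prod_beta)
    then show ?thesis by (subst P\<mu>.nn_integral_fst[symmetric]) simp_all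
  qed
  also have "\<dots> = (\<integral>\<^sup>+x0. \<integral>\<^sup>+y. f (OS t (x0, y)) \<partial>R.S \<partial>\<nu>)"
  proof (rule nn_integral_cong)
    fix x0 assume "x0 \<in> space \<nu>"
    then have "(\<lambda>y. f (OS t (x0, y))) \<in> borel_measurable R.S"
      by measurable
    then show "(\<integral>\<^sup>+g. (\<integral>\<^sup>+u. f (OS t (x0, \<lambda>n. (g n, u n))) \<partial>PW) \<partial>P\<mu>) = (\<integral>\<^sup>+y. f (OS t (x0, y)) \<partial>R.S)"
      by (rule nn_integral_zip[OF prob_\<mu> prob_space_W])
  qed
  also have "\<dots> = (\<integral>\<^sup>+p. f (OS t p) \<partial>(\<nu> \<Otimes>\<^sub>M R.S))"
    using OSm by (subst R.seq.nn_integral_fst[symmetric]) simp_all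
  finally show ?thesis .
qed

lemma OS_eq:
  assumes "Good (R.marks_of y)" "okg y"
  shows "OS t (x0, y) = ren_map (x0 + R.first_pos t y, R.gaps_of t (R.start t y))"
proof -
  have "OS t (x0, y) = (\<lambda>z. x0 + z) ` {R.psum y k |k. surv t (R.marks_of y) k}"
    using assms(2) by (auto simp: OS_def)
  also have "\<dots> = range (\<lambda>n. x0 + R.first_pos t y + (\<Sum>i<n. R.gaps_of t (R.start t y) i))"
    unfolding R.surv_points_eq_start[OF assms(1)] by (simp add: image_image add.assoc)
  finally have *: "OS t (x0, y) = range (\<lambda>n. x0 + R.first_pos t y + (\<Sum>i<n. R.gaps_of t (R.start t y) i))" .
  moreover have "locally_finite (OS t (x0, y))" using OS_min_configs[of t "(x0, y)"] by (simp add: min_configs_iff)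
  ultimately show ?thesis by (simp add: ren_map_def Let_def)
qed

text \<open>Almost surely the evolved configuration is \<open>ren_map\<close> of the first survivor
  and the gaps after it, and their joint law is the product that defines \<open>Ren\<close>.\<close>

theorem ocp_Ren: "ocp_law dmin rl rr (Ren \<nu> \<mu>) t = Ren (R.start_law \<nu> t) (R.gap_law t)"
proof (rule measure_eqI)
  note s = sets_ocp_law[OF is_spp_Ren Ren_min]
  show "sets (ocp_law dmin rl rr (Ren \<nu> \<mu>) t) = sets (Ren (R.start_law \<nu> t) (R.gap_law t))"
    unfolding s by (simp add: Ren_eq)
  fix A assume "A \<in> sets (ocp_law dmin rl rr (Ren \<nu> \<mu>) t)"
  then have [measurable]: "A \<in> sets config_space" by (simp add: s)
  let ?B = "borel \<Otimes>\<^sub>M (\<Pi>\<^sub>M i\<in>(UNIV :: nat set). borel) :: (real \<times> (nat \<Rightarrow> real)) measure"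
  let ?h = "\<lambda>(x, y). (x + R.first_pos t y, R.gaps_of t (R.start t y))"
  have h [measurable]: "?h \<in> measurable (\<nu> \<Otimes>\<^sub>M R.S) ?B" by measurable
  have "emeasure (ocp_law dmin rl rr (Ren \<nu> \<mu>) t) A = (\<integral>\<^sup>+\<eta>. indicator A \<eta> \<partial>ocp_law dmin rl rr (Ren \<nu> \<mu>) t)"
    by (rule nn_integral_indicator[symmetric]) (simp add: s)
  also have "\<dots> = (\<integral>\<^sup>+p. indicator A (OS t p) \<partial>(\<nu> \<Otimes>\<^sub>M R.S))"
    by (rule ocp_half) measurable
  also have "\<dots> = (\<integral>\<^sup>+p. indicator A (ren_map (?h p)) \<partial>(\<nu> \<Otimes>\<^sub>M R.S))"
  proof (rule nn_integral_cong_AE)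
    show "AE p in \<nu> \<Otimes>\<^sub>M R.S. indicator A (OS t p) = (indicator A (ren_map (?h p)) :: ennreal)"
      using AE_pair_snd[OF prob_\<nu> prob_S R.AE_Good] AE_pair_snd[OF prob_\<nu> prob_S AE_okg]
    proof eventually_elim
      case (elim p)
      then show ?case using OS_eq[of "snd p" t "fst p"] by (simp add: case_prod_beta)
    qed
  qed
  also have "\<dots> = (\<integral>\<^sup>+q. indicator A (ren_map q) \<partial>distr (\<nu> \<Otimes>\<^sub>M R.S) ?B ?h)"
    by (rule nn_integral_distr[symmetric]) measurable
  also have "distr (\<nu> \<Otimes>\<^sub>M R.S) ?B ?h = R.start_law \<nu> t \<Otimes>\<^sub>M (\<Pi>\<^sub>M i\<in>(UNIV :: nat set). R.gap_law t)"
    by (rule R.distr_start_gaps[OF \<nu>])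
  also have "(\<integral>\<^sup>+q. indicator A (ren_map q) \<partial>(R.start_law \<nu> t \<Otimes>\<^sub>M (\<Pi>\<^sub>M i\<in>(UNIV :: nat set). R.gap_law t))) =
      emeasure (Ren (R.start_law \<nu> t) (R.gap_law t)) A"
    unfolding Ren_eq
  proof (rule emeasure_distr_indicator[symmetric])
    have "sets (R.start_law \<nu> t \<Otimes>\<^sub>M (\<Pi>\<^sub>M i\<in>(UNIV :: nat set). R.gap_law t)) = sets ?B"
      by (intro sets_pair_measure_cong sets_PiM_cong) (auto simp: R.start_law_def)
    then show "ren_map \<in> measurable (R.start_law \<nu> t \<Otimes>\<^sub>M (\<Pi>\<^sub>M i\<in>(UNIV :: nat set). R.gap_law t)) config_space"
      using ren_map_measurable by (simp cong: measurable_cong_sets)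
  qed measurable
  finally show "emeasure (ocp_law dmin rl rr (Ren \<nu> \<mu>) t) A = emeasure (Ren (R.start_law \<nu> t) (R.gap_law t)) A" .
qed

end

lemma real_distribution_return0: "real_distribution (return borel 0)"
  by (simp add: real_distribution_def real_distribution_axioms_def prob_space_return)

lemma nn_integral_return0_pair:
  assumes [measurable]: "h \<in> borel_measurable (borel \<Otimes>\<^sub>M N)" and N: "prob_space N"
  shows "(\<integral>\<^sup>+p. h p \<partial>(return borel (0::real) \<Otimes>\<^sub>M N)) = (\<integral>\<^sup>+y. h (0, y) \<partial>N)"
proof -
  interpret N: prob_space N by (rule N)
  have "h \<in> borel_measurable (return borel 0 \<Otimes>\<^sub>M N)"
    using assms(1) by (subst measurable_cong_sets[OF sets_pair_measure_cong[OF sets_return refl] refl])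
  then have "(\<integral>\<^sup>+p. h p \<partial>(return borel 0 \<Otimes>\<^sub>M N)) = (\<integral>\<^sup>+x. \<integral>\<^sup>+y. h (x, y) \<partial>N \<partial>return borel 0)"
    by (rule N.nn_integral_fst[symmetric])
  also have "\<dots> = (\<integral>\<^sup>+y. h (0, y) \<partial>N)"
    by (rule nn_integral_return) measurable
  finally show ?thesis .
qed

text \<open>Gaps are positive, so the evolved configuration contains \<open>0\<close> iff the
  initial point there survives. Conditioning on this is the conditioning in \<open>SR t\<close>,
  under which the gaps are i.i.d.\<close>

theorem ocp_Ren_origin:
  "cond_origin (ocp_law dmin rl rr (Ren (return borel 0) \<mu>) t) = Ren (return borel 0) (R.gap_law t)"
proof (rule measure_eqI)
  let ?\<delta> = "return borel (0::real)"
  let ?Qt = "ocp_law dmin rl rr (Ren ?\<delta> \<mu>) t"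
  let ?O = "{\<xi> \<in> space config_space. 0 \<in> \<xi>}"
  note \<delta> = real_distribution_return0
  note s = sets_ocp_law[OF is_spp_Ren[OF \<delta>] Ren_min[OF \<delta>]]
  show "sets (cond_origin ?Qt) = sets (Ren ?\<delta> (R.gap_law t))"
    unfolding cond_origin_def by (simp add: s) (simp add: Ren_eq)
  have [measurable]: "?O \<in> sets config_space" by measurable
  have O: "emeasure ?Qt (?O \<inter> A) = emeasure R.S (R.surv0 t) * (\<integral>\<^sup>+y. indicator A (ren_map (0, R.gaps_of t y)) \<partial>R.SR t)"
    if [measurable]: "A \<in> sets config_space" for A
  proof -
    have "emeasure ?Qt (?O \<inter> A) = (\<integral>\<^sup>+\<eta>. indicator (?O \<inter> A) \<eta> \<partial>?Qt)"
      by (rule nn_integral_indicator[symmetric]) (simp add: s)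
    also have "\<dots> = (\<integral>\<^sup>+p. indicator (?O \<inter> A) (OS t p) \<partial>(?\<delta> \<Otimes>\<^sub>M R.S))"
      by (rule ocp_half[OF \<delta>]) measurable
    also have "\<dots> = (\<integral>\<^sup>+y. indicator (?O \<inter> A) (OS t (0, y)) \<partial>R.S)"
      by (rule nn_integral_return0_pair[OF _ prob_S]) measurable
    also have "\<dots> = (\<integral>\<^sup>+y. of_bool (surv t (R.marks_of y) 0) * indicator A (ren_map (0, R.gaps_of t y)) \<partial>R.S)"
    proof (rule nn_integral_cong_AE)
      show "AE y in R.S. indicator (?O \<inter> A) (OS t (0, y)) = (of_bool (surv t (R.marks_of y) 0) * indicator A (ren_map (0, R.gaps_of t y)) :: ennreal)"
        using R.AE_Good AE_okg
      proof eventually_elim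
        case (elim y)
        have "R.psum y k = 0 \<longleftrightarrow> k = 0" for k
          using strict_mono_eq[OF psum_strict_mono[OF elim(2)], of k 0] by (simp add: R.psum_def)
        then have "0 \<in> OS t (0, y) \<longleftrightarrow> surv t (R.marks_of y) 0"
          using elim(2) by (auto simp: OS_def R.psum_def)
        moreover have "OS t (0, y) = ren_map (0, R.gaps_of t y)" if "surv t (R.marks_of y) 0"
        proof -
          have "first_surv {} t (R.marks_of y) = 0" using that by (simp add: first_surv_def)
          then show ?thesis
            using OS_eq[OF \<delta> elim, of t 0] by (simp add: R.first_pos_def R.start_def R.psum_def)
        qed
        moreover have "OS t (0, y) \<in> space config_space"
          using OS_min_configs[of t "(0, y)"] by (simp add: min_configs_iff space_config_space)
        ultimately show ?case by (auto simp: indicator_def)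
      qed
    qed
    also have "\<dots> = (\<integral>\<^sup>+y. indicator A (ren_map (0, R.gaps_of t y)) \<partial>R.SR t) * emeasure R.S (R.surv0 t)"
      by (rule R.nn_integral_surv0) measurable
    finally show ?thesis by (simp add: mult.commute)
  qed
  have p: "emeasure ?Qt ?O = emeasure R.S (R.surv0 t)"
  proof -
    have "?O \<inter> space config_space = ?O" by auto
    moreover have "(\<integral>\<^sup>+y. indicator (space config_space) (ren_map (0, R.gaps_of t y)) \<partial>R.SR t) = (\<integral>\<^sup>+y. 1 \<partial>R.SR t)"
    proof (rule nn_integral_cong)
      fix y
      show "indicator (space config_space) (ren_map (0, R.gaps_of t y)) = (1::ennreal)"
        by (auto simp: ren_map_def Let_def space_config_space locally_finite_def indicator_def)
    qed
    ultimately show ?thesis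
      using O[of "space config_space"] prob_space.emeasure_space_1[OF R.prob_space_SR[of t]] by simp
  qed
  fix A assume "A \<in> sets (cond_origin ?Qt)"
  then have A [measurable]: "A \<in> sets config_space" by (simp add: cond_origin_def s)
  have one: "emeasure R.S (R.surv0 t) / emeasure R.S (R.surv0 t) = 1"
  proof -
    interpret S: prob_space R.S by (rule prob_S)
    show ?thesis using R.emeasure_surv0_pos[of t] by (intro ennreal_divide_self) (auto simp: less_top[symmetric])
  qed
  have "emeasure (cond_origin ?Qt) A = emeasure ?Qt (?O \<inter> A) / emeasure ?Qt ?O"
    unfolding cond_origin_def by (rule emeasure_uniform_measure) (simp_all add: s A)
  also have "\<dots> = (\<integral>\<^sup>+y. indicator A (ren_map (0, R.gaps_of t y)) \<partial>R.SR t)"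
    unfolding O[OF A] p using one by (simp add: divide_ennreal_def mult.assoc mult.left_commute)
  also have "\<dots> = (\<integral>\<^sup>+g. indicator A (ren_map (0, g)) \<partial>(\<Pi>\<^sub>M i\<in>(UNIV :: nat set). R.gap_law t))"
    unfolding R.distr_gaps[symmetric]
  proof (rule nn_integral_distr[symmetric])
    show "R.gaps_of t \<in> measurable (R.SR t) (\<Pi>\<^sub>M i\<in>(UNIV :: nat set). borel)"
      unfolding measurable_cong_sets[OF R.sets_SR refl] by (rule R.gaps_of_measurable)
    show "(\<lambda>g. indicator A (ren_map (0, g)) :: ennreal) \<in> borel_measurable (distr (R.SR t) (\<Pi>\<^sub>M i\<in>(UNIV :: nat set). borel) (R.gaps_of t))"
      unfolding measurable_distr_eq1 by measurable
  qed
  also have "\<dots> = (\<integral>\<^sup>+p. indicator A (ren_map p) \<partial>(?\<delta> \<Otimes>\<^sub>M (\<Pi>\<^sub>M i\<in>(UNIV :: nat set). R.gap_law t)))"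
  proof (rule nn_integral_return0_pair[symmetric])
    have "sets (borel \<Otimes>\<^sub>M (\<Pi>\<^sub>M i\<in>(UNIV :: nat set). R.gap_law t)) = sets (borel \<Otimes>\<^sub>M (\<Pi>\<^sub>M i\<in>(UNIV :: nat set). borel) :: (real \<times> (nat \<Rightarrow> real)) measure)"
      by (intro sets_pair_measure_cong sets_PiM_cong) auto
    then have "ren_map \<in> measurable (borel \<Otimes>\<^sub>M (\<Pi>\<^sub>M i\<in>(UNIV :: nat set). R.gap_law t)) config_space"
      using ren_map_measurable by (simp cong: measurable_cong_sets)
    then show "(\<lambda>p. indicator A (ren_map p)) \<in> borel_measurable (borel \<Otimes>\<^sub>M (\<Pi>\<^sub>M i\<in>(UNIV :: nat set). R.gap_law t))"
      by measurable
  qed (intro prob_space_PiM R.prob_space_gap_law)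
  also have "\<dots> = emeasure (Ren ?\<delta> (R.gap_law t)) A"
    unfolding Ren_eq
  proof (rule emeasure_distr_indicator[symmetric])
    have "sets (?\<delta> \<Otimes>\<^sub>M (\<Pi>\<^sub>M i\<in>(UNIV :: nat set). R.gap_law t)) = sets (borel \<Otimes>\<^sub>M (\<Pi>\<^sub>M i\<in>(UNIV :: nat set). borel) :: (real \<times> (nat \<Rightarrow> real)) measure)"
      by (intro sets_pair_measure_cong sets_PiM_cong) auto
    then show "ren_map \<in> measurable (?\<delta> \<Otimes>\<^sub>M (\<Pi>\<^sub>M i\<in>(UNIV :: nat set). R.gap_law t)) config_space"
      using ren_map_measurable by (simp cong: measurable_cong_sets)
  qed measurable
  finally show "emeasure (cond_origin ?Qt) A = emeasure (Ren ?\<delta> (R.gap_law t)) A" .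
qed

end

section \<open>Two-sided configurations\<close>

lemma (in marked_renewal) gaps_of_pos:
  assumes "Good (marks_of y)" "\<And>i. 0 < gp (y i)"
  shows "0 < gaps_of t y n"
  using assms
proof (induction n arbitrary: y)
  case 0
  have "{..<first_surv {0} t (marks_of y)} \<noteq> {}" using first_surv(3)[OF 0(1), of t] by auto
  then show ?case unfolding gaps_of_0 gap_of_def psum_def using 0(2) by (intro sum_pos) auto
next
  case (Suc n)
  have "Good (marks_of (nxt t y))" "\<And>i. 0 < gp (nxt t y i)"
    using Suc.prems by (auto simp: nxt_def marks_of_sh Good_sh sh_def)
  then show ?case unfolding gaps_of_Suc by (rule Suc.IH)
qed

lemma int_fun_eqI:
  assumes "x 0 = w 0" "\<And>k. x k - x (k - 1) = w k - (w (k - 1) :: real)"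
  shows "x = (w :: int \<Rightarrow> real)"
proof
  fix k show "x k = w k"
  proof (induction k rule: int_induct[where k = 0])
    case base show ?case by (rule assms)
  next
    case (step1 i) then show ?case using assms(2)[of "i + 1"] by simp
  next
    case (step2 i) then show ?case using assms(2)[of i] by simp
  qed
qed

lemma labelling_origin:
  assumes x: "is_labelling \<xi> x" and "0 \<in> \<xi>"
  shows "x 0 = 0"
proof -
  have sm: "strict_mono x" and 0: "x 0 \<le> 0" "0 < x 1" using x by (auto simp: is_labelling_def)
  obtain k where k: "x k = 0" using x assms(2) by (auto simp: is_labelling_def)
  have "k < 1" using sm 0 k strict_mono_less[of x k 1] by simp
  moreover have "\<not> k < 0" using sm 0 k strict_mono_less[of x k 0] by auto
  ultimately have "k = 0" by linarith
  then show ?thesis using k by simp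
qed

context ocp_gap
begin

definition TS :: "ennreal \<Rightarrow> (nat \<Rightarrow> real \<times> real \<times> real) \<times> (nat \<Rightarrow> real \<times> real \<times> real) \<Rightarrow> real set" where
  "TS t p = (if okg (fst p) \<and> okg (snd p) then
     {pos2 (\<lambda>i. fst (fst p i)) (\<lambda>i. fst (snd p i)) k |k. \<not> idel (two_sided (R.marks_of (fst p)) (L.marks_of (snd p))) t k} else {})"

lemma pos2_separated:
  assumes "\<And>i. dmin \<le> a i" "\<And>i. dmin \<le> b i"
  shows "strict_mono (pos2 a b)" "dmin \<le> pos2 a b (k + 1) - pos2 a b k" "range (pos2 a b) \<in> min_configs dmin"
proof -
  have pos: "0 < a i" "0 < b i" for i using assms[of i] dmin_pos by auto
  show "strict_mono (pos2 a b)" by (rule pos2_strict_mono) (rule pos)+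
  show *: "dmin \<le> pos2 a b (k + 1) - pos2 a b k" for k
    using pos2_diff[of a b "k + 1"] assms by (simp add: comb_def)
  show "range (pos2 a b) \<in> min_configs dmin"
    by (rule labelled_min_configs[OF dmin_pos labelling_pos2 *]) (rule pos)+
qed

lemma TS_min_configs: "TS t p \<in> min_configs dmin"
proof (cases "okg (fst p) \<and> okg (snd p)")
  case True
  have "TS t p \<subseteq> range (pos2 (\<lambda>i. fst (fst p i)) (\<lambda>i. fst (snd p i)))" by (auto simp: TS_def)
  moreover have "range (pos2 (\<lambda>i. fst (fst p i)) (\<lambda>i. fst (snd p i))) \<in> min_configs dmin"
    using True by (intro pos2_separated) (auto simp: okg_def)
  ultimately show ?thesis by (rule min_configs_subset[rotated])
next
  case False
  then have "TS t p = {}" unfolding TS_def by (rule if_not_P)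
  then show ?thesis by (simp add: min_configs_iff locally_finite_def)
qed

lemma TS_measurable [measurable]: "TS t \<in> measurable (R.S \<Otimes>\<^sub>M R.S) config_space"
  unfolding TS_def
proof (rule points_measurable)
  show "(\<lambda>p. pos2 (\<lambda>i. fst (fst p i)) (\<lambda>i. fst (snd p i)) k) \<in> borel_measurable (R.S \<Otimes>\<^sub>M R.S)" for k
    unfolding pos2_def by (cases "0 \<le> k") simp_all
  have m: "(\<lambda>p. two_sided (R.marks_of (fst p)) (L.marks_of (snd p)) i) \<in> measurable (R.S \<Otimes>\<^sub>M R.S) mark_space" for i
  proof (cases "0 \<le> i")
    case True
    then show ?thesis unfolding two_sided_def by simp
  next
    case False
    then show ?thesis unfolding two_sided_def L.marks_of_def using R.mk_measurable
      by (simp add: measurable_compose[OF _ R.mk_measurable])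
  qed
  show "Measurable.pred (R.S \<Otimes>\<^sub>M R.S) (\<lambda>p. \<not> idel (two_sided (R.marks_of (fst p)) (L.marks_of (snd p))) t k)" for k
    using pred_idel[OF m] by simp
  show "Measurable.pred (R.S \<Otimes>\<^sub>M R.S) (\<lambda>p. okg (fst p) \<and> okg (snd p))" by measurable
  fix p :: "(nat \<Rightarrow> real \<times> real \<times> real) \<times> (nat \<Rightarrow> real \<times> real \<times> real)" assume ok: "okg (fst p) \<and> okg (snd p)"
  show "locally_finite {pos2 (\<lambda>i. fst (fst p i)) (\<lambda>i. fst (snd p i)) k |k. \<not> idel (two_sided (R.marks_of (fst p)) (L.marks_of (snd p))) t k}"
    using TS_min_configs[of t p] ok by (simp add: TS_def min_configs_iff)
  have "strict_mono (pos2 (\<lambda>i. fst (fst p i)) (\<lambda>i. fst (snd p i)))"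
    using ok by (intro pos2_separated) (auto simp: okg_def)
  then show "pos2 (\<lambda>i. fst (fst p i)) (\<lambda>i. fst (snd p i)) i = pos2 (\<lambda>i. fst (fst p i)) (\<lambda>i. fst (snd p i)) j \<Longrightarrow> i = j" for i j
    by (simp add: strict_mono_eq)
qed

lemma kernel_two:
  assumes a: "\<And>i. dmin \<le> a i" and b: "\<And>i. dmin \<le> b i" and f [measurable]: "f \<in> borel_measurable config_space"
  shows "(\<integral>\<^sup>+\<eta>. f \<eta> \<partial>ocp_kernel rl rr t (range (pos2 a b))) =
    (\<integral>\<^sup>+u. \<integral>\<^sup>+v. f (TS t (\<lambda>n. (a n, u n), \<lambda>n. (b n, v n))) \<partial>PW \<partial>PW)"
proof -
  define x where "x = pos2 a b"
  define X where "X = (\<lambda>i. if i \<in> (UNIV :: int set) then ereal (x i) else - \<infinity>)"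
  note sep = pos2_separated[of a b, OF a b]
  have sm: "strict_mono x" unfolding x_def by (rule sep)
  have min: "range x \<in> min_configs dmin" unfolding x_def by (rule sep)
  have dom: "domains (range x) = {(X i, X (i + 1)) |i. i + 1 \<in> UNIV}"
    using domains_range[OF sm] by (simp add: X_def)
  have Xeq: "X i = X j \<longleftrightarrow> i = j" for i j using sm by (auto simp: X_def strict_mono_eq)
  \<comment> \<open>Domain \<open>i\<close> gets label \<open>i + 1\<close>, the number of its gap,
    in accordance with \<open>comb\<close>.\<close>
  define lab where "lab \<Delta> = (THE i. \<Delta> = (X i, X (i + 1))) + 1" for \<Delta>
  have lab: "lab (X i, X (i + 1)) = i + 1" for i
    unfolding lab_def using Xeq[of i] by (auto intro!: the_equality)
  have inj: "inj_on lab (domains (range x))"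
    unfolding dom inj_on_def by (auto simp: lab)
  let ?y = "\<lambda>u n. (a n, u (int n + 1))" and ?z = "\<lambda>u n. (b n, u (- int n))"
  have path: "ocp_path (range x) (\<lambda>\<Delta>. hm (dom_length \<Delta>) (u (lab \<Delta>))) t = TS t (?y u, ?z u)" for u
  proof -
    have "ocp_path (range x) (\<lambda>\<Delta>. hm (dom_length \<Delta>) (u (lab \<Delta>))) t =
        {x k |k. k \<in> UNIV \<and> \<not> idel (two_sided (R.marks_of (?y u)) (L.marks_of (?z u))) t k}"
    proof (rule ocp_path_index[OF X_def dom sm])
      fix i :: int
      have d: "dom_length (X i, X (i + 1)) = ereal (comb a b (i + 1))"
        using pos2_diff[of a b "i + 1"] by (simp add: dom_length_def X_def x_def)
      show "two_sided (R.marks_of (?y u)) (L.marks_of (?z u)) i = hm (dom_length (X i, X (i + 1))) (u (lab (X i, X (i + 1))))"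
        unfolding d lab
      proof (cases "0 \<le> i")
        case True
        then show "two_sided (R.marks_of (?y u)) (L.marks_of (?z u)) i = hm (ereal (comb a b (i + 1))) (u (i + 1))"
          by (simp add: two_sided_def R.marks_of_def comb_def) (simp add: mkf_def)
      next
        case False
        then show "two_sided (R.marks_of (?y u)) (L.marks_of (?z u)) i = hm (ereal (comb a b (i + 1))) (u (i + 1))"
          by (simp add: two_sided_def L.marks_of_def comb_def) (simp add: mkf_def add.commute minus_diff_commute)
      qed
    qed auto
    also have "\<dots> = TS t (?y u, ?z u)"
      using a b by (simp add: TS_def okg_def x_def)
    finally show ?thesis .
  qed
  have meas: "(\<lambda>u. f (TS t (?y u, ?z u))) \<in> borel_measurable (\<Pi>\<^sub>M i\<in>(UNIV :: int set). W)"
    unfolding path[symmetric] by (rule measurable_compose[OF nn_integral_kernel(2)[OF min inj f] f])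
  have "(\<integral>\<^sup>+\<eta>. f \<eta> \<partial>ocp_kernel rl rr t (range x)) = (\<integral>\<^sup>+u. f (TS t (?y u, ?z u)) \<partial>(\<Pi>\<^sub>M i\<in>(UNIV :: int set). W))"
    using nn_integral_kernel(1)[OF min inj f, of t] by (simp only: path)
  also have "\<dots> = (\<integral>\<^sup>+u. \<integral>\<^sup>+v. f (TS t (?y (comb u v), ?z (comb u v))) \<partial>PW \<partial>PW)"
    by (rule nn_integral_comb[OF meas prob_space_W])
  also have "\<dots> = (\<integral>\<^sup>+u. \<integral>\<^sup>+v. f (TS t (\<lambda>n. (a n, u n), \<lambda>n. (b n, v n))) \<partial>PW \<partial>PW)"
    by (simp add: comb_def)
  finally show ?thesis by (simp add: x_def)
qed

lemma measurable_TS_zip [measurable (raw)]: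
  assumes "fa \<in> measurable N P\<mu>" "fu \<in> measurable N PW" "fb \<in> measurable N P\<mu>" "fv \<in> measurable N PW"
  shows "(\<lambda>p. TS t (\<lambda>n. (fa p n, fu p n), \<lambda>n. (fb p n, fv p n))) \<in> measurable N config_space"
proof -
  have z: "(\<lambda>p n. (g p n, w p n)) \<in> measurable N R.S" if "g \<in> measurable N P\<mu>" "w \<in> measurable N PW" for g w
    using measurable_compose[OF measurable_Pair[OF that] distr_zip(2)[OF prob_\<mu> prob_space_W]] by simp
  show ?thesis
    by (rule measurable_compose[OF measurable_Pair[OF z[OF assms(1,2)] z[OF assms(3,4)]] TS_measurable])
qed

text \<open>Fubini exchanges the gaps on the left with the noise on the right, so that each gap
  stands next to its own noise; both sides are then zipped into \<open>R.S\<close>.\<close>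

lemma nn_integral_TS:
  assumes f [measurable]: "f \<in> borel_measurable config_space"
  shows "(\<integral>\<^sup>+a. \<integral>\<^sup>+b. \<integral>\<^sup>+u. \<integral>\<^sup>+v. f (TS t (\<lambda>n. (a n, u n), \<lambda>n. (b n, v n))) \<partial>PW \<partial>PW \<partial>P\<mu> \<partial>P\<mu>) =
    (\<integral>\<^sup>+y. \<integral>\<^sup>+z. f (TS t (y, z)) \<partial>R.S \<partial>R.S)"
proof -
  interpret PW: prob_space PW by (rule prob_PW)
  interpret P\<mu>: prob_space P\<mu> by (rule prob_P\<mu>)
  interpret PP: pair_prob_space P\<mu> PW ..
  have "(\<integral>\<^sup>+a. \<integral>\<^sup>+b. \<integral>\<^sup>+u. \<integral>\<^sup>+v. f (TS t (\<lambda>n. (a n, u n), \<lambda>n. (b n, v n))) \<partial>PW \<partial>PW \<partial>P\<mu> \<partial>P\<mu>) =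
      (\<integral>\<^sup>+a. \<integral>\<^sup>+u. \<integral>\<^sup>+b. \<integral>\<^sup>+v. f (TS t (\<lambda>n. (a n, u n), \<lambda>n. (b n, v n))) \<partial>PW \<partial>P\<mu> \<partial>PW \<partial>P\<mu>)"
  proof (rule nn_integral_cong)
    fix a assume [measurable]: "a \<in> space P\<mu>"
    have "(\<lambda>q. f (TS t (\<lambda>n. (a n, snd (fst q) n), \<lambda>n. (fst (fst q) n, snd q n)))) \<in> borel_measurable ((P\<mu> \<Otimes>\<^sub>M PW) \<Otimes>\<^sub>M PW)"
      by measurable
    then have "(\<lambda>q. \<integral>\<^sup>+v. f (TS t (\<lambda>n. (a n, snd q n), \<lambda>n. (fst q n, v n))) \<partial>PW) \<in> borel_measurable (P\<mu> \<Otimes>\<^sub>M PW)"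
      by (intro PW.borel_measurable_nn_integral) (simp add: case_prod_beta)
    then show "(\<integral>\<^sup>+b. \<integral>\<^sup>+u. \<integral>\<^sup>+v. f (TS t (\<lambda>n. (a n, u n), \<lambda>n. (b n, v n))) \<partial>PW \<partial>PW \<partial>P\<mu>) =
        (\<integral>\<^sup>+u. \<integral>\<^sup>+b. \<integral>\<^sup>+v. f (TS t (\<lambda>n. (a n, u n), \<lambda>n. (b n, v n))) \<partial>PW \<partial>P\<mu> \<partial>PW)"
      using PP.Fubini[of "\<lambda>q. \<integral>\<^sup>+v. f (TS t (\<lambda>n. (a n, snd q n), \<lambda>n. (fst q n, v n))) \<partial>PW"] by simp
  qed
  also have "\<dots> = (\<integral>\<^sup>+a. \<integral>\<^sup>+u. (\<integral>\<^sup>+z. f (TS t (\<lambda>n. (a n, u n), z)) \<partial>R.S) \<partial>PW \<partial>P\<mu>)"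
  proof (intro nn_integral_cong)
    fix a u assume "a \<in> space P\<mu>" "u \<in> space PW"
    then have "(\<lambda>n. (a n, u n)) \<in> space R.S"
      by (auto simp: space_PiM PiE_def Pi_iff space_pair_measure)
    then have "(\<lambda>z. f (TS t (\<lambda>n. (a n, u n), z))) \<in> borel_measurable R.S"
      by (intro measurable_compose[OF _ f] measurable_compose[OF _ TS_measurable]) measurable
    then show "(\<integral>\<^sup>+b. \<integral>\<^sup>+v. f (TS t (\<lambda>n. (a n, u n), \<lambda>n. (b n, v n))) \<partial>PW \<partial>P\<mu>) =
        (\<integral>\<^sup>+z. f (TS t (\<lambda>n. (a n, u n), z)) \<partial>R.S)"
      by (rule nn_integral_zip[OF prob_\<mu> prob_space_W])
  qed
  also have "\<dots> = (\<integral>\<^sup>+y. \<integral>\<^sup>+z. f (TS t (y, z)) \<partial>R.S \<partial>R.S)"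
  proof (rule nn_integral_zip[OF prob_\<mu> prob_space_W])
    have "(\<lambda>p. f (TS t p)) \<in> borel_measurable (R.S \<Otimes>\<^sub>M R.S)" by measurable
    then show "(\<lambda>y. \<integral>\<^sup>+z. f (TS t (y, z)) \<partial>R.S) \<in> borel_measurable R.S"
      by (intro R.seq.borel_measurable_nn_integral) simp
  qed
  finally show ?thesis .
qed

text \<open>\<open>two_sided_split\<close> decides the fate of the origin. If it survives, both
  sides are half-line processes with positive gaps, so the configuration comes with an explicit
  labelling.\<close>

lemma TS_cases:
  assumes G: "Good (R.marks_of y)" "Good (L.marks_of z)" and ok: "okg y" "okg z"
  shows "0 \<in> TS t (y, z) \<longleftrightarrow> surv t (R.marks_of y) 0 \<and> surv t (L.marks_of z) 0"
    and "0 \<in> TS t (y, z) \<Longrightarrow> is_labelling (TS t (y, z)) (pos2 (R.gaps_of t y) (L.gaps_of t z))"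
    and "TS t (y, z) \<noteq> {}"
proof -
  let ?p = "pos2 (\<lambda>i. fst (y i)) (\<lambda>i. fst (z i))" and ?d = "idel (two_sided (R.marks_of y) (L.marks_of z)) t"
  have TS: "TS t (y, z) = {?p k |k. \<not> ?d k}" using ok by (simp add: TS_def)
  have sm: "strict_mono ?p" using ok by (intro pos2_separated) (auto simp: okg_def)
  have p0: "?p k = 0 \<longleftrightarrow> k = 0" for k using strict_mono_eq[OF sm, of k 0] by simp
  show 0: "0 \<in> TS t (y, z) \<longleftrightarrow> surv t (R.marks_of y) 0 \<and> surv t (L.marks_of z) 0"
    unfolding TS two_sided_split(1)[OF G, symmetric] using p0 by force
  show "TS t (y, z) \<noteq> {}" using two_sided_exists[OF G(1), of "L.marks_of z" t] by (auto simp: TS)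
  assume "0 \<in> TS t (y, z)"
  then have s: "surv t (R.marks_of y) 0" "surv t (L.marks_of z) 0" using 0 by auto
  have pR: "?p (int k) = R.psum y k" for k by (simp add: pos2_def R.psum_def)
  have pL: "?p (- int k) = - L.psum z k" for k by (cases k) (auto simp: pos2_def L.psum_def simp del: of_nat_Suc)
  have "TS t (y, z) = {?p (int k) |k. \<not> ?d (int k)} \<union> {?p (- int k) |k. \<not> ?d (- int k)}"
  proof -
    have ex: "\<exists>n. k = int n \<or> k = - int n" for k by (cases k rule: int_cases2) auto
    show ?thesis
    proof (intro set_eqI iffI)
      fix w assume "w \<in> TS t (y, z)"
      then obtain k where "w = ?p k" "\<not> ?d k" unfolding TS by blast
      moreover obtain n where "k = int n \<or> k = - int n" using ex by blast
      ultimately show "w \<in> {?p (int k) |k. \<not> ?d (int k)} \<union> {?p (- int k) |k. \<not> ?d (- int k)}" by blast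
    qed (auto simp: TS)
  qed
  also have "{?p (int k) |k. \<not> ?d (int k)} = {R.psum y k |k. surv t (R.marks_of y) k}"
    unfolding pR two_sided_split(2)[OF G s] ..
  also have "\<dots> = range (\<lambda>n. \<Sum>i<n. R.gaps_of t y i)" by (rule R.surv_points_eq[OF G(1) s(1)])
  also have "{?p (- int k) |k. \<not> ?d (- int k)} = uminus ` {L.psum z k |k. surv t (L.marks_of z) k}"
    unfolding pL two_sided_split(3)[OF G s] by auto
  also have "\<dots> = range (\<lambda>n. - (\<Sum>i<n. L.gaps_of t z i))"
    unfolding L.surv_points_eq[OF G(2) s(2)] by (simp add: image_image)
  finally have "TS t (y, z) = range (pos2 (R.gaps_of t y) (L.gaps_of t z))" unfolding range_pos2 .
  moreover have "0 < R.gaps_of t y n" "0 < L.gaps_of t z n" for n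
    using ok dmin_pos by (auto simp: okg_def intro!: R.gaps_of_pos[OF G(1)] L.gaps_of_pos[OF G(2)] intro: less_le_trans)
  ultimately show "is_labelling (TS t (y, z)) (pos2 (R.gaps_of t y) (L.gaps_of t z))"
    using labelling_pos2[of "R.gaps_of t y" "L.gaps_of t z"] by simp
qed

section \<open>Evolution of a law seen from one of its points\<close>

context
  fixes P assumes P: "is_spp_law P" and iid: "iid_gaps \<mu> P" and origin: "AE \<xi> in P. 0 \<in> \<xi>"
begin

abbreviation "right_gaps \<xi> \<equiv> (\<lambda>n. gap (1 + int n) \<xi>)"
abbreviation "left_gaps \<xi> \<equiv> (\<lambda>n. gap (- int n) \<xi>)"

lemma setsP [measurable_cong]: "sets P = sets config_space" using P by (simp add: is_spp_law_def)

lemma gapP [measurable]: "gap k \<in> borel_measurable P"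
  by (subst measurable_cong_sets[OF setsP refl]) (rule gap_measurable)

text \<open>A labelled configuration that contains the origin has the origin as its point number
  \<open>0\<close>, and so is determined by its gaps.\<close>

lemma AE_structure:
  "AE \<xi> in P. (\<forall>k. dmin \<le> gap k \<xi>) \<and> \<xi> = range (pos2 (right_gaps \<xi>) (left_gaps \<xi>))"
proof -
  have "AE \<xi> in P. dmin \<le> gap k \<xi>" for k
  proof -
    have eq: "distr P borel (gap k) = \<mu>" using iid by (simp add: iid_gaps_def)
    have "AE x in distr P borel (gap k). dmin \<le> x" unfolding eq by (rule \<mu>_ge)
    then show ?thesis by (rule AE_distrD[OF gapP])
  qed
  then have "AE \<xi> in P. \<forall>k. dmin \<le> gap k \<xi>" by (simp add: AE_all_countable)
  moreover have "AE \<xi> in P. \<exists>x. is_labelling \<xi> x" using iid by (simp add: iid_gaps_def)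
  moreover have "AE \<xi> in P. \<xi> \<in> space P" by (rule AE_space)
  ultimately show ?thesis using origin
  proof eventually_elim
    case (elim \<xi>)
    then obtain x where x: "is_labelling \<xi> x" by blast
    have "locally_finite \<xi>"
      using elim sets_eq_imp_space_eq[OF setsP] by (simp add: space_config_space)
    then have pt: "point \<xi> = x" by (rule point_eq[OF x])
    have "x = pos2 (right_gaps \<xi>) (left_gaps \<xi>)"
    proof (rule int_fun_eqI)
      show "x 0 = pos2 (right_gaps \<xi>) (left_gaps \<xi>) 0" using labelling_origin[OF x] elim by simp
      fix k
      have "comb (right_gaps \<xi>) (left_gaps \<xi>) k = gap k \<xi>" by (simp add: comb_def)
      then show "x k - x (k - 1) = pos2 (right_gaps \<xi>) (left_gaps \<xi>) k - pos2 (right_gaps \<xi>) (left_gaps \<xi>) (k - 1)"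
        unfolding pos2_diff by (simp add: gap_def pt)
    qed
    moreover have "\<xi> = range x" using x by (simp add: is_labelling_def)
    ultimately show ?case using elim by blast
  qed
qed

lemma iid_min: "AE \<xi> in P. \<xi> \<in> min_configs dmin"
  using AE_structure
proof eventually_elim
  case (elim \<xi>)
  then have "range (pos2 (right_gaps \<xi>) (left_gaps \<xi>)) \<in> min_configs dmin"
    by (intro pos2_separated) auto
  then show ?case using elim by simp
qed

lemma distr_gap: "distr P (\<Pi>\<^sub>M i\<in>(UNIV :: int set). borel) (\<lambda>\<xi> k. gap k \<xi>) = (\<Pi>\<^sub>M i\<in>(UNIV :: int set). \<mu>)"
proof -
  interpret P: prob_space P using P by (simp add: is_spp_law_def)
  have "distr P (\<Pi>\<^sub>M i\<in>(UNIV :: int set). borel) (\<lambda>\<xi>. \<lambda>k\<in>UNIV. gap k \<xi>) = (\<Pi>\<^sub>M k\<in>(UNIV :: int set). distr P borel (gap k))"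
    using iid by (subst P.indep_vars_iff_distr_eq_PiM[symmetric]) (auto simp: iid_gaps_def)
  also have "(\<Pi>\<^sub>M k\<in>(UNIV :: int set). distr P borel (gap k)) = (\<Pi>\<^sub>M k\<in>(UNIV :: int set). \<mu>)"
    using iid by (simp add: iid_gaps_def)
  finally show ?thesis by (simp add: restrict_UNIV)
qed

lemma ocp_two:
  assumes f [measurable]: "f \<in> borel_measurable config_space"
  shows "(\<integral>\<^sup>+\<eta>. f \<eta> \<partial>ocp_law dmin rl rr P t) = (\<integral>\<^sup>+y. \<integral>\<^sup>+z. f (TS t (y, z)) \<partial>R.S \<partial>R.S)"
proof -
  interpret PW: prob_space PW by (rule prob_PW)
  let ?Z = "\<Pi>\<^sub>M i\<in>(UNIV :: int set). borel :: real measure"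
  have ss: "sets (\<Pi>\<^sub>M i\<in>(UNIV :: int set). \<mu>) = sets ?Z" "sets P\<mu> = sets (\<Pi>\<^sub>M i\<in>(UNIV :: nat set). borel)"
    by (rule sets_PiM_cong; simp)+
  define H where "H a b = (\<integral>\<^sup>+u. \<integral>\<^sup>+v. f (TS t (\<lambda>n. (a n, u n), \<lambda>n. (b n, v n))) \<partial>PW \<partial>PW)" for a b
  define H' where "H' g = H (\<lambda>n. g (1 + int n)) (\<lambda>n. g (- int n))" for g :: "int \<Rightarrow> real"
  have H'm: "H' \<in> borel_measurable ?Z"
  proof -
    have c: "(\<lambda>g n. g (j n)) \<in> measurable ?Z P\<mu>" for j :: "nat \<Rightarrow> int"
      by (subst measurable_cong_sets[OF refl ss(2)], rule measurable_PiM_single') auto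
    have [measurable]: "(\<lambda>q. (\<lambda>n. fst (fst q) (j n))) \<in> measurable ((?Z \<Otimes>\<^sub>M PW) \<Otimes>\<^sub>M PW) P\<mu>" for j :: "nat \<Rightarrow> int"
      by (rule measurable_compose[OF _ c]) measurable
    have "(\<lambda>q. f (TS t (\<lambda>n. (fst (fst q) (1 + int n), snd (fst q) n), \<lambda>n. (fst (fst q) (- int n), snd q n)))) \<in> borel_measurable ((?Z \<Otimes>\<^sub>M PW) \<Otimes>\<^sub>M PW)"
      by (rule measurable_compose[OF _ f], rule measurable_TS_zip) measurable
    then have "(\<lambda>q. \<integral>\<^sup>+v. f (TS t (\<lambda>n. (fst q (1 + int n), snd q n), \<lambda>n. (fst q (- int n), v n))) \<partial>PW) \<in> borel_measurable (?Z \<Otimes>\<^sub>M PW)"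
      by (intro PW.borel_measurable_nn_integral) (simp add: case_prod_beta)
    then show ?thesis unfolding H'_def H_def
      by (intro PW.borel_measurable_nn_integral) (simp add: case_prod_beta)
  qed
  have gm: "(\<lambda>\<xi> k. gap k \<xi>) \<in> measurable P ?Z"
    by (rule measurable_PiM_single') auto
  have "(\<integral>\<^sup>+\<eta>. f \<eta> \<partial>ocp_law dmin rl rr P t) = (\<integral>\<^sup>+\<xi>. (\<integral>\<^sup>+\<eta>. f \<eta> \<partial>ocp_kernel rl rr t \<xi>) \<partial>P)"
    by (rule nn_integral_ocp_law_AE[OF P iid_min f])
  also have "\<dots> = (\<integral>\<^sup>+\<xi>. H' (\<lambda>k. gap k \<xi>) \<partial>P)"
  proof (rule nn_integral_cong_AE)
    show "AE \<xi> in P. (\<integral>\<^sup>+\<eta>. f \<eta> \<partial>ocp_kernel rl rr t \<xi>) = H' (\<lambda>k. gap k \<xi>)"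
      using AE_structure
    proof eventually_elim
      case (elim \<xi>)
      have "(\<integral>\<^sup>+\<eta>. f \<eta> \<partial>ocp_kernel rl rr t (range (pos2 (right_gaps \<xi>) (left_gaps \<xi>)))) = H' (\<lambda>k. gap k \<xi>)"
        unfolding H'_def H_def using elim by (intro kernel_two f) auto
      then show ?case using elim by simp
    qed
  qed
  also have "\<dots> = (\<integral>\<^sup>+g. H' g \<partial>distr P ?Z (\<lambda>\<xi> k. gap k \<xi>))"
    by (rule nn_integral_distr[symmetric, OF gm]) (simp add: H'm)
  also have "\<dots> = (\<integral>\<^sup>+g. H' g \<partial>(\<Pi>\<^sub>M i\<in>(UNIV :: int set). \<mu>))" unfolding distr_gap ..
  also have "\<dots> = (\<integral>\<^sup>+a. \<integral>\<^sup>+b. H' (comb a b) \<partial>P\<mu> \<partial>P\<mu>)"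
    by (rule nn_integral_comb[OF _ prob_\<mu>]) (subst measurable_cong_sets[OF ss(1) refl], rule H'm)
  also have "\<dots> = (\<integral>\<^sup>+a. \<integral>\<^sup>+b. H a b \<partial>P\<mu> \<partial>P\<mu>)"
    by (simp add: H'_def comb_def)
  also have "\<dots> = (\<integral>\<^sup>+y. \<integral>\<^sup>+z. f (TS t (y, z)) \<partial>R.S \<partial>R.S)"
    unfolding H_def by (rule nn_integral_TS[OF f])
  finally show ?thesis .
qed

lemma AE_two:
  assumes "\<And>y z. Good (R.marks_of y) \<Longrightarrow> Good (L.marks_of z) \<Longrightarrow> okg y \<Longrightarrow> okg z \<Longrightarrow> F y z = (G y z :: ennreal)"
  shows "(\<integral>\<^sup>+y. \<integral>\<^sup>+z. F y z \<partial>R.S \<partial>R.S) = (\<integral>\<^sup>+y. \<integral>\<^sup>+z. G y z \<partial>R.S \<partial>R.S)"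
proof (rule nn_integral_cong_AE)
  show "AE y in R.S. (\<integral>\<^sup>+z. F y z \<partial>R.S) = (\<integral>\<^sup>+z. G y z \<partial>R.S)"
    using R.AE_Good AE_okg
  proof eventually_elim
    case (elim y)
    show ?case
    proof (rule nn_integral_cong_AE)
      show "AE z in R.S. F y z = G y z"
        using L.AE_Good AE_okg by eventually_elim (use elim assms in auto)
    qed
  qed
qed

abbreviation "O0 \<equiv> {\<xi> \<in> space config_space. (0::real) \<in> \<xi>}"

text \<open>The probability that the origin survives: the two sides have to spare it independently
  of each other.\<close>

abbreviation "two_mass t \<equiv> emeasure R.S (R.surv0 t) * emeasure R.S (L.surv0 t)"

lemma two_mass: "two_mass t > 0" "two_mass t < \<infinity>"
proof -
  interpret S: prob_space R.S by (rule prob_S)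
  show "two_mass t > 0" using R.emeasure_surv0_pos[of t] L.emeasure_surv0_pos[of t] by (simp add: zero_less_iff_neq_zero)
  show "two_mass t < \<infinity>"
    using R.seq.P.emeasure_finite[of "R.surv0 t"] R.seq.P.emeasure_finite[of "L.surv0 t"]
    by (simp add: ennreal_mult_eq_top_iff less_top[symmetric])
qed

text \<open>On survival of the origin the integrand factorises over the two half-lines, and under
  the conditional law each side has i.i.d. gaps. Left and right gap laws agree by reversal, so the
  sides glue to one i.i.d. sequence over the integers.\<close>

lemma emeasure_ocp_two_gaps:
  assumes B [measurable]: "B \<in> sets (\<Pi>\<^sub>M i\<in>(UNIV :: int set). borel)"
  shows "emeasure (ocp_law dmin rl rr P t) (O0 \<inter> {\<eta> \<in> space config_space. labelled \<eta> \<and> (\<lambda>k. gap k \<eta>) \<in> B}) =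
    two_mass t * emeasure (\<Pi>\<^sub>M i\<in>(UNIV :: int set). R.gap_law t) B"
proof -
  let ?A = "O0 \<inter> {\<eta> \<in> space config_space. labelled \<eta> \<and> (\<lambda>k. gap k \<eta>) \<in> B}"
  let ?N = "\<Pi>\<^sub>M i\<in>(UNIV :: nat set). borel :: real measure"
  have gm [measurable]: "(\<lambda>\<xi> k. gap k \<xi>) \<in> measurable config_space (\<Pi>\<^sub>M i\<in>(UNIV :: int set). borel)"
    by (rule measurable_PiM_single') auto
  have A: "?A \<in> sets config_space" by measurable
  have ss: "sets (\<Pi>\<^sub>M i\<in>(UNIV :: int set). R.gap_law t) = sets (\<Pi>\<^sub>M i\<in>(UNIV :: int set). borel)"
    "sets (\<Pi>\<^sub>M i\<in>(UNIV :: nat set). R.gap_law t) = sets ?N"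
    by (rule sets_PiM_cong; simp)+
  interpret G: prob_space "\<Pi>\<^sub>M i\<in>(UNIV :: nat set). R.gap_law t" by (intro prob_space_PiM R.prob_space_gap_law)
  have cm: "(\<lambda>p. indicator B (comb (fst p) (snd p)) :: ennreal) \<in> borel_measurable (?N \<Otimes>\<^sub>M ?N)" by measurable
  have cm1: "(\<lambda>b. indicator B (comb a b) :: ennreal) \<in> borel_measurable ?N" for a
    using measurable_compose[OF measurable_Pair1'[of a ?N ?N] cm] by (simp add: space_PiM)
  have cm2: "(\<lambda>a. \<integral>\<^sup>+b. indicator B (comb a b) \<partial>(\<Pi>\<^sub>M i\<in>(UNIV :: nat set). R.gap_law t)) \<in> borel_measurable ?N"
  proof (rule G.borel_measurable_nn_integral)
    show "case_prod (\<lambda>a b. indicator B (comb a b) :: ennreal) \<in> borel_measurable (?N \<Otimes>\<^sub>M (\<Pi>\<^sub>M i\<in>(UNIV :: nat set). R.gap_law t))"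
      using cm by (simp add: case_prod_beta measurable_cong_sets[OF sets_pair_measure_cong[OF refl ss(2)] refl])
  qed
  have "emeasure (ocp_law dmin rl rr P t) ?A = (\<integral>\<^sup>+\<eta>. indicator ?A \<eta> \<partial>ocp_law dmin rl rr P t)"
    by (rule nn_integral_indicator[symmetric]) (simp only: sets_ocp_law[OF P iid_min] A)
  also have "\<dots> = (\<integral>\<^sup>+y. \<integral>\<^sup>+z. indicator ?A (TS t (y, z)) \<partial>R.S \<partial>R.S)"
    by (rule ocp_two) (use A in measurable)
  also have "\<dots> = (\<integral>\<^sup>+y. \<integral>\<^sup>+z. of_bool (surv t (R.marks_of y) 0) * (of_bool (surv t (L.marks_of z) 0) * indicator B (comb (R.gaps_of t y) (L.gaps_of t z))) \<partial>R.S \<partial>R.S)"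
  proof (rule AE_two)
    fix y z assume yz: "Good (R.marks_of y)" "Good (L.marks_of z)" "okg y" "okg z"
    have lf: "locally_finite (TS t (y, z))" using TS_min_configs[of t "(y, z)"] by (simp add: min_configs_iff)
    have "TS t (y, z) \<in> ?A \<longleftrightarrow> 0 \<in> TS t (y, z) \<and> comb (R.gaps_of t y) (L.gaps_of t z) \<in> B"
    proof (cases "0 \<in> TS t (y, z)")
      case True
      note l = TS_cases(2)[OF yz True]
      have "gap k (TS t (y, z)) = comb (R.gaps_of t y) (L.gaps_of t z) k" for k
        by (simp add: gap_def point_eq[OF l lf] pos2_diff)
      then show ?thesis using l True lf by (auto simp: space_config_space labelled_def)
    qed simp
    then show "indicator ?A (TS t (y, z)) = (of_bool (surv t (R.marks_of y) 0) * (of_bool (surv t (L.marks_of z) 0) * indicator B (comb (R.gaps_of t y) (L.gaps_of t z))) :: ennreal)"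
      unfolding TS_cases(1)[OF yz] by (simp add: indicator_def of_bool_def)
  qed
  also have "\<dots> = (\<integral>\<^sup>+y. of_bool (surv t (R.marks_of y) 0) * (\<integral>\<^sup>+z. of_bool (surv t (L.marks_of z) 0) * indicator B (comb (R.gaps_of t y) (L.gaps_of t z)) \<partial>R.S) \<partial>R.S)"
  proof (rule nn_integral_cong)
    fix y
    have "(\<lambda>z. of_bool (surv t (L.marks_of z) 0) * indicator B (comb (R.gaps_of t y) (L.gaps_of t z)) :: ennreal) \<in> borel_measurable R.S"
      using measurable_compose[OF L.gaps_of_measurable cm1] L.surv_measurable by (intro borel_measurable_times_ennreal) simp_all
    then show "(\<integral>\<^sup>+z. of_bool (surv t (R.marks_of y) 0) * (of_bool (surv t (L.marks_of z) 0) * indicator B (comb (R.gaps_of t y) (L.gaps_of t z))) \<partial>R.S) =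
      of_bool (surv t (R.marks_of y) 0) * (\<integral>\<^sup>+z. of_bool (surv t (L.marks_of z) 0) * indicator B (comb (R.gaps_of t y) (L.gaps_of t z)) \<partial>R.S)"
      by (rule nn_integral_cmult)
  qed
  also have "\<dots> = (\<integral>\<^sup>+y. of_bool (surv t (R.marks_of y) 0) * ((\<integral>\<^sup>+b. indicator B (comb (R.gaps_of t y) b) \<partial>(\<Pi>\<^sub>M i\<in>(UNIV :: nat set). R.gap_law t)) * emeasure R.S (L.surv0 t)) \<partial>R.S)"
  proof (intro nn_integral_cong arg_cong2[of _ _ _ _ "(*)"] refl)
    fix y
    have "(\<integral>\<^sup>+z. of_bool (surv t (L.marks_of z) 0) * indicator B (comb (R.gaps_of t y) (L.gaps_of t z)) \<partial>R.S) =
      (\<integral>\<^sup>+z. indicator B (comb (R.gaps_of t y) (L.gaps_of t z)) \<partial>L.SR t) * emeasure R.S (L.surv0 t)"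
      by (rule L.nn_integral_surv0) (rule measurable_compose[OF L.gaps_of_measurable cm1])
    also have "(\<integral>\<^sup>+z. indicator B (comb (R.gaps_of t y) (L.gaps_of t z)) \<partial>L.SR t) =
      (\<integral>\<^sup>+b. indicator B (comb (R.gaps_of t y) b) \<partial>distr (L.SR t) ?N (L.gaps_of t))"
      by (rule nn_integral_distr[symmetric]) (use cm1 L.gaps_of_measurable in \<open>simp_all add: measurable_cong_sets[OF L.sets_SR refl]\<close>)
    also have "distr (L.SR t) ?N (L.gaps_of t) = (\<Pi>\<^sub>M i\<in>(UNIV :: nat set). R.gap_law t)"
      \<comment> \<open>Here the gap law of the reflected left side becomes that of the right
        side.\<close>
      unfolding L.distr_gaps R.gap_law_flip ..
    finally show "(\<integral>\<^sup>+z. of_bool (surv t (L.marks_of z) 0) * indicator B (comb (R.gaps_of t y) (L.gaps_of t z)) \<partial>R.S) =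
      (\<integral>\<^sup>+b. indicator B (comb (R.gaps_of t y) b) \<partial>(\<Pi>\<^sub>M i\<in>(UNIV :: nat set). R.gap_law t)) * emeasure R.S (L.surv0 t)" .
  qed
  also have "\<dots> = (\<integral>\<^sup>+y. (\<integral>\<^sup>+b. indicator B (comb (R.gaps_of t y) b) \<partial>(\<Pi>\<^sub>M i\<in>(UNIV :: nat set). R.gap_law t)) * emeasure R.S (L.surv0 t) \<partial>R.SR t) * emeasure R.S (R.surv0 t)"
    by (rule R.nn_integral_surv0) (use measurable_compose[OF R.gaps_of_measurable cm2] in measurable)
  also have "\<dots> = (\<integral>\<^sup>+y. (\<integral>\<^sup>+b. indicator B (comb (R.gaps_of t y) b) \<partial>(\<Pi>\<^sub>M i\<in>(UNIV :: nat set). R.gap_law t)) \<partial>R.SR t) * emeasure R.S (L.surv0 t) * emeasure R.S (R.surv0 t)"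
    by (subst nn_integral_multc) (use measurable_compose[OF R.gaps_of_measurable cm2] in \<open>simp_all add: measurable_cong_sets[OF R.sets_SR refl]\<close>)
  also have "(\<integral>\<^sup>+y. (\<integral>\<^sup>+b. indicator B (comb (R.gaps_of t y) b) \<partial>(\<Pi>\<^sub>M i\<in>(UNIV :: nat set). R.gap_law t)) \<partial>R.SR t) =
    (\<integral>\<^sup>+a. \<integral>\<^sup>+b. indicator B (comb a b) \<partial>(\<Pi>\<^sub>M i\<in>(UNIV :: nat set). R.gap_law t) \<partial>distr (R.SR t) ?N (R.gaps_of t))"
    by (rule nn_integral_distr[symmetric]) (use cm2 R.gaps_of_measurable in \<open>simp_all add: measurable_cong_sets[OF R.sets_SR refl]\<close>)
  also have "distr (R.SR t) ?N (R.gaps_of t) = (\<Pi>\<^sub>M i\<in>(UNIV :: nat set). R.gap_law t)" by (rule R.distr_gaps)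
  also have "(\<integral>\<^sup>+a. \<integral>\<^sup>+b. indicator B (comb a b) \<partial>(\<Pi>\<^sub>M i\<in>(UNIV :: nat set). R.gap_law t) \<partial>(\<Pi>\<^sub>M i\<in>(UNIV :: nat set). R.gap_law t)) =
      (\<integral>\<^sup>+g. indicator B g \<partial>(\<Pi>\<^sub>M i\<in>(UNIV :: int set). R.gap_law t))"
    by (rule nn_integral_comb[symmetric, OF _ R.prob_space_gap_law]) (subst measurable_cong_sets[OF ss(1) refl], measurable)
  also have "\<dots> = emeasure (\<Pi>\<^sub>M i\<in>(UNIV :: int set). R.gap_law t) B"
    by (rule nn_integral_indicator) (simp add: ss)
  finally show ?thesis by (simp only: ac_simps)
qed

text \<open>Surviving configurations without a labelling are null, so
  \<open>emeasure_ocp_two_gaps\<close> with the whole space for \<open>B\<close> gives the mass of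
  all configurations containing the origin.\<close>

lemma emeasure_ocp_two_origin:
  "emeasure (ocp_law dmin rl rr P t) O0 = two_mass t"
  "emeasure (ocp_law dmin rl rr P t) (O0 \<inter> {\<eta> \<in> space config_space. \<not> labelled \<eta>}) = 0"
proof -
  let ?Qt = "ocp_law dmin rl rr P t"
  have [measurable]: "O0 \<in> sets config_space" by measurable
  have null: "emeasure ?Qt (O0 \<inter> {\<eta> \<in> space config_space. \<not> labelled \<eta>}) = 0"
  proof -
    have "emeasure ?Qt (O0 \<inter> {\<eta> \<in> space config_space. \<not> labelled \<eta>}) = (\<integral>\<^sup>+\<eta>. indicator (O0 \<inter> {\<eta> \<in> space config_space. \<not> labelled \<eta>}) \<eta> \<partial>?Qt)"
      by (rule nn_integral_indicator[symmetric]) (simp only: sets_ocp_law[OF P iid_min], measurable)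
    also have "\<dots> = (\<integral>\<^sup>+y. \<integral>\<^sup>+z. indicator (O0 \<inter> {\<eta> \<in> space config_space. \<not> labelled \<eta>}) (TS t (y, z)) \<partial>R.S \<partial>R.S)"
      by (rule ocp_two) measurable
    also have "\<dots> = (\<integral>\<^sup>+y. \<integral>\<^sup>+z. 0 \<partial>R.S \<partial>R.S)"
      by (rule AE_two) (use TS_cases(2) in \<open>auto simp: indicator_def labelled_def\<close>)
    finally show ?thesis by simp
  qed
  then show "emeasure ?Qt (O0 \<inter> {\<eta> \<in> space config_space. \<not> labelled \<eta>}) = 0" .
  have "O0 = (O0 \<inter> {\<eta> \<in> space config_space. labelled \<eta> \<and> (\<lambda>k. gap k \<eta>) \<in> space (\<Pi>\<^sub>M i\<in>(UNIV :: int set). borel)}) \<union>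
      (O0 \<inter> {\<eta> \<in> space config_space. \<not> labelled \<eta>})"
    by (auto simp: space_PiM)
  then have "emeasure ?Qt O0 = emeasure ?Qt (O0 \<inter> {\<eta> \<in> space config_space. labelled \<eta> \<and> (\<lambda>k. gap k \<eta>) \<in> space (\<Pi>\<^sub>M i\<in>(UNIV :: int set). borel)})"
    using null by (subst \<open>O0 = _\<close>, subst emeasure_Un_null_set) (auto simp: null_sets_def sets_ocp_law[OF P iid_min] space_PiM)
  also have "\<dots> = two_mass t * emeasure (\<Pi>\<^sub>M i\<in>(UNIV :: int set). R.gap_law t) (space (\<Pi>\<^sub>M i\<in>(UNIV :: int set). borel))"
    by (rule emeasure_ocp_two_gaps) simp
  also have "space (\<Pi>\<^sub>M i\<in>(UNIV :: int set). borel) = space (\<Pi>\<^sub>M i\<in>(UNIV :: int set). R.gap_law t)"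
    by (simp add: space_PiM)
  also have "emeasure (\<Pi>\<^sub>M i\<in>(UNIV :: int set). R.gap_law t) \<dots> = 1"
    by (intro prob_space.emeasure_space_1 prob_space_PiM R.prob_space_gap_law)
  finally show "emeasure ?Qt O0 = two_mass t" by simp
qed

lemma sets_cond_origin_ocp: "sets (cond_origin (ocp_law dmin rl rr P t)) = sets config_space"
  by (simp add: cond_origin_def sets_ocp_law[OF P iid_min])

text \<open>Dividing by the survival probability leaves the product law of the gaps; independence is
  equality of the joint law with the product of its marginals.\<close>

theorem iid_gaps_cond_origin: "iid_gaps (R.gap_law t) (cond_origin (ocp_law dmin rl rr P t))"
proof -
  let ?Qt = "ocp_law dmin rl rr P t"
  let ?C = "cond_origin ?Qt"
  let ?Z = "\<Pi>\<^sub>M i\<in>(UNIV :: int set). borel :: real measure"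
  note sC = sets_cond_origin_ocp[of t]
  have O [measurable]: "O0 \<in> sets config_space" by measurable
  have OQ: "O0 \<in> sets ?Qt" by (simp only: sets_ocp_law[OF P iid_min] O)
  note mass = two_mass[of t]
  have prob: "prob_space ?C"
    unfolding cond_origin_def using mass emeasure_ocp_two_origin(1)[of t]
    by (intro prob_space_uniform_measure) auto
  interpret C: prob_space ?C by (rule prob)
  have lab: "AE \<eta> in ?C. labelled \<eta>"
  proof -
    have "AE \<eta> in ?Qt. \<eta> \<notin> O0 \<inter> {\<eta> \<in> space config_space. \<not> labelled \<eta>}"
      using emeasure_ocp_two_origin(2)[of t]
      by (intro AE_not_in) (auto simp: null_sets_def sets_ocp_law[OF P iid_min])
    then show ?thesis unfolding cond_origin_def
      by (intro AE_uniform_measureI[OF OQ]) (auto elim!: eventually_mono)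
  qed
  have gC: "gap k \<in> borel_measurable ?C" for k
    by (subst measurable_cong_sets[OF sC refl]) (rule gap_measurable)
  have gm: "(\<lambda>\<xi> k. gap k \<xi>) \<in> measurable ?C ?Z"
    by (rule measurable_PiM_single') (auto intro: gC)
  have ss: "sets (\<Pi>\<^sub>M i\<in>(UNIV :: int set). R.gap_law t) = sets ?Z"
    by (rule sets_PiM_cong) auto
  have one: "two_mass t / two_mass t = 1" using mass by (intro ennreal_divide_self) (auto simp: less_top)
  have law: "distr ?C ?Z (\<lambda>\<xi> k. gap k \<xi>) = (\<Pi>\<^sub>M i\<in>(UNIV :: int set). R.gap_law t)"
  proof (rule measure_eqI)
    show "sets (distr ?C ?Z (\<lambda>\<xi> k. gap k \<xi>)) = sets (\<Pi>\<^sub>M i\<in>(UNIV :: int set). R.gap_law t)" by (simp add: ss)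
    fix B assume "B \<in> sets (distr ?C ?Z (\<lambda>\<xi> k. gap k \<xi>))"
    then have B [measurable]: "B \<in> sets ?Z" by simp
    have gm' [measurable]: "(\<lambda>\<xi> k. gap k \<xi>) \<in> measurable config_space ?Z"
      by (rule measurable_PiM_single') auto
    let ?A = "{\<eta> \<in> space config_space. labelled \<eta> \<and> (\<lambda>k. gap k \<eta>) \<in> B}"
    have A: "?A \<in> sets config_space" by measurable
    have "emeasure (distr ?C ?Z (\<lambda>\<xi> k. gap k \<xi>)) B = emeasure ?C ((\<lambda>\<xi> k. gap k \<xi>) -` B \<inter> space ?C)"
      by (rule emeasure_distr[OF gm B])
    also have "\<dots> = emeasure ?C ?A"
    proof (rule emeasure_eq_AE)
      show "AE \<eta> in ?C. \<eta> \<in> (\<lambda>\<xi> k. gap k \<xi>) -` B \<inter> space ?C \<longleftrightarrow> \<eta> \<in> ?A"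
        using lab by eventually_elim (simp add: sets_eq_imp_space_eq[OF sC] conj_commute)
      show "(\<lambda>\<xi> k. gap k \<xi>) -` B \<inter> space ?C \<in> sets ?C" by (rule measurable_sets[OF gm B])
      show "?A \<in> sets ?C" by (simp only: sC A)
    qed
    also have "\<dots> = emeasure ?Qt (O0 \<inter> ?A) / emeasure ?Qt O0"
      unfolding cond_origin_def by (rule emeasure_uniform_measure[OF OQ]) (simp only: sets_ocp_law[OF P iid_min] A)
    also have "\<dots> = two_mass t * emeasure (\<Pi>\<^sub>M i\<in>(UNIV :: int set). R.gap_law t) B / two_mass t"
      by (simp only: emeasure_ocp_two_gaps[OF B] emeasure_ocp_two_origin(1))
    also have "\<dots> = emeasure (\<Pi>\<^sub>M i\<in>(UNIV :: int set). R.gap_law t) B"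
      using one by (simp add: divide_ennreal_def mult.commute mult.left_commute)
    finally show "emeasure (distr ?C ?Z (\<lambda>\<xi> k. gap k \<xi>)) B = emeasure (\<Pi>\<^sub>M i\<in>(UNIV :: int set). R.gap_law t) B" .
  qed
  interpret G: product_prob_space "\<lambda>_. R.gap_law t" "UNIV :: int set"
    by (intro product_prob_spaceI R.prob_space_gap_law)
  have marg: "distr ?C borel (gap k) = R.gap_law t" for k
  proof -
    have "distr ?C borel (gap k) = distr (distr ?C ?Z (\<lambda>\<xi> k. gap k \<xi>)) borel (\<lambda>g. g k)"
      by (subst distr_distr[OF _ gm]) (auto simp: comp_def)
    also have "\<dots> = distr (\<Pi>\<^sub>M i\<in>(UNIV :: int set). R.gap_law t) (R.gap_law t) (\<lambda>g. g k)"
      unfolding law by (rule distr_cong) auto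
    also have "\<dots> = R.gap_law t" by (rule G.PiM_component) simp
    finally show ?thesis .
  qed
  have "C.indep_vars (\<lambda>_. borel) gap UNIV"
    by (subst C.indep_vars_iff_distr_eq_PiM) (auto simp: gC restrict_UNIV law marg)
  then show ?thesis
    unfolding iid_gaps_def using prob lab marg by (auto simp: labelled_def)
qed

text \<open>Stated for the kernel rather than for the evolved law, so that it can be transferred
  from a Palm or conditioned law to the stationary law itself.\<close>

lemma kernel_nonempty: "AE \<xi> in P. \<xi> \<in> min_configs dmin \<and> emeasure (ocp_kernel rl rr t \<xi>) {{}} = 0"
proof -
  let ?Qt = "ocp_law dmin rl rr P t"
  have E [measurable]: "{{}} \<in> sets config_space"
  proof -
    have "{\<xi> \<in> space config_space. \<xi> = {}} \<in> sets config_space" by measurable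
    also have "{\<xi> \<in> space config_space. \<xi> = {}} = {{}}" by (auto simp: space_config_space locally_finite_def)
    finally show ?thesis .
  qed
  have "(\<integral>\<^sup>+\<xi>. (\<integral>\<^sup>+\<eta>. indicator {{}} \<eta> \<partial>ocp_kernel rl rr t \<xi>) * indicator (min_configs dmin) \<xi> \<partial>P) = (\<integral>\<^sup>+\<eta>. indicator {{}} \<eta> \<partial>?Qt)"
    by (rule nn_integral_ocp_law[symmetric, OF P iid_min]) measurable
  also have "\<dots> = (\<integral>\<^sup>+y. \<integral>\<^sup>+z. indicator {{}} (TS t (y, z)) \<partial>R.S \<partial>R.S)"
    by (rule ocp_two) measurable
  also have "\<dots> = (\<integral>\<^sup>+y. \<integral>\<^sup>+z. 0 \<partial>R.S \<partial>R.S)"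
    by (rule AE_two) (use TS_cases(3) in \<open>auto simp: indicator_def\<close>)
  finally have "(\<integral>\<^sup>+\<xi>. (\<integral>\<^sup>+\<eta>. indicator {{}} \<eta> \<partial>ocp_kernel rl rr t \<xi>) * indicator (min_configs dmin) \<xi> \<partial>P) = 0" by simp
  then have "AE \<xi> in P. (\<integral>\<^sup>+\<eta>. indicator {{}} \<eta> \<partial>ocp_kernel rl rr t \<xi>) * indicator (min_configs dmin) \<xi> = 0"
    using kernel_integral_measurable[OF P iid_min, of "indicator {{}}" t]
    by (subst (asm) nn_integral_0_iff_AE) (auto simp: measurable_cong_sets[OF setsP refl])
  then show ?thesis using iid_min
    by eventually_elim (simp add: E)
qed

end

end

section \<open>Palm measures\<close>

text \<open>The functional in Campbell's formula: \<open>\<phi>\<close> summed over the points in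
  the unit window, each taken as the origin. Writing the sum as an integral gives additivity and
  monotone convergence without finiteness conditions.\<close>

definition windowed :: "(real set \<Rightarrow> ennreal) \<Rightarrow> real set \<Rightarrow> ennreal" where
  "windowed \<phi> \<xi> = (\<integral>\<^sup>+x. \<phi> ((\<lambda>y. y - x) ` \<xi>) \<partial>count_space (\<xi> \<inter> {0..1}))"

lemma windowed_indicator:
  assumes "locally_finite \<xi>"
  shows "windowed (indicator A) \<xi> = of_nat (card {x \<in> \<xi> \<inter> {0..1}. (\<lambda>y. y - x) ` \<xi> \<in> A})"
proof -
  let ?X = "{x \<in> \<xi> \<inter> {0..1}. (\<lambda>y. y - x) ` \<xi> \<in> A}"
  have fin: "finite ?X" using assms by (auto simp: locally_finite_def intro: finite_subset[of _ "\<xi> \<inter> {0..1}"])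
  have "windowed (indicator A) \<xi> = (\<integral>\<^sup>+x. indicator ?X x \<partial>count_space (\<xi> \<inter> {0..1}))"
    unfolding windowed_def by (rule nn_integral_cong) (auto simp: indicator_def)
  also have "\<dots> = emeasure (count_space (\<xi> \<inter> {0..1})) ?X" by (rule nn_integral_indicator) auto
  also have "\<dots> = of_nat (card ?X)" using fin by (subst emeasure_count_space_finite) auto
  finally show ?thesis .
qed

lemma windowed_sum: "locally_finite \<xi> \<Longrightarrow> windowed \<phi> \<xi> = (\<Sum>x\<in>\<xi> \<inter> {0..1}. \<phi> ((\<lambda>y. y - x) ` \<xi>))"
  unfolding windowed_def by (rule nn_integral_count_space_finite) (simp add: locally_finite_def)

lemma windowed_indicator_measurable:
  assumes [measurable]: "A \<in> sets config_space"
  shows "windowed (indicator A) \<in> borel_measurable config_space"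
proof -
  note shift_measurable_pair [measurable]
  define D where "D = {p \<in> space (borel \<Otimes>\<^sub>M config_space). 0 \<le> fst p \<and> (case p of (x, \<xi>) \<Rightarrow> (\<lambda>y. y - x) ` \<xi>) \<in> A}"
  have D: "D \<in> sets (borel \<Otimes>\<^sub>M config_space)" unfolding D_def by measurable
  have "(\<lambda>\<xi>. of_nat (card {x \<in> \<xi>. x \<in> {- 1..1} \<and> (x, \<xi>) \<in> D}) :: ennreal) \<in> borel_measurable config_space"
    using count_measurable[OF measurable_ident D, of 1] by simp
  then show ?thesis
  proof (rule measurable_cong[THEN iffD1, rotated])
    fix \<xi> assume \<xi>: "\<xi> \<in> space config_space"
    have "{x \<in> \<xi>. x \<in> {- 1..1} \<and> (x, \<xi>) \<in> D} = {x \<in> \<xi> \<inter> {0..1}. (\<lambda>y. y - x) ` \<xi> \<in> A}"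
      using \<xi> by (auto simp: D_def space_pair_measure)
    then show "(of_nat (card {x \<in> \<xi>. x \<in> {- 1..1} \<and> (x, \<xi>) \<in> D}) :: ennreal) = windowed (indicator A) \<xi>"
      using \<xi> by (simp add: windowed_indicator space_config_space)
  qed
qed

lemma intensity_windowed:
  assumes "sets Q = sets config_space"
  shows "intensity Q = (\<integral>\<^sup>+\<xi>. windowed (indicator (space config_space)) \<xi> \<partial>Q)"
  unfolding intensity_def
proof (rule nn_integral_cong)
  fix \<xi> assume "\<xi> \<in> space Q"
  then have lf: "locally_finite \<xi>" using sets_eq_imp_space_eq[OF assms] by (simp add: space_config_space)
  have "{x \<in> \<xi> \<inter> {0..1}. (\<lambda>y. y - x) ` \<xi> \<in> space config_space} = \<xi> \<inter> {0..1}"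
    using locally_finite_image_add[OF lf, of "- x" for x] by (auto simp: space_config_space)
  then show "of_nat (card (\<xi> \<inter> {0..1})) = windowed (indicator (space config_space)) \<xi>"
    by (simp add: windowed_indicator[OF lf])
qed

lemma sets_palm [simp, measurable_cong]: "sets (palm Q) = sets config_space"
  unfolding palm_def by simp

lemma space_palm [simp]: "space (palm Q) = space config_space"
  by (rule sets_eq_imp_space_eq) simp

context
  fixes Q assumes Q: "sets Q = sets config_space"
begin

lemma emeasure_palm:
  assumes A: "A \<in> sets config_space"
  shows "emeasure (palm Q) A = (\<integral>\<^sup>+\<xi>. windowed (indicator A) \<xi> \<partial>Q) / intensity Q"
proof -
  have eq: "(\<integral>\<^sup>+\<xi>. of_nat (card {x \<in> \<xi> \<inter> {0..1}. (\<lambda>y. y - x) ` \<xi> \<in> A}) \<partial>Q) = (\<integral>\<^sup>+\<xi>. windowed (indicator A) \<xi> \<partial>Q)" for A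
    by (rule nn_integral_cong) (use sets_eq_imp_space_eq[OF Q] in \<open>simp add: windowed_indicator space_config_space\<close>)
  show ?thesis
  proof (rule emeasure_measure_of[OF palm_def[of Q, unfolded eq]])
    show "sets config_space \<subseteq> Pow (space config_space)" by (rule sets.space_closed)
    show "A \<in> sets (palm Q)" using A by simp
    show "positive (sets (palm Q)) (\<lambda>A. (\<integral>\<^sup>+\<xi>. windowed (indicator A) \<xi> \<partial>Q) / intensity Q)"
      by (simp add: positive_def windowed_def)
    show "countably_additive (sets (palm Q)) (\<lambda>A. (\<integral>\<^sup>+\<xi>. windowed (indicator A) \<xi> \<partial>Q) / intensity Q)"
    proof (rule countably_additiveI)
      fix B :: "nat \<Rightarrow> real set set"
      assume B: "range B \<subseteq> sets (palm Q)" "disjoint_family B" "(\<Union>i. B i) \<in> sets (palm Q)"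
      have "(\<Sum>i. (\<integral>\<^sup>+\<xi>. windowed (indicator (B i)) \<xi> \<partial>Q) / intensity Q) = (\<Sum>i. \<integral>\<^sup>+\<xi>. windowed (indicator (B i)) \<xi> \<partial>Q) / intensity Q"
        by (rule ennreal_suminf_divide)
      also have "(\<Sum>i. \<integral>\<^sup>+\<xi>. windowed (indicator (B i)) \<xi> \<partial>Q) = (\<integral>\<^sup>+\<xi>. (\<Sum>i. windowed (indicator (B i)) \<xi>) \<partial>Q)"
        by (rule nn_integral_suminf[symmetric])
          (use B(1) in \<open>auto simp: measurable_cong_sets[OF Q refl] intro!: windowed_indicator_measurable\<close>)
      also have "(\<lambda>\<xi>. \<Sum>i. windowed (indicator (B i)) \<xi>) = windowed (indicator (\<Union>i. B i))"
        unfolding windowed_def by (simp add: nn_integral_suminf[symmetric] suminf_indicator[OF B(2)])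
      finally show "(\<Sum>i. (\<integral>\<^sup>+\<xi>. windowed (indicator (B i)) \<xi> \<partial>Q) / intensity Q) =
        (\<integral>\<^sup>+\<xi>. windowed (indicator (\<Union>i. B i)) \<xi> \<partial>Q) / intensity Q" .
    qed
  qed
qed

lemma palm_origin: "AE \<xi> in palm Q. 0 \<in> \<xi>"
proof -
  have N: "{\<xi> \<in> space config_space. 0 \<notin> \<xi>} \<in> sets config_space" by measurable
  have "windowed (indicator {\<xi> \<in> space config_space. 0 \<notin> \<xi>}) \<xi> = 0" for \<xi>
  proof -
    have "windowed (indicator {\<xi> \<in> space config_space. 0 \<notin> \<xi>}) \<xi> = (\<integral>\<^sup>+x. 0 \<partial>count_space (\<xi> \<inter> {0..1}))"
      unfolding windowed_def by (rule nn_integral_cong) (auto simp: indicator_def)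
    then show ?thesis by simp
  qed
  then have "windowed (indicator {\<xi> \<in> space config_space. 0 \<notin> \<xi>}) = (\<lambda>_. 0)" by (rule ext)
  then have "emeasure (palm Q) {\<xi> \<in> space config_space. 0 \<notin> \<xi>} = 0"
    unfolding emeasure_palm[OF N] by simp
  then show ?thesis using N by (intro AE_I[of _ _ "{\<xi> \<in> space config_space. 0 \<notin> \<xi>}"]) auto
qed

context
  assumes palm: "prob_space (palm Q)" and finite: "intensity Q < \<infinity>"
begin

text \<open>For zero intensity the quotient defining \<open>palm Q\<close> is \<open>0\<close>,
  which is not a probability measure.\<close>

lemma intensity_pos: "0 < intensity Q"
proof (rule ccontr)
  assume "\<not> 0 < intensity Q"
  then have 0: "intensity Q = 0" by (simp add: zero_less_iff_neq_zero)
  have "emeasure (palm Q) (space (palm Q)) = 0"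
    using 0 intensity_windowed[OF Q] by (subst emeasure_palm) (simp_all add: divide_ennreal_def)
  then show False using prob_space.emeasure_space_1[OF palm] by simp
qed

text \<open>For indicators this is the definition of \<open>palm Q\<close> cleared of its
  denominator, which is positive and finite; linearity and monotone convergence extend it.\<close>

lemma campbell:
  assumes "\<phi> \<in> borel_measurable config_space"
  shows "windowed \<phi> \<in> borel_measurable config_space"
    and "(\<integral>\<^sup>+\<xi>. windowed \<phi> \<xi> \<partial>Q) = intensity Q * (\<integral>\<^sup>+\<xi>. \<phi> \<xi> \<partial>palm Q)"
proof -
  have "windowed \<phi> \<in> borel_measurable config_space \<and> (\<integral>\<^sup>+\<xi>. windowed \<phi> \<xi> \<partial>Q) = intensity Q * (\<integral>\<^sup>+\<xi>. \<phi> \<xi> \<partial>palm Q)"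
    using assms
  proof (induction \<phi> rule: borel_measurable_induct)
    case (cong f g)
    have lf: "(\<lambda>y. y - x) ` \<xi> \<in> space config_space" if "\<xi> \<in> space config_space" for \<xi> x
      using that locally_finite_image_add[of \<xi> "- x"] by (simp add: space_config_space)
    have w: "windowed f \<xi> = windowed g \<xi>" if "\<xi> \<in> space config_space" for \<xi>
      unfolding windowed_def by (rule nn_integral_cong) (rule cong.hyps(3), rule lf, rule that)
    have "windowed f \<in> borel_measurable config_space"
      using cong.IH w measurable_cong[of config_space "windowed f" "windowed g" borel] by blast
    moreover have "(\<integral>\<^sup>+\<xi>. windowed f \<xi> \<partial>Q) = (\<integral>\<^sup>+\<xi>. windowed g \<xi> \<partial>Q)"
      by (rule nn_integral_cong) (use w sets_eq_imp_space_eq[OF Q] in simp)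
    moreover have "(\<integral>\<^sup>+\<xi>. f \<xi> \<partial>palm Q) = (\<integral>\<^sup>+\<xi>. g \<xi> \<partial>palm Q)"
      by (rule nn_integral_cong) (use cong.hyps(3) in simp)
    ultimately show ?case using cong.IH by simp
  next
    case (set A)
    have "intensity Q * (i / intensity Q) = i" for i
      using intensity_pos finite by (simp add: ennreal_times_divide mult.commute[of _ i] ennreal_mult_divide_eq)
    then show ?case using set by (simp add: windowed_indicator_measurable emeasure_palm)
  next
    case (mult u c)
    have "windowed (\<lambda>\<xi>. c * u \<xi>) = (\<lambda>\<xi>. c * windowed u \<xi>)"
      unfolding windowed_def by (simp add: nn_integral_cmult)
    moreover have "(\<lambda>\<xi>. c * windowed u \<xi>) \<in> borel_measurable config_space"
      using mult.IH by (intro borel_measurable_times_ennreal) auto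
    ultimately show ?case using mult by (simp add: nn_integral_cmult measurable_cong_sets[OF Q refl] mult.left_commute)
  next
    case (add u v)
    have "windowed (\<lambda>\<xi>. v \<xi> + u \<xi>) = (\<lambda>\<xi>. windowed v \<xi> + windowed u \<xi>)"
      unfolding windowed_def by (simp add: nn_integral_add)
    moreover have "(\<lambda>\<xi>. windowed v \<xi> + windowed u \<xi>) \<in> borel_measurable config_space"
      using add.IH by (intro borel_measurable_add) auto
    ultimately show ?case using add by (simp add: nn_integral_add measurable_cong_sets[OF Q refl] distrib_left)
  next
    case (seq U)
    have inc: "incseq (\<lambda>i. windowed (U i))"
      unfolding windowed_def using seq.hyps by (auto simp: incseq_def le_fun_def intro!: nn_integral_mono)
    have w: "windowed (SUP i. U i) = (\<lambda>\<xi>. SUP i. windowed (U i) \<xi>)"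
    proof
      fix \<xi>
      have "(\<integral>\<^sup>+x. (SUP i. U i ((\<lambda>y. y - x) ` \<xi>)) \<partial>count_space (\<xi> \<inter> {0..1})) = (SUP i. \<integral>\<^sup>+x. U i ((\<lambda>y. y - x) ` \<xi>) \<partial>count_space (\<xi> \<inter> {0..1}))"
        by (rule nn_integral_monotone_convergence_SUP) (use seq.hyps in \<open>auto simp: incseq_def le_fun_def\<close>)
      then show "windowed (SUP i. U i) \<xi> = (SUP i. windowed (U i) \<xi>)"
        unfolding windowed_def by (simp add: image_comp)
    qed
    have "(\<integral>\<^sup>+\<xi>. windowed (SUP i. U i) \<xi> \<partial>Q) = (SUP i. \<integral>\<^sup>+\<xi>. windowed (U i) \<xi> \<partial>Q)"
      unfolding w using inc seq.IH by (intro nn_integral_monotone_convergence_SUP) (auto simp: measurable_cong_sets[OF Q refl])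
    also have "\<dots> = intensity Q * (SUP i. \<integral>\<^sup>+\<xi>. U i \<xi> \<partial>palm Q)"
      using seq.IH by (simp add: SUP_mult_left_ennreal)
    also have "(SUP i. \<integral>\<^sup>+\<xi>. U i \<xi> \<partial>palm Q) = (\<integral>\<^sup>+\<xi>. (SUP i. U i) \<xi> \<partial>palm Q)"
    proof -
      have eq: "(SUP i. U i) = (\<lambda>\<xi>. SUP i. U i \<xi>)" by (rule ext) (simp add: image_comp)
      show ?thesis unfolding eq by (rule nn_integral_monotone_convergence_SUP[symmetric]) (use seq.hyps in auto)
    qed
    finally show ?case using seq.IH unfolding w by (auto intro!: borel_measurable_SUP)
  qed
  then show "windowed \<phi> \<in> borel_measurable config_space"
    and "(\<integral>\<^sup>+\<xi>. windowed \<phi> \<xi> \<partial>Q) = intensity Q * (\<integral>\<^sup>+\<xi>. \<phi> \<xi> \<partial>palm Q)" by auto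
qed

text \<open>For a null set of the Palm measure, the expected number of points in the unit window
  that see a configuration in this set is zero.\<close>

lemma AE_palmD:
  assumes "AE \<xi> in palm Q. \<phi> \<xi>"
  shows "AE \<xi> in Q. \<forall>x\<in>\<xi> \<inter> {0..1}. \<phi> ((\<lambda>y. y - x) ` \<xi>)"
proof -
  obtain N where N: "{\<xi> \<in> space (palm Q). \<not> \<phi> \<xi>} \<subseteq> N" "emeasure (palm Q) N = 0" "N \<in> sets (palm Q)"
    using assms by (rule AE_E)
  have [measurable]: "N \<in> sets config_space" using N(3) by simp
  have "(\<integral>\<^sup>+\<xi>. windowed (indicator N) \<xi> \<partial>Q) = intensity Q * (\<integral>\<^sup>+\<xi>. indicator N \<xi> \<partial>palm Q)"
    by (rule campbell(2)) measurable
  then have "(\<integral>\<^sup>+\<xi>. windowed (indicator N) \<xi> \<partial>Q) = 0" using N by simp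
  then have "AE \<xi> in Q. windowed (indicator N) \<xi> = 0"
    using windowed_indicator_measurable[of N] by (simp add: nn_integral_0_iff_AE measurable_cong_sets[OF Q refl])
  moreover have "AE \<xi> in Q. \<xi> \<in> space Q" by (rule AE_space)
  ultimately show ?thesis
  proof eventually_elim
    case (elim \<xi>)
    then have lf: "locally_finite \<xi>" using sets_eq_imp_space_eq[OF Q] by (simp add: space_config_space)
    let ?X = "{x \<in> \<xi> \<inter> {0..1}. (\<lambda>y. y - x) ` \<xi> \<in> N}"
    have "finite (\<xi> \<inter> {0..1})" using lf by (simp add: locally_finite_def)
    then have "finite ?X" by (rule finite_subset[rotated]) auto
    moreover have "card ?X = 0"
      using elim(1) unfolding windowed_indicator[OF lf] of_nat_eq_0_iff .
    ultimately have "?X = {}" by (simp only: card_0_eq)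
    moreover have "(\<lambda>y. y - x) ` \<xi> \<in> space (palm Q)" for x
      using locally_finite_image_add[OF lf, of "- x"] by (simp add: space_config_space)
    ultimately show "\<forall>x\<in>\<xi> \<inter> {0..1}. \<phi> ((\<lambda>y. y - x) ` \<xi>)" using N(1) by blast
  qed
qed

end

end

text \<open>Integer translations bring some point of almost every configuration into
  \<open>I\<close>, and invariance makes the statement for the translates hold almost surely too.
  The window is \<open>{0..1}\<close> for the line and \<open>{0}\<close> for the integers.\<close>

lemma AE_invariant_transfer:
  assumes Q: "sets Q = sets config_space" and inv: "\<And>n::int. invariant_under (of_int n) Q"
    and meets: "AE \<xi> in Q. \<exists>n::int. (\<lambda>y. y + of_int n) ` \<xi> \<inter> I \<noteq> {}"
    and \<phi>: "AE \<xi> in Q. \<xi> \<inter> I \<noteq> {} \<longrightarrow> \<phi> \<xi>"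
    and shift: "\<And>\<xi> n. \<phi> ((\<lambda>y. y + of_int n) ` \<xi>) \<Longrightarrow> \<phi> \<xi>"
  shows "AE \<xi> in Q. \<phi> \<xi>"
proof -
  have "AE \<xi> in Q. (\<lambda>y. y + of_int n) ` \<xi> \<inter> I \<noteq> {} \<longrightarrow> \<phi> ((\<lambda>y. y + of_int n) ` \<xi>)" for n :: int
  proof (rule AE_distrD[where P = "\<lambda>\<xi>. \<xi> \<inter> I \<noteq> {} \<longrightarrow> \<phi> \<xi>" and M' = config_space])
    show "(\<lambda>\<xi>. (\<lambda>y. y + of_int n) ` \<xi>) \<in> measurable Q config_space"
      unfolding measurable_cong_sets[OF Q refl] by (rule shift_add_measurable)
    show "AE \<xi> in distr Q config_space (\<lambda>\<xi>. (\<lambda>y. y + of_int n) ` \<xi>). \<xi> \<inter> I \<noteq> {} \<longrightarrow> \<phi> \<xi>"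
      unfolding inv[of n, unfolded invariant_under_def] by (rule \<phi>)
  qed
  then have "AE \<xi> in Q. \<forall>n::int. (\<lambda>y. y + of_int n) ` \<xi> \<inter> I \<noteq> {} \<longrightarrow> \<phi> ((\<lambda>y. y + of_int n) ` \<xi>)"
    by (simp add: AE_all_countable)
  then show ?thesis using meets by eventually_elim (use shift in blast)
qed

section \<open>Stationary initial laws\<close>

lemma min_configs_shift_iff: "(\<lambda>y. y + a) ` \<xi> \<in> min_configs d \<longleftrightarrow> \<xi> \<in> min_configs d"
  using min_configs_shift[of \<xi> d a] min_configs_shift[of "(\<lambda>y. y + a) ` \<xi>" d "- a"] by (auto simp: image_image)

context ocp
begin

text \<open>Points are only deleted, so the process stays among subsets of its initial
  configuration.\<close>

lemma emeasure_kernel_subsets: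
  assumes "\<xi> \<in> min_configs dmin" "B \<in> sets config_space" "\<And>\<eta>. \<eta> \<subseteq> \<xi> \<Longrightarrow> \<eta> \<notin> B"
  shows "emeasure (ocp_kernel rl rr t \<xi>) B = 0"
proof -
  have "emeasure (ocp_kernel rl rr t \<xi>) B = (\<integral>\<^sup>+\<eta>. indicator B \<eta> \<partial>ocp_kernel rl rr t \<xi>)"
    using assms(2) by simp
  also have "\<dots> = 0"
    using assms(2) by (subst nn_integral_kernel(1)[OF assms(1) inj_on_id2]) (auto simp: assms(3)[OF ocp_path_subset])
  finally show ?thesis .
qed

text \<open>The sum over surviving points becomes a sum over initial points, each with the event
  that it survives. Translation covariance turns the latter into survival of the origin for the
  configuration seen from that point.\<close>

lemma kernel_windowed:
  assumes \<xi>: "\<xi> \<in> min_configs dmin" and A [measurable]: "A \<in> sets config_space"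
  shows "(\<integral>\<^sup>+\<eta>. windowed (indicator A) \<eta> \<partial>ocp_kernel rl rr t \<xi>) =
    windowed (\<lambda>\<zeta>. emeasure (ocp_kernel rl rr t \<zeta>) ({\<xi> \<in> space config_space. 0 \<in> \<xi>} \<inter> A)) \<xi>"
proof -
  let ?B = "{\<xi> \<in> space config_space. 0 \<in> \<xi>} \<inter> A" and ?X = "\<xi> \<inter> {0..1}"
  let ?PW = "\<Pi>\<^sub>M l\<in>(UNIV :: (ereal \<times> ereal) set). W"
  let ?path = "\<lambda>u. ocp_path \<xi> (\<lambda>\<Delta>. hm (dom_length \<Delta>) (u \<Delta>)) t"
  have lf: "locally_finite \<xi>" using \<xi> by (simp add: min_configs_iff)
  have B [measurable]: "?B \<in> sets config_space" by measurable
  have s [measurable]: "(\<lambda>\<eta>. indicator ?B ((\<lambda>y. y - x) ` \<eta>) :: ennreal) \<in> borel_measurable config_space" for x by measurable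
  have eq: "windowed (indicator A) (?path u) = (\<Sum>x\<in>?X. indicator ?B ((\<lambda>y. y - x) ` ?path u))" for u
  proof -
    have sub: "?path u \<subseteq> \<xi>" by (rule ocp_path_subset)
    then have lf': "locally_finite (?path u)" by (rule locally_finite_subset[OF lf])
    have "(\<lambda>y. y - x) ` ?path u \<in> space config_space" for x
      using locally_finite_image_add[OF lf', of "- x"] by (simp add: space_config_space)
    moreover have "0 \<in> (\<lambda>y. y - x) ` ?path u \<longleftrightarrow> x \<in> ?path u" for x by force
    ultimately show ?thesis
      unfolding windowed_sum[OF lf'] using lf sub
      by (intro sum.mono_neutral_cong_left) (auto simp: locally_finite_def indicator_def)
  qed
  have "(\<integral>\<^sup>+\<eta>. windowed (indicator A) \<eta> \<partial>ocp_kernel rl rr t \<xi>) = (\<integral>\<^sup>+u. (\<Sum>x\<in>?X. indicator ?B ((\<lambda>y. y - x) ` ?path u)) \<partial>?PW)"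
    by (subst nn_integral_kernel(1)[OF \<xi> inj_on_id2 windowed_indicator_measurable[OF A]]) (simp only: eq)
  also have "\<dots> = (\<Sum>x\<in>?X. \<integral>\<^sup>+u. indicator ?B ((\<lambda>y. y - x) ` ?path u) \<partial>?PW)"
    by (rule nn_integral_sum) (rule measurable_compose[OF nn_integral_kernel(2)[OF \<xi> inj_on_id2 s] s])
  also have "\<dots> = (\<Sum>x\<in>?X. emeasure (ocp_kernel rl rr t ((\<lambda>y. y - x) ` \<xi>)) ?B)"
  proof (rule sum.cong[OF refl])
    fix x
    have "(\<integral>\<^sup>+u. indicator ?B ((\<lambda>y. y - x) ` ?path u) \<partial>?PW) = (\<integral>\<^sup>+\<eta>. indicator ?B ((\<lambda>y. y - x) ` \<eta>) \<partial>ocp_kernel rl rr t \<xi>)"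
      by (rule nn_integral_kernel(1)[OF \<xi> inj_on_id2 s, symmetric])
    also have "\<dots> = (\<integral>\<^sup>+\<eta>. indicator ?B \<eta> \<partial>ocp_kernel rl rr t ((\<lambda>y. y - x) ` \<xi>))"
      using ocp_kernel_shift[OF \<xi>, of "indicator ?B" t "- x"] by simp
    also have "\<dots> = emeasure (ocp_kernel rl rr t ((\<lambda>y. y - x) ` \<xi>)) ?B"
      by (rule nn_integral_indicator) (simp only: sets_kernel_config B)
    finally show "(\<integral>\<^sup>+u. indicator ?B ((\<lambda>y. y - x) ` ?path u) \<partial>?PW) = emeasure (ocp_kernel rl rr t ((\<lambda>y. y - x) ` \<xi>)) ?B" .
  qed
  also have "\<dots> = windowed (\<lambda>\<zeta>. emeasure (ocp_kernel rl rr t \<zeta>) ?B) \<xi>"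
    by (rule windowed_sum[OF lf, symmetric])
  finally show ?thesis .
qed

lemma emeasure_ocp_law:
  assumes Q: "is_spp_law Q" "AE \<xi> in Q. \<xi> \<in> min_configs dmin" and B [measurable]: "B \<in> sets config_space"
  shows "emeasure (ocp_law dmin rl rr Q t) B = (\<integral>\<^sup>+\<xi>. emeasure (ocp_kernel rl rr t \<xi>) B * indicator (min_configs dmin) \<xi> \<partial>Q)"
    and "(\<lambda>\<xi>. emeasure (ocp_kernel rl rr t \<xi>) B * indicator (min_configs dmin) \<xi>) \<in> borel_measurable config_space"
proof -
  have "emeasure (ocp_law dmin rl rr Q t) B = (\<integral>\<^sup>+\<eta>. indicator B \<eta> \<partial>ocp_law dmin rl rr Q t)"
    by (rule nn_integral_indicator[symmetric]) (simp add: sets_ocp_law[OF Q])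
  then show "emeasure (ocp_law dmin rl rr Q t) B = (\<integral>\<^sup>+\<xi>. emeasure (ocp_kernel rl rr t \<xi>) B * indicator (min_configs dmin) \<xi> \<partial>Q)"
    using nn_integral_ocp_law[OF Q, of "indicator B" t] by simp
  show "(\<lambda>\<xi>. emeasure (ocp_kernel rl rr t \<xi>) B * indicator (min_configs dmin) \<xi>) \<in> borel_measurable config_space"
    using kernel_integral_measurable[OF Q, of "indicator B" t] by simp
qed

lemma AE_ocp_law_subsets:
  assumes Q: "is_spp_law Q" "AE \<xi> in Q. \<xi> \<in> min_configs dmin" and B: "B \<in> sets config_space"
    and sub: "AE \<xi> in Q. emeasure (ocp_kernel rl rr t \<xi>) B = 0"
  shows "AE \<eta> in ocp_law dmin rl rr Q t. \<eta> \<notin> B"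
proof -
  have "emeasure (ocp_law dmin rl rr Q t) B = (\<integral>\<^sup>+\<xi>. 0 \<partial>Q)"
    unfolding emeasure_ocp_law(1)[OF Q B] by (rule nn_integral_cong_AE) (use sub in \<open>auto elim!: eventually_mono\<close>)
  then show ?thesis by (intro AE_not_in) (simp add: null_sets_def sets_ocp_law[OF Q] B)
qed

text \<open>Campbell's formula is applied to the probability that the origin survives and the
  evolved configuration lies in \<open>A\<close>. Taking all configurations gives the new intensity,
  and in the quotient the old intensity cancels.\<close>

lemma palm_ocp_law:
  assumes Q: "is_spp_law Q" "AE \<xi> in Q. \<xi> \<in> min_configs dmin"
    and palm: "prob_space (palm Q)" "AE \<xi> in palm Q. \<xi> \<in> min_configs dmin" and fin: "intensity Q < \<infinity>"
  shows "intensity (ocp_law dmin rl rr Q t) = intensity Q * emeasure (ocp_law dmin rl rr (palm Q) t) {\<xi> \<in> space config_space. 0 \<in> \<xi>}"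
    and "palm (ocp_law dmin rl rr Q t) = cond_origin (ocp_law dmin rl rr (palm Q) t)"
proof -
  let ?Qt = "ocp_law dmin rl rr Q t" and ?Pt = "ocp_law dmin rl rr (palm Q) t"
  let ?O = "{\<xi> \<in> space config_space. (0::real) \<in> \<xi>}"
  have P: "is_spp_law (palm Q)" using palm(1) by (simp add: is_spp_law_def)
  note sQ = setsQ[OF Q]
  have O [measurable]: "?O \<in> sets config_space" by measurable
  have main: "(\<integral>\<^sup>+\<eta>. windowed (indicator A) \<eta> \<partial>?Qt) = intensity Q * emeasure ?Pt (?O \<inter> A)"
    if A [measurable]: "A \<in> sets config_space" for A
  proof -
    let ?\<phi> = "\<lambda>\<zeta>. emeasure (ocp_kernel rl rr t \<zeta>) (?O \<inter> A) * indicator (min_configs dmin) \<zeta>"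
    have OA: "?O \<inter> A \<in> sets config_space" by measurable
    have "(\<integral>\<^sup>+\<eta>. windowed (indicator A) \<eta> \<partial>?Qt) = (\<integral>\<^sup>+\<xi>. (\<integral>\<^sup>+\<eta>. windowed (indicator A) \<eta> \<partial>ocp_kernel rl rr t \<xi>) \<partial>Q)"
      by (rule nn_integral_ocp_law_AE[OF Q windowed_indicator_measurable[OF A]])
    also have "\<dots> = (\<integral>\<^sup>+\<xi>. windowed ?\<phi> \<xi> \<partial>Q)"
    proof (rule nn_integral_cong_AE)
      show "AE \<xi> in Q. (\<integral>\<^sup>+\<eta>. windowed (indicator A) \<eta> \<partial>ocp_kernel rl rr t \<xi>) = windowed ?\<phi> \<xi>"
        using Q(2)
      proof eventually_elim
        case (elim \<xi>)
        have "windowed (\<lambda>\<zeta>. emeasure (ocp_kernel rl rr t \<zeta>) (?O \<inter> A)) \<xi> = windowed ?\<phi> \<xi>"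
          unfolding windowed_def
          by (rule nn_integral_cong) (use min_configs_shift[OF elim, of "- x" for x] in simp)
        then show ?case using kernel_windowed[OF elim A] by simp
      qed
    qed
    also have "\<dots> = intensity Q * (\<integral>\<^sup>+\<xi>. ?\<phi> \<xi> \<partial>palm Q)"
      by (rule campbell(2)[OF sQ palm(1) fin emeasure_ocp_law(2)[OF P palm(2) OA]])
    also have "(\<integral>\<^sup>+\<xi>. ?\<phi> \<xi> \<partial>palm Q) = emeasure ?Pt (?O \<inter> A)"
      by (rule emeasure_ocp_law(1)[OF P palm(2) OA, symmetric])
    finally show ?thesis .
  qed
  have "?O \<inter> space config_space = ?O" by blast
  then show int: "intensity ?Qt = intensity Q * emeasure ?Pt ?O"
    using main[of "space config_space"] intensity_windowed[of ?Qt] sets_ocp_law[OF Q, of t] by simp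
  show "palm ?Qt = cond_origin ?Pt"
  proof (rule measure_eqI)
    show "sets (palm ?Qt) = sets (cond_origin ?Pt)" by (simp add: cond_origin_def sets_ocp_law[OF P palm(2)])
    fix A assume "A \<in> sets (palm ?Qt)"
    then have A: "A \<in> sets config_space" by simp
    have I: "intensity Q \<noteq> 0" "intensity Q \<noteq> \<infinity>" using intensity_pos[OF sQ palm(1) fin] fin by auto
    have "emeasure (palm ?Qt) A = (intensity Q * emeasure ?Pt (?O \<inter> A)) / (intensity Q * emeasure ?Pt ?O)"
      unfolding emeasure_palm[OF sets_ocp_law[OF Q] A] main[OF A] int ..
    also have "\<dots> = emeasure ?Pt (?O \<inter> A) / emeasure ?Pt ?O"
      unfolding mult.commute[of "intensity Q"] by (rule divide_mult_eq[OF I])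
    also have "\<dots> = emeasure (cond_origin ?Pt) A"
      unfolding cond_origin_def
      by (rule emeasure_uniform_measure[symmetric]) (simp_all only: sets_ocp_law[OF P palm(2)] O A)
    finally show "emeasure (palm ?Qt) A = emeasure (cond_origin ?Pt) A" .
  qed
qed

end

text \<open>Conditioning on a null event would give the zero measure instead of a probability
  measure.\<close>

lemma emeasure_pos_cond_origin:
  assumes M: "sets M = sets config_space" and C: "prob_space (cond_origin M)"
  shows "emeasure M {\<xi> \<in> space config_space. 0 \<in> \<xi>} \<noteq> 0"
proof
  have O: "{\<xi> \<in> space config_space. (0::real) \<in> \<xi>} \<in> sets M" unfolding M by measurable
  assume 0: "emeasure M {\<xi> \<in> space config_space. 0 \<in> \<xi>} = 0"
  have "emeasure (cond_origin M) (space M) = 0"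
    unfolding cond_origin_def using 0 O by (subst emeasure_uniform_measure) (auto simp: divide_ennreal_def Int_absorb2 sets.sets_into_space)
  then show False using prob_space.emeasure_space_1[OF C] by (simp add: cond_origin_def)
qed

lemma subset_Ints_measurable [measurable]: "Measurable.pred config_space (\<lambda>\<xi>. \<xi> \<subseteq> \<int>)"
proof -
  have "Measurable.pred config_space (\<lambda>\<xi>. \<forall>n::int. card (\<xi> \<inter> {of_int n<..<of_int n + 1}) = 0)"
    by measurable
  then show ?thesis
  proof (rule measurable_cong[THEN iffD1, rotated])
    fix \<xi> assume "\<xi> \<in> space config_space"
    then have fin: "finite (\<xi> \<inter> {of_int n<..<of_int n + 1})" for n
      by (intro locally_finite_bounded) (auto simp: space_config_space)
    have "\<xi> \<subseteq> \<int> \<longleftrightarrow> (\<forall>n::int. \<xi> \<inter> {of_int n<..<of_int n + 1} = {})"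
    proof (intro iffI allI subsetI)
      fix n :: int assume "\<xi> \<subseteq> \<int>"
      moreover have "\<not> (real_of_int n < of_int k \<and> real_of_int k < of_int n + 1)" for k
      proof
        assume k: "real_of_int n < of_int k \<and> real_of_int k < of_int n + 1"
        then have "real_of_int k < of_int (n + 1)" by simp
        then have "k < n + 1" by (simp only: of_int_less_iff)
        moreover have "n < k" using k by simp
        ultimately show False by simp
      qed
      ultimately show "\<xi> \<inter> {of_int n<..<of_int n + 1} = {}" by (force elim!: Ints_cases)
    next
      fix x assume *: "\<forall>n::int. \<xi> \<inter> {of_int n<..<of_int n + 1} = {}" and x: "x \<in> \<xi>"
      have "x \<in> \<xi> \<inter> {of_int \<lfloor>x\<rfloor><..<of_int \<lfloor>x\<rfloor> + 1}" if "of_int \<lfloor>x\<rfloor> < x" using that x by simp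
      then have "\<not> of_int \<lfloor>x\<rfloor> < x" using * by blast
      then have "x = of_int \<lfloor>x\<rfloor>" using of_int_floor_le[of x] by linarith
      then show "x \<in> \<int>" by (metis Ints_of_int)
    qed
    then show "(\<forall>n::int. card (\<xi> \<inter> {of_int n<..<of_int n + 1}) = 0) \<longleftrightarrow> \<xi> \<subseteq> \<int>"
      using fin by simp
  qed
qed

context ocp_gap
begin

text \<open>\<open>P\<close> stands for the Palm measure or for the law conditioned on
  \<open>0 \<in> \<xi>\<close>. Separation and almost sure nonemptiness after evolution are
  translation invariant, so they pass from the view of a point to the stationary law.\<close>

lemma stationary_min_configs:
  assumes Q: "sets Q = sets config_space" and inv: "\<And>n::int. invariant_under (of_int n) Q"
    and meets: "AE \<xi> in Q. \<exists>n::int. (\<lambda>y. y + of_int n) ` \<xi> \<inter> I \<noteq> {}"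
    and I: "\<And>\<phi>. AE \<xi> in P. \<phi> \<xi> \<Longrightarrow> AE \<xi> in Q. \<forall>x\<in>\<xi> \<inter> I. \<phi> ((\<lambda>y. y - x) ` \<xi>)"
    and P: "is_spp_law P" "iid_gaps \<mu> P" "AE \<xi> in P. 0 \<in> \<xi>"
  shows "AE \<xi> in Q. \<xi> \<in> min_configs dmin"
    and "AE \<xi> in Q. emeasure (ocp_kernel rl rr t \<xi>) {{}} = 0"
proof -
  have E [measurable]: "{{}} \<in> sets config_space"
  proof -
    have "{\<xi> \<in> space config_space. \<xi> = {}} \<in> sets config_space" by measurable
    also have "{\<xi> \<in> space config_space. \<xi> = {}} = {{}}" by (auto simp: space_config_space locally_finite_def)
    finally show ?thesis .
  qed
  define \<phi> where "\<phi> \<xi> \<longleftrightarrow> \<xi> \<in> min_configs dmin \<and> emeasure (ocp_kernel rl rr t \<xi>) {{}} = 0" for \<xi>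
  have shift: "\<phi> ((\<lambda>y. y + a) ` \<xi>) \<longleftrightarrow> \<phi> \<xi>" for \<xi> a
  proof -
    have "emeasure (ocp_kernel rl rr t ((\<lambda>y. y + a) ` \<xi>)) {{}} = emeasure (ocp_kernel rl rr t \<xi>) {{}}" if \<xi>: "\<xi> \<in> min_configs dmin"
      using ocp_kernel_shift[OF \<xi>, of "indicator {{}}" t a] E
      by (simp add: indicator_def[of "{{}}"] nn_integral_indicator[of "{{}}", unfolded indicator_def] flip: nn_integral_indicator[of "{{}}"])
    then show ?thesis by (auto simp: \<phi>_def min_configs_shift_iff)
  qed
  have "AE \<xi> in Q. \<phi> \<xi>"
  proof (rule AE_invariant_transfer[OF Q inv meets])
    have "AE \<xi> in Q. \<forall>x\<in>\<xi> \<inter> I. \<phi> ((\<lambda>y. y - x) ` \<xi>)"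
      using kernel_nonempty[OF P, of t] by (intro I) (simp add: \<phi>_def)
    then show "AE \<xi> in Q. \<xi> \<inter> I \<noteq> {} \<longrightarrow> \<phi> \<xi>"
    proof eventually_elim
      case (elim \<xi>)
      show ?case
      proof
        assume "\<xi> \<inter> I \<noteq> {}"
        then obtain x where "x \<in> \<xi> \<inter> I" by blast
        with elim have "\<phi> ((\<lambda>y. y - x) ` \<xi>)" by blast
        then show "\<phi> \<xi>" using shift[of "- x" \<xi>] by simp
      qed
    qed
  qed (simp add: shift)
  then show "AE \<xi> in Q. \<xi> \<in> min_configs dmin" "AE \<xi> in Q. emeasure (ocp_kernel rl rr t \<xi>) {{}} = 0"
    by (auto simp: \<phi>_def elim: eventually_mono)
qed

lemma nonempty_ocp_law:
  assumes Q: "is_spp_law Q" "AE \<xi> in Q. \<xi> \<in> min_configs dmin"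
    and "AE \<xi> in Q. emeasure (ocp_kernel rl rr t \<xi>) {{}} = 0"
  shows "AE \<eta> in ocp_law dmin rl rr Q t. \<eta> \<noteq> {}"
proof -
  have "{\<xi> \<in> space config_space. \<xi> = {}} \<in> sets config_space" by measurable
  also have "{\<xi> \<in> space config_space. \<xi> = {}} = {{}}" by (auto simp: space_config_space locally_finite_def)
  finally show ?thesis using AE_ocp_law_subsets[OF Q _ assms(3)] by simp
qed

lemma integrable_pair_fst: "integrable \<mu> (\<lambda>x. x) \<Longrightarrow> integrable (\<mu> \<Otimes>\<^sub>M W) fst"
proof -
  assume "integrable \<mu> (\<lambda>x. x)"
  then have "integrable (distr (\<mu> \<Otimes>\<^sub>M W) \<mu> fst) (\<lambda>x. x)"
    by (simp add: prob_space.distr_pair_fst[OF prob_space_W])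
  then show ?thesis using measurable_ident_sets[OF sets_\<mu>] by (subst (asm) integrable_distr_eq) auto
qed

theorem ocp_Ren_R:
  assumes "is_Ren_R \<mu> Q"
  shows "is_Ren_R (R.gap_law t) (ocp_law dmin rl rr Q t)"
proof -
  have int: "integrable \<mu> (\<lambda>x. x)" and Q: "is_spp_law Q" and inv: "\<And>a. invariant_under a Q"
    and fin: "intensity Q < \<infinity>" and ne: "AE \<xi> in Q. \<xi> \<noteq> {}" and iid: "iid_gaps \<mu> (palm Q)"
    using assms by (auto simp: is_Ren_R_def)
  have sQ: "sets Q = sets config_space" using Q by (simp add: is_spp_law_def)
  have palm: "prob_space (palm Q)" using iid by (simp add: iid_gaps_def)
  then have P: "is_spp_law (palm Q)" by (simp add: is_spp_law_def)
  note Pa = P iid palm_origin[OF sQ]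
  \<comment> \<open>Translating by minus the integer part of a point brings that point into the unit
    window.\<close>
  have meets: "AE \<xi> in Q. \<exists>n::int. (\<lambda>y. y + of_int n) ` \<xi> \<inter> {0..1} \<noteq> {}"
    using ne
  proof eventually_elim
    case (elim \<xi>)
    then obtain y where "y \<in> \<xi>" by blast
    moreover have "0 \<le> y + of_int (- \<lfloor>y\<rfloor>)" "y + of_int (- \<lfloor>y\<rfloor>) \<le> 1"
      unfolding of_int_minus by linarith+
    ultimately have "y + of_int (- \<lfloor>y\<rfloor>) \<in> (\<lambda>y. y + of_int (- \<lfloor>y\<rfloor>)) ` \<xi> \<inter> {0..1}"
      by (intro IntI imageI) auto
    then show ?case by blast
  qed
  have min: "AE \<xi> in Q. \<xi> \<in> min_configs dmin"
    by (rule stationary_min_configs(1)[OF sQ inv meets _ Pa]) (rule AE_palmD[OF sQ palm fin])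
  have no_void: "AE \<xi> in Q. emeasure (ocp_kernel rl rr t \<xi>) {{}} = 0"
    by (rule stationary_min_configs(2)[OF sQ inv meets _ Pa]) (rule AE_palmD[OF sQ palm fin])
  note palm_eq = palm_ocp_law[OF Q min palm iid_min[OF Pa] fin, of t]
  show ?thesis
    unfolding is_Ren_R_def
  proof (intro conjI allI)
    show "integrable (R.gap_law t) (\<lambda>x. x)"
      by (rule R.gap_law_integrable[OF integrable_pair_fst[OF int]])
    show "is_spp_law (ocp_law dmin rl rr Q t)" by (rule is_spp_law_ocp_law[OF Q min])
    show "invariant_under a (ocp_law dmin rl rr Q t)" for a by (rule invariant_ocp_law[OF Q min inv])
    show "intensity (ocp_law dmin rl rr Q t) < \<infinity>"
      unfolding palm_eq(1) emeasure_ocp_two_origin(1)[OF Pa] using fin two_mass(2)[OF Pa, of t]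
      unfolding ennreal_mult_less_top[of "intensity Q"] infinity_ennreal_def by blast
    show "AE \<xi> in ocp_law dmin rl rr Q t. \<xi> \<noteq> {}" by (rule nonempty_ocp_law[OF Q min no_void])
    show "iid_gaps (R.gap_law t) (palm (ocp_law dmin rl rr Q t))"
      unfolding palm_eq(2) by (rule iid_gaps_cond_origin[OF Pa])
  qed
qed

theorem ocp_Ren_Z:
  assumes "is_Ren_Z \<mu> Q"
  shows "is_Ren_Z (R.gap_law t) (ocp_law dmin rl rr Q t)"
proof -
  have nat: "AE x in \<mu>. x \<in> \<nat> \<and> 1 \<le> x" and int: "integrable \<mu> (\<lambda>x. x)" and Q: "is_spp_law Q"
    and Z: "AE \<xi> in Q. \<xi> \<subseteq> \<int>" and inv: "\<And>a. a \<in> \<int> \<Longrightarrow> invariant_under a Q"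
    and ne: "AE \<xi> in Q. \<xi> \<noteq> {}" and iid: "iid_gaps \<mu> (cond_origin Q)"
    using assms by (auto simp: is_Ren_Z_def)
  interpret Q: prob_space Q using Q by (simp add: is_spp_law_def)
  have sQ: "sets Q = sets config_space" using Q by (simp add: is_spp_law_def)
  let ?O = "{\<xi> \<in> space config_space. (0::real) \<in> \<xi>}" and ?P = "cond_origin Q"
  let ?Qt = "ocp_law dmin rl rr Q t" and ?Pt = "ocp_law dmin rl rr ?P t"
  have O [measurable]: "?O \<in> sets config_space" by measurable
  have OQ: "?O \<in> sets Q" using O by (simp only: sQ)
  have prob: "prob_space ?P" using iid by (simp add: iid_gaps_def)
  have P: "is_spp_law ?P" using prob by (simp add: is_spp_law_def cond_origin_def sQ)
  have pos: "emeasure Q ?O \<noteq> 0" by (rule emeasure_pos_cond_origin[OF sQ prob])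
  have AE_P: "(AE \<xi> in ?P. \<phi> \<xi>) \<longleftrightarrow> (AE \<xi> in Q. \<xi> \<in> ?O \<longrightarrow> \<phi> \<xi>)" for \<phi>
    unfolding cond_origin_def by (rule AE_uniform_measure) (use pos in \<open>auto simp: less_top[symmetric] Q.emeasure_finite\<close>)
  have orig: "AE \<xi> in ?P. 0 \<in> \<xi>" unfolding AE_P by simp
  note Pa = P iid orig
  have meets: "AE \<xi> in Q. \<exists>n::int. (\<lambda>y. y + of_int n) ` \<xi> \<inter> {0} \<noteq> {}"
    using ne Z
  proof eventually_elim
    case (elim \<xi>)
    then obtain y where y: "y \<in> \<xi>" "y \<in> \<int>" by blast
    then obtain n where "y = of_int n" by (auto elim: Ints_cases)
    then show ?case using y(1) by (intro exI[of _ "- n"]) force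
  qed
  have I: "AE \<xi> in Q. \<forall>x\<in>\<xi> \<inter> {0}. \<phi> ((\<lambda>y. y - x) ` \<xi>)" if "AE \<xi> in ?P. \<phi> \<xi>" for \<phi>
  proof -
    have "AE \<xi> in Q. \<xi> \<in> space Q" by (rule AE_space)
    with that[unfolded AE_P] show ?thesis
      by eventually_elim (use sets_eq_imp_space_eq[OF sQ] in auto)
  qed
  have invZ: "invariant_under (of_int n) Q" for n by (rule inv) simp
  have min: "AE \<xi> in Q. \<xi> \<in> min_configs dmin"
    by (rule stationary_min_configs(1)[OF sQ invZ meets _ Pa]) (rule I)
  have no_void: "AE \<xi> in Q. emeasure (ocp_kernel rl rr t \<xi>) {{}} = 0"
    by (rule stationary_min_configs(2)[OF sQ invZ meets _ Pa]) (rule I)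
  \<comment> \<open>Since points are only deleted, an evolved configuration containing
    \<open>0\<close> stems from an initial one containing \<open>0\<close>. On such events
    conditioning before the evolution just divides by the initial probability of
    \<open>0 \<in> \<xi>\<close>, a factor that disappears on conditioning again.\<close>
  have sub: "emeasure ?Pt B = emeasure ?Qt B / emeasure Q ?O" if B: "B \<in> sets config_space" "B \<subseteq> ?O" for B
  proof -
    let ?f = "\<lambda>\<xi>. emeasure (ocp_kernel rl rr t \<xi>) B * indicator (min_configs dmin) \<xi>"
    have "emeasure ?Pt B = (\<integral>\<^sup>+\<xi>. ?f \<xi> \<partial>?P)" by (rule emeasure_ocp_law(1)[OF P iid_min[OF Pa] B(1)])
    also have "\<dots> = (\<integral>\<^sup>+\<xi>. ?f \<xi> * indicator ?O \<xi> \<partial>Q) / emeasure Q ?O"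
      unfolding cond_origin_def
      by (rule nn_integral_uniform_measure[OF _ OQ]) (simp only: measurable_cong_sets[OF sQ refl] emeasure_ocp_law(2)[OF P iid_min[OF Pa] B(1)])
    also have "(\<integral>\<^sup>+\<xi>. ?f \<xi> * indicator ?O \<xi> \<partial>Q) = (\<integral>\<^sup>+\<xi>. ?f \<xi> \<partial>Q)"
    proof (rule nn_integral_cong)
      fix \<xi> assume "\<xi> \<in> space Q"
      then have "\<xi> \<in> space config_space" using sets_eq_imp_space_eq[OF sQ] by simp
      then show "?f \<xi> * indicator ?O \<xi> = ?f \<xi>"
        using emeasure_kernel_subsets[of \<xi> B t] B by (cases "0 \<in> \<xi>") (auto simp: indicator_def)
    qed
    also have "\<dots> = emeasure ?Qt B" by (rule emeasure_ocp_law(1)[OF Q min B(1), symmetric])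
    finally show ?thesis .
  qed
  have cond: "cond_origin ?Qt = cond_origin ?Pt"
  proof (rule measure_eqI)
    show "sets (cond_origin ?Qt) = sets (cond_origin ?Pt)"
      by (simp only: cond_origin_def[of ?Qt] cond_origin_def[of ?Pt] sets_uniform_measure sets_ocp_law[OF Q min] sets_ocp_law[OF P iid_min[OF Pa]])
    fix A assume "A \<in> sets (cond_origin ?Qt)"
    then have A [measurable]: "A \<in> sets config_space" by (simp add: cond_origin_def sets_ocp_law[OF Q min])
    have OA: "?O \<inter> A \<in> sets config_space" by measurable
    have "emeasure (cond_origin ?Pt) A = emeasure ?Pt (?O \<inter> A) / emeasure ?Pt ?O"
      unfolding cond_origin_def[of ?Pt]
      by (rule emeasure_uniform_measure) (simp_all only: sets_ocp_law[OF P iid_min[OF Pa]] O A)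
    also have "\<dots> = (emeasure ?Qt (?O \<inter> A) / emeasure Q ?O) / (emeasure ?Qt ?O / emeasure Q ?O)"
      using sub[OF OA] sub[OF O] by simp
    also have "\<dots> = emeasure ?Qt (?O \<inter> A) / emeasure ?Qt ?O"
      using pos Q.emeasure_finite[of ?O]
      unfolding divide_ennreal_def by (intro divide_mult_eq[unfolded divide_ennreal_def]) (auto simp: ennreal_inverse_eq_top_iff)
    also have "\<dots> = emeasure (cond_origin ?Qt) A"
      unfolding cond_origin_def
      by (rule emeasure_uniform_measure[symmetric]) (simp_all only: sets_ocp_law[OF Q min] O A)
    finally show "emeasure (cond_origin ?Qt) A = emeasure (cond_origin ?Pt) A" ..
  qed
  show ?thesis
    unfolding is_Ren_Z_def
  proof (intro conjI ballI)
    show "AE x in R.gap_law t. x \<in> \<nat> \<and> 1 \<le> x"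
      by (rule R.gap_law_nat) (rule AE_pair_fst[OF prob_\<mu> prob_space_W nat])
    show "integrable (R.gap_law t) (\<lambda>x. x)"
      by (rule R.gap_law_integrable[OF integrable_pair_fst[OF int]])
    show "is_spp_law ?Qt" by (rule is_spp_law_ocp_law[OF Q min])
    have N: "{\<xi> \<in> space config_space. \<not> \<xi> \<subseteq> \<int>} \<in> sets config_space" by measurable
    have "AE \<xi> in ?Qt. \<xi> \<notin> {\<xi> \<in> space config_space. \<not> \<xi> \<subseteq> \<int>}"
    proof (rule AE_ocp_law_subsets[OF Q min N])
      show "AE \<xi> in Q. emeasure (ocp_kernel rl rr t \<xi>) {\<xi> \<in> space config_space. \<not> \<xi> \<subseteq> \<int>} = 0"
        using min Z by eventually_elim (rule emeasure_kernel_subsets[OF _ N], auto)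
    qed
    moreover have "AE \<xi> in ?Qt. \<xi> \<in> space ?Qt" by (rule AE_space)
    ultimately show "AE \<xi> in ?Qt. \<xi> \<subseteq> \<int>"
      by eventually_elim (simp add: space_ocp_law[OF Q min])
    show "invariant_under a ?Qt" if "a \<in> \<int>" for a by (rule invariant_ocp_law[OF Q min inv[OF that]])
    show "AE \<xi> in ?Qt. \<xi> \<noteq> {}" by (rule nonempty_ocp_law[OF Q min no_void])
    show "iid_gaps (R.gap_law t) (cond_origin ?Qt)"
      unfolding cond by (rule iid_gaps_cond_origin[OF Pa])
  qed
qed

end

theorem theorem2p13:
  fixes dmin dmax :: real
    and rl rr :: "ereal \<Rightarrow> real"
    and \<nu> \<mu> :: "real measure"
  assumes "0 < dmin" and "dmin < dmax"
    and "rl \<in> borel_measurable (restrict_space borel {ereal dmin..})"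
    and "rr \<in> borel_measurable (restrict_space borel {ereal dmin..})"
    and "\<forall>d \<ge> ereal dmin. 0 \<le> rl d" and "\<forall>d \<ge> ereal dmin. 0 \<le> rr d"
    and "bounded (rl ` {ereal dmin..})" and "bounded (rr ` {ereal dmin..})"
    and A1: "\<forall>d \<ge> ereal dmin. 0 < rl d + rr d \<longleftrightarrow> d \<in> {ereal dmin..<ereal dmax}"
    and A2: "\<forall>d \<ge> ereal dmin. \<forall>d' \<ge> ereal dmin. ereal dmax \<le> d + d'"
    and "real_distribution \<nu>"
    and "real_distribution \<mu>" and "AE x in \<mu>. dmin \<le> x"
  shows "\<exists>\<nu>t \<mu>t :: ennreal \<Rightarrow> real measure.
      (\<forall>t. real_distribution (\<nu>t t)) \<and>
      (\<forall>t. real_distribution (\<mu>t t) \<and> (AE x in \<mu>t t. dmin \<le> x)) \<and>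
      \<nu>t 0 = \<nu> \<and> \<mu>t 0 = \<mu> \<and>
      (\<forall>Q. Q = Ren \<nu> \<mu> \<longrightarrow> (\<forall>t. ocp_law dmin rl rr Q t = Ren (\<nu>t t) (\<mu>t t))) \<and>
      (\<forall>Q. is_Ren_R \<mu> Q \<longrightarrow> (\<forall>t. is_Ren_R (\<mu>t t) (ocp_law dmin rl rr Q t))) \<and>
      (\<forall>Q. is_Ren_Z \<mu> Q \<longrightarrow> (\<forall>t. is_Ren_Z (\<mu>t t) (ocp_law dmin rl rr Q t))) \<and>
      (\<forall>Q. Q = Ren (return borel 0) \<mu> \<longrightarrow>
         (\<forall>t. cond_origin (ocp_law dmin rl rr Q t) = Ren (return borel 0) (\<mu>t t))) \<and>
      weak_limit (\<lambda>t::real. \<nu>t (ennreal t)) (\<nu>t \<infinity>) at_top \<and>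
      weak_limit (\<lambda>t::real. \<mu>t (ennreal t)) (\<mu>t \<infinity>) at_top"
proof -
  interpret ocp_gap dmin dmax rl rr \<mu>
  proof (intro ocp_gap.intro ocp.intro grid.intro ocp_axioms.intro ocp_gap_axioms.intro)
    show "0 < dmin" by fact
    show "rl \<in> borel_measurable (restrict_space borel {ereal dmin..})" by fact
    show "rr \<in> borel_measurable (restrict_space borel {ereal dmin..})" by fact
    show "0 \<le> rl d" "0 \<le> rr d" "0 < rl d + rr d \<longleftrightarrow> d \<in> {ereal dmin..<ereal dmax}" if "ereal dmin \<le> d" for d
      using assms(5,6) A1 that by blast+
    show "real_distribution \<mu>" by fact
    show "AE x in \<mu>. dmin \<le> x" by fact
  qed
  have \<nu>: "real_distribution \<nu>" by fact
  have gap_0: "R.gap_law 0 = \<mu>"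
  proof -
    have "R.gap_law 0 = distr (\<mu> \<Otimes>\<^sub>M W) \<mu> fst"
      unfolding R.gap_law_0 by (rule distr_cong) auto
    then show ?thesis by (simp add: prob_space.distr_pair_fst[OF prob_space_W])
  qed
  show ?thesis
  \<comment> \<open>One gap law serves all four initial laws: it is the law of the gap after a
    surviving point, computed on a half-line of i.i.d. domains.\<close>
  proof (rule exI[of _ "R.start_law \<nu>"], rule exI[of _ R.gap_law], intro conjI allI impI)
    fix Q t
    show "real_distribution (R.start_law \<nu> t)" by (rule R.real_distribution_start_law[OF \<nu>])
    show "real_distribution (R.gap_law t)" by (rule R.real_distribution_gap_law)
    show "AE x in R.gap_law t. dmin \<le> x" by (rule R.gap_law_ge)
    show "R.start_law \<nu> 0 = \<nu>" by (rule R.start_law_0[OF \<nu>])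
    show "R.gap_law 0 = \<mu>" by (rule gap_0)
    show "ocp_law dmin rl rr Q t = Ren (R.start_law \<nu> t) (R.gap_law t)" if "Q = Ren \<nu> \<mu>"
      unfolding that by (rule ocp_Ren[OF \<nu>])
    show "is_Ren_R (R.gap_law t) (ocp_law dmin rl rr Q t)" if "is_Ren_R \<mu> Q"
      using that by (rule ocp_Ren_R)
    show "is_Ren_Z (R.gap_law t) (ocp_law dmin rl rr Q t)" if "is_Ren_Z \<mu> Q"
      using that by (rule ocp_Ren_Z)
    show "cond_origin (ocp_law dmin rl rr Q t) = Ren (return borel 0) (R.gap_law t)" if "Q = Ren (return borel 0) \<mu>"
      unfolding that by (rule ocp_Ren_origin)
    show "weak_limit (\<lambda>t::real. R.start_law \<nu> (ennreal t)) (R.start_law \<nu> \<infinity>) at_top"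
      by (rule R.start_law_tendsto[OF \<nu>])
    show "weak_limit (\<lambda>t::real. R.gap_law (ennreal t)) (R.gap_law \<infinity>) at_top"
      by (rule R.gap_law_tendsto)
  qed
qed

end
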